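(* Let $n\ge2$, $1\le k\le n-1$, $r\ge1$, and let $\mathcal T_h$ be a conforming simplicial mesh of a bounded domain $\Omega\subset\mathbb R^n$. For each $f\in\Delta_\ell(\mathcal T_h)$, $\ell=0,\dots,n-1$, choose a global $t$-$n$ basis $\{\boldsymbol t_1^f,\dots,\boldsymbol t_\ell^f,\boldsymbol n_1^f,\dots,\boldsymbol n_{n-\ell}^f\}$ depending only on $f$; let $\{\mathrm dy_i^f\}$ be the corresponding basis of $\mathrm{Alt}^1$ and $\{\mathrm d\hat y_i^f\}$ its dual basis. Then the degrees of freedom (DoFs) (a) $\omega(\mathtt v)\in\mathbb X$, for $\mathtt v\in\Delta_0(\mathcal T_h)$; (b) $(\omega,\eta)_f$, for $\eta\in\mathbb P_{r-(\ell+1)}(f)\otimes\mathrm{span}\{\mathrm d\hat y^f_\sigma\otimes*\mathrm d\hat y^f_i:(\sigma,i)\text{ is free and in the normal constraint block of } f\}$, $f\in\Delta_\ell(\mathcal T_h)$, $\ell=1,\dots,n-1$; (c) $(\mathrm{tr}_F^{\mathrm{div}}\omega,\eta)_f$, for $\eta\in\mathbb P_{r-(\ell+1)}(f)\otimes\mathrm{span}\{\mathrm d\hat y^f_\sigma:\sigma\text{ is in the free block of } f\}$, $F\in\Delta_{n-1}(\mathcal T_h)$, $f\in\Delta_\ell(F)$, $\ell=1,\dots,n-1$; (d) $(\omega,\eta)_T$, for $\eta\in\mathbb B_r(\mathrm{div},T;\mathbb X)$, $T\in\mathcal T_h$, determine a finite element space $V_h\subset H(\mathrm{div},\Omega;\mathbb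 X)$. That is, for each $T\in\mathcal T_h$ the DoFs (a)--(d) attached to $T$ and its sub-simplices uniquely determine an element of $\mathbb P_r(T;\mathbb X)$ (unisolvence), and the space $V_h$ of all $\omega\in L^2(\Omega;\mathbb X)$ with $\omega|_T\in\mathbb P_r(T;\mathbb X)$ for all $T\in\mathcal T_h$, with DoFs (a), (b) single-valued across each $f$, and with DoFs (c) single-valued across each $F\in\Delta_{n-1}(\mathcal T_h)$, is contained in $H(\mathrm{div},\Omega;\mathbb X)$.
   Context: Forms. $\mathrm{Alt}^j$ is the space of alternating $j$-linear forms on $\mathbb R^n$ with the inner product for which $\{\mathrm dx_\sigma\}$ is orthonormal ($\mathrm dx_i$ the standard orthonormal basis of $\mathrm{Alt}^1$); $\mathrm{Alt}^{k,n-1}=\mathrm{Alt}^k\otimes\mathrm{Alt}^{n-1}$ has the tensor product inner product $\langle\cdot,\cdot\rangle$. The map $s^{k,n-1}:\mathrm{Alt}^{k,n-1}\to\mathrm{Alt}^{k-1}\otimes\mathrm{Alt}^n$ is $$s^{k,n-1}\omega(w_1,\dots,w_{k-1})(v_1,\dots,v_n)=\sum_{i=1}^n(-1)^{i-1}\omega(v_i,w_1,\dots,w_{k-1})(v_1,\dots,\widehat{v_i},\dots,v_n),$$ and $\mathbb X:=\ker(s^{k,n-1})$. $(\omega,\eta)_f=\int_f\langle\omega,\eta\rangle\,\mathrm dx_f$ (for $\mathrm{Alt}^{k,n-1}$- or $\mathrm{Alt}^k$-valued functions). Index notation. $\Sigma(1:j,1:n)$ is the set of increasing sequences of length $j$ in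 $\{1,\dots,n\}$, identified with subsets; $\sigma^c$ is the complement; $i+\tau=\tau\cup\{i\}$ for $i\notin\tau$. For a basis $\{\mathrm dy_i\}$ of $\mathrm{Alt}^1$: $\mathrm dy_\sigma=\mathrm dy_{\sigma(1)}\wedge\cdots\wedge \mathrm dy_{\sigma(k)}$, $*\mathrm dy_i=(-1)^{i-1}\mathrm dy_1\wedge\cdots\wedge\widehat{\mathrm dy_i}\wedge\cdots\wedge \mathrm dy_n$, and the dual basis $\{\mathrm d\hat y_i\}$ of $\mathrm{Alt}^1$ satisfies $\langle \mathrm d\hat y_i,\mathrm dy_j\rangle=\delta_{i,j}$. $t$-$n$ basis. $\Delta_\ell(\cdot)$ denotes the set of $\ell$-dimensional sub-simplices. A $t$-$n$ basis of $f$ (of dimension $\ell$) consists of $\ell$ linearly independent unit vectors $\boldsymbol t_i^f$ tangential to $f$ followed by $n-\ell$ linearly independent unit vectors $\boldsymbol n_j^f$ orthogonal to the tangent plane of $f$. The corresponding basis of $\mathrm{Alt}^1$ is $\mathrm dy_i^f(w)=\boldsymbol t_i^f\cdot w$ for $1\le i\le\ell$ and $\mathrm dy_i^f(w)=\boldsymbol n_{i-\ell}^f\cdot w$ for $\ell+1\le i\le n$ (the latter range is written $i\in\mathscr N^f$). Constraints and blocks. For $\tau\in\Sigma(1:k-1,1:n)$ with $\tau^c=\{i_1<\dots<i_{n-k+1}\}$, the constraint sequence of $\tau$ is $\{(i_m+\tau,i_m)\}_{m=1}^{n-k+1}$ and $(i_1+\tau,i_1)$ is its pair index. An index $(\sigma,i)$,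 $\sigma\in\Sigma(1:k,1:n)$, is free if it is not the pair index of any constraint sequence. For $f$ of dimension $\ell$, a constraint is a normal constraint if all its $i_m\ge\ell+1$. For fixed $\sigma$, the row $\{(\sigma,i):i=\ell+1,\dots,n\}$ is a free row if none of these indices belongs to the constraint sequence of a normal constraint. The free rows form the free block of $f$; all the remaining rows (with $i=\ell+1,\dots,n$) form the normal constraint block of $f$. Spaces. A mesh is conforming if any two simplices intersect in the empty set or a common sub-simplex. $\mathbb P_r(f)$: polynomials of degree $\le r$ on $f$ ($\{0\}$ if $r<0$); $\mathbb P_r(T;\mathbb X)$: $\mathbb X$-valued polynomials of degree $\le r$. For $\omega=\sum_{\sigma,i}a_{\sigma,i}\,\mathrm dx_\sigma\otimes*\mathrm dx_i$, with matrix $\boldsymbol A=(a_{\sigma,i})$: $\mathrm{div}\,\omega=\big(\sum_i\partial_{x_i}a_{\sigma,i}\big)_\sigma$; for an $(n-1)$-dimensional face $F$ with a fixed unit normal $\boldsymbol n_F$ (depending only on $F$), $\mathrm{tr}_F^{\mathrm{div}}\omega=\sum_\sigma\big(\sum_ia_{\sigma,i}(\boldsymbol n_F)_i\big)|_F\,\mathrm dx_\sigma$, an $\mathrm{Alt}^k$-valued function on $F$; $H(\mathrm{div},\Omega;\mathbb X)=\{\omega\in L^2(\Omega;\mathbb X):\mathrm{div}\,\omega\in L^2\}$, and $\mathbb B_r(\mathrm{div},T;\mathbb X)=\{\omega\in\mathbb P_r(T;\mathbb X):\mathrm{tr}_F^{\mathrm{div}}\omega=0\ \forall F\in\Delta_{n-1}(T)\}$.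 A DoF is single-valued across $f$ (resp. $F$) if its values computed from $\omega|_T$ and $\omega|_{T'}$ coincide for all $T,T'\in\mathcal T_h$ containing $f$ (resp. $F$). *)

theory Defs
  imports
    "HOL-Analysis.Analysis"
    "HOL-Combinatorics.Permutations"
    "HOL-Library.Function_Algebras"
begin

text \<open>
  Pointwise real vector space structure on functions, so that \<^const>\<open>span\<close> and \<^const>\<open>linear\<close>
  apply to forms and to form-valued functions.
\<close>

instantiation "fun" :: (type, real_vector) real_vector
begin

definition scaleR_fun :: "real \<Rightarrow> ('a \<Rightarrow> 'b) \<Rightarrow> 'a \<Rightarrow> 'b"
  where "scaleR_fun c f = (\<lambda>x. c *\<^sub>R f x)"

instance
  by standard (simp_all add: scaleR_fun_def fun_eq_iff scaleR_add_right scaleR_add_left)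

end


section \<open>Alternating forms\<close>

text \<open>
  The dimension is \<open>n = CARD('n)\<close>.  A form is a function of the list of its arguments; a \<open>j\<close>-linear
  form is set to 0 on lists whose length is not \<open>j\<close>.  The linear order on \<open>'n\<close> only serves to number
  the standard basis vectors of \<open>real ^ 'n\<close> as \<open>e\<^sub>1, \<dots>, e\<^sub>n\<close>.
\<close>

type_synonym 'n Rn = "(real, 'n) vec"
type_synonym 'n form = "'n Rn list \<Rightarrow> real"
type_synonym 'n form2 = "'n Rn list \<Rightarrow> 'n Rn list \<Rightarrow> real"

definition std_vec :: "nat \<Rightarrow> 'n::{finite,linorder} Rn"
  where "std_vec i = axis (sorted_list_of_set (UNIV :: 'n set) ! (i - 1)) 1"

definition Alt :: "nat \<Rightarrow> 'n::finite form set"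
  where "Alt j = {\<alpha>.
     (\<forall>vs. length vs \<noteq> j \<longrightarrow> \<alpha> vs = 0) \<and>
     (\<forall>vs i. length vs = j \<and> i < j \<longrightarrow> linear (\<lambda>v. \<alpha> (vs[i := v]))) \<and>
     (\<forall>vs. length vs = j \<and> \<not> distinct vs \<longrightarrow> \<alpha> vs = 0)}"

definition covector :: "'n Rn \<Rightarrow> 'n::finite form"
  where "covector u = (\<lambda>vs. if length vs = 1 then u \<bullet> hd vs else 0)"

text \<open>\<open>(\<alpha>\<^sub>1 \<and> \<dots> \<and> \<alpha>\<^sub>j)(v\<^sub>1, \<dots>, v\<^sub>j) = det (\<alpha>\<^sub>a(v\<^sub>b))\<close> for 1-forms \<open>\<alpha>\<^sub>1, \<dots>, \<alpha>\<^sub>j\<close>.\<close>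

definition wedge_list :: "'n::finite form list \<Rightarrow> 'n form"
  where "wedge_list \<alpha>s = (\<lambda>vs. if length vs = length \<alpha>s
     then \<Sum>p | p permutes {..<length \<alpha>s}.
            of_int (sign p) * (\<Prod>a<length \<alpha>s. (\<alpha>s ! a) [vs ! p a])
     else 0)"

text \<open>Increasing sequences are represented by their sets of entries.\<close>

definition inc_seqs :: "nat \<Rightarrow> nat \<Rightarrow> nat set set"  (* Sigma(1:j,1:n) *)
  where "inc_seqs j n = {\<sigma>. \<sigma> \<subseteq> {1..n} \<and> card \<sigma> = j}"

definition form_at :: "(nat \<Rightarrow> 'n::finite form) \<Rightarrow> nat set \<Rightarrow> 'n form"  (* dy_sigma *)
  where "form_at dy \<sigma> = wedge_list (map dy (sorted_list_of_set \<sigma>))"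

definition star_form :: "(nat \<Rightarrow> 'n::finite form) \<Rightarrow> nat \<Rightarrow> 'n form"  (* *dy_i *)
  where "star_form dy i = (- 1) ^ (i - 1) *\<^sub>R form_at dy ({1..CARD('n)} - {i})"

definition dx :: "nat \<Rightarrow> 'n::{finite,linorder} form"
  where "dx i = covector (std_vec i)"

definition tensor :: "'n form \<Rightarrow> 'n form \<Rightarrow> 'n form2"
  where "tensor \<alpha> \<beta> = (\<lambda>ws vs. \<alpha> ws * \<beta> vs)"

definition Alt2 :: "nat \<Rightarrow> nat \<Rightarrow> 'n::finite form2 set"  (* Alt^j tensor Alt^m *)
  where "Alt2 j m = span {tensor \<alpha> \<beta> | \<alpha> \<beta>. \<alpha> \<in> Alt j \<and> \<beta> \<in> Alt m}"

text \<open>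
  Since \<open>\<alpha> (std_args \<sigma>)\<close> is the coefficient of \<open>dx\<^sub>\<sigma>\<close> in \<open>\<alpha>\<close>, the following is the inner
  product for which the \<open>dx\<^sub>\<sigma>\<close> are orthonormal, followed by the induced tensor product inner product.
\<close>

definition std_args :: "nat set \<Rightarrow> 'n::{finite,linorder} Rn list"
  where "std_args \<sigma> = map std_vec (sorted_list_of_set \<sigma>)"

definition alt_inner :: "nat \<Rightarrow> 'n::{finite,linorder} form \<Rightarrow> 'n form \<Rightarrow> real"
  where "alt_inner j \<alpha> \<beta> = (\<Sum>\<sigma>\<in>inc_seqs j CARD('n). \<alpha> (std_args \<sigma>) * \<beta> (std_args \<sigma>))"

definition alt2_inner :: "nat \<Rightarrow> nat \<Rightarrow> 'n::{finite,linorder} form2 \<Rightarrow> 'n form2 \<Rightarrow> real"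
  where "alt2_inner j m \<omega> \<eta> =
    (\<Sum>\<sigma>\<in>inc_seqs j CARD('n). \<Sum>\<rho>\<in>inc_seqs m CARD('n).
       \<omega> (std_args \<sigma>) (std_args \<rho>) * \<eta> (std_args \<sigma>) (std_args \<rho>))"

text \<open>\<open>v\<^sub>i\<close> is \<open>vs ! (i - 1)\<close>, whence the sign \<open>(-1)^i\<close> for the list position \<open>i\<close>.\<close>

definition s_map :: "nat \<Rightarrow> 'n::finite form2 \<Rightarrow> 'n form2"
  where "s_map k \<omega> = (\<lambda>ws vs. if length ws = k - 1 \<and> length vs = CARD('n)
     then \<Sum>i<CARD('n). (- 1) ^ i * \<omega> (vs ! i # ws) (take i vs @ drop (Suc i) vs)
     else 0)"

definition XX :: "nat \<Rightarrow> 'n::finite form2 set"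
  where "XX k = {\<omega> \<in> Alt2 k (CARD('n) - 1). s_map k \<omega> = 0}"

text \<open>
  The entry \<open>a\<^sub>\<sigma>\<^sub>,\<^sub>i\<close> of the coefficient matrix of \<open>\<omega>\<close> in the orthonormal basis \<open>dx\<^sub>\<sigma> \<otimes> *dx\<^sub>i\<close> of
  \<open>Alt\<^sup>k \<otimes> Alt\<^sup>n\<^sup>-\<^sup>1\<close>.
\<close>

definition mat_coeff :: "nat \<Rightarrow> 'n::{finite,linorder} form2 \<Rightarrow> nat set \<Rightarrow> nat \<Rightarrow> real"
  where "mat_coeff k \<omega> \<sigma> i =
    alt2_inner k (CARD('n) - 1) \<omega> (tensor (form_at dx \<sigma>) (star_form dx i))"


section \<open>Simplices, meshes and integrals\<close>

definition subsimplices :: "nat \<Rightarrow> 'n Rn set \<Rightarrow> 'n::finite Rn set set"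
  where "subsimplices l T = {f. f face_of T \<and> int l simplex f}"

definition mesh_simplices :: "nat \<Rightarrow> 'n Rn set set \<Rightarrow> 'n::finite Rn set set"
  where "mesh_simplices l \<T> = (\<Union>T\<in>\<T>. subsimplices l T)"

text \<open>\<^const>\<open>triangulation\<close> contains finiteness and the conformity condition.\<close>

definition conforming_mesh :: "'n Rn set set \<Rightarrow> 'n::finite Rn set \<Rightarrow> bool"
  where "conforming_mesh \<T> \<Omega> \<longleftrightarrow>
    triangulation \<T> \<and> (\<forall>T\<in>\<T>. int CARD('n) simplex T) \<and> \<Union>\<T> = closure \<Omega>"

definition bounded_domain :: "'n::finite Rn set \<Rightarrow> bool"
  where "bounded_domain \<Omega> \<longleftrightarrow> open \<Omega> \<and> connected \<Omega> \<and> bounded \<Omega> \<and> \<Omega> \<noteq> {}"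

definition tangent_space :: "'n Rn set \<Rightarrow> 'n::finite Rn set"
  where "tangent_space f = span {x - y | x y. x \<in> f \<and> y \<in> f}"

text \<open>
  The \<open>l\<close>-dimensional surface measure \<open>dx\<^sub>f\<close> on the affine hull of an \<open>l\<close>-simplex \<open>f\<close>: the image of
  Lebesgue measure on \<open>\<real>\<^sup>l\<close> under the isometry \<open>y \<mapsto> p + \<Sum>\<^sub>i y\<^sub>i u\<^sub>i\<close>, for a point \<open>p\<close> of \<open>f\<close> and an
  orthonormal basis \<open>u\<^sub>1, \<dots>, u\<^sub>l\<close> of the tangent space.  The measure does not depend on the choice
  of \<open>p\<close> and \<open>u\<close>; for \<open>l = n\<close> it is Lebesgue measure.
\<close>

definition ortho_frame :: "'n Rn set \<Rightarrow> 'n Rn \<times> (nat \<Rightarrow> 'n::finite Rn) \<Rightarrow> bool"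
  where "ortho_frame f = (\<lambda>(p, u). p \<in> f \<and>
     (\<forall>i\<in>{1..nat (aff_dim f)}. u i \<in> tangent_space f) \<and>
     (\<forall>i\<in>{1..nat (aff_dim f)}. \<forall>j\<in>{1..nat (aff_dim f)}. u i \<bullet> u j = (if i = j then 1 else 0)))"

definition surface_measure :: "'n Rn set \<Rightarrow> 'n::finite Rn measure"
  where "surface_measure f = (let l = nat (aff_dim f); (p, u) = (SOME pu. ortho_frame f pu) in
     distr (Pi\<^sub>M {1..l} (\<lambda>_. lborel)) borel (\<lambda>y. p + (\<Sum>i=1..l. y i *\<^sub>R u i)))"

definition L2_pair :: "nat \<Rightarrow> 'n Rn set \<Rightarrow>
    ('n Rn \<Rightarrow> 'n form) \<Rightarrow> ('n Rn \<Rightarrow> 'n::{finite,linorder} form) \<Rightarrow> real"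
  where "L2_pair k f \<omega> \<eta> = (LINT x:f|surface_measure f. alt_inner k (\<omega> x) (\<eta> x))"

definition L2_pair2 :: "nat \<Rightarrow> 'n Rn set \<Rightarrow>
    ('n Rn \<Rightarrow> 'n form2) \<Rightarrow> ('n Rn \<Rightarrow> 'n::{finite,linorder} form2) \<Rightarrow> real"
  where "L2_pair2 k f \<omega> \<eta> =
    (LINT x:f|surface_measure f. alt2_inner k (CARD('n) - 1) (\<omega> x) (\<eta> x))"


section \<open>Polynomials\<close>

text \<open>
  Polynomial functions of degree at most \<open>r\<close> on \<open>f\<close>, extended by 0 outside \<open>f\<close>; for \<open>r < 0\<close> there
  are no admissible exponents and the space is \<open>{0}\<close>.
\<close>

definition polys :: "int \<Rightarrow> 'n Rn set \<Rightarrow> ('n::finite Rn \<Rightarrow> real) set"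
  where "polys r f = {q. \<exists>c. q = (\<lambda>x. if x \<in> f
     then \<Sum>\<alpha> | int (\<Sum>i\<in>UNIV. \<alpha> i) \<le> r. c \<alpha> * (\<Prod>i\<in>UNIV. (x $ i) ^ \<alpha> i) else 0)}"

definition poly_tensor :: "int \<Rightarrow> 'n Rn set \<Rightarrow> 'b set \<Rightarrow>
    ('n::finite Rn \<Rightarrow> 'b::real_vector) set"  (* P_r(f) tensor W *)
  where "poly_tensor r f W = span {(\<lambda>x. q x *\<^sub>R w) | q w. q \<in> polys r f \<and> w \<in> W}"

definition poly_XX :: "nat \<Rightarrow> nat \<Rightarrow> 'n Rn set \<Rightarrow> ('n::finite Rn \<Rightarrow> 'n form2) set"
  where "poly_XX k r T = poly_tensor (int r) T (XX k)"


section \<open>\<open>t\<close>-\<open>n\<close> bases\<close>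

definition lin_indep_family :: "nat \<Rightarrow> (nat \<Rightarrow> 'n::finite Rn) \<Rightarrow> bool"
  where "lin_indep_family m v \<longleftrightarrow> inj_on v {1..m} \<and> independent (v ` {1..m})"

definition tn_basis :: "nat \<Rightarrow> 'n Rn set \<Rightarrow>
    (nat \<Rightarrow> 'n Rn) \<Rightarrow> (nat \<Rightarrow> 'n::finite Rn) \<Rightarrow> bool"
  where "tn_basis l f t \<nu> \<longleftrightarrow>
    lin_indep_family l t \<and> (\<forall>i\<in>{1..l}. norm (t i) = 1 \<and> t i \<in> tangent_space f) \<and>
    lin_indep_family (CARD('n) - l) \<nu> \<and>
    (\<forall>j\<in>{1..CARD('n) - l}. norm (\<nu> j) = 1 \<and> (\<forall>u\<in>tangent_space f. \<nu> j \<bullet> u = 0))"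

definition tn_forms :: "nat \<Rightarrow> (nat \<Rightarrow> 'n Rn) \<Rightarrow> (nat \<Rightarrow> 'n Rn) \<Rightarrow> nat \<Rightarrow> 'n::finite form"
  where "tn_forms l t \<nu> i = covector (if i \<le> l then t i else \<nu> (i - l))"

definition dual_basis :: "(nat \<Rightarrow> 'n form) \<Rightarrow> (nat \<Rightarrow> 'n::{finite,linorder} form) \<Rightarrow> bool"
  where "dual_basis dy dyh \<longleftrightarrow>
    (\<forall>i\<in>{1..CARD('n)}. dyh i \<in> Alt 1) \<and>
    (\<forall>i\<in>{1..CARD('n)}. \<forall>j\<in>{1..CARD('n)}. alt_inner 1 (dyh i) (dy j) = (if i = j then 1 else 0))"


section \<open>Constraint sequences and blocks\<close>

definition constraint_seq :: "nat \<Rightarrow> nat set \<Rightarrow> (nat set \<times> nat) list"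
  where "constraint_seq n \<tau> = map (\<lambda>i. (insert i \<tau>, i)) (sorted_list_of_set ({1..n} - \<tau>))"

definition pair_index :: "nat \<Rightarrow> nat set \<Rightarrow> nat set \<times> nat"
  where "pair_index n \<tau> = hd (constraint_seq n \<tau>)"

definition free_index :: "nat \<Rightarrow> nat \<Rightarrow> nat set \<times> nat \<Rightarrow> bool"
  where "free_index n k idx \<longleftrightarrow> idx \<in> inc_seqs k n \<times> {1..n} \<and>
    (\<forall>\<tau>\<in>inc_seqs (k - 1) n. idx \<noteq> pair_index n \<tau>)"

definition normal_constraint :: "nat \<Rightarrow> nat \<Rightarrow> nat set \<Rightarrow> bool"
  where "normal_constraint n l \<tau> \<longleftrightarrow> (\<forall>i\<in>{1..n} - \<tau>. l + 1 \<le> i)"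

definition free_row :: "nat \<Rightarrow> nat \<Rightarrow> nat \<Rightarrow> nat set \<Rightarrow> bool"
  where "free_row n k l \<sigma> \<longleftrightarrow> \<sigma> \<in> inc_seqs k n \<and>
    (\<forall>\<tau>\<in>inc_seqs (k - 1) n. normal_constraint n l \<tau> \<longrightarrow>
       (\<forall>i\<in>{l+1..n}. (\<sigma>, i) \<notin> set (constraint_seq n \<tau>)))"

definition normal_block :: "nat \<Rightarrow> nat \<Rightarrow> nat \<Rightarrow> (nat set \<times> nat) set"
  where "normal_block n k l =
    {(\<sigma>, i). \<sigma> \<in> inc_seqs k n \<and> \<not> free_row n k l \<sigma> \<and> i \<in> {l+1..n}}"


section \<open>Trace and bubble space\<close>

definition trace_div :: "nat \<Rightarrow> 'n Rn \<Rightarrow> 'n Rn set \<Rightarrow>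
    ('n Rn \<Rightarrow> 'n form2) \<Rightarrow> 'n Rn \<Rightarrow> 'n::{finite,linorder} form"
  where "trace_div k \<nu> F \<omega> = (\<lambda>x. if x \<in> F
     then \<Sum>\<sigma>\<in>inc_seqs k CARD('n).
            (\<Sum>i=1..CARD('n). mat_coeff k (\<omega> x) \<sigma> i * (\<nu> \<bullet> std_vec i)) *\<^sub>R form_at dx \<sigma>
     else 0)"

definition bubble :: "nat \<Rightarrow> nat \<Rightarrow> ('n Rn set \<Rightarrow> 'n Rn) \<Rightarrow> 'n Rn set \<Rightarrow>
    ('n Rn \<Rightarrow> 'n::{finite,linorder} form2) set"
  where "bubble k r nF T =
    {\<omega> \<in> poly_XX k r T. \<forall>F\<in>subsimplices (CARD('n) - 1) T. trace_div k (nF F) F \<omega> = 0}"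


section \<open>Degrees of freedom\<close>

text \<open>
  The spaces of test functions in the DoFs (b) and (c) for an \<open>l\<close>-simplex \<open>f\<close>, where \<open>dyh\<close> is the
  dual of the basis of 1-forms associated with the \<open>t\<close>-\<open>n\<close> basis of \<open>f\<close>.
\<close>

definition test_b :: "nat \<Rightarrow> nat \<Rightarrow> nat \<Rightarrow> 'n Rn set \<Rightarrow> (nat \<Rightarrow> 'n form) \<Rightarrow>
    ('n Rn \<Rightarrow> 'n::finite form2) set"
  where "test_b k r l f dyh = poly_tensor (int r - (int l + 1)) f
    (span {tensor (form_at dyh \<sigma>) (star_form dyh i) | \<sigma> i.
       free_index CARD('n) k (\<sigma>, i) \<and> (\<sigma>, i) \<in> normal_block CARD('n) k l})"

definition test_c :: "nat \<Rightarrow> nat \<Rightarrow> nat \<Rightarrow> 'n Rn set \<Rightarrow> (nat \<Rightarrow> 'n form) \<Rightarrow>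
    ('n Rn \<Rightarrow> 'n::finite form) set"
  where "test_c k r l f dyh = poly_tensor (int r - (int l + 1)) f
    (span {form_at dyh \<sigma> | \<sigma>. free_row CARD('n) k l \<sigma>})"

text \<open>
  Arbitrary values of the DoFs on \<open>T\<close> are an element of \<open>XX\<close> for every vertex and a linear
  functional on each test space; every linear functional on a subspace is the restriction of a linear
  functional on the whole function space, so it suffices to quantify over the latter.
\<close>

definition unisolvent :: "nat \<Rightarrow> nat \<Rightarrow> ('n Rn set \<Rightarrow> nat \<Rightarrow> 'n form) \<Rightarrow>
    ('n Rn set \<Rightarrow> 'n Rn) \<Rightarrow> 'n::{finite,linorder} Rn set \<Rightarrow> bool"
  where "unisolvent k r dyh nF T \<longleftrightarrow>
    (\<forall>A La Lb Lc.
       (\<forall>v. {v} \<in> subsimplices 0 T \<longrightarrow> A v \<in> XX k) \<longrightarrow>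
       (\<forall>f. linear (La f :: ('n Rn \<Rightarrow> 'n form2) \<Rightarrow> real)) \<longrightarrow>
       (\<forall>F f. linear (Lb F f :: ('n Rn \<Rightarrow> 'n form) \<Rightarrow> real)) \<longrightarrow>
       linear (Lc :: ('n Rn \<Rightarrow> 'n form2) \<Rightarrow> real) \<longrightarrow>
       (\<exists>!\<omega>. \<omega> \<in> poly_XX k r T \<and>
          (\<forall>v. {v} \<in> subsimplices 0 T \<longrightarrow> \<omega> v = A v) \<and>
          (\<forall>l\<in>{1..CARD('n) - 1}. \<forall>f\<in>subsimplices l T. \<forall>\<eta>\<in>test_b k r l f (dyh f).
             L2_pair2 k f \<omega> \<eta> = La f \<eta>) \<and>
          (\<forall>F\<in>subsimplices (CARD('n) - 1) T.
             \<forall>l\<in>{1..CARD('n) - 1}. \<forall>f\<in>subsimplices l F. \<forall>\<eta>\<in>test_c k r l f (dyh f).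
               L2_pair k f (trace_div k (nF F) F \<omega>) \<eta> = Lb F f \<eta>) \<and>
          (\<forall>\<eta>\<in>bubble k r nF T. L2_pair2 k T \<omega> \<eta> = Lc \<eta>)))"


section \<open>Function spaces on the domain\<close>

definition L2_fun :: "'n::finite Rn set \<Rightarrow> ('n Rn \<Rightarrow> real) set"
  where "L2_fun \<Omega> = {g. g \<in> borel_measurable (lebesgue_on \<Omega>) \<and>
     integrable (lebesgue_on \<Omega>) (\<lambda>x. (g x)\<^sup>2)}"

definition L2_XX :: "nat \<Rightarrow> 'n Rn set \<Rightarrow> ('n::finite Rn \<Rightarrow> 'n form2) set"
  where "L2_XX k \<Omega> = {\<omega>. (\<forall>x\<in>\<Omega>. \<omega> x \<in> XX k) \<and> (\<forall>ws vs. (\<lambda>x. \<omega> x ws vs) \<in> L2_fun \<Omega>)}"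

definition partial_deriv :: "nat \<Rightarrow> ('n Rn \<Rightarrow> real) \<Rightarrow> 'n::{finite,linorder} Rn \<Rightarrow> real"
  where "partial_deriv i \<phi> = (\<lambda>x. frechet_derivative \<phi> (at x) (std_vec i))"

fun C_k :: "nat \<Rightarrow> ('n::{finite,linorder} Rn \<Rightarrow> real) \<Rightarrow> bool"
  where
    "C_k 0 \<phi> \<longleftrightarrow> continuous_on UNIV \<phi>"
  | "C_k (Suc m) \<phi> \<longleftrightarrow> (\<forall>x. \<phi> differentiable (at x)) \<and>
       (\<forall>i\<in>{1..CARD('n)}. C_k m (partial_deriv i \<phi>))"

definition test_functions :: "'n Rn set \<Rightarrow> ('n::{finite,linorder} Rn \<Rightarrow> real) set"
  where "test_functions \<Omega> = {\<phi>. (\<forall>m. C_k m \<phi>) \<and>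
     (\<exists>K. compact K \<and> K \<subseteq> \<Omega> \<and> (\<forall>x. x \<notin> K \<longrightarrow> \<phi> x = 0))}"

text \<open>\<open>g\<close> is the distributional divergence \<open>(\<Sum>\<^sub>i \<partial>\<^sub>i a\<^sub>\<sigma>\<^sub>,\<^sub>i)\<^sub>\<sigma>\<close> of \<open>\<omega>\<close>.\<close>

definition has_weak_div :: "nat \<Rightarrow> 'n Rn set \<Rightarrow> ('n Rn \<Rightarrow> 'n form2) \<Rightarrow>
    (nat set \<Rightarrow> 'n::{finite,linorder} Rn \<Rightarrow> real) \<Rightarrow> bool"
  where "has_weak_div k \<Omega> \<omega> g \<longleftrightarrow>
    (\<forall>\<sigma>\<in>inc_seqs k CARD('n). \<forall>\<phi>\<in>test_functions \<Omega>.
       (\<integral>x. g \<sigma> x * \<phi> x \<partial>lebesgue_on \<Omega>) =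
       - (\<integral>x. (\<Sum>i=1..CARD('n). mat_coeff k (\<omega> x) \<sigma> i * partial_deriv i \<phi> x) \<partial>lebesgue_on \<Omega>))"

definition H_div :: "nat \<Rightarrow> 'n Rn set \<Rightarrow> ('n::{finite,linorder} Rn \<Rightarrow> 'n form2) set"
  where "H_div k \<Omega> = {\<omega> \<in> L2_XX k \<Omega>.
     \<exists>g. (\<forall>\<sigma>\<in>inc_seqs k CARD('n). g \<sigma> \<in> L2_fun \<Omega>) \<and> has_weak_div k \<Omega> \<omega> g}"

text \<open>
  \<open>p T\<close> is the polynomial representative of \<open>\<omega>|\<^sub>T\<close>, from which the DoFs on \<open>T\<close> are computed; \<open>\<omega>\<close> itself
  is only determined almost everywhere.
\<close>

definition V_h :: "nat \<Rightarrow> nat \<Rightarrow> ('n Rn set \<Rightarrow> nat \<Rightarrow> 'n form) \<Rightarrow>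
    ('n Rn set \<Rightarrow> 'n Rn) \<Rightarrow> 'n Rn set set \<Rightarrow> 'n Rn set \<Rightarrow>
    ('n::{finite,linorder} Rn \<Rightarrow> 'n form2) set"
  where "V_h k r dyh nF \<T> \<Omega> = {\<omega> \<in> L2_XX k \<Omega>. \<exists>p.
     (\<forall>T\<in>\<T>. p T \<in> poly_XX k r T \<and> (AE x in lebesgue. x \<in> T \<inter> \<Omega> \<longrightarrow> \<omega> x = p T x)) \<and>
     (\<forall>T\<in>\<T>. \<forall>T'\<in>\<T>. \<forall>v. {v} \<in> subsimplices 0 T \<inter> subsimplices 0 T' \<longrightarrow> p T v = p T' v) \<and>
     (\<forall>T\<in>\<T>. \<forall>T'\<in>\<T>. \<forall>l\<in>{1..CARD('n) - 1}. \<forall>f\<in>subsimplices l T \<inter> subsimplices l T'.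
        \<forall>\<eta>\<in>test_b k r l f (dyh f). L2_pair2 k f (p T) \<eta> = L2_pair2 k f (p T') \<eta>) \<and>
     (\<forall>T\<in>\<T>. \<forall>T'\<in>\<T>.
        \<forall>F\<in>subsimplices (CARD('n) - 1) T \<inter> subsimplices (CARD('n) - 1) T'.
        \<forall>l\<in>{1..CARD('n) - 1}. \<forall>f\<in>subsimplices l F. \<forall>\<eta>\<in>test_c k r l f (dyh f).
          L2_pair k f (trace_div k (nF F) F (p T)) \<eta> =
          L2_pair k f (trace_div k (nF F) F (p T')) \<eta>)}"

end

theory Submission
  imports Defs
begin

text \<open>
  Unisolvence.  In the dual of a \<open>t\<close>-\<open>n\<close> basis of a face \<open>f\<close>, membership in the kernel \<open>XX\<close> means that
  the coefficients along every constraint sequence sum to zero up to sign, so the free coefficients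
  are arbitrary and determine the rest.  The rows in the normal constraint block are therefore governed
  by DoFs (b), and the free rows by the traces on the facets containing \<open>f\<close>, that is by (c): the
  normals of these facets form a basis of the normal space of \<open>f\<close>.  Going up in the dimension of
  \<open>f\<close>, a trace which vanishes on the boundary of \<open>f\<close> is the product of the barycentric bubble of \<open>f\<close> and
  a polynomial of degree \<open>r - (dim f + 1)\<close>, which the DoFs on \<open>f\<close> see as a positive definite
  pairing; this gives both uniqueness and, correcting face by face, existence, and (d) fixes the
  remaining bubble.  The same induction on a facet shows that its trace depends only on the DoFs
  attached to it, so it is single-valued.

  Conformity.  By the divergence theorem on each simplex, the traces on shared facets cancel and test
  functions vanish on the others.  Facet fluxes are expressed as averages over unit slabs
  orthogonal to the facet, so that the divergence theorem reduces to the one-dimensional fundamental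
  theorem of calculus and limits of Lipschitz cutoffs, without surface integrals.
\<close>

text \<open>The normal indices of a face decide which DoF sees a row. In a free row every entry with
  a normal index is free, so modulo the tangent space the row is an arbitrary vector, and its
  products with the normals of the facets through the face can be prescribed independently. In any
  other row an entry that is not free is tied by its constraint to free entries of the same block,
  so (b) determines the normal part of the row and its share in the traces on all facets through the
  face.

  No dimensions are counted. Uniqueness and existence use the same definite pairing, the integral of
  bubble times p times q: any functional on the test space comes from a polynomial divisible by the
  bubble of the face, and this divisibility leaves the DoFs on smaller faces, and on other faces of
  the same dimension, unchanged.

  The frames are not orthonormal, and passing from the standard basis to a dual frame multiplies the
  normal trace by a determinant. This is the constant \<open>\<kappa>\<close>, nonzero and common to
  all rows, normals and forms.\<close>

lemma fun_sum_apply: "(\<Sum>x\<in>A. f x) y = (\<Sum>x\<in>A. f x y :: 'b::comm_monoid_add)"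
  by (induction A rule: infinite_finite_induct) auto

lemma fun_scaleR_apply [simp]: "(c *\<^sub>R f) x = c *\<^sub>R f x"
  by (simp add: scaleR_fun_def)

section \<open>Linear algebra: alternating forms, the kernel and the trace in an arbitrary pair of
  dual bases\<close>

section \<open>Alternating forms\<close>

lemma Alt_linear: "\<alpha> \<in> Alt j \<Longrightarrow> length vs = j \<Longrightarrow> i < j \<Longrightarrow> linear (\<lambda>v. \<alpha> (vs[i := v]))"
  by (simp add: Alt_def)

lemma Alt_length: "\<alpha> \<in> Alt j \<Longrightarrow> length vs \<noteq> j \<Longrightarrow> \<alpha> vs = 0"
  by (simp add: Alt_def)

lemma Alt_distinct: "\<alpha> \<in> Alt j \<Longrightarrow> \<not> distinct vs \<Longrightarrow> \<alpha> vs = 0"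
  by (cases "length vs = j") (simp_all add: Alt_def)

lemma Alt_linear_append:
  assumes "\<alpha> \<in> Alt j" "Suc (length xs + length ys) = j"
  shows "linear (\<lambda>v. \<alpha> (xs @ v # ys))"
  using Alt_linear[OF assms(1), of "xs @ 0 # ys" "length xs"] assms(2) by simp

lemma subspace_Alt: "subspace (Alt j :: 'n::finite form set)"
proof (rule subspaceI)
  fix x y :: "'n form" assume "x \<in> Alt j" "y \<in> Alt j"
  then show "x + y \<in> Alt j" by (auto simp: Alt_def intro!: linear_compose_add)
next
  fix c :: real and x :: "'n form" assume "x \<in> Alt j"
  then show "c *\<^sub>R x \<in> Alt j"
    using linear_compose_scale_right[of _ c] by (auto simp: Alt_def real_scaleR_def[symmetric] simp del: real_scaleR_def)
qed (auto simp: Alt_def linear_zero zero_fun_def)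

text \<open>Polarization: the value at the repeated argument \<open>u + v\<close> vanishes, and
  expanding it leaves the two mixed terms. \<open>Alt\<close> encodes antisymmetry by vanishing on
  repeated arguments.\<close>

lemma Alt_swap_adjacent:
  assumes "\<alpha> \<in> Alt j"
  shows "\<alpha> (xs @ u # v # ys) = - \<alpha> (xs @ v # u # ys)"
proof (cases "Suc (Suc (length xs + length ys)) = j")
  case True
  have add1: "\<alpha> (xs @ (a + b) # w # ys) = \<alpha> (xs @ a # w # ys) + \<alpha> (xs @ b # w # ys)" for a b w
    using linear_add[OF Alt_linear_append[OF assms, of xs "w # ys"]] True by simp
  have add2: "\<alpha> (xs @ w # (a + b) # ys) = \<alpha> (xs @ w # a # ys) + \<alpha> (xs @ w # b # ys)" for a b w
    using linear_add[OF Alt_linear_append[OF assms, of "xs @ [w]" ys]] True by simp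
  have zero: "\<alpha> (xs @ w # w # ys) = 0" for w
    by (rule Alt_distinct[OF assms]) simp
  have "\<alpha> (xs @ (u + v) # (u + v) # ys) = 0" by (rule zero)
  then show ?thesis
    unfolding add1 add2 using zero[of u] zero[of v] by linarith
qed (use assms Alt_length in force)

lemma Alt_move:
  assumes "\<alpha> \<in> Alt j"
  shows "\<alpha> (xs @ u # ys @ zs) = (- 1) ^ length ys * \<alpha> (xs @ ys @ u # zs)"
proof (induction ys arbitrary: xs)
  case (Cons y ys)
  show ?case
    using Alt_swap_adjacent[OF assms, of xs u y "ys @ zs"] Cons.IH[of "xs @ [y]"] by simp
qed simp

text \<open>Absolute values suffice because the lemma serves to transfer vanishing from sorted
  arguments to reordered ones. The prefix \<open>zs\<close> lets the induction fix the first
  argument once it has been moved into place.\<close>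

lemma Alt_mset_abs:
  assumes "\<alpha> \<in> Alt j" "mset xs = mset ys"
  shows "\<bar>\<alpha> (zs @ xs)\<bar> = \<bar>\<alpha> (zs @ ys)\<bar>"
  using assms(2)
proof (induction xs arbitrary: ys zs)
  case (Cons x xs)
  then obtain as bs where ys: "ys = as @ x # bs"
    by (metis list.set_intros(1) mset_eq_setD split_list)
  then have "mset xs = mset (as @ bs)" using Cons.prems by simp
  from Cons.IH[OF this, of "zs @ [x]"] show ?case
    using Alt_move[OF assms(1), of zs x as bs] by (simp add: ys abs_mult power_abs)
qed simp

definition blist :: "(nat \<Rightarrow> 'a) \<Rightarrow> nat set \<Rightarrow> 'a list"
  where "blist b \<sigma> = map b (sorted_list_of_set \<sigma>)"

lemma inc_seqs_finite [simp]: "finite (inc_seqs j n)"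
  by (rule finite_subset[of _ "Pow {1..n}"]) (auto simp: inc_seqs_def)

lemma inc_seqsD: "\<sigma> \<in> inc_seqs j n \<Longrightarrow> \<sigma> \<subseteq> {1..n} \<and> card \<sigma> = j \<and> finite \<sigma>"
  by (auto simp: inc_seqs_def intro: finite_subset)

lemma length_blist [simp]: "finite \<sigma> \<Longrightarrow> length (blist b \<sigma>) = card \<sigma>"
  by (simp add: blist_def)

text \<open>Arguments are traded for basis vectors one at a time. In \<open>gen\<close> a prefix of
  arbitrary vectors is followed by basis vectors \<open>map b xs\<close>; linearity in the last
  arbitrary slot extends vanishing from the vectors of \<open>b\<close> to their span. With no
  arbitrary slot left, sorting reduces to the increasing lists of the hypothesis.\<close>

lemma Alt_eq_0:
  fixes b :: "nat \<Rightarrow> 'n::finite Rn"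
  assumes \<alpha>: "\<alpha> \<in> Alt j" and b: "span (b ` {1..n}) = UNIV"
    and z: "\<And>\<sigma>. \<sigma> \<in> inc_seqs j n \<Longrightarrow> \<alpha> (blist b \<sigma>) = 0"
  shows "\<alpha> vs = 0"
proof -
  have base: "\<alpha> (map b xs) = 0" if xs: "set xs \<subseteq> {1..n}" for xs
  proof (cases "distinct (map b xs) \<and> length xs = j")
    case True
    then have d: "distinct xs" by (simp add: distinct_map)
    have "set xs \<in> inc_seqs j n" using xs True d by (auto simp: inc_seqs_def distinct_card)
    moreover have "mset xs = mset (sorted_list_of_set (set xs))"
      using d by (simp flip: set_eq_iff_mset_eq_distinct)
    then have "mset (map b xs) = mset (blist b (set xs))" by (simp add: blist_def)
    from Alt_mset_abs[OF \<alpha> this, of "[]"] have "\<bar>\<alpha> (map b xs)\<bar> = \<bar>\<alpha> (blist b (set xs))\<bar>" by simp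
    ultimately show ?thesis using z by simp
  qed (use Alt_distinct[OF \<alpha>, of "map b xs"] Alt_length[OF \<alpha>, of "map b xs"] in auto)
  have gen: "\<alpha> (vs @ map b xs) = 0" if "set xs \<subseteq> {1..n}" for xs
    using that
  proof (induction vs arbitrary: xs rule: rev_induct)
    case (snoc v vs)
    show ?case
    proof (cases "Suc (length vs + length xs) = j")
      case True
      have lin: "linear (\<lambda>v. \<alpha> (vs @ v # map b xs))"
        by (rule Alt_linear_append[OF \<alpha>]) (simp add: True)
      have "\<alpha> (vs @ w # map b xs) = 0" if w: "w \<in> b ` {1..n}" for w
      proof -
        obtain i where i: "i \<in> {1..n}" "w = b i" using w by auto
        then show ?thesis using snoc.IH[of "i # xs"] snoc.prems by simp
      qed
      from linear_eq_0_on_span[OF lin this] show ?thesis using b by simp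
    qed (use Alt_length[OF \<alpha>, of "(vs @ [v]) @ map b xs"] in auto)
  qed (simp add: base)
  show ?thesis using gen[of "[]"] by simp
qed

lemma Alt_eqI:
  fixes b :: "nat \<Rightarrow> 'n::finite Rn"
  assumes "\<alpha> \<in> Alt j" "\<beta> \<in> Alt j" "span (b ` {1..n}) = UNIV"
    and "\<And>\<sigma>. \<sigma> \<in> inc_seqs j n \<Longrightarrow> \<alpha> (blist b \<sigma>) = \<beta> (blist b \<sigma>)"
  shows "\<alpha> = \<beta>"
  using Alt_eq_0[OF subspace_diff[OF subspace_Alt assms(1,2)] assms(3)] assms(4)
  by (simp add: fun_eq_iff)

lemma wedge_list_covector:
  assumes "length vs = length us"
  shows "wedge_list (map covector us) vs =
    (\<Sum>p | p permutes {..<length us}. of_int (sign p) * (\<Prod>a<length us. us ! a \<bullet> vs ! p a))"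
  using assms by (simp add: wedge_list_def covector_def)

lemma wedge_list_length: "length vs \<noteq> length us \<Longrightarrow> wedge_list (map covector us) vs = 0"
  by (simp add: wedge_list_def)

text \<open>A determinant is invariant under transposition: permutations are reindexed by their
  inverses. This exchanges covectors and arguments in \<open>alt_inner_wedge\<close>.\<close>

lemma wedge_list_commute:
  "wedge_list (map covector us) vs = wedge_list (map covector vs) us"
proof (cases "length vs = length us")
  case True
  let ?m = "length us"
  have "(\<Sum>p | p permutes {..<?m}. of_int (sign p) * (\<Prod>a<?m. us ! a \<bullet> vs ! p a))
      = (\<Sum>p | p permutes {..<?m}. of_int (sign (inv p)) * (\<Prod>a<?m. us ! a \<bullet> vs ! inv p a))"
    by (rule sum.reindex_bij_witness[of _ inv inv]) (auto simp: permutes_inv permutes_inv_inv)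
  also have "\<dots> = (\<Sum>p | p permutes {..<?m}. of_int (sign p) * (\<Prod>a<?m. vs ! a \<bullet> us ! p a))"
  proof (rule sum.cong[OF refl])
    fix p assume "p \<in> {p. p permutes {..<?m}}"
    then have p: "p permutes {..<?m}" by simp
    have "(\<Prod>a<?m. us ! a \<bullet> vs ! inv p a) = (\<Prod>a<?m. us ! p a \<bullet> vs ! inv p (p a))"
      using prod.permute[OF p, of "\<lambda>a. us ! a \<bullet> vs ! inv p a"] by (simp add: o_def)
    also have "\<dots> = (\<Prod>a<?m. vs ! a \<bullet> us ! p a)"
      using p by (simp add: permutes_inverses inner_commute)
    finally show "of_int (sign (inv p)) * (\<Prod>a<?m. us ! a \<bullet> vs ! inv p a) =
        of_int (sign p) * (\<Prod>a<?m. vs ! a \<bullet> us ! p a)"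
      using sign_inverse[of p] p permutation_permutes[of p] by auto
  qed
  finally show ?thesis using True by (simp add: wedge_list_covector)
qed (simp add: wedge_list_def)

lemma wedge_list_Alt: "wedge_list (map covector us) \<in> Alt (length us)"
  unfolding Alt_def
proof (intro CollectI conjI allI impI; (elim conjE)?)
  fix vs :: "'a Rn list" assume "length vs \<noteq> length us"
  then show "wedge_list (map covector us) vs = 0" by (rule wedge_list_length)
next
  fix vs :: "'a Rn list" and i assume len: "length vs = length us" and i: "i < length us"
  let ?m = "length us"
  have "of_int (sign p) * (\<Prod>a<?m. us ! a \<bullet> vs[i := v] ! p a) =
      (of_int (sign p) * (\<Prod>a\<in>{..<?m} - {inv p i}. us ! a \<bullet> vs ! p a)) * (us ! inv p i \<bullet> v)"
    if "p \<in> {p. p permutes {..<?m}}" for p v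
  proof -
    have p: "p permutes {..<?m}" using that by simp
    have inv: "inv p i < ?m" using permutes_in_image[OF permutes_inv[OF p], of i] i by simp
    have "(\<Prod>a<?m. us ! a \<bullet> vs[i := v] ! p a) = (us ! inv p i \<bullet> vs[i := v] ! p (inv p i)) *
        (\<Prod>a\<in>{..<?m} - {inv p i}. us ! a \<bullet> vs[i := v] ! p a)"
      by (rule prod.remove) (use inv in auto)
    also have "(\<Prod>a\<in>{..<?m} - {inv p i}. us ! a \<bullet> vs[i := v] ! p a) =
        (\<Prod>a\<in>{..<?m} - {inv p i}. us ! a \<bullet> vs ! p a)"
    proof (rule prod.cong[OF refl])
      fix a assume "a \<in> {..<?m} - {inv p i}"
      then have "p a \<noteq> i" using permutes_inv_eq[OF p, of i a] by auto
      then show "us ! a \<bullet> vs[i := v] ! p a = us ! a \<bullet> vs ! p a" by simp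
    qed
    also have "vs[i := v] ! p (inv p i) = v" using p i len by (simp add: permutes_inverses)
    finally show ?thesis by simp
  qed
  then have *: "(\<lambda>v. wedge_list (map covector us) (vs[i := v])) = (\<lambda>v. \<Sum>p | p permutes {..<?m}.
      (of_int (sign p) * (\<Prod>a\<in>{..<?m} - {inv p i}. us ! a \<bullet> vs ! p a)) * (us ! inv p i \<bullet> v))"
    using len by (simp add: wedge_list_covector fun_eq_iff mult.assoc)
  show "linear (\<lambda>v. wedge_list (map covector us) (vs[i := v]))"
    unfolding * by (intro linearI) (simp_all add: inner_add_right sum.distrib algebra_simps sum_distrib_left)
next
  fix vs :: "'a Rn list" assume len: "length vs = length us" and nd: "\<not> distinct vs"
  let ?m = "length us"
  obtain i j where ij: "i < ?m" "j < ?m" "i \<noteq> j" "vs ! i = vs ! j"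
    using nd len by (auto simp: distinct_conv_nth)
  let ?t = "Transposition.transpose i j"
  let ?F = "\<lambda>p. of_int (sign p) * (\<Prod>a<?m. us ! a \<bullet> vs ! p a) :: real"
  have t: "?t permutes {..<?m}" using ij by (intro permutes_swap_id) auto
  have tt: "?t \<circ> (?t \<circ> p) = p" for p by (simp add: fun_eq_iff)
  \<comment> \<open>Composition with the transposition of the two equal positions is an involution
    that keeps each product and flips its sign, so the sum equals its own negative.\<close>
  have "(\<Sum>p | p permutes {..<?m}. ?F p) = (\<Sum>p | p permutes {..<?m}. ?F (?t \<circ> p))"
    by (rule sum.reindex_bij_witness[of _ "\<lambda>p. ?t \<circ> p" "\<lambda>p. ?t \<circ> p"])
      (use permutes_compose[OF _ t] in \<open>auto simp only: tt mem_Collect_eq\<close>)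
  also have "\<dots> = (\<Sum>p | p permutes {..<?m}. - ?F p)"
  proof (rule sum.cong[OF refl])
    fix p assume "p \<in> {p. p permutes {..<?m}}"
    then have p: "permutation p" using permutation_permutes by auto
    have "sign (?t \<circ> p) = - sign p"
      using sign_compose[OF permutation_swap_id p, of i j] ij by (simp add: sign_swap_id)
    moreover have "vs ! (?t \<circ> p) a = vs ! p a" for a
      using ij by (auto simp: Transposition.transpose_def)
    ultimately show "?F (?t \<circ> p) = - ?F p" by (simp del: comp_apply)
  qed
  finally show "wedge_list (map covector us) vs = 0"
    using len by (simp add: wedge_list_covector sum_negf)
qed

text \<open>The matrix of pairings has entries 0 and 1, so a permutation contributes only if it
  matches the two lists entry by entry. Matching forces the index sets to agree, and a
  duplicate-free list is matched to itself only by the identity.\<close>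

lemma wedge_list_dual:
  assumes dual: "\<And>i j. i \<in> {1..n} \<Longrightarrow> j \<in> {1..n} \<Longrightarrow> b i \<bullet> b' j = (if i = j then 1 else 0 :: real)"
    and \<sigma>: "\<sigma> \<in> inc_seqs k n" and \<rho>: "\<rho> \<in> inc_seqs k n"
  shows "wedge_list (map covector (blist b \<sigma>)) (blist b' \<rho>) = (if \<sigma> = \<rho> then 1 else 0)"
proof -
  note s = inc_seqsD[OF \<sigma>] and r = inc_seqsD[OF \<rho>]
  let ?s = "sorted_list_of_set \<sigma>" and ?r = "sorted_list_of_set \<rho>"
  have ls: "length ?s = k" "length ?r = k" using s r by auto
  have in_s: "?s ! a \<in> \<sigma>" if "a < k" for a using nth_mem[of a ?s] that s by simp
  have in_r: "?r ! a \<in> \<rho>" if "a < k" for a using nth_mem[of a ?r] that r by simp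
  have val: "b (?s ! a) \<bullet> b' (?r ! c) = (if ?s ! a = ?r ! c then 1 else 0)" if "a < k" "c < k" for a c
    using dual in_s[OF that(1)] in_r[OF that(2)] s r by blast
  have trm: "(\<Prod>a<k. blist b \<sigma> ! a \<bullet> blist b' \<rho> ! p a) = (if p = id \<and> \<sigma> = \<rho> then 1 else 0)"
    if p: "p permutes {..<k}" for p
  proof -
    have pk: "p a < k" if "a < k" for a using permutes_in_image[OF p, of a] that by simp
    have "(\<Prod>a<k. blist b \<sigma> ! a \<bullet> blist b' \<rho> ! p a) = (\<Prod>a<k. if ?s ! a = ?r ! p a then 1 else 0)"
      by (rule prod.cong) (use val pk ls in \<open>auto simp: blist_def\<close>)
    also have "\<dots> = (if \<forall>a<k. ?s ! a = ?r ! p a then 1 else 0)"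
      by (cases "\<forall>a<k. ?s ! a = ?r ! p a") (auto intro!: prod_zero)
    also have "(\<forall>a<k. ?s ! a = ?r ! p a) \<longleftrightarrow> p = id \<and> \<sigma> = \<rho>"
    proof
      assume all: "\<forall>a<k. ?s ! a = ?r ! p a"
      have "\<sigma> \<subseteq> \<rho>"
      proof
        fix x assume "x \<in> \<sigma>"
        then obtain a where "a < k" "x = ?s ! a" using s ls by (metis in_set_conv_nth set_sorted_list_of_set)
        then show "x \<in> \<rho>" using all in_r pk by auto
      qed
      then have eq: "\<sigma> = \<rho>" using s r by (intro card_subset_eq) auto
      have "p a = a" for a
      proof (cases "a < k")
        case True
        then have "?s ! a = ?s ! p a" using all eq by simp
        then show ?thesis using nth_eq_iff_index_eq[of ?s a "p a"] True pk ls by simp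
      qed (use p in \<open>auto simp: permutes_def\<close>)
      then show "p = id \<and> \<sigma> = \<rho>" using eq by auto
    qed auto
    finally show ?thesis by simp
  qed
  have "wedge_list (map covector (blist b \<sigma>)) (blist b' \<rho>) =
      (\<Sum>p | p permutes {..<k}. of_int (sign p) * (if p = id \<and> \<sigma> = \<rho> then 1 else 0))"
    using s r trm by (simp add: wedge_list_covector)
  also have "\<dots> = (\<Sum>p | p permutes {..<k}. if p = id then (if \<sigma> = \<rho> then 1 else 0) else 0)"
    by (rule sum.cong) auto
  also have "\<dots> = (if \<sigma> = \<rho> then 1 else 0)"
    by (subst sum.delta) (auto simp: finite_permutations permutes_id)
  finally show ?thesis .
qed

lemma Alt_Cons:
  assumes "\<alpha> \<in> Alt (Suc j)"
  shows "(\<lambda>ws. \<alpha> (v # ws)) \<in> Alt j"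
  unfolding Alt_def
proof (intro CollectI conjI allI impI; (elim conjE)?)
  fix ws :: "'a Rn list" and i assume "length ws = j" "i < j"
  then show "linear (\<lambda>u. \<alpha> (v # ws[i := u]))"
    using Alt_linear[OF assms, of "v # ws" "Suc i"] by simp
qed (use Alt_length[OF assms] Alt_distinct[OF assms] in auto)

text \<open>This is the antisymmetrization behind an exterior product with a 1-form. It serves
  twice: for \<open>s_map\<close> in its second list of arguments, and for the top-degree form whose
  change of basis gives the trace in a dual basis.\<close>

lemma Alt_alternating_sum:
  assumes B: "\<And>v. B v \<in> Alt m" and lin: "\<And>vs. linear (\<lambda>v. B v vs)"
  shows "(\<lambda>vs. if length vs = Suc m
    then \<Sum>i<Suc m. (- 1) ^ i * B (vs ! i) (take i vs @ drop (Suc i) vs) else 0) \<in> Alt (Suc m)"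
  unfolding Alt_def
proof (intro CollectI conjI allI impI; (elim conjE)?)
  fix vs :: "'a Rn list" and p assume len: "length vs = Suc m" and p: "p < Suc m"
  have "linear (\<lambda>v. B (vs[p := v] ! i) (take i (vs[p := v]) @ drop (Suc i) (vs[p := v])))"
    if i: "i < Suc m" for i
  proof -
    consider "i = p" | "p < i" | "i < p" by linarith
    then show ?thesis
    proof cases
      case 1
      then show ?thesis using lin len p by simp
    next
      case 2
      then have "take i (vs[p := v]) @ drop (Suc i) (vs[p := v]) = (take i vs @ drop (Suc i) vs)[p := v]"
        for v using len i by (simp add: take_update_swap list_update_append)
      then show ?thesis using Alt_linear[OF B, of "take i vs @ drop (Suc i) vs" p "vs ! i"] 2 len i
        by simp
    next
      case 3
      then have "take i (vs[p := v]) @ drop (Suc i) (vs[p := v]) = (take i vs @ drop (Suc i) vs)[p - 1 := v]"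
        for v using len i p 3 by (auto simp: drop_update_swap list_update_append)
      then show ?thesis using Alt_linear[OF B, of "take i vs @ drop (Suc i) vs" "p - 1" "vs ! i"] 3 len i p
        by simp
    qed
  qed
  then have l: "linear (\<lambda>v. \<Sum>i<Suc m. (- 1) ^ i *\<^sub>R
      B (vs[p := v] ! i) (take i (vs[p := v]) @ drop (Suc i) (vs[p := v])))"
    by (intro linear_compose_sum linear_compose_scale_right ballI) auto
  show "linear (\<lambda>v. if length (vs[p := v]) = Suc m then \<Sum>i<Suc m. (- 1) ^ i *
      B (vs[p := v] ! i) (take i (vs[p := v]) @ drop (Suc i) (vs[p := v])) else 0)"
    using l len by simp
next
  fix vs :: "'a Rn list" assume len: "length vs = Suc m" and nd: "\<not> distinct vs"
  obtain i j where ij: "i < j" "j < Suc m" "vs ! i = vs ! j"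
    using nd len by (metis distinct_conv_nth linorder_neqE_nat)
  let ?F = "\<lambda>l. (- 1) ^ l * B (vs ! l) (take l vs @ drop (Suc l) vs)"
  \<comment> \<open>If the omitted position is neither \<open>i\<close> nor \<open>j\<close>, the
    two equal arguments both survive and the term vanishes.\<close>
  have zero: "?F l = 0" if l: "l < Suc m" "l \<noteq> i" "l \<noteq> j" for l
  proof -
    let ?us = "take l vs @ drop (Suc l) vs"
    have nth: "?us ! (if a < l then a else a - 1) = vs ! a" if "a < Suc m" "a \<noteq> l" for a
      using that l len by (auto simp: nth_append)
    have "(if i < l then i else i - 1) \<noteq> (if j < l then j else j - 1)"
      using ij l by auto
    moreover have "(if i < l then i else i - 1) < length ?us" "(if j < l then j else j - 1) < length ?us"
      using ij l len by auto
    moreover have "?us ! (if i < l then i else i - 1) = ?us ! (if j < l then j else j - 1)"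
      using nth[of i] nth[of j] ij l by (simp del: nth_append)
    ultimately have "\<not> distinct ?us" by (metis nth_eq_iff_index_eq)
    then show ?thesis using Alt_distinct[OF B] by simp
  qed
  \<comment> \<open>Only the terms omitting \<open>i\<close> or \<open>j\<close> remain. Their
    argument lists differ by moving the repeated vector across the block \<open>C\<close> of length
    \<open>j - i - 1\<close>, and with the outer sign \<open>(- 1) ^ j\<close> the two terms
    cancel.\<close>
  define A C D where "A = take i vs" and "C = take (j - Suc i) (drop (Suc i) vs)" and "D = drop (Suc j) vs"
  have vs: "vs = A @ vs ! i # C @ vs ! i # D"
  proof -
    have "drop (Suc i) vs = C @ drop (j - Suc i) (drop (Suc i) vs)"
      by (simp only: C_def append_take_drop_id)
    also have "drop (j - Suc i) (drop (Suc i) vs) = drop j vs" using ij by simp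
    also have "drop j vs = vs ! j # D" using ij len by (simp add: D_def Cons_nth_drop_Suc)
    finally have d: "drop (Suc i) vs = C @ vs ! j # D" .
    have v: "vs = A @ vs ! i # drop (Suc i) vs"
      unfolding A_def by (rule id_take_nth_drop) (use ij len in simp)
    show ?thesis using v d ij(3) by metis
  qed
  have lens: "length A = i" "length C = j - Suc i" using ij len by (auto simp: A_def C_def)
  have ri: "take i vs @ drop (Suc i) vs = A @ C @ vs ! i # D"
    by (subst (1 2) vs) (use lens in simp)
  define E where "E = A @ vs ! i # C"
  have E: "vs = E @ vs ! i # D"
    using vs unfolding E_def append.assoc append_Cons .
  have lE: "length E = j" using lens ij by (simp add: E_def)
  have "take j vs @ drop (Suc j) vs = E @ D"
    by (subst (1 2) E) (use lE in simp)
  then have rj: "take j vs @ drop (Suc j) vs = A @ vs ! i # C @ D"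
    by (simp add: E_def)
  have "(\<Sum>l<Suc m. ?F l) = (\<Sum>l\<in>{i, j}. ?F l)"
    by (rule sum.mono_neutral_right) (use ij zero in auto)
  also have "\<dots> = ?F i + ?F j" using ij by simp
  also have "\<dots> = 0"
  proof -
    have "j = Suc (i + length C)" using lens ij by simp
    then have pj: "(- 1 :: real) ^ j = - ((- 1) ^ i * (- 1) ^ length C)"
      by (simp add: power_add)
    have sq: "(- 1 :: real) ^ length C * (- 1) ^ length C = 1"
      by (simp flip: power_add mult_2)
    have mv: "B (vs ! i) (A @ vs ! i # C @ D) = (- 1) ^ length C * B (vs ! i) (A @ C @ vs ! i # D)"
      by (rule Alt_move[OF B])
    have "?F i + ?F j = (- 1) ^ i * B (vs ! i) (A @ C @ vs ! i # D) * (1 - (- 1) ^ length C * (- 1) ^ length C)"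
      unfolding ri rj ij(3)[symmetric] mv pj by (simp add: algebra_simps)
    then show ?thesis unfolding sq by simp
  qed
  finally have z: "(\<Sum>l<Suc m. ?F l) = 0" .
  show "(if length vs = Suc m then \<Sum>l<Suc m. ?F l else 0) = 0" unfolding z by simp
qed simp

section \<open>Dual bases and coefficients\<close>

definition dual_vecs :: "(nat \<Rightarrow> 'n::finite Rn) \<Rightarrow> (nat \<Rightarrow> 'n Rn) \<Rightarrow> bool"
  where "dual_vecs b b' \<longleftrightarrow> (\<forall>i\<in>{1..CARD('n)}. \<forall>j\<in>{1..CARD('n)}. b i \<bullet> b' j = (if i = j then 1 else 0))"

abbreviation wform :: "(nat \<Rightarrow> 'n::finite Rn) \<Rightarrow> nat set \<Rightarrow> 'n form"
  where "wform b \<sigma> \<equiv> wedge_list (map covector (blist b \<sigma>))"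

lemma dual_vecs_span:
  fixes b b' :: "nat \<Rightarrow> 'n::finite Rn"
  assumes "dual_vecs b b'"
  shows "span (b' ` {1..CARD('n)}) = UNIV"
proof -
  let ?N = "{1..CARD('n)}"
  have d: "b i \<bullet> b' j = (if i = j then 1 else 0)" if "i \<in> ?N" "j \<in> ?N" for i j
    using assms that by (auto simp: dual_vecs_def)
  have inj: "inj_on b' ?N"
    by (rule inj_onI) (metis d zero_neq_one)
  have "independent (b' ` ?N)"
    unfolding dependent_def
  proof (safe)
    fix j assume j: "j \<in> ?N" and dep: "b' j \<in> span (b' ` ?N - {b' j})"
    have "orthogonal (b j) x" if "x \<in> b' ` ?N - {b' j}" for x
      using that d j by (auto simp: orthogonal_def)
    then have "orthogonal (b j) (b' j)" using orthogonal_to_span[OF dep] by auto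
    then show False using d[OF j j] by (simp add: orthogonal_def)
  qed
  then have "UNIV \<subseteq> span (b' ` ?N)"
    by (intro card_ge_dim_independent) (auto simp: card_image[OF inj, simplified])
  then show ?thesis by auto
qed

lemma dual_vecs_std: "dual_vecs std_vec (std_vec :: nat \<Rightarrow> 'n::{finite,linorder} Rn)"
proof -
  let ?L = "sorted_list_of_set (UNIV :: 'n set)"
  have "?L ! (i - 1) = ?L ! (j - 1) \<longleftrightarrow> i = j" if "i \<in> {1..CARD('n)}" "j \<in> {1..CARD('n)}" for i j
  proof -
    have "?L ! (i - 1) = ?L ! (j - 1) \<longleftrightarrow> i - 1 = j - 1"
      using that by (subst nth_eq_iff_index_eq) auto
    then show ?thesis using that by auto
  qed
  then show ?thesis by (auto simp: dual_vecs_def std_vec_def inner_axis_axis)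
qed

lemmas span_std = dual_vecs_span[OF dual_vecs_std]

lemma inc_seqs_top: "inc_seqs n n = {{1..n}}"
  using card_subset_eq[of "{1..n}"] by (auto simp: inc_seqs_def)

lemma inc_seqs_minus: "i \<in> {1..n} \<Longrightarrow> {1..n} - {i} \<in> inc_seqs (n - 1) n"
  by (auto simp: inc_seqs_def)

lemma wform_Alt: "\<sigma> \<in> inc_seqs j n \<Longrightarrow> wform b \<sigma> \<in> Alt j"
  using wedge_list_Alt[of "blist b \<sigma>"] inc_seqsD[of \<sigma> j n] by simp

lemma wform_dual:
  fixes b b' :: "nat \<Rightarrow> 'n::finite Rn"
  assumes "dual_vecs b b'" "\<sigma> \<in> inc_seqs j CARD('n)" "\<rho> \<in> inc_seqs j CARD('n)"
  shows "wform b \<sigma> (blist b' \<rho>) = (if \<sigma> = \<rho> then 1 else 0)"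
  by (rule wedge_list_dual[OF _ assms(2,3)]) (use assms(1) in \<open>auto simp: dual_vecs_def\<close>)

lemma Alt_expand:
  fixes b b' :: "nat \<Rightarrow> 'n::finite Rn"
  assumes d: "dual_vecs b b'" and a: "\<alpha> \<in> Alt j"
  shows "\<alpha> vs = (\<Sum>\<sigma>\<in>inc_seqs j CARD('n). \<alpha> (blist b' \<sigma>) * wform b \<sigma> vs)"
proof -
  have "\<alpha> = (\<Sum>\<sigma>\<in>inc_seqs j CARD('n). \<alpha> (blist b' \<sigma>) *\<^sub>R wform b \<sigma>)" (is "_ = ?S")
  proof (rule Alt_eqI[OF a _ dual_vecs_span[OF d]])
    show "?S \<in> Alt j" by (intro subspace_sum subspace_scale subspace_Alt wform_Alt)
    show "\<alpha> (blist b' \<rho>) = ?S (blist b' \<rho>)" if "\<rho> \<in> inc_seqs j CARD('n)" for \<rho>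
      using that by (simp add: fun_sum_apply wform_dual[OF d] if_distrib cong: if_cong)
  qed
  then have "\<alpha> vs = ?S vs" by (rule fun_cong)
  then show ?thesis by (simp add: fun_sum_apply)
qed

lemma std_args_eq: "std_args \<sigma> = blist std_vec \<sigma>"
  by (simp add: std_args_def blist_def)

lemma form_at_eq:
  assumes "\<And>i. i \<in> \<sigma> \<Longrightarrow> dy i = covector (b i)" "finite \<sigma>"
  shows "form_at dy \<sigma> = wform b \<sigma>"
proof -
  have "map dy (sorted_list_of_set \<sigma>) = map (\<lambda>i. covector (b i)) (sorted_list_of_set \<sigma>)"
    using assms by (intro map_cong) auto
  then show ?thesis by (simp only: form_at_def blist_def map_map o_def)
qed

text \<open>A wedge of covectors represents evaluation at the corresponding vectors, for arbitrary
  \<open>us\<close> and not just for standard basis vectors. Inner products with the test forms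
  thereby become values of the form, whether or not the frame of a face is orthonormal.\<close>

lemma alt_inner_wedge:
  fixes \<alpha> :: "'n::{finite,linorder} form"
  assumes "\<alpha> \<in> Alt j"
  shows "alt_inner j \<alpha> (wedge_list (map covector us)) = \<alpha> us"
  unfolding alt_inner_def std_args_eq
  by (subst Alt_expand[OF dual_vecs_std assms, of us]) (simp add: wedge_list_commute)

lemma Alt2_slice:
  assumes "\<omega> \<in> Alt2 j m"
  shows "\<omega> ws \<in> Alt m" "(\<lambda>ws. \<omega> ws vs) \<in> Alt j"
proof -
  have "(\<forall>ws. \<omega> ws \<in> Alt m) \<and> (\<forall>vs. (\<lambda>ws. \<omega> ws vs) \<in> Alt j)"
    using assms unfolding Alt2_def
  proof (induction rule: span_induct_alt)
    case base
    then show ?case using subspace_0[OF subspace_Alt] by (auto simp: zero_fun_def)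
  next
    case (step c x y)
    then obtain \<alpha> \<beta> where x: "x = tensor \<alpha> \<beta>" "\<alpha> \<in> Alt j" "\<beta> \<in> Alt m" by auto
    have "x ws = \<alpha> ws *\<^sub>R \<beta>" "(\<lambda>ws. x ws vs) = \<beta> vs *\<^sub>R \<alpha>" for ws vs
      by (auto simp: x tensor_def fun_eq_iff)
    moreover have "(c *\<^sub>R x + y) ws = c *\<^sub>R x ws + y ws"
      "(\<lambda>ws. (c *\<^sub>R x + y) ws vs) = c *\<^sub>R (\<lambda>ws. x ws vs) + (\<lambda>ws. y ws vs)" for ws vs
      by (auto simp: fun_eq_iff)
    ultimately show ?case using step x
      by (metis (no_types, lifting) subspace_Alt subspace_add subspace_scale)
  qed
  then show "\<omega> ws \<in> Alt m" "(\<lambda>ws. \<omega> ws vs) \<in> Alt j" by auto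
qed

lemma subspace_Alt2: "subspace (Alt2 j m)"
  by (simp add: Alt2_def)

lemma tensor_Alt2: "\<alpha> \<in> Alt j \<Longrightarrow> \<beta> \<in> Alt m \<Longrightarrow> tensor \<alpha> \<beta> \<in> Alt2 j m"
  unfolding Alt2_def by (rule span_base) auto

lemma alt2_inner_tensor:
  fixes \<omega> :: "'n::{finite,linorder} form2"
  assumes "\<omega> \<in> Alt2 j m"
  shows "alt2_inner j m \<omega> (tensor (wedge_list (map covector us)) (wedge_list (map covector vs))) = \<omega> us vs"
proof -
  let ?a = "wedge_list (map covector us)" and ?b = "wedge_list (map covector vs)"
  have "alt2_inner j m \<omega> (tensor ?a ?b) = (\<Sum>\<sigma>\<in>inc_seqs j CARD('n). \<omega> (std_args \<sigma>) vs * ?a (std_args \<sigma>))"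
    unfolding alt2_inner_def
  proof (rule sum.cong[OF refl])
    fix \<sigma>
    show "(\<Sum>\<rho>\<in>inc_seqs m CARD('n). \<omega> (std_args \<sigma>) (std_args \<rho>) * tensor ?a ?b (std_args \<sigma>) (std_args \<rho>)) =
        \<omega> (std_args \<sigma>) vs * ?a (std_args \<sigma>)"
      unfolding alt_inner_wedge[OF Alt2_slice(1)[OF assms], of "std_args \<sigma>" vs, symmetric]
      by (simp add: alt_inner_def tensor_def sum_distrib_left mult_ac)
  qed
  also have "\<dots> = \<omega> us vs"
    using alt_inner_wedge[OF Alt2_slice(2)[OF assms], of vs us] by (simp add: alt_inner_def)
  finally show ?thesis .
qed

lemma Alt2_eq_0:
  fixes b :: "nat \<Rightarrow> 'n::finite Rn"
  assumes w: "\<omega> \<in> Alt2 j m" and b: "span (b ` {1..n}) = UNIV"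
    and z: "\<And>\<sigma> \<rho>. \<sigma> \<in> inc_seqs j n \<Longrightarrow> \<rho> \<in> inc_seqs m n \<Longrightarrow> \<omega> (blist b \<sigma>) (blist b \<rho>) = 0"
  shows "\<omega> = 0"
proof (intro ext)
  fix ws vs
  have "\<omega> (blist b \<sigma>) vs = 0" if "\<sigma> \<in> inc_seqs j n" for \<sigma>
    by (rule Alt_eq_0[OF Alt2_slice(1)[OF w] b z[OF that]])
  then have "(\<lambda>ws. \<omega> ws vs) ws = 0" by (rule Alt_eq_0[OF Alt2_slice(2)[OF w] b])
  then show "\<omega> ws vs = 0 ws vs" by simp
qed

lemma alt2_inner_definite:
  fixes \<omega> :: "'n::{finite,linorder} form2"
  assumes "\<omega> \<in> Alt2 j m" "alt2_inner j m \<omega> \<omega> = 0"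
  shows "\<omega> = 0"
proof (rule Alt2_eq_0[OF assms(1) span_std])
  fix \<sigma> \<rho> assume s: "\<sigma> \<in> inc_seqs j CARD('n)" and r: "\<rho> \<in> inc_seqs m CARD('n)"
  have "(\<Sum>\<rho>\<in>inc_seqs m CARD('n). \<omega> (std_args \<sigma>) (std_args \<rho>) * \<omega> (std_args \<sigma>) (std_args \<rho>)) = 0"
    using assms(2) s by (subst (asm) alt2_inner_def, subst (asm) sum_nonneg_eq_0_iff) (auto intro: sum_nonneg)
  then show "\<omega> (blist std_vec \<sigma>) (blist std_vec \<rho>) = 0"
    using r by (subst (asm) sum_nonneg_eq_0_iff) (auto simp: std_args_eq)
qed

text \<open>\<open>cf b \<omega> \<sigma> i\<close> is the coefficient of \<open>\<omega>\<close> at index \<open>(\<sigma>, i)\<close> in the dual of the basis \<open>b\<close>, and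
  equally its inner product with \<open>tform b \<sigma> i\<close>.\<close>

definition cf :: "(nat \<Rightarrow> 'n::finite Rn) \<Rightarrow> 'n form2 \<Rightarrow> nat set \<Rightarrow> nat \<Rightarrow> real"
  where "cf b \<omega> \<sigma> i = (- 1) ^ (i - 1) * \<omega> (blist b \<sigma>) (blist b ({1..CARD('n)} - {i}))"

definition tform :: "(nat \<Rightarrow> 'n::finite Rn) \<Rightarrow> nat set \<Rightarrow> nat \<Rightarrow> 'n form2"
  where "tform b \<sigma> i = tensor (wform b \<sigma>) ((- 1) ^ (i - 1) *\<^sub>R wform b ({1..CARD('n)} - {i}))"

lemma linear_cf: "linear (\<lambda>\<omega>. cf b \<omega> \<sigma> i)"
  by (rule linearI) (auto simp: cf_def algebra_simps)

lemma alt2_inner_tform: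
  fixes \<omega> :: "'n::{finite,linorder} form2"
  assumes "\<omega> \<in> Alt2 k (CARD('n) - 1)"
  shows "alt2_inner k (CARD('n) - 1) \<omega> (tform b \<sigma> i) = cf b \<omega> \<sigma> i"
proof -
  have "alt2_inner k (CARD('n) - 1) \<omega> (tform b \<sigma> i) = (- 1) ^ (i - 1) *
     alt2_inner k (CARD('n) - 1) \<omega> (tensor (wform b \<sigma>) (wform b ({1..CARD('n)} - {i})))"
    by (simp add: alt2_inner_def tform_def tensor_def sum_distrib_left mult_ac)
  then show ?thesis unfolding alt2_inner_tensor[OF assms] cf_def .
qed

lemma tform_eq:
  fixes dy :: "nat \<Rightarrow> 'n::finite form"
  assumes "\<And>i. i \<in> {1..CARD('n)} \<Longrightarrow> dy i = covector (b i)" "\<sigma> \<in> inc_seqs k CARD('n)"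
  shows "tensor (form_at dy \<sigma>) (star_form dy i) = tform b \<sigma> i"
proof -
  have "form_at dy \<sigma> = wform b \<sigma>" "form_at dy ({1..CARD('n)} - {i}) = wform b ({1..CARD('n)} - {i})"
    using assms inc_seqsD[OF assms(2)] by (auto intro!: form_at_eq)
  then show ?thesis by (simp add: star_form_def tform_def)
qed

lemma mat_coeff_eq:
  fixes \<omega> :: "'n::{finite,linorder} form2"
  assumes "\<omega> \<in> Alt2 k (CARD('n) - 1)" "\<sigma> \<in> inc_seqs k CARD('n)"
  shows "mat_coeff k \<omega> \<sigma> i = cf std_vec \<omega> \<sigma> i"
  unfolding mat_coeff_def tform_eq[OF dx_def assms(2)] alt2_inner_tform[OF assms(1)] ..

section \<open>The constraints defining the kernel\<close>

text \<open>The sign of sorting \<open>i\<close>, placed in front of \<tau>, into the increasing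
  sequence of \<open>insert i \<tau>\<close>.\<close>

definition nsg :: "nat \<Rightarrow> nat set \<Rightarrow> real"
  where "nsg i \<tau> = (- 1) ^ card {j \<in> \<tau>. j < i}"

lemma nsg_square [simp]: "nsg i \<tau> * nsg i \<tau> = 1"
  by (simp add: nsg_def flip: power_add mult_2)

lemma sorted_list_of_set_insert_split:
  fixes \<tau> :: "nat set"
  assumes "finite \<tau>" "i \<notin> \<tau>"
  shows "sorted_list_of_set \<tau> = sorted_list_of_set {j \<in> \<tau>. j < i} @ sorted_list_of_set {j \<in> \<tau>. i < j}"
    and "sorted_list_of_set (insert i \<tau>) =
      sorted_list_of_set {j \<in> \<tau>. j < i} @ i # sorted_list_of_set {j \<in> \<tau>. i < j}"
proof -
  have u: "{j \<in> \<tau>. j < i} \<union> {j \<in> \<tau>. i < j} = \<tau>" using assms(2) by (auto, metis linorder_neqE_nat)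
  have f: "finite {j \<in> \<tau>. j < i}" "finite {j \<in> \<tau>. i < j}" using assms(1) by auto
  let ?A = "sorted_list_of_set {j \<in> \<tau>. j < i}" and ?B = "sorted_list_of_set {j \<in> \<tau>. i < j}"
  have sets: "set ?A = {j \<in> \<tau>. j < i}" "set ?B = {j \<in> \<tau>. i < j}" using f by simp_all
  have s1: "sorted (?A @ ?B)" "distinct (?A @ ?B)" "sorted (?A @ i # ?B)" "distinct (?A @ i # ?B)"
    unfolding sorted_append distinct_append sorted_simps distinct.simps list.set sets by auto
  have s2: "set (?A @ ?B) = \<tau>" "set (?A @ i # ?B) = insert i \<tau>"
    unfolding set_append list.set sets using u by blast+
  show "sorted_list_of_set \<tau> = ?A @ ?B"
    by (rule sorted_distinct_set_unique[OF _ _ s1(1,2)]) (simp_all only: s2 assms(1)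
      sorted_sorted_list_of_set distinct_sorted_list_of_set set_sorted_list_of_set)
  show "sorted_list_of_set (insert i \<tau>) = ?A @ i # ?B"
    by (rule sorted_distinct_set_unique[OF _ _ s1(3,4)]) (simp_all only: s2 assms(1) finite_insert
      sorted_sorted_list_of_set distinct_sorted_list_of_set set_sorted_list_of_set)
qed

lemma Alt_insert:
  assumes "\<alpha> \<in> Alt k" "finite \<tau>" "i \<notin> \<tau>"
  shows "\<alpha> (b i # blist b \<tau>) = nsg i \<tau> * \<alpha> (blist b (insert i \<tau>))"
  using Alt_move[OF assms(1), of "[]" "b i" "blist b {j \<in> \<tau>. j < i}" "blist b {j \<in> \<tau>. i < j}"]
    sorted_list_of_set_insert_split[OF assms(2,3)] assms(2)
  by (simp add: blist_def nsg_def del: sorted_list_of_set_insert_remove)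

lemma blist_remove:
  assumes "i < n"
  shows "take i (blist b {1..n}) @ drop (Suc i) (blist b {1..n}) = blist b ({1..n} - {Suc i})"
proof -
  have e: "sorted_list_of_set {1..n} = [1..<Suc n]"
    by (rule sorted_distinct_set_unique) (auto simp del: upt_Suc)
  have "sorted_list_of_set ({1..n} - {Suc i}) = [1..<Suc i] @ [Suc (Suc i)..<Suc n]"
    by (rule sorted_distinct_set_unique) (use assms in \<open>auto simp: sorted_append\<close>)
  moreover have "take i [1..<Suc n] = [1..<Suc i]" "drop (Suc i) [1..<Suc n] = [Suc (Suc i)..<Suc n]"
    using assms by (auto simp: take_upt drop_upt simp del: upt_Suc)
  ultimately show ?thesis unfolding blist_def e take_map drop_map by simp
qed

lemma blist_top_nth: "i < n \<Longrightarrow> blist b {1..n} ! i = b (Suc i)"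
proof -
  assume i: "i < n"
  have e: "sorted_list_of_set {1..n} = [1..<Suc n]"
    by (rule sorted_distinct_set_unique) (auto simp del: upt_Suc)
  show ?thesis using i unfolding blist_def e by (simp add: nth_append del: upt_Suc)
qed

lemma alternating_sum_basis:
  "(\<Sum>i<n. (- 1) ^ i * B (blist b {1..n} ! i) (take i (blist b {1..n}) @ drop (Suc i) (blist b {1..n})))
   = (\<Sum>i\<in>{1..n}. (- 1) ^ (i - 1) * (B (b i) (blist b ({1..n} - {i})) :: real))"
  by (rule sum.reindex_bij_witness[of _ "\<lambda>i. i - 1" Suc])
    (auto simp: blist_remove[simplified] blist_top_nth[simplified])

text \<open>Terms with \<open>i\<close> in \<tau> repeat an argument and vanish; in the others
  \<open>i\<close> is sorted into \<tau> at the cost of \<open>nsg i \<tau>\<close>, while the sign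
  of position \<open>i\<close> is part of \<open>cf\<close>. What remains runs along the constraint
  sequence of \<tau>, for any family \<open>b\<close> of vectors.\<close>

lemma s_map_basis:
  fixes \<omega> :: "'n::finite form2"
  assumes \<omega>: "\<omega> \<in> Alt2 k (CARD('n) - 1)" and \<tau>: "\<tau> \<in> inc_seqs (k - 1) CARD('n)"
  shows "s_map k \<omega> (blist b \<tau>) (blist b {1..CARD('n)}) =
    (\<Sum>i\<in>{1..CARD('n)} - \<tau>. nsg i \<tau> * cf b \<omega> (insert i \<tau>) i)"
proof -
  let ?N = "{1..CARD('n)}"
  note t = inc_seqsD[OF \<tau>]
  have "s_map k \<omega> (blist b \<tau>) (blist b ?N) =
      (\<Sum>i\<in>?N. (- 1) ^ (i - 1) * \<omega> (b i # blist b \<tau>) (blist b (?N - {i})))"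
    using t alternating_sum_basis[of "\<lambda>v. \<omega> (v # blist b \<tau>)" b "CARD('n)"] by (simp add: s_map_def)
  also have "\<dots> = (\<Sum>i\<in>?N - \<tau>. (- 1) ^ (i - 1) * \<omega> (b i # blist b \<tau>) (blist b (?N - {i})))"
  proof (rule sum.mono_neutral_right)
    show "\<forall>i\<in>?N - (?N - \<tau>). (- 1) ^ (i - 1) * \<omega> (b i # blist b \<tau>) (blist b (?N - {i})) = 0"
    proof
      fix i assume "i \<in> ?N - (?N - \<tau>)"
      then have "\<not> distinct (b i # blist b \<tau>)" using t by (auto simp: blist_def)
      then show "(- 1) ^ (i - 1) * \<omega> (b i # blist b \<tau>) (blist b (?N - {i})) = 0"
        using Alt_distinct[OF Alt2_slice(2)[OF \<omega>]] by simp
    qed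
  qed auto
  also have "\<dots> = (\<Sum>i\<in>?N - \<tau>. nsg i \<tau> * cf b \<omega> (insert i \<tau>) i)"
    using Alt_insert[OF Alt2_slice(2)[OF \<omega>]] t by (intro sum.cong) (auto simp: cf_def)
  finally show ?thesis .
qed

lemma XX_constraint:
  fixes \<omega> :: "'n::finite form2"
  assumes "\<omega> \<in> XX k" "\<tau> \<in> inc_seqs (k - 1) CARD('n)"
  shows "(\<Sum>i\<in>{1..CARD('n)} - \<tau>. nsg i \<tau> * cf b \<omega> (insert i \<tau>) i) = 0"
  using s_map_basis[OF _ assms(2), of \<omega> b] assms(1) by (simp add: XX_def)

lemma s_map_linear: "linear (s_map k)"
  by (rule linearI)
    (auto simp: s_map_def fun_eq_iff sum.distrib algebra_simps sum_distrib_left)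

lemma subspace_XX: "subspace (XX k :: 'n::finite form2 set)"
proof -
  have "XX k = Alt2 k (CARD('n) - 1) \<inter> {\<omega> :: 'n form2. s_map k \<omega> = 0}" by (auto simp: XX_def)
  then show ?thesis by (simp add: subspace_inter subspace_Alt2 linear_subspace_kernel s_map_linear)
qed

lemma XX_Alt2: "\<omega> \<in> XX k \<Longrightarrow> \<omega> \<in> Alt2 k (CARD('n) - 1)" for \<omega> :: "'n::finite form2"
  by (simp add: XX_def)

text \<open>For fixed first arguments \<open>s_map k \<omega>\<close> is an alternating form of top
  degree, so its value on one ordered basis decides; for fixed second arguments it is an alternating
  form of degree \<open>k - 1\<close>. Both lists may therefore be tested on basis vectors.\<close>

lemma s_map_eq_0:
  fixes \<omega> :: "'n::finite form2"
  assumes \<omega>: "\<omega> \<in> Alt2 k (CARD('n) - 1)" and k: "k \<ge> 1" and b: "span (b ` {1..CARD('n)}) = UNIV"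
    and z: "\<And>\<tau>. \<tau> \<in> inc_seqs (k - 1) CARD('n) \<Longrightarrow> s_map k \<omega> (blist b \<tau>) (blist b {1..CARD('n)}) = 0"
  shows "s_map k \<omega> = 0"
proof (intro ext)
  fix ws vs :: "'n Rn list"
  have n: "Suc (CARD('n) - 1) = CARD('n)" by simp
  show "s_map k \<omega> ws vs = 0 ws vs"
  proof (cases "length ws = k - 1")
    case True
    have in_vs: "s_map k \<omega> us \<in> Alt CARD('n)" if us: "length us = k - 1" for us
    proof -
      have "linear (\<lambda>v. \<omega> (v # us) vs)" for vs
        using Alt_linear_append[OF Alt2_slice(2)[OF \<omega>], of "[]" us] us k by simp
      then have "(\<lambda>vs. if length vs = Suc (CARD('n) - 1)
        then \<Sum>i<Suc (CARD('n) - 1). (- 1) ^ i * \<omega> (vs ! i # us) (take i vs @ drop (Suc i) vs) else 0)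
        \<in> Alt (Suc (CARD('n) - 1))"
        by (intro Alt_alternating_sum Alt2_slice(1)[OF \<omega>])
      then show ?thesis using us unfolding n by (simp add: s_map_def[abs_def])
    qed
    have in_ws: "(\<lambda>us. s_map k \<omega> us us') \<in> Alt (k - 1)" for us'
    proof (cases "length us' = CARD('n)")
      case True
      let ?F = "\<Sum>i<CARD('n). (- 1) ^ i *\<^sub>R (\<lambda>us. \<omega> (us' ! i # us) (take i us' @ drop (Suc i) us'))"
      have F: "?F \<in> Alt (k - 1)"
        using Alt2_slice(2)[OF \<omega>] k
        by (intro subspace_sum subspace_scale subspace_Alt Alt_Cons) simp
      have "s_map k \<omega> us us' = ?F us" for us
      proof (cases "length us = k - 1")
        case False
        then show ?thesis using Alt_length[OF F] by (simp add: s_map_def)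
      qed (simp add: s_map_def True fun_sum_apply)
      then have "(\<lambda>us. s_map k \<omega> us us') = ?F" by (rule ext)
      then show ?thesis using F by simp
    next
      case False
      then show ?thesis using subspace_0[OF subspace_Alt] by (simp add: s_map_def zero_fun_def)
    qed
    have "s_map k \<omega> (blist b \<tau>) vs = 0" if "\<tau> \<in> inc_seqs (k - 1) CARD('n)" for \<tau>
    proof (rule Alt_eq_0[OF in_vs b])
      show "length (blist b \<tau>) = k - 1" using inc_seqsD[OF that] by simp
    qed (use z[OF that] in \<open>simp add: inc_seqs_top\<close>)
    then have "(\<lambda>us. s_map k \<omega> us vs) ws = 0" by (rule Alt_eq_0[OF in_ws b])
    then show ?thesis by simp
  qed (simp add: s_map_def)
qed

lemma tform_Alt2:
  fixes b :: "nat \<Rightarrow> 'n::finite Rn"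
  assumes "\<sigma> \<in> inc_seqs k CARD('n)" "i \<in> {1..CARD('n)}"
  shows "tform b \<sigma> i \<in> Alt2 k (CARD('n) - 1)"
  unfolding tform_def
  by (intro tensor_Alt2 subspace_scale[OF subspace_Alt] wform_Alt[OF assms(1)]
      wform_Alt[OF inc_seqs_minus[OF assms(2)]])

lemma cf_tform:
  fixes b b' :: "nat \<Rightarrow> 'n::finite Rn"
  assumes d: "dual_vecs b b'" and "\<sigma> \<in> inc_seqs k CARD('n)" "\<rho> \<in> inc_seqs k CARD('n)"
    and ij: "i \<in> {1..CARD('n)}" "j \<in> {1..CARD('n)}"
  shows "cf b' (tform b \<sigma> i) \<rho> j = (if \<sigma> = \<rho> \<and> i = j then 1 else 0)"
proof -
  have "{1..CARD('n)} - {i} = {1..CARD('n)} - {j} \<longleftrightarrow> i = j" using ij by blast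
  then show ?thesis
    using wform_dual[OF d inc_seqs_minus[OF ij(1)] inc_seqs_minus[OF ij(2)]] wform_dual[OF d assms(2,3)]
    by (auto simp: cf_def tform_def tensor_def simp flip: power_add mult_2)
qed

text \<open>Converse of \<open>XX_constraint\<close>: since \<open>tform b\<close> is dual to the
  coefficients \<open>cf b'\<close>, the constraints in the basis \<open>b'\<close> characterize the
  kernel among all matrices.\<close>

lemma XX_of_matrix:
  fixes b b' :: "nat \<Rightarrow> 'n::finite Rn"
  assumes d: "dual_vecs b b'" and k: "k \<ge> 1"
    and D: "\<And>\<tau>. \<tau> \<in> inc_seqs (k - 1) CARD('n) \<Longrightarrow>
      (\<Sum>i\<in>{1..CARD('n)} - \<tau>. nsg i \<tau> * D (insert i \<tau>) i) = 0"
  obtains w where "w \<in> XX k"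
    "\<And>\<sigma> i. \<sigma> \<in> inc_seqs k CARD('n) \<Longrightarrow> i \<in> {1..CARD('n)} \<Longrightarrow> cf b' w \<sigma> i = D \<sigma> i"
proof
  let ?N = "{1..CARD('n)}"
  define w where "w = (\<Sum>\<sigma>\<in>inc_seqs k CARD('n). \<Sum>i\<in>?N. D \<sigma> i *\<^sub>R tform b \<sigma> i)"
  have w: "w \<in> Alt2 k (CARD('n) - 1)"
    unfolding w_def by (intro subspace_sum subspace_scale subspace_Alt2 tform_Alt2)
  show cf: "cf b' w \<rho> j = D \<rho> j" if "\<rho> \<in> inc_seqs k CARD('n)" "j \<in> ?N" for \<rho> j
  proof -
    have "cf b' w \<rho> j = (\<Sum>\<sigma>\<in>inc_seqs k CARD('n). \<Sum>i\<in>?N. D \<sigma> i * cf b' (tform b \<sigma> i) \<rho> j)"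
      unfolding w_def by (simp add: linear_sum[OF linear_cf] linear_cmul[OF linear_cf])
    also have "\<dots> = (\<Sum>\<sigma>\<in>inc_seqs k CARD('n). \<Sum>i\<in>?N. if i = j then (if \<sigma> = \<rho> then D \<sigma> i else 0) else 0)"
      by (intro sum.cong refl) (use that in \<open>simp add: cf_tform[OF d]\<close>)
    also have "\<dots> = D \<rho> j" using that by (simp cong: if_cong)
    finally show ?thesis .
  qed
  have "s_map k w = 0"
  proof (rule s_map_eq_0[OF w k dual_vecs_span[OF d]])
    fix \<tau> assume \<tau>: "\<tau> \<in> inc_seqs (k - 1) CARD('n)"
    have "insert i \<tau> \<in> inc_seqs k CARD('n)" if "i \<in> ?N - \<tau>" for i
      using that inc_seqsD[OF \<tau>] k by (auto simp: inc_seqs_def)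
    then have "(\<Sum>i\<in>?N - \<tau>. nsg i \<tau> * cf b' w (insert i \<tau>) i) = (\<Sum>i\<in>?N - \<tau>. nsg i \<tau> * D (insert i \<tau>) i)"
      by (intro sum.cong) (auto simp: cf)
    then show "s_map k w (blist b' \<tau>) (blist b' ?N) = 0"
      using s_map_basis[OF w \<tau>, of b'] D[OF \<tau>] by simp
  qed
  then show "w \<in> XX k" using w by (simp add: XX_def)
qed

section \<open>Free indices and free rows\<close>

lemma pair_index_eq:
  assumes "{1..n} - \<tau> \<noteq> {}"
  shows "pair_index n \<tau> = (insert (Min ({1..n} - \<tau>)) \<tau>, Min ({1..n} - \<tau>))"
proof -
  have "hd (sorted_list_of_set ({1..n} - \<tau>)) = Min ({1..n} - \<tau>)"
    using assms by (simp add: sorted_list_of_set_nonempty)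
  then show ?thesis using assms by (simp add: pair_index_def constraint_seq_def hd_map)
qed

lemma inc_seqs_compl_nonempty: "\<tau> \<in> inc_seqs j n \<Longrightarrow> j < n \<Longrightarrow> {1..n} - \<tau> \<noteq> {}"
  by (metis card_atLeastAtMost card_mono diff_Suc_1 Diff_eq_empty_iff inc_seqsD leD)

text \<open>The only constraint sequence that can contain \<open>(\<sigma>, i)\<close> is that of
  \<open>\<sigma> - {i}\<close>, and only if \<open>i\<close> belongs to \<sigma>. Freeness thus
  compares \<open>i\<close> with the least element outside \<open>\<sigma> - {i}\<close>.\<close>

lemma free_index_iff:
  assumes k: "1 \<le> k" "k \<le> n"
  shows "free_index n k (\<sigma>, i) \<longleftrightarrow> \<sigma> \<in> inc_seqs k n \<and> i \<in> {1..n} \<and>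
    (i \<in> \<sigma> \<longrightarrow> i \<noteq> Min ({1..n} - (\<sigma> - {i})))"
proof -
  have "(\<exists>\<tau>\<in>inc_seqs (k - 1) n. (\<sigma>, i) = pair_index n \<tau>) \<longleftrightarrow> i \<in> \<sigma> \<and> i = Min ({1..n} - (\<sigma> - {i}))"
    if s: "\<sigma> \<in> inc_seqs k n" and i: "i \<in> {1..n}"
  proof
    assume "\<exists>\<tau>\<in>inc_seqs (k - 1) n. (\<sigma>, i) = pair_index n \<tau>"
    then obtain \<tau> where t: "\<tau> \<in> inc_seqs (k - 1) n" and e: "(\<sigma>, i) = pair_index n \<tau>" by blast
    have ne: "{1..n} - \<tau> \<noteq> {}" using inc_seqs_compl_nonempty[OF t] k by simp
    then have i: "i = Min ({1..n} - \<tau>)" "\<sigma> = insert i \<tau>" using e pair_index_eq by auto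
    moreover have "i \<in> {1..n} - \<tau>" using i(1) Min_in[OF _ ne] by simp
    ultimately show "i \<in> \<sigma> \<and> i = Min ({1..n} - (\<sigma> - {i}))" by auto
  next
    assume a: "i \<in> \<sigma> \<and> i = Min ({1..n} - (\<sigma> - {i}))"
    have t: "\<sigma> - {i} \<in> inc_seqs (k - 1) n" using inc_seqsD[OF s] a by (auto simp: inc_seqs_def)
    have "(\<sigma>, i) = pair_index n (\<sigma> - {i})"
      using a pair_index_eq[OF inc_seqs_compl_nonempty[OF t]] k by auto
    then show "\<exists>\<tau>\<in>inc_seqs (k - 1) n. (\<sigma>, i) = pair_index n \<tau>" using t by blast
  qed
  then show ?thesis by (auto simp: free_index_def)
qed

lemma free_row_iff:
  assumes k: "1 \<le> k" "k \<le> n"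
  shows "free_row n k l \<sigma> \<longleftrightarrow> \<sigma> \<in> inc_seqs k n \<and>
    \<not> (\<exists>i\<in>{l+1..n}. i \<in> \<sigma> \<and> normal_constraint n l (\<sigma> - {i}))"
proof -
  have "(\<exists>\<tau>\<in>inc_seqs (k - 1) n. normal_constraint n l \<tau> \<and> (\<sigma>, i) \<in> set (constraint_seq n \<tau>)) \<longleftrightarrow>
      i \<in> \<sigma> \<and> normal_constraint n l (\<sigma> - {i})"
    if s: "\<sigma> \<in> inc_seqs k n" and i: "i \<in> {l+1..n}" for i
  proof
    assume "\<exists>\<tau>\<in>inc_seqs (k - 1) n. normal_constraint n l \<tau> \<and> (\<sigma>, i) \<in> set (constraint_seq n \<tau>)"
    then obtain \<tau> where "normal_constraint n l \<tau>" "\<sigma> = insert i \<tau>" "i \<in> {1..n} - \<tau>"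
      by (auto simp: constraint_seq_def)
    then show "i \<in> \<sigma> \<and> normal_constraint n l (\<sigma> - {i})" by auto
  next
    assume a: "i \<in> \<sigma> \<and> normal_constraint n l (\<sigma> - {i})"
    have "\<sigma> - {i} \<in> inc_seqs (k - 1) n" using inc_seqsD[OF s] a by (auto simp: inc_seqs_def)
    moreover have "(\<sigma>, i) \<in> set (constraint_seq n (\<sigma> - {i}))"
      using a i by (auto simp: constraint_seq_def)
    ultimately show "\<exists>\<tau>\<in>inc_seqs (k - 1) n. normal_constraint n l \<tau> \<and> (\<sigma>, i) \<in> set (constraint_seq n \<tau>)"
      using a by blast
  qed
  then show ?thesis unfolding free_row_def by blast
qed

text \<open>If \<open>i\<close> belongs to \<sigma>, then \<open>\<sigma> - {i}\<close> is not a
  normal constraint in a free row, so some tangential index \<open>j \<le> l\<close> lies outside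
  it, and \<open>i > l\<close> is not the least such element.\<close>

lemma free_row_free_index:
  assumes k: "1 \<le> k" "k \<le> n" and "free_row n k l \<sigma>" "i \<in> {l+1..n}"
  shows "free_index n k (\<sigma>, i)"
proof -
  have s: "\<sigma> \<in> inc_seqs k n" and "i \<in> \<sigma> \<Longrightarrow> \<not> normal_constraint n l (\<sigma> - {i})"
    using assms free_row_iff[OF k] by auto
  moreover have "i \<noteq> Min ({1..n} - (\<sigma> - {i}))" if nn: "\<not> normal_constraint n l (\<sigma> - {i})"
  proof -
    obtain j where "j \<in> {1..n} - (\<sigma> - {i})" "j \<le> l"
      using nn by (force simp: normal_constraint_def not_le)
    then show ?thesis using Min_le[of "{1..n} - (\<sigma> - {i})" j] assms(4) by fastforce
  qed
  ultimately show ?thesis using free_index_iff[OF k] assms(4) by auto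
qed

text \<open>Distinct constraint sequences are disjoint, as \<tau> is recovered from
  \<open>(insert i \<tau>, i)\<close> by removing \<open>i\<close>. Each constraint can therefore be
  solved separately for its pair index.\<close>

lemma XX_free_coeffs:
  fixes b b' :: "nat \<Rightarrow> 'n::finite Rn"
  assumes d: "dual_vecs b b'" and k: "1 \<le> k" "k \<le> CARD('n)"
  obtains w where "w \<in> XX k" "\<And>\<sigma> i. free_index CARD('n) k (\<sigma>, i) \<Longrightarrow> cf b' w \<sigma> i = D0 \<sigma> i"
proof -
  let ?N = "{1..CARD('n)}" let ?m = "\<lambda>\<tau>. Min (?N - \<tau>)"
  \<comment> \<open>All entries of a constraint other than its pair index are free, so the value at
    the pair index is explicit: up to sign, the signed sum of the prescribed entries of the same
    constraint.\<close>
  define D where "D \<sigma> i = (if free_index CARD('n) k (\<sigma>, i) then D0 \<sigma> i else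
    - nsg i (\<sigma> - {i}) * (\<Sum>j\<in>?N - (\<sigma> - {i}) - {i}. nsg j (\<sigma> - {i}) * D0 (insert j (\<sigma> - {i})) j))" for \<sigma> i
  have "(\<Sum>i\<in>?N - \<tau>. nsg i \<tau> * D (insert i \<tau>) i) = 0" if \<tau>: "\<tau> \<in> inc_seqs (k - 1) CARD('n)" for \<tau>
  proof -
    have ne: "?N - \<tau> \<noteq> {}" using inc_seqs_compl_nonempty[OF \<tau>] k by simp
    have ins: "insert i \<tau> \<in> inc_seqs k CARD('n)" if "i \<in> ?N - \<tau>" for i
      using that inc_seqsD[OF \<tau>] k by (auto simp: inc_seqs_def)
    have m: "?m \<tau> \<in> ?N - \<tau>" using Min_in[OF _ ne] by simp
    have D1: "D (insert i \<tau>) i = D0 (insert i \<tau>) i" if "i \<in> ?N - \<tau> - {?m \<tau>}" for i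
    proof -
      have "free_index CARD('n) k (insert i \<tau>, i)" using that ins free_index_iff[OF k] by auto
      then show ?thesis by (simp add: D_def)
    qed
    have "\<not> free_index CARD('n) k (insert (?m \<tau>) \<tau>, ?m \<tau>)" using m free_index_iff[OF k] by auto
    then have D2: "nsg (?m \<tau>) \<tau> * D (insert (?m \<tau>) \<tau>) (?m \<tau>) =
        - (\<Sum>j\<in>?N - \<tau> - {?m \<tau>}. nsg j \<tau> * D0 (insert j \<tau>) j)"
      using m by (simp add: D_def)
    have "(\<Sum>i\<in>?N - \<tau>. nsg i \<tau> * D (insert i \<tau>) i) = nsg (?m \<tau>) \<tau> * D (insert (?m \<tau>) \<tau>) (?m \<tau>) +
        (\<Sum>i\<in>?N - \<tau> - {?m \<tau>}. nsg i \<tau> * D (insert i \<tau>) i)"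
      by (rule sum.remove) (use m in auto)
    also have "(\<Sum>i\<in>?N - \<tau> - {?m \<tau>}. nsg i \<tau> * D (insert i \<tau>) i) = (\<Sum>i\<in>?N - \<tau> - {?m \<tau>}. nsg i \<tau> * D0 (insert i \<tau>) i)"
      by (intro sum.cong refl) (use D1 in simp)
    finally show ?thesis using D2 by simp
  qed
  from XX_of_matrix[OF d k(1) this] obtain w where w: "w \<in> XX k"
    "\<And>\<sigma> i. \<sigma> \<in> inc_seqs k CARD('n) \<Longrightarrow> i \<in> ?N \<Longrightarrow> cf b' w \<sigma> i = D \<sigma> i" by blast
  show ?thesis
  proof (rule that[OF w(1)])
    fix \<sigma> i assume f: "free_index CARD('n) k (\<sigma>, i)"
    then have "\<sigma> \<in> inc_seqs k CARD('n)" "i \<in> ?N" using free_index_iff[OF k] by auto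
    then show "cf b' w \<sigma> i = D0 \<sigma> i" using w(2) f by (simp add: D_def)
  qed
qed

text \<open>All entries of a normal constraint other than its pair index are free and lie in the
  normal constraint block.\<close>

lemma XX_normal_block:
  fixes \<omega> :: "'n::finite form2"
  assumes \<omega>: "\<omega> \<in> XX k" and k: "1 \<le> k" "k \<le> CARD('n)"
    and row: "\<sigma> \<in> inc_seqs k CARD('n)" "\<not> free_row CARD('n) k l \<sigma>" "i \<in> {l+1..CARD('n)}"
    and nfree: "\<not> free_index CARD('n) k (\<sigma>, i)"
  shows "i \<in> \<sigma>"
    "cf b \<omega> \<sigma> i = - nsg i (\<sigma> - {i}) *
      (\<Sum>j\<in>{1..CARD('n)} - \<sigma>. nsg j (\<sigma> - {i}) * cf b \<omega> (insert j (\<sigma> - {i})) j)"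
    "\<And>j. j \<in> {1..CARD('n)} - \<sigma> \<Longrightarrow> free_index CARD('n) k (insert j (\<sigma> - {i}), j) \<and>
      (insert j (\<sigma> - {i}), j) \<in> normal_block CARD('n) k l"
proof -
  let ?N = "{1..CARD('n)}" let ?\<tau> = "\<sigma> - {i}"
  have i: "i \<in> \<sigma>" "i = Min (?N - ?\<tau>)" using nfree row free_index_iff[OF k] by auto
  show "i \<in> \<sigma>" by (rule i)
  have iN: "i \<in> ?N" using row by auto
  have \<tau>: "?\<tau> \<in> inc_seqs (k - 1) CARD('n)" using inc_seqsD[OF row(1)] i by (auto simp: inc_seqs_def)
  have split: "?N - ?\<tau> - {i} = ?N - \<sigma>" using i by auto
  have "0 = nsg i ?\<tau> * cf b \<omega> (insert i ?\<tau>) i + (\<Sum>j\<in>?N - ?\<tau> - {i}. nsg j ?\<tau> * cf b \<omega> (insert j ?\<tau>) j)"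
    unfolding XX_constraint[OF \<omega> \<tau>, of b, symmetric] by (rule sum.remove) (use iN in auto)
  then have "nsg i ?\<tau> * cf b \<omega> \<sigma> i = - (\<Sum>j\<in>?N - \<sigma>. nsg j ?\<tau> * cf b \<omega> (insert j ?\<tau>) j)"
    using i unfolding split by (simp add: insert_absorb)
  then have "nsg i ?\<tau> * (nsg i ?\<tau> * cf b \<omega> \<sigma> i) = nsg i ?\<tau> * - (\<Sum>j\<in>?N - \<sigma>. nsg j ?\<tau> * cf b \<omega> (insert j ?\<tau>) j)"
    by (rule arg_cong)
  then show "cf b \<omega> \<sigma> i = - nsg i ?\<tau> * (\<Sum>j\<in>?N - \<sigma>. nsg j ?\<tau> * cf b \<omega> (insert j ?\<tau>) j)"
    by (simp flip: mult.assoc)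
  fix j assume j: "j \<in> ?N - \<sigma>"
  have "insert j ?\<tau> \<in> inc_seqs k CARD('n)" using inc_seqsD[OF \<tau>] j k by (auto simp: inc_seqs_def)
  moreover have ge: "i \<le> m" if "m \<in> ?N - ?\<tau>" for m using i(2) Min_le[of "?N - ?\<tau>" m] that by simp
  then have "j > i" using j i(1) by (metis DiffD1 DiffD2 DiffI le_neq_implies_less Diff_iff)
  moreover have rm: "insert j ?\<tau> - {j} = ?\<tau>" using j by auto
  \<comment> \<open>The pair index \<open>i\<close> is the least element outside \<tau> and is
    itself normal, so the whole constraint is normal and puts the rows of all its entries into the
    block.\<close>
  moreover have "normal_constraint CARD('n) l ?\<tau>"
    using ge row(3) by (force simp: normal_constraint_def)
  ultimately show "free_index CARD('n) k (insert j ?\<tau>, j) \<and> (insert j ?\<tau>, j) \<in> normal_block CARD('n) k l"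
    using free_index_iff[OF k] free_row_iff[OF k] j i row(3) by (auto simp: normal_block_def)
qed

section \<open>The trace in a dual basis\<close>

definition trv :: "nat \<Rightarrow> 'n Rn \<Rightarrow> 'n::{finite,linorder} form2 \<Rightarrow> 'n form"
  where "trv k \<nu> \<omega> = (\<Sum>\<sigma>\<in>inc_seqs k CARD('n).
     (\<Sum>i=1..CARD('n). mat_coeff k \<omega> \<sigma> i * (\<nu> \<bullet> std_vec i)) *\<^sub>R form_at dx \<sigma>)"

lemma trace_div_eq: "trace_div k \<nu> F W x = (if x \<in> F then trv k \<nu> (W x) else 0)"
  by (simp add: trace_div_def trv_def)

lemma linear_mat_coeff: "linear (\<lambda>\<omega>. mat_coeff k \<omega> \<sigma> i)"
  by (rule linearI) (auto simp: mat_coeff_def alt2_inner_def algebra_simps sum.distrib sum_distrib_left)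

lemma linear_trv: "linear (trv k \<nu>)"
  by (rule linearI) (simp_all add: trv_def linear_add[OF linear_mat_coeff] linear_cmul[OF linear_mat_coeff]
      sum.distrib distrib_right scaleR_add_left scaleR_sum_right sum_distrib_left mult.assoc)

lemma form_at_dx: "finite \<sigma> \<Longrightarrow> form_at dx \<sigma> = wform std_vec \<sigma>"
  by (rule form_at_eq) (simp_all add: dx_def)

lemma trv_Alt: "trv k \<nu> \<omega> \<in> Alt k"
  unfolding trv_def
proof (intro subspace_sum subspace_scale subspace_Alt)
  fix \<sigma> assume "\<sigma> \<in> inc_seqs k CARD('a)"
  then show "form_at dx \<sigma> \<in> Alt k" using wform_Alt inc_seqsD by (simp add: form_at_dx)
qed

text \<open>Summing over \<sigma> reassembles \<omega> in its first list, so the trace is known at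
  arbitrary \<open>ws\<close>; standard coordinates remain only in the second factor.\<close>

lemma trv_apply:
  fixes \<omega> :: "'n::{finite,linorder} form2"
  assumes \<omega>: "\<omega> \<in> Alt2 k (CARD('n) - 1)"
  shows "trv k \<nu> \<omega> ws = (\<Sum>i=1..CARD('n). (- 1) ^ (i - 1) *
    ((\<nu> \<bullet> std_vec i) * \<omega> ws (blist std_vec ({1..CARD('n)} - {i}))))"
proof -
  let ?N = "{1..CARD('n)}" and ?I = "inc_seqs k CARD('n)"
  have "trv k \<nu> \<omega> ws = (\<Sum>\<sigma>\<in>?I. (\<Sum>i\<in>?N. cf std_vec \<omega> \<sigma> i * (\<nu> \<bullet> std_vec i)) * wform std_vec \<sigma> ws)"
    unfolding trv_def fun_sum_apply
    by (intro sum.cong refl) (use inc_seqsD in \<open>auto simp: mat_coeff_eq[OF \<omega>] form_at_dx\<close>)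
  also have "\<dots> = (\<Sum>i\<in>?N. \<Sum>\<sigma>\<in>?I. cf std_vec \<omega> \<sigma> i * (\<nu> \<bullet> std_vec i) * wform std_vec \<sigma> ws)"
    unfolding sum_distrib_right by (rule sum.swap)
  also have "\<dots> = (\<Sum>i\<in>?N. (- 1) ^ (i - 1) * ((\<nu> \<bullet> std_vec i) *
      (\<Sum>\<sigma>\<in>?I. \<omega> (blist std_vec \<sigma>) (blist std_vec (?N - {i})) * wform std_vec \<sigma> ws)))"
    by (simp add: cf_def sum_distrib_left mult_ac)
  finally show ?thesis
    unfolding Alt_expand[OF dual_vecs_std Alt2_slice(2)[OF \<omega>], symmetric] .
qed

lemma trv_std:
  fixes \<omega> :: "'n::{finite,linorder} form2"
  assumes \<omega>: "\<omega> \<in> Alt2 k (CARD('n) - 1)" and \<sigma>: "\<sigma> \<in> inc_seqs k CARD('n)"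
  shows "trv k \<nu> \<omega> (std_args \<sigma>) = (\<Sum>i=1..CARD('n). mat_coeff k \<omega> \<sigma> i * (\<nu> \<bullet> std_vec i))"
  unfolding trv_apply[OF \<omega>] mat_coeff_eq[OF \<omega> \<sigma>] by (simp add: cf_def std_args_eq mult_ac)

text \<open>For fixed first arguments, the sum over \<open>i\<close> is the value on a basis of the
  top-degree form \<gamma>, the wedge of the covector of \<nu> with \<omega>. Such forms make up a
  line, so passing from the standard basis to \<open>b'\<close> multiplies the value by a factor
  \<kappa>, the determinant of \<open>b'\<close>, chosen before \<open>k\<close>, \<nu>, \<omega>
  and \<sigma>.\<close>

lemma trv_dual_coeff:
  fixes b b' :: "nat \<Rightarrow> 'n::{finite,linorder} Rn"
  assumes d: "dual_vecs b b'"
  obtains \<kappa> :: real where "\<kappa> \<noteq> 0"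
    "\<And>k \<nu> \<omega> \<sigma>. \<omega> \<in> Alt2 k (CARD('n) - 1) \<Longrightarrow> \<sigma> \<in> inc_seqs k CARD('n) \<Longrightarrow>
      \<kappa> * alt_inner k (trv k \<nu> \<omega>) (wform b' \<sigma>) = (\<Sum>i=1..CARD('n). (\<nu> \<bullet> b' i) * cf b' \<omega> \<sigma> i)"
proof
  let ?N = "{1..CARD('n)}"
  have top: "?N \<in> inc_seqs CARD('n) CARD('n)" by (simp add: inc_seqs_top)
  define \<kappa> where "\<kappa> = wform std_vec ?N (blist b' ?N)"
  have n: "Suc (CARD('n) - 1) = CARD('n)" by simp
  show "\<kappa> \<noteq> 0"
  proof
    assume "\<kappa> = 0"
    then have z: "wform std_vec ?N (blist b' \<sigma>) = 0" if "\<sigma> \<in> inc_seqs CARD('n) CARD('n)" for \<sigma>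
      using that by (simp add: inc_seqs_top \<kappa>_def)
    have "wform std_vec ?N (blist (std_vec :: nat \<Rightarrow> 'n Rn) ?N) = 0"
      by (rule Alt_eq_0[OF wform_Alt[OF top] dual_vecs_span[OF d] z])
    then show False using wform_dual[OF dual_vecs_std top top] by simp
  qed
  fix k \<nu> and \<omega> :: "'n form2" and \<sigma>
  assume \<omega>: "\<omega> \<in> Alt2 k (CARD('n) - 1)" and \<sigma>: "\<sigma> \<in> inc_seqs k CARD('n)"
  let ?ws = "blist b' \<sigma>"
  define B where "B v = (\<nu> \<bullet> v) *\<^sub>R \<omega> ?ws" for v :: "'n Rn"
  define \<gamma> where "\<gamma> = (\<lambda>vs :: 'n Rn list. if length vs = Suc (CARD('n) - 1)
    then \<Sum>i<Suc (CARD('n) - 1). (- 1) ^ i * B (vs ! i) (take i vs @ drop (Suc i) vs) else 0)"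
  have "\<gamma> \<in> Alt (Suc (CARD('n) - 1))"
    unfolding \<gamma>_def
  proof (rule Alt_alternating_sum)
    show "B v \<in> Alt (CARD('n) - 1)" for v
      unfolding B_def by (rule subspace_scale[OF subspace_Alt Alt2_slice(1)[OF \<omega>]])
    show "linear (\<lambda>v. B v vs)" for vs
      by (rule linearI) (simp_all add: B_def inner_add_right algebra_simps)
  qed
  then have \<gamma>: "\<gamma> \<in> Alt CARD('n)" by simp
  have val: "\<gamma> (blist c ?N) = (\<Sum>i\<in>?N. (- 1) ^ (i - 1) * ((\<nu> \<bullet> c i) * \<omega> ?ws (blist c (?N - {i}))))" for c
    using alternating_sum_basis[of B c "CARD('n)"] unfolding \<gamma>_def n by (simp add: B_def)
  have "(\<Sum>i\<in>?N. (\<nu> \<bullet> b' i) * cf b' \<omega> \<sigma> i) = \<gamma> (blist b' ?N)"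
    unfolding val by (simp add: cf_def mult_ac)
  also have "\<dots> = \<gamma> (blist std_vec ?N) * \<kappa>"
    using Alt_expand[OF dual_vecs_std \<gamma>, of "blist b' ?N"] by (simp add: inc_seqs_top \<kappa>_def)
  also have "\<gamma> (blist std_vec ?N) = trv k \<nu> \<omega> ?ws"
    unfolding val trv_apply[OF \<omega>] ..
  also have "\<dots> = alt_inner k (trv k \<nu> \<omega>) (wform b' \<sigma>)"
    by (rule alt_inner_wedge[OF trv_Alt, symmetric])
  finally show "\<kappa> * alt_inner k (trv k \<nu> \<omega>) (wform b' \<sigma>) = (\<Sum>i\<in>?N. (\<nu> \<bullet> b' i) * cf b' \<omega> \<sigma> i)"
    by simp
qed

section \<open>Scalar polynomials on a simplex and their divisibility by face bubbles\<close>

section \<open>Polynomial functions\<close>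

definition mon :: "('n::finite \<Rightarrow> nat) \<Rightarrow> 'n Rn \<Rightarrow> real"
  where "mon \<alpha> x = (\<Prod>i\<in>UNIV. (x $ i) ^ \<alpha> i)"

definition polyP :: "nat \<Rightarrow> ('n::finite Rn \<Rightarrow> real) set"
  where "polyP r = span (mon ` {\<alpha>. sum \<alpha> UNIV \<le> r})"

lemma finite_exponents [simp]: "finite {\<alpha> :: 'n::finite \<Rightarrow> nat. sum \<alpha> UNIV \<le> r}"
proof (rule finite_subset)
  show "{\<alpha> :: 'n \<Rightarrow> nat. sum \<alpha> UNIV \<le> r} \<subseteq> PiE UNIV (\<lambda>_. {..r})"
  proof
    fix \<alpha> :: "'n \<Rightarrow> nat" assume "\<alpha> \<in> {\<alpha>. sum \<alpha> UNIV \<le> r}"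
    then have "\<alpha> i \<le> r" for i using member_le_sum[of i UNIV \<alpha>] by simp
    then show "\<alpha> \<in> PiE UNIV (\<lambda>_. {..r})" by (simp add: PiE_iff)
  qed
qed (simp add: finite_PiE)

lemma span_image_explicit:
  fixes g :: "'a \<Rightarrow> 'b::real_vector"
  assumes "finite S"
  shows "span (g ` S) = {\<Sum>s\<in>S. c s *\<^sub>R g s | c. True}"
proof
  show "span (g ` S) \<subseteq> {\<Sum>s\<in>S. c s *\<^sub>R g s | c. True}"
  proof (rule span_minimal)
    show "g ` S \<subseteq> {\<Sum>s\<in>S. c s *\<^sub>R g s | c. True}"
    proof safe
      fix s assume "s \<in> S"
      then have "g s = (\<Sum>s'\<in>S. (if s' = s then 1 else 0) *\<^sub>R g s')"
        using assms by (simp add: if_distrib[of "\<lambda>c. c *\<^sub>R _"] cong: if_cong)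
      then show "\<exists>c. g s = (\<Sum>s\<in>S. c s *\<^sub>R g s) \<and> True"
        by (intro exI[of _ "\<lambda>s'. if s' = s then 1 else 0"]) simp
    qed
    show "subspace {\<Sum>s\<in>S. c s *\<^sub>R g s | c. True}"
    proof (rule subspaceI; safe)
      have "0 = (\<Sum>s\<in>S. 0 *\<^sub>R g s)" by simp
      then show "\<exists>c. 0 = (\<Sum>s\<in>S. c s *\<^sub>R g s) \<and> True" by fast
    next
      fix c d :: "'a \<Rightarrow> real"
      have "(\<Sum>s\<in>S. c s *\<^sub>R g s) + (\<Sum>s\<in>S. d s *\<^sub>R g s) = (\<Sum>s\<in>S. (c s + d s) *\<^sub>R g s)"
        by (simp add: sum.distrib algebra_simps)
      then show "\<exists>e. (\<Sum>s\<in>S. c s *\<^sub>R g s) + (\<Sum>s\<in>S. d s *\<^sub>R g s) = (\<Sum>s\<in>S. e s *\<^sub>R g s) \<and> True"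
        by (intro exI[of _ "\<lambda>s. c s + d s"]) simp
    next
      fix a and c :: "'a \<Rightarrow> real"
      have "a *\<^sub>R (\<Sum>s\<in>S. c s *\<^sub>R g s) = (\<Sum>s\<in>S. (a * c s) *\<^sub>R g s)"
        by (simp add: scaleR_sum_right)
      then show "\<exists>e. a *\<^sub>R (\<Sum>s\<in>S. c s *\<^sub>R g s) = (\<Sum>s\<in>S. e s *\<^sub>R g s) \<and> True"
        by (intro exI[of _ "\<lambda>s. a * c s"]) simp
    qed
  qed
qed (auto intro!: span_sum span_scale intro: span_base)

lemma polys_eq:
  fixes f :: "'n::finite Rn set"
  shows "polys d f = (if d < 0 then {0} else (\<lambda>p x. if x \<in> f then p x else 0) ` polyP (nat d))"
proof (cases "d < 0")
  case True
  have "\<not> int (sum \<alpha> UNIV) \<le> d" for \<alpha> :: "'n \<Rightarrow> nat"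
    using True of_nat_0_le_iff[of "sum \<alpha> UNIV"] by linarith
  then have e: "{\<alpha> :: 'n \<Rightarrow> nat. int (sum \<alpha> UNIV) \<le> d} = {}" by auto
  have "polys d f = {q. \<exists>c :: ('n \<Rightarrow> nat) \<Rightarrow> real. q = (\<lambda>x. 0)}"
    unfolding polys_def e sum.empty if_cancel by simp
  then show ?thesis using True by (auto simp: zero_fun_def)
next
  case False
  then have e: "{\<alpha> :: 'n \<Rightarrow> nat. int (\<Sum>i\<in>UNIV. \<alpha> i) \<le> d} = {\<alpha>. sum \<alpha> UNIV \<le> nat d}"
    by (auto simp: le_nat_iff)
  show ?thesis
    using False unfolding polys_def e polyP_def span_image_explicit[OF finite_exponents]
    by (auto simp: fun_sum_apply mon_def image_iff fun_eq_iff; blast)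
qed

lemma subspace_polyP: "subspace (polyP r)"
  by (simp add: polyP_def)

lemma polyP_add: "p \<in> polyP r \<Longrightarrow> q \<in> polyP r \<Longrightarrow> (\<lambda>x. p x + q x) \<in> polyP r"
  using subspace_add[OF subspace_polyP, of p r q] by (simp add: plus_fun_def)

lemma polyP_cmult: "p \<in> polyP r \<Longrightarrow> (\<lambda>x. c * p x) \<in> polyP r"
  using subspace_scale[OF subspace_polyP, of p r c] by (simp add: scaleR_fun_def)

lemma polyP_sum: "(\<And>i. i \<in> I \<Longrightarrow> p i \<in> polyP r) \<Longrightarrow> (\<lambda>x. \<Sum>i\<in>I. p i x) \<in> polyP r"
  using subspace_sum[OF subspace_polyP, of I p r] by (simp add: fun_sum_apply fun_eq_iff[symmetric] flip: fun_sum_apply)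

lemma mon_polyP: "sum \<alpha> UNIV \<le> r \<Longrightarrow> mon \<alpha> \<in> polyP r"
  unfolding polyP_def by (rule span_base) auto

lemma polyP_const [simp]: "(\<lambda>x. c) \<in> polyP r"
  using polyP_cmult[OF mon_polyP[of "\<lambda>_. 0"], of r c] by (simp add: mon_def)

lemma polyP_mult:
  assumes "p \<in> polyP r" "q \<in> polyP s"
  shows "(\<lambda>x. p x * q x) \<in> polyP (r + s)"
proof -
  have 1: "(\<lambda>x. mon \<alpha> x * q x) \<in> polyP (r + s)" if "sum \<alpha> UNIV \<le> r" for \<alpha>
    using assms(2) unfolding polyP_def[of s]
  proof (induction rule: span_induct_alt)
    case base
    then show ?case using subspace_0[OF subspace_polyP] by (simp add: zero_fun_def)
  next
    case (step c m q)
    then obtain \<beta> where b: "m = mon \<beta>" "sum \<beta> UNIV \<le> s" by auto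
    have "(\<lambda>x. mon \<alpha> x * m x) = mon (\<lambda>i. \<alpha> i + \<beta> i)"
      by (simp add: b mon_def power_add prod.distrib fun_eq_iff)
    moreover have "mon (\<lambda>i. \<alpha> i + \<beta> i) \<in> polyP (r + s)"
      using that b by (intro mon_polyP) (simp add: sum.distrib)
    ultimately have "(\<lambda>x. c * (mon \<alpha> x * m x)) \<in> polyP (r + s)" using polyP_cmult by metis
    from polyP_add[OF this step(2)] show ?case by (simp add: algebra_simps)
  qed
  show ?thesis
    using assms(1) unfolding polyP_def[of r]
  proof (induction rule: span_induct_alt)
    case base
    then show ?case using subspace_0[OF subspace_polyP] by (simp add: zero_fun_def)
  next
    case (step c m p)
    then have "(\<lambda>x. m x * q x) \<in> polyP (r + s)" using 1 by auto
    from polyP_add[OF polyP_cmult[OF this, of c] step(2)] show ?case by (simp add: algebra_simps)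
  qed
qed

lemma polyP_coord: "(\<lambda>x. x $ i) \<in> polyP (Suc 0)"
proof -
  have "mon (\<lambda>j. if j = i then 1 else 0) = (\<lambda>x :: 'a Rn. x $ i)"
    by (simp add: mon_def fun_eq_iff if_distrib[of "\<lambda>e. _ ^ e"] cong: if_cong)
  then show ?thesis using mon_polyP[of "\<lambda>j. if j = i then 1 else 0" "Suc 0"] by simp
qed

lemma polyP_linear:
  assumes "linear g"
  shows "g \<in> polyP (Suc 0)"
proof -
  have "g x = (\<Sum>i\<in>UNIV. g (axis i 1) * x $ i)" for x
  proof -
    have "g x = g (\<Sum>i\<in>UNIV. (x $ i) *\<^sub>R axis i 1)"
      by (metis (no_types, lifting) basis_expansion scalar_mult_eq_scaleR sum.cong)
    then show ?thesis using assms by (simp add: linear_sum linear_cmul mult.commute)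
  qed
  then have "g = (\<lambda>x. \<Sum>i\<in>UNIV. g (axis i 1) * x $ i)" by blast
  moreover have "\<dots> \<in> polyP (Suc 0)" by (intro polyP_sum polyP_cmult polyP_coord)
  ultimately show ?thesis by simp
qed

lemma polyP_power: "p \<in> polyP r \<Longrightarrow> (\<lambda>x. p x ^ m) \<in> polyP (m * r)"
  by (induction m) (use polyP_mult[of p r] in auto)

lemma polyP_prod:
  assumes "finite I" "\<And>i. i \<in> I \<Longrightarrow> p i \<in> polyP (r i)"
  shows "(\<lambda>x. \<Prod>i\<in>I. p i x) \<in> polyP (\<Sum>i\<in>I. r i)"
  using assms by (induction I rule: finite_induct) (simp_all add: polyP_mult)

lemma polyP_continuous: "p \<in> polyP r \<Longrightarrow> continuous_on S p"
  unfolding polyP_def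
proof (induction rule: span_induct_alt)
  case base
  then show ?case by (simp add: zero_fun_def)
next
  case (step c m p)
  then obtain \<alpha> where "m = mon \<alpha>" by auto
  moreover have "continuous_on S (mon \<alpha>)"
    unfolding mon_def[abs_def] by (intro continuous_intros)
  ultimately show ?case using step by (auto simp: plus_fun_def intro!: continuous_intros)
qed

section \<open>Barycentric coordinates\<close>

definition simplex_verts :: "'n::finite Rn set \<Rightarrow> bool"
  where "simplex_verts C \<longleftrightarrow> \<not> affine_dependent C \<and> card C = CARD('n) + 1"

text \<open>Affine coordinates on the whole space, not only inside the simplex, so that they are
  polynomials of degree 1. For the vertices of a full simplex the choice is unique by
  \<open>bary_unique\<close>.\<close>

definition bary :: "'n::finite Rn set \<Rightarrow> 'n Rn \<Rightarrow> 'n Rn \<Rightarrow> real"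
  where "bary C x = (SOME u. sum u C = 1 \<and> (\<Sum>v\<in>C. u v *\<^sub>R v) = x)"

lemma simplex_verts_finite: "simplex_verts C \<Longrightarrow> finite C"
  by (simp add: simplex_verts_def aff_independent_finite)

lemma bary_spec:
  assumes "simplex_verts (C :: 'n::finite Rn set)"
  shows "sum (bary C x) C = 1" "(\<Sum>v\<in>C. bary C x v *\<^sub>R v) = x"
proof -
  have "aff_dim C = int CARD('n)"
    using assms aff_dim_affine_independent[of C] by (simp add: simplex_verts_def)
  then have "affine hull C = UNIV" by (simp flip: affine_hull_UNIV aff_dim_eq_full)
  then have "x \<in> affine hull C" by simp
  then have "\<exists>u. sum u C = 1 \<and> (\<Sum>v\<in>C. u v *\<^sub>R v) = x"
    using affine_hull_finite[OF simplex_verts_finite[OF assms]] by blast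
  from someI_ex[OF this] show "sum (bary C x) C = 1" "(\<Sum>v\<in>C. bary C x v *\<^sub>R v) = x"
    by (simp_all add: bary_def)
qed

lemma bary_unique:
  assumes C: "simplex_verts C" and u: "sum u C = 1" "(\<Sum>v\<in>C. u v *\<^sub>R v) = x" and v: "v \<in> C"
  shows "bary C x v = u v"
proof (rule ccontr)
  assume "bary C x v \<noteq> u v"
  moreover have "(\<Sum>v\<in>C. bary C x v - u v) = 0" "(\<Sum>v\<in>C. (bary C x v - u v) *\<^sub>R v) = 0"
    using bary_spec[OF C, of x] u by (simp_all add: sum_subtractf algebra_simps)
  ultimately have "affine_dependent C"
    using v unfolding affine_dependent_explicit_finite[OF simplex_verts_finite[OF C]]
    by (intro exI[of _ "\<lambda>v. bary C x v - u v"]) auto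
  then show False using C by (simp add: simplex_verts_def)
qed

lemma bary_vertex:
  assumes C: "simplex_verts C" and "v \<in> C" "w \<in> C"
  shows "bary C w v = (if v = w then 1 else 0)"
  by (rule bary_unique[OF C _ _ assms(2)])
    (use assms simplex_verts_finite[OF C] in \<open>simp_all add: if_distrib[of "\<lambda>c. c *\<^sub>R _"] cong: if_cong\<close>)

lemma linear_bary:
  assumes C: "simplex_verts C" and v: "v \<in> C"
  shows "linear (\<lambda>x. bary C x v - bary C 0 v)"
proof (rule linearI)
  note s = bary_spec[OF C]
  fix x y
  have "bary C (x + y) v = bary C x v + bary C y v - bary C 0 v"
    by (rule bary_unique[OF C _ _ v]) (use s in \<open>simp_all add: sum.distrib sum_subtractf algebra_simps\<close>)
  then show "bary C (x + y) v - bary C 0 v = bary C x v - bary C 0 v + (bary C y v - bary C 0 v)" by simp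
next
  note s = bary_spec[OF C]
  fix c x
  have "bary C (c *\<^sub>R x) v = c * bary C x v + (1 - c) * bary C 0 v"
    by (rule bary_unique[OF C _ _ v])
      (use s in \<open>simp_all add: sum.distrib algebra_simps sum_subtractf
        flip: sum_distrib_left scaleR_scaleR scaleR_sum_right\<close>)
  then show "bary C (c *\<^sub>R x) v - bary C 0 v = c *\<^sub>R (bary C x v - bary C 0 v)"
    by (simp add: algebra_simps)
qed

lemma bary_polyP:
  assumes "simplex_verts C" "v \<in> C"
  shows "(\<lambda>x. bary C x v) \<in> polyP (Suc 0)"
  using polyP_add[OF polyP_linear[OF linear_bary[OF assms]] polyP_const[of "bary C 0 v"]] by simp

lemma bary_continuous: "simplex_verts C \<Longrightarrow> v \<in> C \<Longrightarrow> continuous_on S (\<lambda>x. bary C x v)"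
  by (rule polyP_continuous[OF bary_polyP])

lemma in_face_iff:
  assumes C: "simplex_verts C" and c: "c \<subseteq> C"
  shows "x \<in> convex hull c \<longleftrightarrow> (\<forall>v\<in>C. 0 \<le> bary C x v) \<and> (\<forall>v\<in>C - c. bary C x v = 0)"
proof -
  have fin: "finite C" "finite c" using simplex_verts_finite[OF C] c finite_subset by auto
  show ?thesis
  proof
    assume "x \<in> convex hull c"
    then obtain u where u: "\<forall>v\<in>c. 0 \<le> u v" "sum u c = 1" "(\<Sum>v\<in>c. u v *\<^sub>R v) = x"
      by (auto simp: convex_hull_finite[OF fin(2)])
    let ?u = "\<lambda>v. if v \<in> c then u v else 0"
    have "sum ?u C = 1" "(\<Sum>v\<in>C. ?u v *\<^sub>R v) = x"
      using u c fin by (simp_all add: sum.If_cases if_distrib[of "\<lambda>c. c *\<^sub>R _"] Int_absorb1 cong: if_cong)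
    then have "bary C x v = ?u v" if "v \<in> C" for v using bary_unique[OF C] that by blast
    then show "(\<forall>v\<in>C. 0 \<le> bary C x v) \<and> (\<forall>v\<in>C - c. bary C x v = 0)" using u by auto
  next
    assume r: "(\<forall>v\<in>C. 0 \<le> bary C x v) \<and> (\<forall>v\<in>C - c. bary C x v = 0)"
    have "sum (bary C x) c = sum (bary C x) C" "(\<Sum>v\<in>c. bary C x v *\<^sub>R v) = (\<Sum>v\<in>C. bary C x v *\<^sub>R v)"
      using r c fin by (auto intro: sum.mono_neutral_left)
    then show "x \<in> convex hull c"
      using r c bary_spec[OF C, of x] by (auto simp: convex_hull_finite[OF fin(2)])
  qed
qed

lemma subsimplices_eq:
  assumes ind: "\<not> affine_dependent C"
  shows "subsimplices l (convex hull C) = {convex hull c | c. c \<subseteq> C \<and> card c = Suc l}"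
proof -
  have *: "int l simplex (convex hull c) \<longleftrightarrow> card c = Suc l" if "c \<subseteq> C" for c
  proof -
    have ic: "\<not> affine_dependent c" using ind that affine_dependent_subset by blast
    show ?thesis
    proof
      assume "int l simplex (convex hull c)"
      then have "aff_dim (convex hull c) = int l" by (rule aff_dim_simplex)
      then show "card c = Suc l" using aff_dim_affine_independent[OF ic] by (simp add: aff_dim_convex_hull)
    qed (use ic in \<open>simp add: simplex_convex_hull\<close>)
  qed
  have "f \<in> subsimplices l (convex hull C) \<longleftrightarrow> (\<exists>c. f = convex hull c \<and> c \<subseteq> C \<and> card c = Suc l)" for f
  proof
    assume f: "f \<in> subsimplices l (convex hull C)"
    then obtain c where c: "c \<subseteq> C" "f = convex hull c"
      unfolding subsimplices_def face_of_convex_hull_affine_independent[OF ind] by auto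
    moreover have "card c = Suc l" using f c(2) *[OF c(1)] by (simp add: subsimplices_def)
    ultimately show "\<exists>c. f = convex hull c \<and> c \<subseteq> C \<and> card c = Suc l" by auto
  next
    assume "\<exists>c. f = convex hull c \<and> c \<subseteq> C \<and> card c = Suc l"
    then obtain c where c: "f = convex hull c" "c \<subseteq> C" "card c = Suc l" by auto
    then have "int l simplex f" using *[OF c(2)] by simp
    moreover have "f face_of convex hull C"
      using c unfolding face_of_convex_hull_affine_independent[OF ind] by auto
    ultimately show "f \<in> subsimplices l (convex hull C)" by (simp add: subsimplices_def)
  qed
  then show ?thesis by (intro set_eqI) (simp only: mem_Collect_eq)
qed

lemma convex_hull_inj:
  assumes C: "simplex_verts C" and "c \<subseteq> C" "d \<subseteq> C" "convex hull c \<subseteq> convex hull d"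
  shows "c \<subseteq> d"
proof
  fix v assume v: "v \<in> c"
  then have vd: "v \<in> convex hull d" and vC: "v \<in> C"
    using assms(2) subsetD[OF assms(4) hull_inc[OF v]] by auto
  have "\<forall>w\<in>C - d. bary C v w = 0" using vd unfolding in_face_iff[OF C assms(3)] by (rule conjunct2)
  then show "v \<in> d" using bary_vertex[OF C vC vC] vC by (metis DiffI zero_neq_one)
qed

lemma simplex_verts_obtain:
  assumes "int CARD('n) simplex (T :: 'n::finite Rn set)"
  obtains C where "simplex_verts C" "T = convex hull C"
proof -
  obtain C where "\<not> affine_dependent C" "int (card C) = int CARD('n) + 1" "T = convex hull C"
    using assms by (auto simp: simplex_def)
  moreover from this(2) have "card C = CARD('n) + 1" by linarith
  ultimately show ?thesis using that by (simp add: simplex_verts_def)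
qed

section \<open>Polynomials vanishing on the boundary of a face\<close>

definition bmon :: "'n::finite Rn set \<Rightarrow> 'n Rn set \<Rightarrow> ('n Rn \<Rightarrow> nat) \<Rightarrow> 'n Rn \<Rightarrow> real"
  where "bmon C c \<alpha> x = (\<Prod>v\<in>c. bary C x v ^ \<alpha> v)"

text \<open>Exponents are set to 0 off \<open>c\<close>, so each monomial has exactly one exponent
  function and, for finite \<open>c\<close>, the index set is finite.\<close>

definition bidx :: "'a set \<Rightarrow> nat \<Rightarrow> ('a \<Rightarrow> nat) set"
  where "bidx c r = {\<alpha>. (\<forall>v. v \<notin> c \<longrightarrow> \<alpha> v = 0) \<and> sum \<alpha> c = r}"

lemma finite_bidx:
  assumes "finite c"
  shows "finite (bidx c r)"
proof -
  have "bidx c r \<subseteq> {f. \<forall>x. (x \<in> c \<longrightarrow> f x \<in> {..r}) \<and> (x \<notin> c \<longrightarrow> f x = 0)}"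
    using assms member_le_sum[of _ c] by (auto simp: bidx_def)
  then show ?thesis using finite_set_of_finite_funs[OF assms, of "{..r}" 0] finite_subset by blast
qed

text \<open>Each coordinate function is a linear form in the barycentric coordinates, and these sum
  to 1. Multiplying a monomial by a power of this sum raises it to degree exactly
  \<open>r\<close>.\<close>

lemma polyP_homogeneous:
  assumes C: "simplex_verts C" and p: "p \<in> polyP r"
  shows "p \<in> span (bmon C C ` bidx C r)"
proof -
  let ?H = "\<lambda>r. span (bmon C C ` bidx C r)"
  note fin = simplex_verts_finite[OF C]
  have H_base: "(\<lambda>x. bary C x v) \<in> ?H 1" if "v \<in> C" for v
  proof -
    let ?\<alpha> = "\<lambda>w. if w = v then 1 else 0 :: nat"
    have "bmon C C ?\<alpha> = (\<lambda>x. bary C x v)"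
      using that fin by (simp add: bmon_def fun_eq_iff if_distrib[of "\<lambda>e. _ ^ e"] cong: if_cong)
    moreover have "?\<alpha> \<in> bidx C 1" using that fin by (auto simp: bidx_def)
    ultimately show ?thesis by (metis image_eqI span_base)
  qed
  have H_mult: "(\<lambda>x. p x * q x) \<in> ?H (r + s)" if "p \<in> ?H r" "q \<in> ?H s" for p q r s
  proof -
    have 1: "(\<lambda>x. bmon C C \<alpha> x * q x) \<in> ?H (r + s)" if a: "\<alpha> \<in> bidx C r" for \<alpha>
      using \<open>q \<in> ?H s\<close>
    proof (induction rule: span_induct_alt)
      case base
      then show ?case using span_zero[of "bmon C C ` bidx C (r + s)"] by (simp add: zero_fun_def)
    next
      case (step c m q)
      then obtain \<beta> where b: "m = bmon C C \<beta>" "\<beta> \<in> bidx C s" by auto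
      have "(\<lambda>x. bmon C C \<alpha> x * m x) = bmon C C (\<lambda>v. \<alpha> v + \<beta> v)"
        by (simp add: b bmon_def power_add prod.distrib fun_eq_iff)
      moreover have "(\<lambda>v. \<alpha> v + \<beta> v) \<in> bidx C (r + s)"
        using a b by (simp add: bidx_def sum.distrib)
      ultimately have "(\<lambda>x. bmon C C \<alpha> x * m x) \<in> ?H (r + s)" by (metis image_eqI span_base)
      from span_add[OF span_scale[OF this, of c] step(2)] show ?case
        by (simp add: plus_fun_def scaleR_fun_def algebra_simps)
    qed
    show ?thesis
      using \<open>p \<in> ?H r\<close>
    proof (induction rule: span_induct_alt)
      case base
      then show ?case using span_zero[of "bmon C C ` bidx C (r + s)"] by (simp add: zero_fun_def)
    next
      case (step c m p)
      then have "(\<lambda>x. m x * q x) \<in> ?H (r + s)" using 1 by auto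
      from span_add[OF span_scale[OF this, of c] step(2)] show ?case
        by (simp add: plus_fun_def scaleR_fun_def algebra_simps)
    qed
  qed
  have H_sum: "(\<lambda>x. \<Sum>v\<in>C. a v * bary C x v) \<in> ?H 1" for a :: "_ \<Rightarrow> real"
  proof -
    have "(\<Sum>v\<in>C. a v *\<^sub>R (\<lambda>x. bary C x v)) \<in> ?H 1"
      by (intro span_sum span_scale H_base)
    moreover have "(\<Sum>v\<in>C. a v *\<^sub>R (\<lambda>x. bary C x v)) = (\<lambda>x. \<Sum>v\<in>C. a v * bary C x v)"
      by (simp add: fun_eq_iff fun_sum_apply)
    ultimately show ?thesis by simp
  qed
  have H_1: "(\<lambda>x. 1) \<in> ?H 1" using H_sum[of "\<lambda>_. 1"] bary_spec(1)[OF C] by simp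
  have H_coord: "(\<lambda>x. x $ i) \<in> ?H 1" for i
  proof -
    have "x $ i = (\<Sum>v\<in>C. v $ i * bary C x v)" for x
    proof -
      have "x $ i = (\<Sum>v\<in>C. bary C x v *\<^sub>R v) $ i" unfolding bary_spec(2)[OF C] ..
      also have "\<dots> = (\<Sum>v\<in>C. v $ i * bary C x v)" by (simp add: mult.commute)
      finally show ?thesis .
    qed
    then have eq: "(\<lambda>x. x $ i) = (\<lambda>x. \<Sum>v\<in>C. v $ i * bary C x v)" by (rule ext)
    show ?thesis by (subst eq) (rule H_sum)
  qed
  have H_0: "(\<lambda>x. 1) \<in> ?H 0"
  proof -
    have "bmon C C (\<lambda>_. 0) = (\<lambda>x. 1)" "(\<lambda>_. 0) \<in> bidx C 0" by (auto simp: bmon_def bidx_def)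
    then show ?thesis by (metis image_eqI span_base)
  qed
  have H_pow: "(\<lambda>x. f x ^ m) \<in> ?H m" if "f \<in> ?H 1" for f and m :: nat
  proof (induction m)
    case (Suc m)
    from H_mult[OF that Suc] show ?case by simp
  qed (simp add: H_0)
  have H_prod: "(\<lambda>x. \<Prod>i\<in>I. x $ i ^ \<alpha> i) \<in> ?H (sum \<alpha> I)" if "finite I" for I and \<alpha> :: "'a \<Rightarrow> nat"
    using that
  proof (induction I rule: finite_induct)
    case (insert i I)
    from H_mult[OF H_pow[OF H_coord[of i], of "\<alpha> i"] insert(3)] insert(1,2) show ?case by simp
  qed (simp add: H_0)
  have "mon \<alpha> \<in> ?H r" if "sum \<alpha> UNIV \<le> r" for \<alpha>
  proof -
    have "(\<lambda>x. mon \<alpha> x * 1 ^ (r - sum \<alpha> UNIV)) \<in> ?H (sum \<alpha> UNIV + (r - sum \<alpha> UNIV))"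
      using H_mult[OF H_prod H_pow[OF H_1], of UNIV \<alpha> "r - sum \<alpha> UNIV"] by (simp add: mon_def)
    then show ?thesis using that by (simp add: fun_eq_iff[symmetric])
  qed
  then have "mon ` {\<alpha>. sum \<alpha> UNIV \<le> r} \<subseteq> ?H r" by auto
  then have "span (mon ` {\<alpha>. sum \<alpha> UNIV \<le> r}) \<subseteq> ?H r" by (rule span_minimal) simp
  then show ?thesis using p by (auto simp: polyP_def)
qed

text \<open>Homogeneity: the sum of the terms without \<open>bary C x v\<close> vanishes on the cone over the
  opposite facet, hence on the whole face.\<close>

lemma bary_drop_vertex:
  assumes C: "simplex_verts C" and c: "c \<subseteq> C" and v: "v \<in> c" and r: "r \<ge> 1"
    and fin: "finite A" and A: "A \<subseteq> bidx c r"
    and z: "\<And>x. x \<in> convex hull (c - {v}) \<Longrightarrow> (\<Sum>\<alpha>\<in>A. a \<alpha> * bmon C c \<alpha> x) = 0"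
    and x: "x \<in> convex hull c"
  shows "(\<Sum>\<alpha>\<in>A. a \<alpha> * bmon C c \<alpha> x) = (\<Sum>\<alpha>\<in>{\<alpha>\<in>A. \<alpha> v > 0}. a \<alpha> * bmon C c \<alpha> x)"
proof -
  have fC: "finite C" "finite c" using simplex_verts_finite[OF C] c finite_subset by auto
  let ?b = "bary C x"
  have xb: "\<forall>w\<in>C. 0 \<le> ?b w" "\<forall>w\<in>C - c. ?b w = 0" using x in_face_iff[OF C c] by auto
  let ?A0 = "{\<alpha>\<in>A. \<alpha> v = 0}"
  define s where "s = (\<Sum>w\<in>c - {v}. ?b w)"
  have s0: "s \<ge> 0" unfolding s_def by (rule sum_nonneg) (use xb c in auto)
  have bm0: "bmon C c \<alpha> y = (\<Prod>w\<in>c - {v}. bary C y w ^ \<alpha> w)" if "\<alpha> \<in> ?A0" for \<alpha> y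
    using that prod.remove[OF fC(2) v, of "\<lambda>w. bary C y w ^ \<alpha> w"] by (simp add: bmon_def)
  have deg: "sum \<alpha> (c - {v}) = r" if "\<alpha> \<in> ?A0" for \<alpha>
    using that A sum.remove[OF fC(2) v, of \<alpha>] by (auto simp: bidx_def)
  have "(\<Sum>\<alpha>\<in>?A0. a \<alpha> * bmon C c \<alpha> x) = 0"
  proof (cases "s = 0")
    case True
    \<comment> \<open>Here \<open>x\<close> is the vertex \<open>v\<close>: a monomial without the
      coordinate of \<open>v\<close> has degree \<open>r\<close>, at least 1, in coordinates that
      all vanish.\<close>
    then have b0: "?b w = 0" if "w \<in> c - {v}" for w
      using that xb c fC unfolding s_def by (subst (asm) sum_nonneg_eq_0_iff) auto
    have "bmon C c \<alpha> x = 0" if a: "\<alpha> \<in> ?A0" for \<alpha>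
    proof -
      obtain w where "w \<in> c - {v}" "\<alpha> w \<noteq> 0" using deg[OF a] r by (metis not_one_le_zero sum.neutral)
      then show ?thesis using b0 fC by (auto simp: bm0[OF a])
    qed
    then show ?thesis by simp
  next
    case False
    then have s: "s > 0" using s0 by simp
    \<comment> \<open>\<open>y\<close> is the projection of \<open>x\<close> from the vertex
      \<open>v\<close> to the opposite facet of \<open>c\<close>: the coordinate of \<open>v\<close>
      is dropped and the others are renormalized by their sum \<open>s\<close>. Homogeneity turns
      this into the factor \<open>s ^ r\<close>.\<close>
    define y where "y = (\<Sum>w\<in>C. (if w \<in> c - {v} then ?b w / s else 0) *\<^sub>R w)"
    have "sum (\<lambda>w. if w \<in> c - {v} then ?b w / s else 0) C = (\<Sum>w\<in>c - {v}. ?b w / s)"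
      using fC c by (subst sum.inter_restrict[symmetric]) (auto intro: arg_cong[where f = "sum _"])
    also have "\<dots> = 1" using s by (simp add: s_def flip: sum_divide_distrib)
    finally have "bary C y w = (if w \<in> c - {v} then ?b w / s else 0)" if "w \<in> C" for w
      using bary_unique[OF C _ y_def[symmetric]] that by blast
    note yb = this
    have yin: "y \<in> convex hull (c - {v})"
      using yb xb s c by (subst in_face_iff[OF C]) auto
    have "(\<Sum>\<alpha>\<in>?A0. a \<alpha> * bmon C c \<alpha> y) = (\<Sum>\<alpha>\<in>A. a \<alpha> * bmon C c \<alpha> y)"
    proof (rule sum.mono_neutral_left[OF fin])
      show "\<forall>\<alpha>\<in>A - ?A0. a \<alpha> * bmon C c \<alpha> y = 0"
        using yb v c fC by (auto simp: bmon_def intro!: bexI[of _ v])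
    qed auto
    also have "\<dots> = 0" by (rule z[OF yin])
    finally have "0 = (\<Sum>\<alpha>\<in>?A0. a \<alpha> * bmon C c \<alpha> y)" by simp
    also have "\<dots> = (\<Sum>\<alpha>\<in>?A0. a \<alpha> * bmon C c \<alpha> x / s ^ r)"
    proof (rule sum.cong[OF refl])
      fix \<alpha> assume a: "\<alpha> \<in> ?A0"
      have "bmon C c \<alpha> y = (\<Prod>w\<in>c - {v}. (?b w / s) ^ \<alpha> w)"
        unfolding bm0[OF a] by (rule prod.cong) (use yb c in auto)
      also have "\<dots> = bmon C c \<alpha> x / s ^ r"
        by (simp add: bm0[OF a] power_divide prod_dividef deg[OF a] flip: power_sum)
      finally show "a \<alpha> * bmon C c \<alpha> y = a \<alpha> * bmon C c \<alpha> x / s ^ r" by simp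
    qed
    finally show ?thesis using s by (simp flip: sum_divide_distrib)
  qed
  moreover have "(\<Sum>\<alpha>\<in>A. a \<alpha> * bmon C c \<alpha> x) =
      (\<Sum>\<alpha>\<in>?A0. a \<alpha> * bmon C c \<alpha> x) + (\<Sum>\<alpha>\<in>{\<alpha>\<in>A. \<alpha> v > 0}. a \<alpha> * bmon C c \<alpha> x)"
    using fin by (subst sum.union_disjoint[symmetric]) (auto intro: sum.cong)
  ultimately show ?thesis by simp
qed

text \<open>After \<open>bary_drop_vertex\<close> has been applied to every vertex of
  \<open>c\<close>, each surviving monomial contains all coordinates of \<open>c\<close>. Either
  \<open>r\<close> is too small for that, or their product factors out; the remaining degree
  \<open>r - card c\<close> is exactly that of the test polynomials, as \<open>card c\<close> is the
  dimension plus one.\<close>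

lemma polyP_face_factor:
  assumes C: "simplex_verts C" and c: "c \<subseteq> C" and r: "r \<ge> 1" and p: "p \<in> polyP r"
    and z: "\<And>v x. v \<in> c \<Longrightarrow> x \<in> convex hull (c - {v}) \<Longrightarrow> p x = 0"
  obtains "r < card c" "\<And>x. x \<in> convex hull c \<Longrightarrow> p x = 0"
  | q where "card c \<le> r" "q \<in> polyP (r - card c)"
    "\<And>x. x \<in> convex hull c \<Longrightarrow> p x = (\<Prod>v\<in>c. bary C x v) * q x"
proof -
  have fC: "finite C" "finite c" using simplex_verts_finite[OF C] c finite_subset by auto
  obtain a where a: "p = (\<Sum>\<alpha>\<in>bidx C r. a \<alpha> *\<^sub>R bmon C C \<alpha>)"
    using polyP_homogeneous[OF C p] unfolding span_image_explicit[OF finite_bidx[OF fC(1)]] by auto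
  have sub: "bidx c r \<subseteq> bidx C r"
    using c fC by (auto simp: bidx_def sum.mono_neutral_left[OF fC(1) c])
  have bm: "bmon C C \<alpha> x = bmon C c \<alpha> x" if "\<alpha> \<in> bidx c r" for \<alpha> x
    using that c fC unfolding bmon_def by (intro prod.mono_neutral_right) (auto simp: bidx_def)
  have bm0: "bmon C C \<alpha> x = 0" if "\<alpha> \<in> bidx C r - bidx c r" "x \<in> convex hull c" for \<alpha> x
  proof -
    have "\<exists>v\<in>C - c. \<alpha> v \<noteq> 0"
    proof (rule ccontr)
      assume "\<not> ?thesis"
      then have "\<forall>v\<in>C - c. \<alpha> v = 0" by auto
      then have "sum \<alpha> c = sum \<alpha> C" by (intro sum.mono_neutral_left fC c)
      then have "\<alpha> \<in> bidx c r"
        using that(1) \<open>\<forall>v\<in>C - c. \<alpha> v = 0\<close> unfolding bidx_def by fastforce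
      then show False using that(1) by simp
    qed
    then show ?thesis using in_face_iff[OF C c, of x] that(2) fC by (auto simp: bmon_def)
  qed
  have p1: "p x = (\<Sum>\<alpha>\<in>bidx c r. a \<alpha> * bmon C c \<alpha> x)" if "x \<in> convex hull c" for x
  proof -
    have "p x = (\<Sum>\<alpha>\<in>bidx C r. a \<alpha> * bmon C C \<alpha> x)" by (simp add: a fun_sum_apply)
    also have "\<dots> = (\<Sum>\<alpha>\<in>bidx c r. a \<alpha> * bmon C C \<alpha> x)"
      by (rule sum.mono_neutral_right[OF finite_bidx[OF fC(1)] sub]) (use bm0 that in auto)
    finally show ?thesis by (simp add: bm)
  qed
  have p2: "\<forall>x\<in>convex hull c. p x = (\<Sum>\<alpha>\<in>{\<alpha>\<in>bidx c r. \<forall>v\<in>d. \<alpha> v > 0}. a \<alpha> * bmon C c \<alpha> x)"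
    if "finite d" "d \<subseteq> c" for d
    using that
  proof (induction d rule: finite_induct)
    case (insert v d)
    then have IH: "\<And>x. x \<in> convex hull c \<Longrightarrow> p x = (\<Sum>\<alpha>\<in>{\<alpha>\<in>bidx c r. \<forall>v\<in>d. \<alpha> v > 0}. a \<alpha> * bmon C c \<alpha> x)"
      by auto
    have v: "v \<in> c" using insert by auto
    have m: "convex hull (c - {v}) \<subseteq> convex hull c" by (rule hull_mono) auto
    have e: "{\<alpha> \<in> {\<alpha>\<in>bidx c r. \<forall>v\<in>d. \<alpha> v > 0}. \<alpha> v > 0} = {\<alpha>\<in>bidx c r. \<forall>v\<in>insert v d. \<alpha> v > 0}" by auto
    show ?case
    proof
      fix x assume x: "x \<in> convex hull c"
      show "p x = (\<Sum>\<alpha>\<in>{\<alpha>\<in>bidx c r. \<forall>v\<in>insert v d. \<alpha> v > 0}. a \<alpha> * bmon C c \<alpha> x)"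
        unfolding IH[OF x] e[symmetric]
      proof (rule bary_drop_vertex[OF C c v r _ _ _ x])
        fix y assume y: "y \<in> convex hull (c - {v})"
        then have "y \<in> convex hull c" using m by auto
        from IH[OF this] show "(\<Sum>\<alpha>\<in>{\<alpha>\<in>bidx c r. \<forall>v\<in>d. \<alpha> v > 0}. a \<alpha> * bmon C c \<alpha> y) = 0"
          using z[OF v y] by simp
      qed (use finite_bidx[OF fC(2)] in auto)
    qed
  qed (use p1 in auto)
  let ?I = "{\<alpha>\<in>bidx c r. \<forall>v\<in>c. \<alpha> v > 0}"
  have p3: "p x = (\<Sum>\<alpha>\<in>?I. a \<alpha> * bmon C c \<alpha> x)" if "x \<in> convex hull c" for x
    using p2[OF fC(2)] that by auto
  have card: "card c \<le> r" if "\<alpha> \<in> ?I" for \<alpha>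
  proof -
    have "(\<Sum>v\<in>c. 1) \<le> sum \<alpha> c" by (rule sum_mono) (use that in \<open>auto simp: Suc_le_eq\<close>)
    then show ?thesis using that by (simp add: bidx_def)
  qed
  show ?thesis
  proof (cases "r < card c")
    case True
    then have e: "?I = {}" using card by fastforce
    have "p x = 0" if "x \<in> convex hull c" for x using p3[OF that] unfolding e by simp
    then show ?thesis using that(1)[OF True] by blast
  next
    case False
    define q where "q = (\<lambda>x. \<Sum>\<alpha>\<in>?I. a \<alpha> * (\<Prod>v\<in>c. bary C x v ^ (\<alpha> v - 1)))"
    have "(\<lambda>x. \<Prod>v\<in>c. bary C x v ^ (\<alpha> v - 1)) \<in> polyP (r - card c)" if "\<alpha> \<in> ?I" for \<alpha>
    proof -
      have "(\<lambda>x. \<Prod>v\<in>c. bary C x v ^ (\<alpha> v - 1)) \<in> polyP (\<Sum>v\<in>c. (\<alpha> v - 1) * Suc 0)"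
        by (intro polyP_prod polyP_power bary_polyP C fC) (use c in auto)
      moreover have "(\<Sum>v\<in>c. (\<alpha> v - 1) * Suc 0) = r - card c"
        using that by (simp add: sum_subtractf_nat Suc_le_eq bidx_def)
      ultimately show ?thesis by simp
    qed
    then have "q \<in> polyP (r - card c)" unfolding q_def by (intro polyP_sum polyP_cmult) auto
    moreover have "p x = (\<Prod>v\<in>c. bary C x v) * q x" if "x \<in> convex hull c" for x
    proof -
      have "bmon C c \<alpha> x = (\<Prod>v\<in>c. bary C x v) * (\<Prod>v\<in>c. bary C x v ^ (\<alpha> v - 1))" if "\<alpha> \<in> ?I" for \<alpha>
        unfolding bmon_def prod.distrib[symmetric]
        by (rule prod.cong) (use that in \<open>auto simp flip: power_Suc\<close>)
      then show ?thesis unfolding p3[OF that] q_def by (simp add: sum_distrib_left mult_ac)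
    qed
    ultimately show ?thesis using that(2) False by auto
  qed
qed

section \<open>Integration: definiteness of face integrals, and the divergence theorem without
  surface measure\<close>

section \<open>The surface measure of a convex body\<close>

lemma subspace_tangent_space: "subspace (tangent_space f)"
  by (simp add: tangent_space_def)

lemma tangent_space_diff: "x \<in> f \<Longrightarrow> y \<in> f \<Longrightarrow> x - y \<in> tangent_space f"
  unfolding tangent_space_def by (rule span_base) auto

lemma tangent_space_alt:
  assumes "a \<in> f"
  shows "tangent_space f = span ((\<lambda>x. x - a) ` f)"
proof
  show "span ((\<lambda>x. x - a) ` f) \<subseteq> tangent_space f"
    unfolding tangent_space_def by (rule span_mono) (use assms in auto)
  have "{x - y | x y. x \<in> f \<and> y \<in> f} \<subseteq> span ((\<lambda>x. x - a) ` f)"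
  proof safe
    fix x y assume "x \<in> f" "y \<in> f"
    then have "(x - a) - (y - a) \<in> span ((\<lambda>x. x - a) ` f)"
      by (intro span_diff span_base) auto
    then show "x - y \<in> span ((\<lambda>x. x - a) ` f)" by simp
  qed
  then show "tangent_space f \<subseteq> span ((\<lambda>x. x - a) ` f)"
    unfolding tangent_space_def by (rule span_minimal) simp
qed

lemma dim_tangent_space:
  assumes "f \<noteq> {}"
  shows "int (dim (tangent_space f)) = aff_dim f"
proof -
  obtain a where a: "a \<in> f" using assms by auto
  have "aff_dim f = int (dim ((\<lambda>x. - a + x) ` f))"
    using aff_dim_eq_dim[of a f] a by (simp add: hull_inc)
  moreover have "(\<lambda>x. - a + x) ` f = (\<lambda>x. x - a) ` f" by auto
  ultimately show ?thesis by (simp add: tangent_space_alt[OF a])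
qed

lemma ortho_frame_exists:
  assumes "f \<noteq> {}"
  shows "\<exists>pu. ortho_frame f pu"
proof -
  obtain a where a: "a \<in> f" using assms by auto
  let ?l = "nat (aff_dim f)"
  obtain B where B: "B \<subseteq> tangent_space f" "pairwise orthogonal B" "\<And>x. x \<in> B \<Longrightarrow> norm x = 1"
    "independent B" "card B = dim (tangent_space f)" "span B = tangent_space f"
    using orthonormal_basis_subspace[OF subspace_tangent_space] by metis
  have "card B = ?l" using B(5) dim_tangent_space[OF assms] by (metis nat_int)
  then obtain u where u: "bij_betw u {1..?l} B"
    using ex_bij_betw_nat_finite_1[of B] independent_imp_finite[OF B(4)] by auto
  have "u i \<in> B" if "i \<in> {1..?l}" for i using u that by (auto simp: bij_betw_def)
  moreover have "u i \<bullet> u j = 0" if "i \<in> {1..?l}" "j \<in> {1..?l}" "i \<noteq> j" for i j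
  proof -
    have "u i \<noteq> u j" using u that by (auto simp: bij_betw_def dest: inj_onD)
    then show ?thesis using B(2) that calculation by (auto simp: pairwise_def orthogonal_def)
  qed
  ultimately have "ortho_frame f (a, u)"
    using a B(1,3) by (fastforce simp: ortho_frame_def norm_eq_1)
  then show ?thesis by blast
qed

lemma ortho_frame_expand:
  assumes f: "ortho_frame f (p, u)" and x: "x \<in> tangent_space f"
  shows "x = (\<Sum>i=1..nat (aff_dim f). (x \<bullet> u i) *\<^sub>R u i)"
proof -
  let ?l = "nat (aff_dim f)" and ?U = "u ` {1..nat (aff_dim f)}"
  have p: "p \<in> f" and ut: "\<And>i. i \<in> {1..?l} \<Longrightarrow> u i \<in> tangent_space f"
    and uu: "\<And>i j. i \<in> {1..?l} \<Longrightarrow> j \<in> {1..?l} \<Longrightarrow> u i \<bullet> u j = (if i = j then 1 else 0)"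
    using f by (auto simp: ortho_frame_def)
  have inj: "inj_on u {1..?l}" by (rule inj_onI) (metis uu zero_neq_one)
  have ind: "independent ?U"
  proof (rule pairwise_orthogonal_independent)
    show "pairwise orthogonal ?U" using uu by (auto simp: pairwise_def orthogonal_def)
    show "0 \<notin> ?U" using uu by force
  qed
  have "tangent_space f \<subseteq> span ?U"
  proof (rule card_ge_dim_independent[OF _ ind])
    show "?U \<subseteq> tangent_space f" using ut by auto
    have "dim (tangent_space f) = ?l" using dim_tangent_space[of f] p by (metis empty_iff nat_int)
    then show "dim (tangent_space f) \<le> card ?U" by (simp add: card_image[OF inj, simplified])
  qed
  then have "x \<in> span ?U" using x by auto
  then show ?thesis
  proof (induction rule: span_induct_alt)
    case (step c y z)
    then obtain j where j: "j \<in> {1..?l}" "y = u j" by auto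
    have "(\<Sum>i=1..?l. (y \<bullet> u i) *\<^sub>R u i) = (\<Sum>i=1..?l. if i = j then u i else 0)"
      by (rule sum.cong) (use uu j in auto)
    then have "(\<Sum>i=1..?l. (y \<bullet> u i) *\<^sub>R u i) = y" using j by simp
    moreover have "(\<Sum>i=1..?l. ((c *\<^sub>R y + z) \<bullet> u i) *\<^sub>R u i) =
        c *\<^sub>R (\<Sum>i=1..?l. (y \<bullet> u i) *\<^sub>R u i) + (\<Sum>i=1..?l. (z \<bullet> u i) *\<^sub>R u i)"
      by (simp add: inner_add_left scaleR_add_left sum.distrib scaleR_sum_right)
    ultimately show ?case using step(2) by metis
  qed simp
qed

context
  fixes f :: "'n::finite Rn set"
  assumes f: "convex f" "compact f" "f \<noteq> {}"
begin

lemma surface_frame: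
  obtains p u where "ortho_frame f (p, u)"
    "surface_measure f = distr (Pi\<^sub>M {1..nat (aff_dim f)} (\<lambda>_. lborel)) borel
      (\<lambda>y. p + (\<Sum>i=1..nat (aff_dim f). y i *\<^sub>R u i))"
proof -
  obtain p u where pu: "(SOME pu. ortho_frame f pu) = (p, u)" by fastforce
  then have "ortho_frame f (p, u)" using someI_ex[OF ortho_frame_exists[OF f(3)]] by simp
  then show ?thesis using that pu by (simp add: surface_measure_def Let_def)
qed

lemma chart_measurable:
  "(\<lambda>y. p + (\<Sum>i=1..l. y i *\<^sub>R u i)) \<in> Pi\<^sub>M {1..l} (\<lambda>_. lborel) \<rightarrow>\<^sub>M (borel :: 'n Rn measure)"
  by measurable

text \<open>In an orthonormal chart the parameters of a point are its inner products with the frame,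
  so the preimage of the bounded set \<open>f\<close> lies in a cube of finite measure.\<close>

lemma surface_set_integrable:
  fixes h :: "'n Rn \<Rightarrow> real"
  assumes h: "continuous_on f h"
  shows "set_integrable (surface_measure f) f h"
proof -
  obtain p u where pu: "ortho_frame f (p, u)" and sm:
    "surface_measure f = distr (Pi\<^sub>M {1..nat (aff_dim f)} (\<lambda>_. lborel)) borel
      (\<lambda>y. p + (\<Sum>i=1..nat (aff_dim f). y i *\<^sub>R u i))" by (rule surface_frame)
  define l where "l = nat (aff_dim f)"
  let ?M = "Pi\<^sub>M {1..l} (\<lambda>_. lborel :: real measure)" and ?\<phi> = "\<lambda>y. p + (\<Sum>i=1..l. y i *\<^sub>R u i)"
  interpret product_sigma_finite "\<lambda>_ :: nat. lborel :: real measure" ..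
  have fs: "f \<in> sets borel" using f(2) by (simp add: borel_compact)
  have hm: "(\<lambda>x. indicator f x *\<^sub>R h x) \<in> borel_measurable borel"
    by (rule borel_measurable_continuous_on_indicator[OF fs h])
  obtain K where K: "\<And>x. x \<in> f \<Longrightarrow> \<bar>h x\<bar> \<le> K"
    using compact_imp_bounded[OF compact_continuous_image[OF h f(2)]] by (auto simp: bounded_iff)
  obtain R where R: "\<And>x. x \<in> f \<Longrightarrow> norm (x - p) \<le> R"
    using compact_imp_bounded[OF f(2)] bounded_translation[of f "- p"] by (auto simp: bounded_iff)
  let ?B = "PiE {1..l} (\<lambda>_. {-R..R})"
  have uu: "\<And>i j. i \<in> {1..l} \<Longrightarrow> j \<in> {1..l} \<Longrightarrow> u i \<bullet> u j = (if i = j then 1 else 0)"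
    using pu by (auto simp: ortho_frame_def l_def)
  have inB: "y \<in> ?B" if y: "y \<in> space ?M" "?\<phi> y \<in> f" for y
  proof -
    have "y i \<in> {-R..R}" if i: "i \<in> {1..l}" for i
    proof -
      have "(?\<phi> y - p) \<bullet> u i = (\<Sum>j=1..l. y j * (u j \<bullet> u i))" by (simp add: inner_sum_left)
      also have "\<dots> = (\<Sum>j=1..l. if j = i then y j else 0)"
        by (rule sum.cong) (use uu i in auto)
      also have "\<dots> = y i" using i by simp
      finally have "\<bar>y i\<bar> \<le> norm (?\<phi> y - p) * norm (u i)" using Cauchy_Schwarz_ineq2 by metis
      also have "norm (u i) = 1" using uu[OF i i] by (simp add: norm_eq_1)
      finally have "\<bar>y i\<bar> \<le> R" using R[OF y(2)] by simp
      then show ?thesis by auto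
    qed
    then show ?thesis using y(1) by (auto simp: space_PiM PiE_def)
  qed
  have "integrable ?M (\<lambda>y. indicator f (?\<phi> y) *\<^sub>R h (?\<phi> y))"
  proof (rule integrableI_bounded_set)
    show "?B \<in> sets ?M" by (intro sets_PiM_I_finite) auto
    show "emeasure ?M ?B < \<infinity>" by (subst emeasure_PiM) (auto simp: emeasure_lborel_Icc_eq power_less_top_ennreal)
    show "(\<lambda>y. indicator f (?\<phi> y) *\<^sub>R h (?\<phi> y)) \<in> borel_measurable ?M"
      using measurable_compose[OF chart_measurable hm] .
    show "AE y\<in>?B in ?M. norm (indicator f (?\<phi> y) *\<^sub>R h (?\<phi> y)) \<le> \<bar>K\<bar>"
      using K by (intro AE_I2) (fastforce simp: indicator_def)
    show "AE y in ?M. y \<notin> ?B \<longrightarrow> indicator f (?\<phi> y) *\<^sub>R h (?\<phi> y) = 0"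
      using inB by (intro AE_I2) (auto simp: indicator_def)
  qed
  then show ?thesis
    unfolding set_integrable_def sm l_def[symmetric]
    by (subst integrable_distr_eq[OF chart_measurable hm])
qed

text \<open>A point of positivity may sit on the relative boundary, where no full chart
  neighbourhood stays in \<open>f\<close>. By continuity it can be replaced by a nearby point
  \<open>x0\<close> of the relative interior, and a small cube of parameters around
  \<open>x0\<close> has positive measure.\<close>

lemma surface_integral_eq_0:
  fixes h :: "'n Rn \<Rightarrow> real"
  assumes h: "continuous_on f h" and nonneg: "\<And>x. x \<in> f \<Longrightarrow> h x \<ge> 0"
    and z: "(LINT x:f|surface_measure f. h x) = 0" and x: "x \<in> f"
  shows "h x = 0"
proof (rule ccontr)
  assume nz: "h x \<noteq> 0"
  then have pos: "h x > 0" using nonneg[OF x] by simp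
  obtain p u where pu: "ortho_frame f (p, u)" and sm:
    "surface_measure f = distr (Pi\<^sub>M {1..nat (aff_dim f)} (\<lambda>_. lborel)) borel
      (\<lambda>y. p + (\<Sum>i=1..nat (aff_dim f). y i *\<^sub>R u i))" by (rule surface_frame)
  define l where "l = nat (aff_dim f)"
  let ?M = "Pi\<^sub>M {1..l} (\<lambda>_. lborel :: real measure)" and ?\<phi> = "\<lambda>y. p + (\<Sum>i=1..l. y i *\<^sub>R u i)"
  interpret product_sigma_finite "\<lambda>_ :: nat. lborel :: real measure" ..
  have p: "p \<in> f" and ut: "\<And>i. i \<in> {1..l} \<Longrightarrow> u i \<in> tangent_space f"
    and uu: "\<And>i j. i \<in> {1..l} \<Longrightarrow> j \<in> {1..l} \<Longrightarrow> u i \<bullet> u j = (if i = j then 1 else 0)"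
    using pu by (auto simp: ortho_frame_def l_def)
  have fs: "f \<in> sets borel" using f(2) by (simp add: borel_compact)
  have hm: "(\<lambda>x. indicator f x *\<^sub>R h x) \<in> borel_measurable borel"
    by (rule borel_measurable_continuous_on_indicator[OF fs h])
  have cm: "(\<lambda>y. indicator f (?\<phi> y) *\<^sub>R h (?\<phi> y)) \<in> borel_measurable ?M"
    using measurable_compose[OF chart_measurable hm] .
  have int: "integrable ?M (\<lambda>y. indicator f (?\<phi> y) *\<^sub>R h (?\<phi> y))"
    using surface_set_integrable[OF h] unfolding set_integrable_def sm l_def[symmetric]
    by (subst (asm) integrable_distr_eq[OF chart_measurable hm])
  have "(\<integral>y. indicator f (?\<phi> y) *\<^sub>R h (?\<phi> y) \<partial>?M) = 0"
    using z unfolding set_lebesgue_integral_def sm l_def[symmetric]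
    by (subst (asm) integral_distr[OF chart_measurable hm])
  then have AE0: "AE y in ?M. indicator f (?\<phi> y) *\<^sub>R h (?\<phi> y) = 0"
    using integral_nonneg_eq_0_iff_AE[OF int] nonneg by (auto simp: indicator_def)
  have "x \<in> closure (rel_interior f)" using x f(1) convex_closure_rel_interior closure_subset by blast
  obtain d where d: "d > 0" "\<And>y. y \<in> f \<Longrightarrow> dist y x < d \<Longrightarrow> dist (h y) (h x) < h x"
    using h x pos unfolding continuous_on_iff by metis
  obtain x0 where x0: "x0 \<in> rel_interior f" "dist x0 x < d"
    using \<open>x \<in> closure (rel_interior f)\<close> d(1) by (auto simp: closure_approachable)
  have x0f: "x0 \<in> f" using x0 rel_interior_subset by blast
  have h0: "h x0 > 0" using d(2)[OF x0f x0(2)] pos by (auto simp: dist_real_def)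
  obtain d1 where d1: "d1 > 0" "\<And>y. y \<in> f \<Longrightarrow> dist y x0 < d1 \<Longrightarrow> dist (h y) (h x0) < h x0"
    using h x0f h0 unfolding continuous_on_iff by metis
  obtain d2 where d2: "d2 > 0" "ball x0 d2 \<inter> affine hull f \<subseteq> f"
    using x0(1) by (auto simp: mem_rel_interior_ball)
  \<comment> \<open>Dividing by \<open>l + 1\<close> keeps the sum of \<open>l\<close> coordinate
    deviations strictly below \<open>min d1 d2\<close>, also for \<open>l = 0\<close>.\<close>
  define e where "e = min d1 d2 / (real l + 1)"
  have e: "e > 0" using d1 d2 by (simp add: e_def)
  let ?y0 = "\<lambda>i. (x0 - p) \<bullet> u i"
  let ?B = "PiE {1..l} (\<lambda>i. {?y0 i - e<..<?y0 i + e})"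
  have B: "?\<phi> y \<in> f \<and> h (?\<phi> y) > 0" if y: "y \<in> ?B" for y
  proof -
    have hx: "x0 - p = (\<Sum>i=1..l. ?y0 i *\<^sub>R u i)"
      using ortho_frame_expand[OF pu tangent_space_diff[OF x0f p]] by (simp add: l_def)
    have "?\<phi> y - x0 = (\<Sum>i=1..l. y i *\<^sub>R u i) - (x0 - p)" by simp
    also have "\<dots> = (\<Sum>i=1..l. y i *\<^sub>R u i) - (\<Sum>i=1..l. ?y0 i *\<^sub>R u i)"
      using hx by (rule arg_cong)
    finally have eq: "?\<phi> y - x0 = (\<Sum>i=1..l. (y i - ?y0 i) *\<^sub>R u i)"
      by (simp only: scaleR_diff_left sum_subtractf)
    have "norm (?\<phi> y - x0) \<le> (\<Sum>i=1..l. \<bar>y i - ?y0 i\<bar>)"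
      unfolding eq by (rule order_trans[OF norm_sum]) (use uu in \<open>auto intro!: sum_mono simp: norm_eq_1[symmetric] norm_eq_sqrt_inner\<close>)
    also have "\<dots> \<le> (\<Sum>i=1..l. e)" by (rule sum_mono) (use y in \<open>fastforce simp: PiE_def Pi_def abs_le_iff\<close>)
    also have "\<dots> < e * (real l + 1)" using e by (simp add: algebra_simps)
    also have "\<dots> = min d1 d2" by (simp add: e_def)
    finally have dist: "dist (?\<phi> y) x0 < d1" "dist (?\<phi> y) x0 < d2" by (auto simp: dist_norm)
    have "?\<phi> y - x0 \<in> tangent_space f"
      unfolding eq by (intro subspace_sum subspace_scale subspace_tangent_space ut)
    then have "?\<phi> y - x0 \<in> span ((\<lambda>x. x - x0) ` f)" using tangent_space_alt[OF x0f] by simp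
    moreover have "x0 + z \<in> affine hull f" if "z \<in> span ((\<lambda>x. x - x0) ` f)" for z
      unfolding affine_hull_span_gen[OF hull_inc[OF x0f]] using that by simp
    ultimately have "x0 + (?\<phi> y - x0) \<in> affine hull f" by blast
    then have "?\<phi> y \<in> f" using d2 dist(2) by (auto simp: dist_commute)
    moreover have "h (?\<phi> y) > 0" using d1(2)[OF calculation dist(1)] h0 by (auto simp: dist_real_def)
    ultimately show ?thesis by simp
  qed
  have "AE y in ?M. y \<notin> ?B"
    using AE0 by eventually_elim (use B in \<open>force simp: indicator_def\<close>)
  moreover have Bs: "?B \<in> sets ?M" by (intro sets_PiM_I_finite) auto
  ultimately have "?B \<in> null_sets ?M" by (subst AE_iff_null_sets) auto
  then have "emeasure ?M ?B = 0" by (rule null_setsD1)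
  moreover have "emeasure ?M ?B = (\<Prod>i\<in>{1..l}. emeasure lborel {?y0 i - e<..<?y0 i + e})"
    by (rule emeasure_PiM) auto
  ultimately show False using e by (auto simp: ennreal_eq_0_iff)
qed

end

section \<open>Averaging along lines\<close>

lemma integrable_bounded_support:
  fixes f :: "'a::euclidean_space \<Rightarrow> real"
  assumes m: "f \<in> borel_measurable borel" and K: "\<And>x. \<bar>f x\<bar> \<le> K" and R: "\<And>x. norm x > R \<Longrightarrow> f x = 0"
  shows "integrable lborel f"
proof (rule integrableI_bounded_set[where A = "cball 0 R" and B = K])
  show "emeasure lborel (cball (0::'a) R) < \<infinity>" using emeasure_bounded_finite[OF bounded_cball] by simp
qed (use assms in \<open>auto intro!: AE_I2\<close>)

text \<open>A weight of total mass 1 across parallel hyperplanes. Slab integrals with this weight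
  stand in for integration over a hyperplane, so that no coordinates adapted to its normal have to
  be chosen.\<close>

definition unit_ind :: "real \<Rightarrow> real"
  where "unit_ind t = (if 0 \<le> t \<and> t \<le> 1 then 1 else 0)"

lemma unit_ind_measurable [measurable]: "unit_ind \<in> borel_measurable borel"
  unfolding unit_ind_def[abs_def] by measurable

lemma unit_ind_bound: "0 \<le> unit_ind t" "unit_ind t \<le> 1"
  by (auto simp: unit_ind_def)

lemma integral_unit_ind: "(\<integral>s. unit_ind (a - s) \<partial>lborel) = 1"
proof -
  have "unit_ind (a - s) = indicator {a - 1..a} s" for s
    by (auto simp: unit_ind_def indicator_def)
  then show ?thesis by simp
qed

lemma integral_translate:
  fixes f :: "'a::euclidean_space \<Rightarrow> real"
  assumes [measurable]: "f \<in> borel_measurable borel"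
  shows "(\<integral>x. f (a + x) \<partial>lborel) = (\<integral>x. f x \<partial>lborel)"
proof -
  have "(\<integral>x. f x \<partial>lborel) = (\<integral>x. f x \<partial>distr lborel borel ((+) a))" by (simp add: lborel_distr_plus)
  also have "\<dots> = (\<integral>x. f (a + x) \<partial>lborel)" by (rule integral_distr) auto
  finally show ?thesis by simp
qed

text \<open>Fubini along the direction \<open>e\<close> without a change of coordinates: the
  integral over the line through \<open>x\<close> is counted for all \<open>x\<close> in a unit
  slab, and translating back gives each point the total weight 1.\<close>

lemma integral_average_lines:
  fixes f :: "'a::euclidean_space \<Rightarrow> real"
  assumes m [measurable]: "f \<in> borel_measurable borel" and K: "\<And>x. \<bar>f x\<bar> \<le> K"
    and R: "\<And>x. norm x > R \<Longrightarrow> f x = 0" and e: "norm e = 1"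
  shows "(\<integral>x. f x \<partial>lborel) = (\<integral>x. unit_ind (e \<bullet> x) * (\<integral>s. f (x + s *\<^sub>R e) \<partial>lborel) \<partial>lborel)"
proof -
  have K0: "0 \<le> K" using K[of 0] by linarith
  have ee: "e \<bullet> e = 1" using e by (simp add: norm_eq_1)
  have es: "\<bar>e \<bullet> y\<bar> \<le> norm y" for y using Cauchy_Schwarz_ineq2[of e y] e by simp
  have bound: "\<bar>unit_ind t * f x\<bar> \<le> K" for t x
    using K[of x] K0 unit_ind_bound[of t] mult_mono[of "unit_ind t" 1 "\<bar>f x\<bar>" K] by (simp add: abs_mult)
  have int1: "integrable (lborel \<Otimes>\<^sub>M lborel) (case_prod (\<lambda>x s. unit_ind (e \<bullet> x) * f (x + s *\<^sub>R e)))"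
    unfolding lborel_prod
  proof (rule integrable_bounded_support)
    show "case_prod (\<lambda>x s. unit_ind (e \<bullet> x) * f (x + s *\<^sub>R e)) \<in> borel_measurable borel"
      unfolding borel_prod[symmetric] by measurable
    show "\<bar>case_prod (\<lambda>x s. unit_ind (e \<bullet> x) * f (x + s *\<^sub>R e)) z\<bar> \<le> K" for z
      using bound by (cases z) simp
    fix z :: "'a \<times> real"
    \<comment> \<open>On the support, \<open>e \<bullet> x\<close> is in [0, 1] and
      \<open>x + s *\<^sub>R e\<close> has norm at most \<open>R\<close>; hence \<open>s\<close> is
      at most \<open>\<bar>R\<bar> + 1\<close> and \<open>x\<close> at most
      \<open>2 * \<bar>R\<bar> + 1\<close> in norm.\<close>
    assume z: "norm z > 2 * \<bar>R\<bar> + 3 + \<bar>R\<bar>"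
    obtain x s where zz: "z = (x, s)" by fastforce
    show "case_prod (\<lambda>x s. unit_ind (e \<bullet> x) * f (x + s *\<^sub>R e)) z = 0"
    proof (rule ccontr)
      assume "\<not> ?thesis"
      then have 1: "0 \<le> e \<bullet> x" "e \<bullet> x \<le> 1" and 2: "norm (x + s *\<^sub>R e) \<le> R"
        using R[of "x + s *\<^sub>R e"] by (auto simp: zz unit_ind_def not_less[symmetric] split: if_splits)
      have "\<bar>e \<bullet> (x + s *\<^sub>R e)\<bar> \<le> R" using es[of "x + s *\<^sub>R e"] 2 by linarith
      then have s: "\<bar>s\<bar> \<le> \<bar>R\<bar> + 1" using 1 by (simp add: inner_add_right ee)
      have "norm x \<le> norm (x + s *\<^sub>R e) + norm (s *\<^sub>R e)"
        using norm_triangle_ineq4[of "x + s *\<^sub>R e" "s *\<^sub>R e"] by simp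
      then have "norm x \<le> \<bar>R\<bar> + (\<bar>R\<bar> + 1)" using 2 s e by simp
      moreover have "norm z \<le> norm x + norm s" unfolding zz by (rule norm_Pair_le)
      ultimately show False using s z by simp
    qed
  qed
  have int2: "integrable (lborel \<Otimes>\<^sub>M lborel) (case_prod (\<lambda>x s. unit_ind (e \<bullet> x - s) * f x))"
    unfolding lborel_prod
  proof (rule integrable_bounded_support)
    show "case_prod (\<lambda>x s. unit_ind (e \<bullet> x - s) * f x) \<in> borel_measurable borel"
      unfolding borel_prod[symmetric] by measurable
    show "\<bar>case_prod (\<lambda>x s. unit_ind (e \<bullet> x - s) * f x) z\<bar> \<le> K" for z
      using bound by (cases z) simp
    fix z :: "'a \<times> real"
    assume z: "norm z > 2 * \<bar>R\<bar> + 3"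
    obtain x s where zz: "z = (x, s)" by fastforce
    show "case_prod (\<lambda>x s. unit_ind (e \<bullet> x - s) * f x) z = 0"
    proof (rule ccontr)
      assume "\<not> ?thesis"
      then have 1: "0 \<le> e \<bullet> x - s" "e \<bullet> x - s \<le> 1" and 2: "norm x \<le> R"
        using R[of x] by (auto simp: zz unit_ind_def not_less[symmetric] split: if_splits)
      have "\<bar>e \<bullet> x\<bar> \<le> R" using es[of x] 2 by linarith
      then have "\<bar>s\<bar> \<le> R + 1" using 1 by linarith
      moreover have "norm z \<le> norm x + norm s" unfolding zz by (rule norm_Pair_le)
      ultimately show False using 2 z by simp
    qed
  qed
  have "(\<integral>x. unit_ind (e \<bullet> x) * (\<integral>s. f (x + s *\<^sub>R e) \<partial>lborel) \<partial>lborel) =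
      (\<integral>x. (\<integral>s. unit_ind (e \<bullet> x) * f (x + s *\<^sub>R e) \<partial>lborel) \<partial>lborel)" by simp
  also have "\<dots> = (\<integral>s. (\<integral>x. unit_ind (e \<bullet> x) * f (x + s *\<^sub>R e) \<partial>lborel) \<partial>lborel)"
    using lborel_pair.Fubini_integral[OF int1] by simp
  also have "\<dots> = (\<integral>s. (\<integral>x. unit_ind (e \<bullet> x - s) * f x \<partial>lborel) \<partial>lborel)"
  proof (rule Bochner_Integration.integral_cong[OF refl])
    fix s
    have "(\<integral>x. unit_ind (e \<bullet> x - s) * f x \<partial>lborel) =
        (\<integral>x. unit_ind (e \<bullet> (s *\<^sub>R e + x) - s) * f (s *\<^sub>R e + x) \<partial>lborel)"
      by (rule integral_translate[symmetric]) measurable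
    then show "(\<integral>x. unit_ind (e \<bullet> x) * f (x + s *\<^sub>R e) \<partial>lborel) = (\<integral>x. unit_ind (e \<bullet> x - s) * f x \<partial>lborel)"
      by (simp add: inner_add_right ee add.commute)
  qed
  also have "\<dots> = (\<integral>x. (\<integral>s. unit_ind (e \<bullet> x - s) * f x \<partial>lborel) \<partial>lborel)"
    using lborel_pair.Fubini_integral[OF int2] by simp
  also have "\<dots> = (\<integral>x. f x \<partial>lborel)" by (simp add: integral_unit_ind)
  finally show ?thesis by simp
qed

section \<open>The divergence theorem on a polyhedron\<close>

definition clamp01 :: "real \<Rightarrow> real"
  where "clamp01 t = max 0 (min 1 t)"

lemma clamp01_bound: "0 \<le> clamp01 t" "clamp01 t \<le> 1"
  by (auto simp: clamp01_def)

lemma clamp01_measurable [measurable]: "clamp01 \<in> borel_measurable borel"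
  unfolding clamp01_def[abs_def] by measurable

lemma clamp01_continuous: "continuous_on S clamp01"
  unfolding clamp01_def[abs_def] by (intro continuous_intros)

lemma clamp01_deriv:
  assumes "t \<noteq> 0" "t \<noteq> 1"
  shows "(clamp01 has_real_derivative (if 0 < t \<and> t < 1 then 1 else 0)) (at t)"
proof -
  consider "t < 0" | "0 < t" "t < 1" | "t > 1" using assms by linarith
  then show ?thesis
  proof cases
    case 1
    have "(clamp01 has_real_derivative 0) (at t)"
      by (rule has_field_derivative_transform_within_open[of "\<lambda>_. 0" _ _ "{..<0}"])
        (use 1 in \<open>auto simp: clamp01_def\<close>)
    then show ?thesis using 1 by simp
  next
    case 2
    have "(clamp01 has_real_derivative 1) (at t)"
      by (rule has_field_derivative_transform_within_open[of "\<lambda>t. t" _ _ "{0<..<1}"])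
        (use 2 in \<open>auto simp: clamp01_def\<close>)
    then show ?thesis using 2 by simp
  next
    case 3
    have "(clamp01 has_real_derivative 0) (at t)"
      by (rule has_field_derivative_transform_within_open[of "\<lambda>_. 1" _ _ "{1<..}"])
        (use 3 in \<open>auto simp: clamp01_def\<close>)
    then show ?thesis using 3 by simp
  qed
qed

lemma AE_hyperplane:
  fixes a :: "'a::euclidean_space"
  assumes "a \<noteq> 0"
  shows "AE x in lborel. a \<bullet> x \<noteq> b"
proof -
  have "{x. a \<bullet> x = b} \<in> null_sets lebesgue"
    using negligible_hyperplane[of a b] assms by (simp add: negligible_iff_null_sets)
  moreover have "{x. a \<bullet> x = b} \<in> sets lborel" by measurable
  ultimately have "{x. a \<bullet> x = b} \<in> null_sets lborel" by (simp add: null_sets_completion_iff)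
  then show ?thesis by (auto dest: AE_not_in)
qed

text \<open>The polyhedron is the intersection of the half-spaces
  \<open>\<nu> j \<bullet> x > c j\<close> with inward unit normals; it may be unbounded, since
  \<open>g\<close> has bounded support. As no two normals are parallel, almost every point of one
  bounding hyperplane avoids all the others, and at such points the cutoffs converge.\<close>

locale polyhedron_flux =
  fixes J :: "'i set" and \<nu> :: "'i \<Rightarrow> 'a::euclidean_space" and c :: "'i \<Rightarrow> real"
    and g :: "'a \<Rightarrow> real" and g' :: "'a \<Rightarrow> 'a" and R :: real
  assumes J: "finite J" and unit: "\<And>j. j \<in> J \<Longrightarrow> norm (\<nu> j) = 1"
    and nonparallel: "\<And>i j. i \<in> J \<Longrightarrow> j \<in> J \<Longrightarrow> i \<noteq> j \<Longrightarrow> \<nu> i \<noteq> (\<nu> i \<bullet> \<nu> j) *\<^sub>R \<nu> j"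
    and deriv: "\<And>x. (g has_derivative (\<lambda>h. g' x \<bullet> h)) (at x)"
    and cont: "continuous_on UNIV g'" and supp: "\<And>x. norm x > R \<Longrightarrow> g x = 0"
begin

definition d where "d j x = \<nu> j \<bullet> x - c j"
definition cutoff where "cutoff A \<epsilon> x = (\<Prod>i\<in>A. clamp01 (d i x / \<epsilon>))"
text \<open>The derivative of \<open>clamp01 (t / \<epsilon>)\<close> at \<open>t = d j x\<close>,
  away from the two kinks.\<close>

definition layer where "layer j \<epsilon> x = (if 0 < d j x \<and> d j x < \<epsilon> then 1 / \<epsilon> else (0::real))"

lemma d_measurable [measurable]: "d j \<in> borel_measurable borel"
  unfolding d_def[abs_def] by measurable

lemma cutoff_measurable [measurable]: "cutoff A \<epsilon> \<in> borel_measurable borel"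
  unfolding cutoff_def[abs_def] by measurable

lemma layer_measurable [measurable]: "layer j \<epsilon> \<in> borel_measurable borel"
  unfolding layer_def[abs_def] by measurable

lemma g_cont: "continuous_on S g"
  by (meson deriv has_derivative_continuous continuous_at_imp_continuous_on)

lemma g_measurable [measurable]: "g \<in> borel_measurable borel"
  by (rule borel_measurable_continuous_onI[OF g_cont])

lemma g'_measurable [measurable]: "g' \<in> borel_measurable borel"
  by (rule borel_measurable_continuous_onI[OF cont])

lemma g'_supp: "norm x > R \<Longrightarrow> g' x = 0"
proof -
  assume x: "norm x > R"
  have "open {x :: 'a. norm x > R}" by (intro open_Collect_less continuous_intros)
  then have "(g has_derivative (\<lambda>h. 0)) (at x)"
    using has_derivative_transform_within_open[OF has_derivative_const, of "{x. norm x > R}" x 0 g] x supp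
    by auto
  then have "(\<lambda>h. g' x \<bullet> h) = (\<lambda>h. 0)" by (rule has_derivative_unique[OF deriv])
  then have "g' x \<bullet> g' x = 0" by (rule fun_cong)
  then show ?thesis by simp
qed

lemma bounded_by_support:
  fixes h :: "'a \<Rightarrow> 'b::real_normed_vector"
  assumes h: "continuous_on UNIV h" "\<And>x. norm x > R \<Longrightarrow> h x = 0"
  obtains K where "K \<ge> 0" "\<And>x. norm (h x) \<le> K"
proof -
  have "bounded (h ` cball 0 R)"
    by (intro compact_imp_bounded compact_continuous_image continuous_on_subset[OF h(1)]) auto
  then obtain K where K: "\<And>x. x \<in> cball 0 R \<Longrightarrow> norm (h x) \<le> K"
    unfolding bounded_iff by blast
  have "norm (h x) \<le> max K 0" for x
    using K[of x] h(2)[of x] by (cases "norm x > R") auto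
  then show ?thesis using that[of "max K 0"] by simp
qed

lemma cutoff_bound: "0 \<le> cutoff A \<epsilon> x" "cutoff A \<epsilon> x \<le> 1"
  unfolding cutoff_def by (auto intro!: prod_nonneg prod_le_1 simp: clamp01_bound)

lemma layer_bound: "\<epsilon> > 0 \<Longrightarrow> 0 \<le> layer j \<epsilon> x \<and> layer j \<epsilon> x \<le> 1 / \<epsilon>"
  by (auto simp: layer_def)

text \<open>The derivative in direction \<open>e\<close> of \<open>g\<close> times the Lipschitz cutoff \<open>cutoff J \<epsilon>\<close> of the polyhedron.\<close>

definition D where "D e \<epsilon> x = (g' x \<bullet> e) * cutoff J \<epsilon> x +
   g x * (\<Sum>j\<in>J. (\<nu> j \<bullet> e) * layer j \<epsilon> x * cutoff (J - {j}) \<epsilon> x)"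

lemma D_measurable [measurable]: "D e \<epsilon> \<in> borel_measurable borel"
  unfolding D_def[abs_def] by measurable

lemma D_bound:
  assumes "\<epsilon> > 0"
  obtains K where "\<And>x. \<bar>D e \<epsilon> x\<bar> \<le> K"
proof -
  obtain K where K: "K \<ge> 0" "\<And>x. norm (g x) \<le> K" using bounded_by_support[OF g_cont supp] by metis
  obtain K' where K': "K' \<ge> 0" "\<And>x. norm (g' x) \<le> K'" using bounded_by_support[OF cont g'_supp] by metis
  have "\<bar>D e \<epsilon> x\<bar> \<le> K' * norm e * 1 + K * (\<Sum>j\<in>J. \<bar>\<nu> j \<bullet> e\<bar> * (1 / \<epsilon>) * 1)" for x
    unfolding D_def
  proof (rule order_trans[OF abs_triangle_ineq], rule add_mono)
    have "\<bar>g' x \<bullet> e\<bar> \<le> K' * norm e"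
      using Cauchy_Schwarz_ineq2[of "g' x" e] mult_right_mono[OF K'(2)[of x], of "norm e"] by simp
    then show "\<bar>g' x \<bullet> e * cutoff J \<epsilon> x\<bar> \<le> K' * norm e * 1"
      unfolding abs_mult using cutoff_bound K' by (intro mult_mono) auto
    have "\<bar>\<nu> j \<bullet> e * layer j \<epsilon> x * cutoff (J - {j}) \<epsilon> x\<bar> \<le> \<bar>\<nu> j \<bullet> e\<bar> * (1 / \<epsilon>) * 1" for j
      unfolding abs_mult using cutoff_bound layer_bound[OF assms] assms
      by (intro mult_mono) auto
    then have "\<bar>\<Sum>j\<in>J. \<nu> j \<bullet> e * layer j \<epsilon> x * cutoff (J - {j}) \<epsilon> x\<bar> \<le> (\<Sum>j\<in>J. \<bar>\<nu> j \<bullet> e\<bar> * (1 / \<epsilon>) * 1)"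
      by (intro order_trans[OF sum_abs] sum_mono)
    then show "\<bar>g x * (\<Sum>j\<in>J. \<nu> j \<bullet> e * layer j \<epsilon> x * cutoff (J - {j}) \<epsilon> x)\<bar>
        \<le> K * (\<Sum>j\<in>J. \<bar>\<nu> j \<bullet> e\<bar> * (1 / \<epsilon>) * 1)"
      unfolding abs_mult using K by (intro mult_mono) auto
  qed
  then show ?thesis using that by blast
qed

lemma D_supp: "norm x > R \<Longrightarrow> D e \<epsilon> x = 0"
  by (simp add: D_def supp g'_supp)

text \<open>The kinks at \<open>d j = 0\<close> and \<open>d j = \<epsilon>\<close> matter only for
  faces whose hyperplane the line crosses; if \<open>\<nu> j\<close> is orthogonal to
  \<open>e\<close>, the factor is constant along the line, in agreement with the coefficient
  \<open>\<nu> j \<bullet> e\<close>.\<close>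

lemma line_deriv:
  assumes \<epsilon>: "\<epsilon> > 0"
    and s: "\<And>j. j \<in> J \<Longrightarrow> \<nu> j \<bullet> e \<noteq> 0 \<Longrightarrow> d j (x + s *\<^sub>R e) \<noteq> 0 \<and> d j (x + s *\<^sub>R e) \<noteq> \<epsilon>"
  shows "((\<lambda>s. g (x + s *\<^sub>R e) * cutoff J \<epsilon> (x + s *\<^sub>R e)) has_real_derivative D e \<epsilon> (x + s *\<^sub>R e)) (at s)"
proof -
  have "((\<lambda>s. g (x + s *\<^sub>R e)) has_derivative (\<lambda>h. g' (x + s *\<^sub>R e) \<bullet> (h *\<^sub>R e))) (at s)"
    by (rule has_derivative_compose[OF _ deriv]) (auto intro!: derivative_eq_intros)
  then have 1: "((\<lambda>s. g (x + s *\<^sub>R e)) has_real_derivative g' (x + s *\<^sub>R e) \<bullet> e) (at s)"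
    by (simp add: has_field_derivative_def mult_commute_abs)
  have dl: "d j (x + s *\<^sub>R e) = d j x + s * (\<nu> j \<bullet> e)" for j s
    by (simp add: d_def inner_add_right)
  have f: "((\<lambda>s. clamp01 (d j (x + s *\<^sub>R e) / \<epsilon>)) has_real_derivative
      (\<nu> j \<bullet> e) * layer j \<epsilon> (x + s *\<^sub>R e)) (at s)" if j: "j \<in> J" for j
  proof (cases "\<nu> j \<bullet> e = 0")
    case False
    have a: "((\<lambda>s. d j (x + s *\<^sub>R e) / \<epsilon>) has_real_derivative (\<nu> j \<bullet> e) / \<epsilon>) (at s)"
      unfolding dl using \<epsilon> by (auto intro!: derivative_eq_intros)
    have "((\<lambda>s. clamp01 (d j (x + s *\<^sub>R e) / \<epsilon>)) has_real_derivative
      (if 0 < d j (x + s *\<^sub>R e) / \<epsilon> \<and> d j (x + s *\<^sub>R e) / \<epsilon> < 1 then 1 else 0) * ((\<nu> j \<bullet> e) / \<epsilon>)) (at s)"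
      by (rule DERIV_chain2[OF clamp01_deriv a]) (use s[OF j False] \<epsilon> in auto)
    moreover have "(if 0 < d j (x + s *\<^sub>R e) / \<epsilon> \<and> d j (x + s *\<^sub>R e) / \<epsilon> < 1 then 1 else 0) * ((\<nu> j \<bullet> e) / \<epsilon>) =
        (\<nu> j \<bullet> e) * layer j \<epsilon> (x + s *\<^sub>R e)"
      using \<epsilon> by (auto simp: layer_def zero_less_divide_iff divide_less_eq_1)
    ultimately show ?thesis by simp
  qed (simp add: dl)
  have 2: "((\<lambda>s. cutoff J \<epsilon> (x + s *\<^sub>R e)) has_real_derivative
      (\<Sum>j\<in>J. (\<nu> j \<bullet> e) * layer j \<epsilon> (x + s *\<^sub>R e) * cutoff (J - {j}) \<epsilon> (x + s *\<^sub>R e))) (at s)"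
    unfolding cutoff_def by (rule has_field_derivative_prod) (rule f)
  show ?thesis unfolding D_def
    using DERIV_mult[OF 1 2] by (simp add: algebra_simps)
qed

text \<open>Along each line of direction \<open>e\<close> the product of \<open>g\<close> and the
  cutoff is continuous, differentiable off finitely many kinks (unless it meets them trivially), and
  0 at both ends of a long interval. The fundamental theorem makes every line integral 0, and
  averaging over lines gives the volume integral.\<close>

lemma integral_D_eq_0:
  assumes \<epsilon>: "\<epsilon> > 0" and e: "norm e = 1"
  shows "(\<integral>x. D e \<epsilon> x \<partial>lborel) = 0"
proof -
  obtain K where K: "\<And>x. \<bar>D e \<epsilon> x\<bar> \<le> K" using D_bound[OF \<epsilon>] by blast
  have line: "(\<integral>s. D e \<epsilon> (x + s *\<^sub>R e) \<partial>lborel) = 0" for x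
  proof -
    let ?G = "\<lambda>s. g (x + s *\<^sub>R e) * cutoff J \<epsilon> (x + s *\<^sub>R e)" and ?D = "\<lambda>s. D e \<epsilon> (x + s *\<^sub>R e)"
    define M where "M = \<bar>R\<bar> + norm x + 1"
    have far: "norm (x + s *\<^sub>R e) > R" if "\<bar>s\<bar> \<ge> M" for s
    proof -
      have "norm (s *\<^sub>R e) \<le> norm (x + s *\<^sub>R e) + norm x"
        using norm_triangle_ineq4[of "x + s *\<^sub>R e" x] by simp
      then show ?thesis using that e by (simp add: M_def)
    qed
    let ?S = "\<Union>j\<in>{j\<in>J. \<nu> j \<bullet> e \<noteq> 0}. {- d j x / (\<nu> j \<bullet> e), (\<epsilon> - d j x) / (\<nu> j \<bullet> e)}"
    have "(?D has_integral (?G M - ?G (- M))) {- M..M}"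
    proof (rule fundamental_theorem_of_calculus_interior_strong)
      show "finite ?S" using J by auto
      show "- M \<le> M" by (simp add: M_def)
      show "(?G has_vector_derivative ?D s) (at s)" if s: "s \<in> {- M<..<M} - ?S" for s
      proof -
        have "d j (x + s *\<^sub>R e) \<noteq> 0 \<and> d j (x + s *\<^sub>R e) \<noteq> \<epsilon>" if j: "j \<in> J" "\<nu> j \<bullet> e \<noteq> 0" for j
        proof -
          have "s \<noteq> - d j x / (\<nu> j \<bullet> e)" "s \<noteq> (\<epsilon> - d j x) / (\<nu> j \<bullet> e)" using s j by auto
          moreover have "d j (x + s *\<^sub>R e) = d j x + s * (\<nu> j \<bullet> e)" by (simp add: d_def inner_add_right)
          ultimately show ?thesis using j(2) by (auto simp: field_simps)
        qed
        then show ?thesis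
          using line_deriv[OF \<epsilon>, of e x s] by (simp add: has_real_derivative_iff_has_vector_derivative)
      qed
      have "continuous_on UNIV (\<lambda>s. cutoff J \<epsilon> (x + s *\<^sub>R e))"
        unfolding cutoff_def d_def using \<epsilon>
        by (intro continuous_on_prod continuous_on_compose2[OF clamp01_continuous[of UNIV]] continuous_intros) auto
      moreover have "continuous_on UNIV (\<lambda>s. g (x + s *\<^sub>R e))"
        by (intro continuous_on_compose2[OF g_cont[of UNIV]] continuous_intros) auto
      ultimately show "continuous_on {- M..M} ?G"
        by (intro continuous_on_mult) (auto intro: continuous_on_subset)
    qed
    then have "(?D has_integral 0) {- M..M}" using far[of M] far[of "- M"] supp by (simp add: M_def)
    then have hi: "(?D has_integral 0) UNIV"
    proof (rule has_integral_on_superset)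
      show "?D s = 0" if "s \<notin> {- M..M}" for s using that by (intro D_supp far) auto
    qed simp
    have "integrable lborel ?D"
    proof (rule integrable_bounded_support[where K = K and R = M])
      show "?D s = 0" if "norm s > M" for s using that by (intro D_supp far) auto
    qed (use K in auto)
    from has_integral_integral_lborel[OF this] hi show ?thesis by (rule has_integral_unique)
  qed
  show ?thesis
    by (subst integral_average_lines[OF D_measurable K D_supp e]) (auto simp: line)
qed

definition proj where "proj j x = x - d j x *\<^sub>R \<nu> j"

lemma proj_measurable [measurable]: "proj j \<in> borel_measurable borel"
  unfolding proj_def[abs_def] by measurable

lemma layer_cutoff_bound:
  assumes "\<epsilon> > 0" "\<And>x. norm (g x) \<le> K" "K \<ge> 0"
  shows "\<bar>g x * (layer j \<epsilon> x * cutoff A \<epsilon> x)\<bar> \<le> K * (1 / \<epsilon> * 1)"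
  unfolding abs_mult using cutoff_bound layer_bound[OF assms(1)] assms by (intro mult_mono) auto

text \<open>The slab is placed along \<mu>, which may be the opposite of the inward normal
  \<open>\<nu> j\<close>. With a normal fixed per facet as \<mu>, the two simplices on either side
  of a facet obtain the same slab integral. In the inner integral the layer of thickness \<epsilon>
  is stretched to the unit interval, which absorbs its height \<open>1 / \<epsilon>\<close>.\<close>

lemma integral_layer:
  assumes \<epsilon>: "\<epsilon> > 0" and j: "j \<in> J" and \<sigma>: "\<sigma> = 1 \<or> \<sigma> = -1" and \<mu>: "\<nu> j = \<sigma> *\<^sub>R \<mu>"
  shows "(\<integral>x. g x * (layer j \<epsilon> x * cutoff A \<epsilon> x) \<partial>lborel) =
    (\<integral>x. unit_ind (\<mu> \<bullet> x) * (\<integral>\<tau>. indicator {0<..<1} \<tau> *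
      (g (proj j x + (\<epsilon> * \<tau>) *\<^sub>R \<nu> j) * cutoff A \<epsilon> (proj j x + (\<epsilon> * \<tau>) *\<^sub>R \<nu> j)) \<partial>lborel) \<partial>lborel)"
proof -
  obtain K where K: "K \<ge> 0" "\<And>x. norm (g x) \<le> K" using bounded_by_support[OF g_cont supp] by metis
  let ?f = "\<lambda>x. g x * (layer j \<epsilon> x * cutoff A \<epsilon> x)"
  have \<mu>1: "norm \<mu> = 1" using unit[OF j] \<sigma> by (auto simp: \<mu>)
  have m: "?f \<in> borel_measurable borel" by measurable
  have inner: "(\<integral>s. ?f (x + s *\<^sub>R \<mu>) \<partial>lborel) = (\<integral>\<tau>. indicator {0<..<1} \<tau> *
      (g (proj j x + (\<epsilon> * \<tau>) *\<^sub>R \<nu> j) * cutoff A \<epsilon> (proj j x + (\<epsilon> * \<tau>) *\<^sub>R \<nu> j)) \<partial>lborel)" for x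
  proof -
    have "(\<integral>s. ?f (x + s *\<^sub>R \<mu>) \<partial>lborel) =
        \<bar>\<sigma> * \<epsilon>\<bar> *\<^sub>R (\<integral>\<tau>. ?f (x + (- \<sigma> * d j x + (\<sigma> * \<epsilon>) * \<tau>) *\<^sub>R \<mu>) \<partial>lborel)"
      by (rule lborel_integral_real_affine) (use \<epsilon> \<sigma> in auto)
    also have "\<dots> = (\<integral>\<tau>. \<epsilon> * ?f (x + (- \<sigma> * d j x + (\<sigma> * \<epsilon>) * \<tau>) *\<^sub>R \<mu>) \<partial>lborel)"
      using \<epsilon> \<sigma> by (auto simp: abs_mult)
    also have "\<dots> = (\<integral>\<tau>. indicator {0<..<1} \<tau> *
      (g (proj j x + (\<epsilon> * \<tau>) *\<^sub>R \<nu> j) * cutoff A \<epsilon> (proj j x + (\<epsilon> * \<tau>) *\<^sub>R \<nu> j)) \<partial>lborel)"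
    proof (rule Bochner_Integration.integral_cong[OF refl])
      fix \<tau>
      have p: "x + (- \<sigma> * d j x + (\<sigma> * \<epsilon>) * \<tau>) *\<^sub>R \<mu> = proj j x + (\<epsilon> * \<tau>) *\<^sub>R \<nu> j"
        using \<sigma> by (auto simp: proj_def \<mu> algebra_simps)
      have "\<nu> j \<bullet> \<nu> j = 1" using unit[OF j] by (simp add: norm_eq_1)
      then have "d j (proj j x + (\<epsilon> * \<tau>) *\<^sub>R \<nu> j) = \<epsilon> * \<tau>"
        by (simp add: proj_def d_def inner_add_right inner_diff_right)
      then have "\<epsilon> * layer j \<epsilon> (proj j x + (\<epsilon> * \<tau>) *\<^sub>R \<nu> j) = indicator {0<..<1} \<tau>"
        using \<epsilon> by (auto simp: layer_def indicator_def zero_less_mult_iff)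
      then have l: "\<epsilon> * (g y * (layer j \<epsilon> y * z)) = indicator {0<..<1} \<tau> * (g y * z)"
        if "y = proj j x + (\<epsilon> * \<tau>) *\<^sub>R \<nu> j" for y z
        using that by (metis mult.assoc mult.left_commute)
      show "\<epsilon> * ?f (x + (- \<sigma> * d j x + (\<sigma> * \<epsilon>) * \<tau>) *\<^sub>R \<mu>) = indicator {0<..<1} \<tau> *
        (g (proj j x + (\<epsilon> * \<tau>) *\<^sub>R \<nu> j) * cutoff A \<epsilon> (proj j x + (\<epsilon> * \<tau>) *\<^sub>R \<nu> j))"
        unfolding p by (rule l) simp
    qed
    finally show ?thesis .
  qed
  have "(\<integral>x. ?f x \<partial>lborel) = (\<integral>x. unit_ind (\<mu> \<bullet> x) * (\<integral>s. ?f (x + s *\<^sub>R \<mu>) \<partial>lborel) \<partial>lborel)"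
    by (rule integral_average_lines[where R = R, OF m layer_cutoff_bound[OF \<epsilon> K(2,1)] _ \<mu>1]) (simp add: supp)
  then show ?thesis unfolding inner .
qed

abbreviation eps where "eps m \<equiv> inverse (real (Suc m))"

text \<open>The argument is \<open>a / eps m + b\<close>, so for nonzero \<open>a\<close> its sign
  decides; \<open>b\<close> accounts for the shift of the evaluation point inside the layer.\<close>

lemma clamp_limit:
  assumes "a \<noteq> 0 \<or> b = 0"
  shows "(\<lambda>m. clamp01 ((a + eps m * b) / eps m)) \<longlonglongrightarrow> (if 0 < a then 1 else 0)"
proof -
  have r: "(a + eps m * b) / eps m = real (Suc m) * a + b" for m
    by (simp add: field_simps)
  consider "a = 0" | "a > 0" | "a < 0" by linarith
  then have "\<forall>\<^sub>F m in sequentially. clamp01 (real (Suc m) * a + b) = (if 0 < a then 1 else 0)"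
  proof cases
    case 2
    obtain N where N: "real N > (1 - b) / a" using reals_Archimedean2 by blast
    have "real (Suc m) * a + b \<ge> 1" if "m \<ge> N" for m
    proof -
      have "(1 - b) / a < real (Suc m)" using N that by simp
      then show ?thesis using 2 by (simp add: pos_divide_less_eq)
    qed
    then show ?thesis using 2 by (auto simp: eventually_sequentially clamp01_def intro!: exI[of _ N])
  next
    case 3
    obtain N where N: "real N > b / (- a)" using reals_Archimedean2 by blast
    have "real (Suc m) * a + b \<le> 0" if "m \<ge> N" for m
    proof -
      have "b / (- a) < real (Suc m)" using N that by simp
      then have "b < real (Suc m) * (- a)" using 3 by (subst (asm) pos_divide_less_eq) auto
      then show ?thesis by simp
    qed
    then have "clamp01 (real (Suc m) * a + b) = 0" if "m \<ge> N" for m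
      using that unfolding clamp01_def by (metis max_absorb1 min.coboundedI2)
    then show ?thesis using 3 by (auto simp: eventually_sequentially intro!: exI[of _ N])
  qed (use assms in \<open>simp add: clamp01_def\<close>)
  then show ?thesis unfolding r by (rule tendsto_eventually)
qed

lemma prod_if: "finite A \<Longrightarrow> (\<Prod>i\<in>A. if P i then 1 else 0 :: real) = (if \<forall>i\<in>A. P i then 1 else 0)"
  by (induction A rule: finite_induct) auto

text \<open>\<open>g\<close> on the open face of index \<open>j\<close>, cut out of its hyperplane
  by the other half-spaces and pulled back by orthogonal projection.\<close>

definition face_fun where
  "face_fun j x = g (proj j x) * (if \<forall>i\<in>J - {j}. 0 < d i (proj j x) then 1 else 0)"

text \<open>As the thickness shrinks, the layer concentrates on the face. Dominated convergence is
  used twice: over the stretched normal variable for fixed \<open>x\<close>, and over the slab, with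
  all integrands supported in a common ball.\<close>

lemma layer_limit:
  assumes j: "j \<in> J" and \<sigma>: "\<sigma> = 1 \<or> \<sigma> = -1" and \<mu>: "\<nu> j = \<sigma> *\<^sub>R \<mu>"
  shows "(\<lambda>m. \<integral>x. g x * (layer j (eps m) x * cutoff (J - {j}) (eps m) x) \<partial>lborel)
    \<longlonglongrightarrow> (\<integral>x. unit_ind (\<mu> \<bullet> x) * face_fun j x \<partial>lborel)"
proof -
  obtain K where K: "K \<ge> 0" "\<And>x. norm (g x) \<le> K" using bounded_by_support[OF g_cont supp] by metis
  let ?A = "J - {j}"
  let ?y = "\<lambda>m x \<tau>. proj j x + (eps m * \<tau>) *\<^sub>R \<nu> j"
  let ?s = "\<lambda>m x \<tau>. indicator {0<..<1} \<tau> * (g (?y m x \<tau>) * cutoff ?A (eps m) (?y m x \<tau>))"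
  have eps: "eps m > 0" "eps m \<le> 1" for m by (auto simp: field_simps)
  have sb: "\<bar>?s m x \<tau>\<bar> \<le> indicator {0<..<1} \<tau> * K" for m x \<tau>
  proof -
    have "\<bar>g (?y m x \<tau>)\<bar> * cutoff ?A (eps m) (?y m x \<tau>) \<le> K * 1"
      using K cutoff_bound by (intro mult_mono) auto
    then show ?thesis using cutoff_bound[of ?A "eps m" "?y m x \<tau>"]
      by (auto simp: abs_mult indicator_def)
  qed
  have sm: "(\<lambda>\<tau>. ?s m x \<tau>) \<in> borel_measurable borel" for m x by measurable
  have wi: "integrable lborel (\<lambda>\<tau>. indicator {0<..<1::real} \<tau> * K)" by simp
  have inner_bound: "\<bar>\<integral>\<tau>. ?s m x \<tau> \<partial>lborel\<bar> \<le> K" for m x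
  proof -
    have "\<bar>\<integral>\<tau>. ?s m x \<tau> \<partial>lborel\<bar> \<le> (\<integral>\<tau>. \<bar>?s m x \<tau>\<bar> \<partial>lborel)" by (rule integral_abs_bound)
    also have "\<dots> \<le> (\<integral>\<tau>. indicator {0<..<1::real} \<tau> * K \<partial>lborel)"
    proof (rule integral_mono_AE)
      show "integrable lborel (\<lambda>\<tau>. \<bar>?s m x \<tau>\<bar>)"
        by (rule Bochner_Integration.integrable_bound[OF wi]) (use sm sb K in auto)
    qed (use wi sb in auto)
    finally show ?thesis by simp
  qed
  \<comment> \<open>In the slab the absolute value of \<open>d j x\<close> is at most
    \<open>1 + \<bar>c j\<bar>\<close>, and the points \<open>?y m x \<tau>\<close> are within 1 of
    the projection, so an integrand can be nonzero only within this radius.\<close>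
  let ?R = "\<bar>R\<bar> + \<bar>c j\<bar> + 3"
  have zero: "unit_ind (\<mu> \<bullet> x) * (\<integral>\<tau>. ?s m x \<tau> \<partial>lborel) = 0" if x: "norm x > ?R" for m x
  proof (cases "unit_ind (\<mu> \<bullet> x) = 0")
    case False
    then have "\<bar>\<mu> \<bullet> x\<bar> \<le> 1" by (auto simp: unit_ind_def split: if_splits)
    then have "\<bar>\<nu> j \<bullet> x\<bar> \<le> 1" using \<sigma> by (auto simp: \<mu>)
    then have dj: "\<bar>d j x\<bar> \<le> 1 + \<bar>c j\<bar>" by (simp add: d_def)
    have "?s m x \<tau> = 0" for \<tau>
    proof (cases "\<tau> \<in> {0<..<1}")
      case True
      have "norm x \<le> norm (?y m x \<tau>) + norm (x - ?y m x \<tau>)" by (rule norm_triangle_sub)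
      also have "x - ?y m x \<tau> = (d j x - eps m * \<tau>) *\<^sub>R \<nu> j" by (simp add: proj_def algebra_simps)
      also have "norm \<dots> \<le> \<bar>d j x\<bar> + \<bar>eps m * \<tau>\<bar>" using unit[OF j] by simp
      also have "\<bar>eps m * \<tau>\<bar> \<le> 1" using True eps[of m] mult_mono[of "eps m" 1 \<tau> 1] by (simp add: abs_mult)
      finally have "norm (?y m x \<tau>) > R" using x dj by linarith
      then show ?thesis by (simp add: supp)
    qed simp
    then have "(\<integral>\<tau>. ?s m x \<tau> \<partial>lborel) = integral\<^sup>L lborel (\<lambda>\<tau>::real. 0)"
      by (intro Bochner_Integration.integral_cong refl)
    then show ?thesis by simp
  qed simp
  have main: "(\<lambda>m. \<integral>x. unit_ind (\<mu> \<bullet> x) * (\<integral>\<tau>. ?s m x \<tau> \<partial>lborel) \<partial>lborel)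
      \<longlonglongrightarrow> (\<integral>x. unit_ind (\<mu> \<bullet> x) * face_fun j x \<partial>lborel)"
  proof (rule integral_dominated_convergence[where w = "\<lambda>x. if norm x \<le> ?R then K else 0"])
    have [measurable]: "Measurable.pred borel (\<lambda>x. \<forall>i\<in>?A. 0 < d i (proj j x))"
      using J by (intro pred_intros_finite) auto
    show "(\<lambda>x. unit_ind (\<mu> \<bullet> x) * face_fun j x) \<in> borel_measurable lborel"
      unfolding face_fun_def by measurable
    show "(\<lambda>x. unit_ind (\<mu> \<bullet> x) * (\<integral>\<tau>. ?s m x \<tau> \<partial>lborel)) \<in> borel_measurable lborel" for m
      by measurable
    show "integrable lborel (\<lambda>x :: 'a. if norm x \<le> ?R then K else 0)"
      by (rule integrable_bounded_support[where K = K and R = ?R]) (use K in auto)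
    show "AE x in lborel. norm (unit_ind (\<mu> \<bullet> x) * (\<integral>\<tau>. ?s m x \<tau> \<partial>lborel)) \<le> (if norm x \<le> ?R then K else 0)" for m
    proof (rule AE_I2)
      fix x
      have "unit_ind (\<mu> \<bullet> x) * \<bar>\<integral>\<tau>. ?s m x \<tau> \<partial>lborel\<bar> \<le> 1 * K"
        using unit_ind_bound inner_bound[where x = x and m = m] by (intro mult_mono) auto
      then show "norm (unit_ind (\<mu> \<bullet> x) * (\<integral>\<tau>. ?s m x \<tau> \<partial>lborel)) \<le> (if norm x \<le> ?R then K else 0)"
        using zero[where x = x and m = m] unit_ind_bound by (auto simp: abs_mult)
    qed
    \<comment> \<open>The exceptional hyperplane is normal to the component of
      \<open>\<nu> i\<close> orthogonal to \<open>\<nu> j\<close>, which is nonzero as the two are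
      not parallel.\<close>
    have "AE x in lborel. d i (proj j x) \<noteq> 0" if i: "i \<in> ?A" for i
    proof -
      have "\<nu> i - (\<nu> i \<bullet> \<nu> j) *\<^sub>R \<nu> j \<noteq> 0" using nonparallel[of i j] i j by simp
      from AE_hyperplane[OF this, of "c i - c j * (\<nu> i \<bullet> \<nu> j)"] show ?thesis
        by eventually_elim (auto simp: d_def proj_def inner_diff_right inner_diff_left algebra_simps)
    qed
    then have "AE x in lborel. \<forall>i\<in>?A. d i (proj j x) \<noteq> 0"
      using J by (intro AE_finite_allI) auto
    then show "AE x in lborel. (\<lambda>m. unit_ind (\<mu> \<bullet> x) * (\<integral>\<tau>. ?s m x \<tau> \<partial>lborel))
        \<longlonglongrightarrow> unit_ind (\<mu> \<bullet> x) * face_fun j x"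
    proof eventually_elim
      fix x assume x: "\<forall>i\<in>?A. d i (proj j x) \<noteq> 0"
      have "(\<lambda>m. \<integral>\<tau>. ?s m x \<tau> \<partial>lborel) \<longlonglongrightarrow> (\<integral>\<tau>. indicator {0<..<1::real} \<tau> * face_fun j x \<partial>lborel)"
      proof (rule integral_dominated_convergence[where w = "\<lambda>\<tau>. indicator {0<..<1} \<tau> * K"])
        show "AE \<tau> in lborel. (\<lambda>m. ?s m x \<tau>) \<longlonglongrightarrow> indicator {0<..<1} \<tau> * face_fun j x"
        proof (rule AE_I2)
          fix \<tau> :: real
          have "(\<lambda>m. ?y m x \<tau>) \<longlonglongrightarrow> proj j x + (0 * \<tau>) *\<^sub>R \<nu> j"
            by (intro tendsto_intros LIMSEQ_inverse_real_of_nat)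
          then have 1: "(\<lambda>m. g (?y m x \<tau>)) \<longlonglongrightarrow> g (proj j x)"
            using continuous_on_tendsto_compose[OF g_cont[of UNIV]] by fastforce
          have "d i (?y m x \<tau>) = d i (proj j x) + eps m * (\<tau> * (\<nu> i \<bullet> \<nu> j))" for i m
            by (simp add: d_def inner_add_right)
          then have "(\<lambda>m. clamp01 (d i (?y m x \<tau>) / eps m)) \<longlonglongrightarrow> (if 0 < d i (proj j x) then 1 else 0)"
            if "i \<in> ?A" for i
            using clamp_limit[of "d i (proj j x)" "\<tau> * (\<nu> i \<bullet> \<nu> j)"] x that by (simp only: simp_thms)
          then have "(\<lambda>m. cutoff ?A (eps m) (?y m x \<tau>)) \<longlonglongrightarrow> (\<Prod>i\<in>?A. if 0 < d i (proj j x) then 1 else 0)"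
            unfolding cutoff_def by (intro tendsto_prod)
          then have 2: "(\<lambda>m. cutoff ?A (eps m) (?y m x \<tau>)) \<longlonglongrightarrow> (if \<forall>i\<in>?A. 0 < d i (proj j x) then 1 else 0)"
            using prod_if[of ?A "\<lambda>i. 0 < d i (proj j x)"] J by simp
          show "(\<lambda>m. ?s m x \<tau>) \<longlonglongrightarrow> indicator {0<..<1} \<tau> * face_fun j x"
            unfolding face_fun_def by (intro tendsto_mult tendsto_const 1 2)
        qed
        show "AE \<tau> in lborel. norm (?s m x \<tau>) \<le> indicator {0<..<1} \<tau> * K" for m
          using sb[where x = x and m = m] by (intro AE_I2) simp
      qed (use wi sm in auto)
      then have "(\<lambda>m. \<integral>\<tau>. ?s m x \<tau> \<partial>lborel) \<longlonglongrightarrow> face_fun j x" by simp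
      then show "(\<lambda>m. unit_ind (\<mu> \<bullet> x) * (\<integral>\<tau>. ?s m x \<tau> \<partial>lborel)) \<longlonglongrightarrow> unit_ind (\<mu> \<bullet> x) * face_fun j x"
        by (intro tendsto_mult tendsto_const)
    qed
  qed
  show ?thesis
    using main unfolding integral_layer[OF eps(1) j \<sigma> \<mu>, symmetric] .
qed

lemma interior_limit:
  "(\<lambda>m. \<integral>x. (g' x \<bullet> e) * cutoff J (eps m) x \<partial>lborel)
    \<longlonglongrightarrow> (\<integral>x. (g' x \<bullet> e) * (if \<forall>i\<in>J. 0 < d i x then 1 else 0) \<partial>lborel)"
proof -
  obtain K where K: "K \<ge> 0" "\<And>x. norm (g' x) \<le> K" using bounded_by_support[OF cont g'_supp] by metis
  have Ke: "\<bar>g' x \<bullet> e\<bar> \<le> K * norm e" for x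
    using Cauchy_Schwarz_ineq2[of "g' x" e] mult_right_mono[OF K(2)[of x], of "norm e"] by simp
  have wi: "integrable lborel (\<lambda>x. \<bar>g' x \<bullet> e\<bar>)"
    by (rule integrable_bounded_support[where K = "K * norm e" and R = R]) (use Ke g'_supp in auto)
  have [measurable]: "Measurable.pred borel (\<lambda>x. \<forall>i\<in>J. 0 < d i x)"
    using J by (intro pred_intros_finite) auto
  show ?thesis
  proof (rule integral_dominated_convergence[where w = "\<lambda>x. \<bar>g' x \<bullet> e\<bar>"])
    show "AE x in lborel. (\<lambda>m. (g' x \<bullet> e) * cutoff J (eps m) x) \<longlonglongrightarrow>
        (g' x \<bullet> e) * (if \<forall>i\<in>J. 0 < d i x then 1 else 0)"
    proof (rule AE_I2, rule tendsto_mult[OF tendsto_const])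
      fix x
      have "(\<lambda>m. clamp01 (d i x / eps m)) \<longlonglongrightarrow> (if 0 < d i x then 1 else 0)" for i
        using clamp_limit[of "d i x" 0] by simp
      then show "(\<lambda>m. cutoff J (eps m) x) \<longlonglongrightarrow> (if \<forall>i\<in>J. 0 < d i x then 1 else 0)"
        unfolding cutoff_def prod_if[OF J, symmetric] by (intro tendsto_prod)
    qed
    show "AE x in lborel. norm ((g' x \<bullet> e) * cutoff J (eps m) x) \<le> \<bar>g' x \<bullet> e\<bar>" for m
      using cutoff_bound[of J "eps m"] by (intro AE_I2) (auto simp: abs_mult mult_left_le)
  qed (use wi in auto)
qed

text \<open>The vanishing of the integral of \<open>D e (eps m)\<close> is a balance between an
  interior term and one layer term per face, and each term converges. The minus sign is due to the
  normals pointing inward.\<close>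

theorem divergence_polyhedron:
  assumes e: "norm e = 1" and \<sigma>: "\<And>j. j \<in> J \<Longrightarrow> \<sigma> j = 1 \<or> \<sigma> j = -1"
    and \<mu>: "\<And>j. j \<in> J \<Longrightarrow> \<nu> j = \<sigma> j *\<^sub>R \<mu> j"
  shows "(\<integral>x. (g' x \<bullet> e) * (if \<forall>i\<in>J. 0 < d i x then 1 else 0) \<partial>lborel) =
    - (\<Sum>j\<in>J. (\<nu> j \<bullet> e) * (\<integral>x. unit_ind (\<mu> j \<bullet> x) * face_fun j x \<partial>lborel))"
proof -
  obtain K where K: "K \<ge> 0" "\<And>x. norm (g x) \<le> K" using bounded_by_support[OF g_cont supp] by metis
  obtain K' where K': "K' \<ge> 0" "\<And>x. norm (g' x) \<le> K'" using bounded_by_support[OF cont g'_supp] by metis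
  let ?L = "\<lambda>j m. \<integral>x. g x * (layer j (eps m) x * cutoff (J - {j}) (eps m) x) \<partial>lborel"
  have eps: "eps m > 0" for m by simp
  have "(\<integral>x. (g' x \<bullet> e) * cutoff J (eps m) x \<partial>lborel) = - (\<Sum>j\<in>J. (\<nu> j \<bullet> e) * ?L j m)" for m
  proof -
    have b: "\<bar>g' x \<bullet> e * cutoff J (eps m) x\<bar> \<le> K' * 1" for x
      unfolding abs_mult using Cauchy_Schwarz_ineq2[of "g' x" e] e K' cutoff_bound
      by (intro mult_mono) (auto intro: order_trans)
    have i1: "integrable lborel (\<lambda>x. (g' x \<bullet> e) * cutoff J (eps m) x)"
      by (rule integrable_bounded_support[OF _ b, where R = R]) (simp_all add: g'_supp)
    have i2: "integrable lborel (\<lambda>x. g x * (layer j (eps m) x * cutoff (J - {j}) (eps m) x))" for j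
      by (rule integrable_bounded_support[OF _ layer_cutoff_bound[OF eps K(2,1)], where R = R])
        (simp_all add: supp)
    have "D e (eps m) x = (g' x \<bullet> e) * cutoff J (eps m) x +
        (\<Sum>j\<in>J. (\<nu> j \<bullet> e) * (g x * (layer j (eps m) x * cutoff (J - {j}) (eps m) x)))" for x
      by (simp add: D_def sum_distrib_left mult_ac)
    then have "0 = (\<integral>x. (g' x \<bullet> e) * cutoff J (eps m) x +
        (\<Sum>j\<in>J. (\<nu> j \<bullet> e) * (g x * (layer j (eps m) x * cutoff (J - {j}) (eps m) x))) \<partial>lborel)"
      using integral_D_eq_0[OF eps e, of m] by simp
    also have "\<dots> = (\<integral>x. (g' x \<bullet> e) * cutoff J (eps m) x \<partial>lborel) + (\<Sum>j\<in>J. (\<nu> j \<bullet> e) * ?L j m)"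
      using i1 i2 by (subst Bochner_Integration.integral_add) (auto simp: Bochner_Integration.integral_sum)
    finally show ?thesis by simp
  qed
  moreover have "(\<lambda>m. - (\<Sum>j\<in>J. (\<nu> j \<bullet> e) * ?L j m)) \<longlonglongrightarrow>
      - (\<Sum>j\<in>J. (\<nu> j \<bullet> e) * (\<integral>x. unit_ind (\<mu> j \<bullet> x) * face_fun j x \<partial>lborel))"
    by (intro tendsto_minus tendsto_sum tendsto_mult tendsto_const) (rule layer_limit[OF _ \<sigma> \<mu>])
  ultimately show ?thesis using interior_limit[of e] LIMSEQ_unique by simp
qed

end

section \<open>Unisolvence on one simplex, and the dependence of a trace on the DoFs of its
  facet\<close>

section \<open>Polynomial forms\<close>

abbreviation restr :: "'a set \<Rightarrow> ('a \<Rightarrow> 'b::zero) \<Rightarrow> 'a \<Rightarrow> 'b"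
  where "restr f p \<equiv> (\<lambda>x. if x \<in> f then p x else 0)"

lemma polysI: "q \<in> polyP (nat d) \<Longrightarrow> 0 \<le> d \<Longrightarrow> restr f q \<in> polys d f"
  by (auto simp: polys_eq)

text \<open>For negative \<open>d\<close> the number \<open>nat d\<close> is 0 and
  \<open>polyP 0\<close> still contains the constants; the last clause records that the space is
  nevertheless trivial.\<close>

lemma polysE:
  assumes "p \<in> polys d f"
  obtains q where "q \<in> polyP (nat d)" "p = restr f q" "d < 0 \<longrightarrow> q = (\<lambda>x. 0)"
proof (cases "d < 0")
  case True
  then have "p = restr f (\<lambda>x. 0)" using assms by (auto simp: polys_eq zero_fun_def)
  then show ?thesis using that[of "\<lambda>x. 0"] by simp
next
  case False
  then show ?thesis using assms that by (auto simp: polys_eq)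
qed

lemma linear_restr: "linear (restr f :: ('a \<Rightarrow> 'b::real_vector) \<Rightarrow> 'a \<Rightarrow> 'b)"
  by (rule linearI) (auto simp: fun_eq_iff)

lemma polys_span:
  obtains S where "finite S" "polys d f = span S"
proof (cases "d < 0")
  case True
  then show ?thesis using that[of "{}"] by (simp add: polys_eq)
next
  case False
  have "restr f ` polyP (nat d) = span (restr f ` mon ` {\<alpha>. sum \<alpha> UNIV \<le> nat d})"
    unfolding polyP_def using linear_span_image[OF linear_restr] by blast
  then show ?thesis using False that[of "restr f ` mon ` {\<alpha>. sum \<alpha> UNIV \<le> nat d}"] by (simp add: polys_eq)
qed

lemma subspace_polys: "subspace (polys d f)"
  by (rule polys_span[of d f]) simp

lemma polys_continuous: "p \<in> polys d f \<Longrightarrow> continuous_on f p"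
  by (erule polysE) (auto intro: continuous_on_eq[OF polyP_continuous])

lemma poly_tensor_polys:
  assumes "\<omega> \<in> poly_tensor d f W" "linear \<phi>"
  shows "(\<lambda>x. \<phi> (\<omega> x)) \<in> polys d f"
  using assms(1) unfolding poly_tensor_def
proof (induction rule: span_induct_alt)
  case base
  then show ?case using subspace_0[OF subspace_polys[of d f]] linear_0[OF assms(2)] by (simp add: zero_fun_def)
next
  case (step c m \<omega>)
  then obtain q w where m: "m = (\<lambda>x. q x *\<^sub>R w)" "q \<in> polys d f" by auto
  have "(\<lambda>x. \<phi> ((c *\<^sub>R m + \<omega>) x)) = (c * \<phi> w) *\<^sub>R q + (\<lambda>x. \<phi> (\<omega> x))"
    by (simp add: m linear_add[OF assms(2)] linear_cmul[OF assms(2)] fun_eq_iff)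
  then show ?case using m(2) step(2) subspace_polys by (metis subspace_add subspace_scale)
qed

lemma poly_tensor_in:
  assumes "\<omega> \<in> poly_tensor d f W" "subspace W"
  shows "\<omega> x \<in> W"
  using assms(1) unfolding poly_tensor_def
proof (induction rule: span_induct_alt)
  case (step c m \<omega>)
  then show ?case using assms(2) by (auto intro!: subspace_add subspace_scale)
qed (simp add: subspace_0[OF assms(2)])

lemma polys_outside: "q \<in> polys d f \<Longrightarrow> x \<notin> f \<Longrightarrow> q x = 0"
  by (erule polysE) simp

lemma poly_tensor_outside:
  assumes "\<omega> \<in> poly_tensor d f W" "x \<notin> f"
  shows "\<omega> x = 0"
  using assms(1) unfolding poly_tensor_def
  by (induction rule: span_induct_alt) (use polys_outside assms(2) in fastforce)+

lemma subspace_poly_tensor: "subspace (poly_tensor d f W)"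
  by (simp add: poly_tensor_def)

lemma poly_tensor_base: "q \<in> polys d f \<Longrightarrow> w \<in> W \<Longrightarrow> (\<lambda>x. q x *\<^sub>R w) \<in> poly_tensor d f W"
  unfolding poly_tensor_def by (rule span_base) blast

text \<open>Members of \<open>poly_tensor d f W\<close> are cut off outside \<open>f\<close>. The
  factorization on faces and the comparison of neighbouring simplices work with polynomials on the
  whole space, which this provides.\<close>

lemma poly_tensor_extend:
  assumes "\<omega> \<in> poly_tensor d f W"
  obtains G where "G \<in> poly_tensor d UNIV W" "\<omega> = restr f G"
proof -
  have "\<exists>G\<in>poly_tensor d UNIV W. \<omega> = restr f G"
    using assms unfolding poly_tensor_def[of d f]
  proof (induction rule: span_induct_alt)
    case base
    then show ?case using subspace_0[OF subspace_poly_tensor[of d UNIV W]]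
      by (intro bexI[of _ 0]) (auto simp: fun_eq_iff)
  next
    case (step c m \<omega>)
    then obtain q w G where m: "m = (\<lambda>x. q x *\<^sub>R w)" "q \<in> polys d f" "w \<in> W"
      and G: "G \<in> poly_tensor d UNIV W" "\<omega> = restr f G" by auto
    obtain p where p: "p \<in> polyP (nat d)" "q = restr f p" "d < 0 \<longrightarrow> p = (\<lambda>x. 0)"
      by (rule polysE[OF m(2)])
    have "p \<in> polys d UNIV"
      using polysI[of p d UNIV] p subspace_0[OF subspace_polys[of d UNIV]]
      by (cases "d < 0") (auto simp: zero_fun_def)
    then have "c *\<^sub>R (\<lambda>x. p x *\<^sub>R w) + G \<in> poly_tensor d UNIV W"
      using G(1) m(3) by (intro subspace_add subspace_scale subspace_poly_tensor poly_tensor_base)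
    moreover have "c *\<^sub>R m + \<omega> = restr f (c *\<^sub>R (\<lambda>x. p x *\<^sub>R w) + G)"
      by (auto simp: m(1) p(2) G(2) fun_eq_iff)
    ultimately show ?case by blast
  qed
  then show ?thesis using that by blast
qed

lemma polys_UNIV: "polys (int r) UNIV = polyP r"
  by (simp add: polys_eq)

text \<open>\<open>M\<close> will be an integral pairing, additive only where the integrals exist,
  whereas \<open>L\<close> is a linear functional on all functions. Hence linearity of
  \<open>M\<close> is asked for on the polynomial space alone, and agreement on generators is
  propagated through both spans.\<close>

lemma poly_tensor_span_cong:
  assumes lin: "linear L" and add: "\<And>x y. x \<in> poly_tensor d f (span G) \<Longrightarrow> y \<in> poly_tensor d f (span G) \<Longrightarrow> M (x + y) = M x + M y"
    and scale: "\<And>c x. x \<in> poly_tensor d f (span G) \<Longrightarrow> M (c *\<^sub>R x) = c * (M x :: real)"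
    and eq: "\<And>p g. p \<in> polys d f \<Longrightarrow> g \<in> G \<Longrightarrow> M (\<lambda>x. p x *\<^sub>R g) = L (\<lambda>x. p x *\<^sub>R g)"
    and \<eta>: "\<eta> \<in> poly_tensor d f (span G)"
  shows "M \<eta> = L \<eta>"
proof -
  have M0: "M 0 = 0" using scale[OF subspace_0[OF subspace_poly_tensor], of 0] by simp
  have 1: "w \<in> span G \<and> M (\<lambda>x. p x *\<^sub>R w) = L (\<lambda>x. p x *\<^sub>R w)" if p: "p \<in> polys d f" and w: "w \<in> span G" for p w
    using w
  proof (induction rule: span_induct_alt)
    case base
    then show ?case using M0 linear_0[OF lin] by (simp add: zero_fun_def span_zero)
  next
    case (step c g w)
    have e: "(\<lambda>x. p x *\<^sub>R (c *\<^sub>R g + w)) = c *\<^sub>R (\<lambda>x. p x *\<^sub>R g) + (\<lambda>x. p x *\<^sub>R w)"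
      by (simp add: fun_eq_iff scaleR_add_right mult_ac)
    note in1 = poly_tensor_base[OF p span_base[OF step(1)]]
    have w: "w \<in> span G" using step(2) by simp
    have "M (c *\<^sub>R (\<lambda>x. p x *\<^sub>R g) + (\<lambda>x. p x *\<^sub>R w)) = L (c *\<^sub>R (\<lambda>x. p x *\<^sub>R g) + (\<lambda>x. p x *\<^sub>R w))"
      unfolding add[OF subspace_scale[OF subspace_poly_tensor in1] poly_tensor_base[OF p w]] scale[OF in1]
        linear_add[OF lin] linear_cmul[OF lin] using step(2) eq[OF p step(1)] by simp
    then show ?case unfolding e using step(1) w by (simp add: span_add span_scale span_base)
  qed
  have "\<eta> \<in> poly_tensor d f (span G) \<and> M \<eta> = L \<eta>"
    using \<eta> unfolding poly_tensor_def[of d f "span G"]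
  proof (induction rule: span_induct_alt)
    case base
    show ?case
    proof (intro conjI)
      show "M 0 = L 0" using M0 linear_0[OF lin] by simp
    qed (rule span_zero)
  next
    case (step c m \<eta>)
    then obtain p w where m: "m = (\<lambda>x. p x *\<^sub>R w)" "p \<in> polys d f" "w \<in> span G" by auto
    have "m \<in> poly_tensor d f (span G)" using m poly_tensor_base by metis
    moreover have "\<eta> \<in> poly_tensor d f (span G)" using step by (simp add: poly_tensor_def)
    ultimately have A: "M (c *\<^sub>R m + \<eta>) = c * M m + M \<eta>"
      using add[of "c *\<^sub>R m" \<eta>] scale subspace_scale[OF subspace_poly_tensor] by metis
    have m': "M m = L m" unfolding m(1) using 1[OF m(2,3)] by simp
    show ?case
    proof (intro conjI)
      show "c *\<^sub>R m + \<eta> \<in> span {\<lambda>x. q x *\<^sub>R w |q w. q \<in> polys d f \<and> w \<in> span G}"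
        using step(2) by (intro span_add span_scale span_base[OF step(1)]) simp
      show "M (c *\<^sub>R m + \<eta>) = L (c *\<^sub>R m + \<eta>)"
        unfolding A linear_add[OF lin] linear_cmul[OF lin] m' using step(2) by simp
    qed
  qed
  then show ?thesis by simp
qed

section \<open>Riesz representation on finite-dimensional spaces\<close>

text \<open>Gram-Schmidt by induction on the spanning set, whose members may be dependent.
  \<open>B\<close> and \<open>L\<close> are linear only on the span, as they will be integrals, and
  definiteness is required in the weak form that \<open>B x x = 0\<close> forces
  \<open>x = 0\<close>.\<close>

lemma riesz_finite:
  assumes "finite S" and "L 0 = 0"
    and add: "\<And>x y. x \<in> span S \<Longrightarrow> y \<in> span S \<Longrightarrow> L (x + y) = L x + (L y :: real)"
    and scale: "\<And>c x. x \<in> span S \<Longrightarrow> L (c *\<^sub>R x) = c * L x"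
    and Badd: "\<And>x y z. x \<in> span S \<Longrightarrow> y \<in> span S \<Longrightarrow> z \<in> span S \<Longrightarrow> B (x + y) z = B x z + (B y z :: real)"
    and Bscale: "\<And>c x z. x \<in> span S \<Longrightarrow> z \<in> span S \<Longrightarrow> B (c *\<^sub>R x) z = c * B x z"
    and sym: "\<And>x y. x \<in> span S \<Longrightarrow> y \<in> span S \<Longrightarrow> B x y = B y x"
    and def: "\<And>x. x \<in> span S \<Longrightarrow> B x x = 0 \<Longrightarrow> x = 0"
  shows "\<exists>q\<in>span S. \<forall>p\<in>span S. B q p = L p"
  using assms
proof (induction S arbitrary: L rule: finite_induct)
  case empty
  have "B (0 *\<^sub>R 0) 0 = 0 * B 0 0" by (rule empty.prems(5)) auto
  then show ?case using empty.prems(1) by simp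
next
  case (insert a S)
  have sub: "x \<in> span (insert a S)" if "x \<in> span S" for x
    using that span_mono[of S "insert a S"] by auto
  note add = insert.prems(2) and scale = insert.prems(3) and Badd = insert.prems(4)
    and Bscale = insert.prems(5) and sym = insert.prems(6) and def = insert.prems(7)
  have a: "a \<in> span (insert a S)" by (rule span_base) simp
  have IH: "\<exists>q\<in>span S. \<forall>p\<in>span S. B q p = M p"
    if "M 0 = 0" "\<And>x y. x \<in> span S \<Longrightarrow> y \<in> span S \<Longrightarrow> M (x + y) = M x + M y"
      "\<And>c x. x \<in> span S \<Longrightarrow> M (c *\<^sub>R x) = c * M x" for M
    by (rule insert.IH) (use that sub Badd Bscale sym def in auto)
  have "B a 0 = 0" using sym[OF a span_zero] Bscale[OF span_zero a, of 0] by simp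
  then obtain qa where qa: "qa \<in> span S" "\<And>p. p \<in> span S \<Longrightarrow> B qa p = B a p"
    using IH[of "B a"] sub a sym Badd Bscale by (metis (no_types, lifting) subspace_add subspace_scale subspace_span)
  obtain q where q: "q \<in> span S" "\<And>p. p \<in> span S \<Longrightarrow> B q p = L p"
    using IH[of L] insert.prems(1) add scale sub by (metis (no_types, lifting))
  \<comment> \<open>\<open>qa\<close> represents \<open>B a\<close> on the span of \<open>S\<close>,
    so it is the projection of \<open>a\<close>, and \<open>e\<close> is orthogonal to
    \<open>span S\<close>. If \<open>e\<close> is 0 the new generator adds nothing; otherwise
    \<open>q\<close> is corrected along \<open>e\<close>.\<close>
  define e where "e = a - qa"
  have e: "e \<in> span (insert a S)" unfolding e_def using a sub[OF qa(1)] by (rule span_diff)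
  have Be: "B e p = 0" if "p \<in> span S" for p
  proof -
    have ea: "e = a + (-1) *\<^sub>R qa" by (simp add: e_def)
    have "B e p = B a p + (-1) * B qa p"
      unfolding ea Badd[OF a span_scale[OF sub[OF qa(1)]] sub[OF that]] Bscale[OF sub[OF qa(1)] sub[OF that]] ..
    then show ?thesis using qa(2)[OF that] by simp
  qed
  have split: "\<exists>c p'. p' \<in> span S \<and> p = p' + c *\<^sub>R e" if p: "p \<in> span (insert a S)" for p
  proof -
    obtain c where c: "p - c *\<^sub>R a \<in> span S" using p by (auto simp: span_insert)
    have "p = (p - c *\<^sub>R a + c *\<^sub>R qa) + c *\<^sub>R e" by (simp add: e_def algebra_simps)
    moreover have "p - c *\<^sub>R a + c *\<^sub>R qa \<in> span S" using c qa(1) by (intro span_add span_scale)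
    ultimately show ?thesis by blast
  qed
  show ?case
  proof (cases "e = 0")
    case True
    then have "span (insert a S) \<subseteq> span S" using split by fastforce
    then show ?thesis using q sub by blast
  next
    case False
    then have Bee: "B e e \<noteq> 0" using def[OF e] by blast
    define q' where "q' = q + (L e / B e e) *\<^sub>R e"
    have q': "q' \<in> span (insert a S)" unfolding q'_def using sub[OF q(1)] e by (intro span_add span_scale)
    have "B q' p = L p" if p: "p \<in> span (insert a S)" for p
    proof -
      obtain c p' where pp: "p' \<in> span S" "p = p' + c *\<^sub>R e" using split[OF p] by blast
      have 1: "B x p = B x p' + c * B x e" if x: "x \<in> span (insert a S)" for x
      proof -
        have "B x p = B p x" by (rule sym[OF x p])
        also have "\<dots> = B p' x + c * B e x"
          unfolding pp(2) using Badd[OF sub[OF pp(1)] span_scale[OF e] x] Bscale[OF e x] by simp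
        finally show ?thesis using sym[OF x sub[OF pp(1)]] sym[OF x e] by simp
      qed
      have 2: "B q' z = B q z + L e / B e e * B e z" if "z \<in> span (insert a S)" for z
        unfolding q'_def using Badd[OF sub[OF q(1)] span_scale[OF e] that] Bscale[OF e that] by simp
      have "B q e = 0" using sym[OF sub[OF q(1)] e] Be[OF q(1)] by simp
      then have "B q' p = L p' + c * L e"
        using 1[OF q'] 2[OF sub[OF pp(1)]] 2[OF e] q(2)[OF pp(1)] Be[OF pp(1)] Bee by simp
      also have "\<dots> = L p" unfolding pp(2) using add[OF sub[OF pp(1)] span_scale[OF e]] scale[OF e] by simp
      finally show ?thesis .
    qed
    then show ?thesis using q' by blast
  qed
qed

lemma finite_spanning_subset:
  fixes W :: "'a::real_vector set"
  assumes "subspace W" "W \<subseteq> span S" "finite S"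
  obtains B where "finite B" "W = span B"
proof -
  obtain B where B: "B \<subseteq> W" "independent B" "W \<subseteq> span B" using maximal_independent_subset by blast
  have "finite B" using independent_span_bound[OF assms(3) B(2)] B(1) assms(2) by auto
  moreover have "span B \<subseteq> W" using B(1) assms(1) by (simp add: span_minimal)
  ultimately show ?thesis using that B(3) by blast
qed

section \<open>Dual frames\<close>

lemma dual_vecs_expand:
  fixes b b' :: "nat \<Rightarrow> 'n::finite Rn"
  assumes d: "dual_vecs b b'"
  shows "u = (\<Sum>j=1..CARD('n). (u \<bullet> b' j) *\<^sub>R b j)"
proof -
  let ?z = "u - (\<Sum>j=1..CARD('n). (u \<bullet> b' j) *\<^sub>R b j)"
  have "?z \<bullet> b' i = 0" if i: "i \<in> {1..CARD('n)}" for i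
  proof -
    have "(\<Sum>j=1..CARD('n). (u \<bullet> b' j) * (b j \<bullet> b' i)) = (\<Sum>j=1..CARD('n). if j = i then u \<bullet> b' j else 0)"
      by (rule sum.cong) (use d i in \<open>auto simp: dual_vecs_def\<close>)
    then show ?thesis using i by (simp add: inner_diff_left inner_sum_left)
  qed
  then have "orthogonal ?z x" if "x \<in> b' ` {1..CARD('n)}" for x using that by (auto simp: orthogonal_def)
  then have "orthogonal ?z ?z"
    using orthogonal_to_span[of ?z "b' ` {1..CARD('n)}" ?z] dual_vecs_span[OF d] by auto
  then show ?thesis by (simp add: orthogonal_def)
qed

lemma covector_wedge: "covector v = wedge_list (map covector [v])"
proof -
  have "{..<Suc 0} = {0}" by auto
  then have "{p. p permutes {..<Suc 0}} = {id}" by (auto simp: permutes_sing)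
  then show ?thesis
    by (auto simp: fun_eq_iff covector_def wedge_list_def length_Suc_conv)
qed

lemma covector_Alt: "covector v \<in> Alt 1"
  by (subst covector_wedge) (use wedge_list_Alt[of "[v]"] in simp)

lemma alt_inner_covector: "alt_inner 1 (covector u) (covector v) = u \<bullet> v"
proof -
  have "alt_inner 1 (covector u) (covector v) = covector u [v]"
    by (subst (2) covector_wedge) (rule alt_inner_wedge[OF covector_Alt])
  then show ?thesis by (simp add: covector_def)
qed

lemma Alt1_covector:
  assumes "\<alpha> \<in> Alt 1"
  obtains v where "\<alpha> = covector v"
proof -
  have lin: "linear (\<lambda>x. \<alpha> [x])" using Alt_linear_append[OF assms, of "[]" "[]"] by simp
  define v where "v = adjoint (\<lambda>x. \<alpha> [x]) 1"
  have "\<alpha> [x] = v \<bullet> x" for x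
    using adjoint_works[OF lin, of x 1] unfolding v_def by (metis inner_commute inner_real_def mult.right_neutral)
  moreover have "\<alpha> vs = 0" if "length vs \<noteq> 1" for vs using Alt_length[OF assms that] .
  ultimately have "\<alpha> = covector v"
    by (auto simp: fun_eq_iff covector_def length_Suc_conv)
  then show ?thesis using that by blast
qed

text \<open>What is used of a t-n basis: \<open>b\<close> holds its vectors and \<open>b'\<close>
  the dual ones. By the third clause the first \<open>l\<close> vectors of \<open>b'\<close> are
  tangential, being orthogonal to every normal vector; by the fourth the last vectors of
  \<open>b\<close> are normal.\<close>

definition frame :: "nat \<Rightarrow> 'n Rn set \<Rightarrow> (nat \<Rightarrow> 'n form) \<Rightarrow>
    (nat \<Rightarrow> 'n Rn) \<Rightarrow> (nat \<Rightarrow> 'n::{finite,linorder} Rn) \<Rightarrow> bool"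
  where "frame l f dyh b b' \<longleftrightarrow> dual_vecs b b' \<and> (\<forall>i\<in>{1..CARD('n)}. dyh i = covector (b' i)) \<and>
    (\<forall>u. (\<forall>x\<in>tangent_space f. u \<bullet> x = 0) \<longrightarrow> (\<forall>i\<in>{1..l}. u \<bullet> b' i = 0)) \<and>
    (\<forall>i\<in>{l+1..CARD('n)}. \<forall>x\<in>tangent_space f. b i \<bullet> x = 0)"

lemma frame_exists:
  fixes dyh :: "nat \<Rightarrow> 'n::{finite,linorder} form"
  assumes tn: "tn_basis l f t \<nu>" and dual: "dual_basis (tn_forms l t \<nu>) dyh" and l: "l \<le> CARD('n)"
  shows "\<exists>b b'. frame l f dyh b b'"
proof -
  let ?N = "{1..CARD('n)}"
  define b where "b i = (if i \<le> l then t i else \<nu> (i - l))" for i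
  have "\<exists>v. dyh i = covector v" if "i \<in> ?N" for i
    using dual that Alt1_covector by (metis dual_basis_def)
  then obtain b' where b': "\<And>i. i \<in> ?N \<Longrightarrow> dyh i = covector (b' i)" by metis
  have d: "dual_vecs b b'"
    unfolding dual_vecs_def
  proof (intro ballI)
    fix i j assume ij: "i \<in> ?N" "j \<in> ?N"
    have "alt_inner 1 (dyh j) (tn_forms l t \<nu> i) = (if j = i then 1 else 0)"
      using dual ij by (simp add: dual_basis_def)
    moreover have "tn_forms l t \<nu> i = covector (b i)" by (simp add: tn_forms_def b_def)
    ultimately show "b i \<bullet> b' j = (if i = j then 1 else 0)"
      using b'[OF ij(2)] by (auto simp: alt_inner_covector[simplified] inner_commute split: if_splits)
  qed
  have bt: "b j \<bullet> x = 0" if "j \<in> {l+1..CARD('n)}" "x \<in> tangent_space f" for j x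
  proof -
    have "j - l \<in> {1..CARD('n) - l}" using that(1) by auto
    then show ?thesis using tn that by (auto simp: tn_basis_def b_def)
  qed
  have "u \<bullet> b' i = 0" if u: "\<And>x. x \<in> tangent_space f \<Longrightarrow> u \<bullet> x = 0" and i: "i \<in> {1..l}" for u i
  proof -
    \<comment> \<open>A normal vector \<open>u\<close> is split along \<open>b\<close> into a
      tangential part \<open>?x\<close> and a part \<open>?y\<close> orthogonal to the tangent
      space; pairing with \<open>?x\<close> shows that \<open>?x\<close> has norm 0, so its
      coefficients vanish.\<close>
    let ?x = "\<Sum>j=1..l. (u \<bullet> b' j) *\<^sub>R b j" and ?y = "\<Sum>j\<in>{l+1..CARD('n)}. (u \<bullet> b' j) *\<^sub>R b j"
    have x: "?x \<in> tangent_space f"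
      using tn by (intro subspace_sum subspace_scale subspace_tangent_space) (auto simp: tn_basis_def b_def)
    have y: "?y \<bullet> x = 0" if "x \<in> tangent_space f" for x
      using that bt by (auto simp: inner_sum_left)
    have "u = (\<Sum>j=1..CARD('n). (u \<bullet> b' j) *\<^sub>R b j)" by (rule dual_vecs_expand[OF d])
    also have "\<dots> = ?x + ?y"
      using sum.ub_add_nat[of 1 l "\<lambda>j. (u \<bullet> b' j) *\<^sub>R b j" "CARD('n) - l"] l by simp
    finally have "u \<bullet> ?x = (?x + ?y) \<bullet> ?x" by (rule arg_cong)
    then have "?x \<bullet> ?x = 0" unfolding u[OF x] inner_add_left y[OF x] by simp
    then have "0 = ?x \<bullet> b' i" by simp
    also have "\<dots> = (\<Sum>j=1..l. if j = i then u \<bullet> b' j else 0)"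
      unfolding inner_sum_left by (rule sum.cong) (use d i l in \<open>auto simp: dual_vecs_def\<close>)
    also have "\<dots> = u \<bullet> b' i" using i by simp
    finally show ?thesis by simp
  qed
  then have "frame l f dyh b b'" using d b' bt by (auto simp: frame_def)
  then show ?thesis by blast
qed

section \<open>Degrees of freedom on a simplex\<close>

lemma inc_seqs_codim1: "n \<ge> 1 \<Longrightarrow> \<rho> \<in> inc_seqs (n - 1) n \<Longrightarrow> \<exists>i\<in>{1..n}. \<rho> = {1..n} - {i}"
proof -
  assume n: "n \<ge> 1" and r: "\<rho> \<in> inc_seqs (n - 1) n"
  note r = inc_seqsD[OF r]
  have "card ({1..n} - \<rho>) = 1" using r n by (simp add: card_Diff_subset)
  then obtain i where "{1..n} - \<rho> = {i}" by (auto simp: card_1_singleton_iff)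
  then have "i \<in> {1..n}" "\<rho> = {1..n} - {i}" using r by auto
  then show ?thesis by blast
qed

text \<open>Faces of the simplex are given by nonempty subsets \<open>c\<close> of the vertex set
  \<open>C\<close>, the dimension being \<open>card c - 1\<close>, and a vertex \<open>v\<close>
  stands for the facet opposite to it. Frames and normals are attached to faces as point sets, so
  neighbouring simplices see the same ones.\<close>

locale simplex_dofs =
  fixes C :: "'n::{finite,linorder} Rn set" and k r :: nat
    and dyh :: "'n Rn set \<Rightarrow> nat \<Rightarrow> 'n form" and nF :: "'n Rn set \<Rightarrow> 'n Rn"
  assumes C: "simplex_verts C" and n: "CARD('n) \<ge> 2" and k: "1 \<le> k" "k \<le> CARD('n) - 1" and r: "1 \<le> r"
    and frames: "\<And>c. c \<subseteq> C \<Longrightarrow> c \<noteq> {} \<Longrightarrow> card c \<le> CARD('n) \<Longrightarrow>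
      \<exists>b b'. frame (card c - 1) (convex hull c) (dyh (convex hull c)) b b'"
    and normal: "\<And>v. v \<in> C \<Longrightarrow> norm (nF (convex hull (C - {v}))) = 1 \<and>
      (\<forall>u\<in>tangent_space (convex hull (C - {v})). nF (convex hull (C - {v})) \<bullet> u = 0)"
begin

abbreviation fc :: "'n Rn set \<Rightarrow> 'n Rn set" where "fc c \<equiv> convex hull c"
abbreviation nv :: "'n Rn \<Rightarrow> 'n Rn" where "nv v \<equiv> nF (fc (C - {v}))"
abbreviation XXk :: "'n form2 set" where "XXk \<equiv> XX k"

definition bp where "bp c = (SOME p. frame (card c - 1) (fc c) (dyh (fc c)) (fst p) (snd p))"
definition b where "b c = fst (bp c)"
definition b' where "b' c = snd (bp c)"

lemma frame_c:
  assumes "c \<subseteq> C" "c \<noteq> {}" "card c \<le> CARD('n)"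
  shows "frame (card c - 1) (fc c) (dyh (fc c)) (b c) (b' c)"
proof -
  have "\<exists>p. frame (card c - 1) (fc c) (dyh (fc c)) (fst p) (snd p)" using frames[OF assms] by auto
  then show ?thesis unfolding b_def b'_def bp_def by (rule someI_ex)
qed

lemma dual_c: "c \<subseteq> C \<Longrightarrow> c \<noteq> {} \<Longrightarrow> card c \<le> CARD('n) \<Longrightarrow> dual_vecs (b c) (b' c)"
  using frame_c by (simp add: frame_def)

lemma fin: "finite C" "c \<subseteq> C \<Longrightarrow> finite c"
  using simplex_verts_finite[OF C] finite_subset by auto

lemma cardC: "card C = CARD('n) + 1" and indC: "\<not> affine_dependent C"
  using C by (auto simp: simplex_verts_def)

lemma ind: "c \<subseteq> C \<Longrightarrow> \<not> affine_dependent c"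
  using indC affine_dependent_subset by blast

lemma kN: "k \<le> CARD('n)" using k by simp

lemma body: "c \<subseteq> C \<Longrightarrow> c \<noteq> {} \<Longrightarrow> convex (fc c) \<and> compact (fc c) \<and> fc c \<noteq> {}"
  using fin by (simp add: finite_imp_compact_convex_hull)

lemma fc_mono: "c \<subseteq> d \<Longrightarrow> fc c \<subseteq> fc d"
  by (rule hull_mono)

lemma facets: "subsimplices (CARD('n) - 1) (fc C) = {fc (C - {v}) | v. v \<in> C}"
proof -
  have *: "c \<subseteq> C \<and> card c = Suc (CARD('n) - 1) \<longleftrightarrow> (\<exists>v\<in>C. c = C - {v})" for c
  proof
    assume c: "c \<subseteq> C \<and> card c = Suc (CARD('n) - 1)"
    then have "card (C - c) = 1" using fin cardC by (simp add: card_Diff_subset)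
    then obtain v where v: "C - c = {v}" by (metis card_1_singletonE)
    then have "v \<in> C" "c = C - {v}" using c by blast+
    then show "\<exists>v\<in>C. c = C - {v}" by blast
  next
    assume "\<exists>v\<in>C. c = C - {v}"
    then obtain v where "v \<in> C" "c = C - {v}" by blast
    then show "c \<subseteq> C \<and> card c = Suc (CARD('n) - 1)" using fin(1) cardC by simp
  qed
  have "{c. c \<subseteq> C \<and> card c = Suc (CARD('n) - 1)} = (\<lambda>v. C - {v}) ` C"
    by (intro set_eqI) (unfold mem_Collect_eq image_iff, rule *)
  note e = this
  show ?thesis unfolding subsimplices_eq[OF indC] setcompr_eq_image e image_image by simp
qed

definition I :: "'n Rn set \<Rightarrow> ('n Rn \<Rightarrow> real) \<Rightarrow> real"
  where "I c h = (LINT x:fc c|surface_measure (fc c). h x)"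

lemma I_integrable:
  fixes h :: "'n Rn \<Rightarrow> real"
  shows "c \<subseteq> C \<Longrightarrow> c \<noteq> {} \<Longrightarrow> continuous_on (fc c) h \<Longrightarrow> set_integrable (surface_measure (fc c)) (fc c) h"
  using surface_set_integrable[of "fc c" h] body[of c] by simp

lemma I_add:
  assumes "c \<subseteq> C" "c \<noteq> {}" "continuous_on (fc c) g" "continuous_on (fc c) h"
  shows "I c (\<lambda>x. g x + h x) = I c g + I c h"
  unfolding I_def using I_integrable[OF assms(1,2)] assms(3,4) by (intro set_integral_add)

lemma I_cmult: "I c (\<lambda>x. a * h x) = a * I c h"
  unfolding I_def by simp

lemma I_cong: "(\<And>x. x \<in> fc c \<Longrightarrow> g x = h x) \<Longrightarrow> I c g = I c h"
  unfolding I_def set_lebesgue_integral_def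
  by (rule Bochner_Integration.integral_cong) (auto simp: indicator_def)

lemma I_0: "I c (\<lambda>x. 0) = 0" using I_cmult[of c 0 "\<lambda>_. 0"] by simp

lemma I_sum:
  assumes "c \<subseteq> C" "c \<noteq> {}" "\<And>j. j \<in> J \<Longrightarrow> continuous_on (fc c) (h j)"
  shows "I c (\<lambda>x. \<Sum>j\<in>J. h j x) = (\<Sum>j\<in>J. I c (h j))"
  using assms(3)
proof (induction J rule: infinite_finite_induct)
  case (insert j J)
  then show ?case using I_add[OF assms(1,2), of "h j" "\<lambda>x. \<Sum>j\<in>J. h j x"]
    by (simp add: continuous_on_sum)
qed (auto simp: I_0)

lemma I_definite:
  assumes "c \<subseteq> C" "c \<noteq> {}" "continuous_on (fc c) h" "\<And>x. x \<in> fc c \<Longrightarrow> h x \<ge> 0" "I c h = 0" "x \<in> fc c"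
  shows "h x = 0"
  using surface_integral_eq_0[of "fc c" h x] body[OF assms(1,2)] assms by (auto simp: I_def)

definition bprod where "bprod c x = (\<Prod>v\<in>c. bary C x v)"

lemma bprod_nonneg: "c \<subseteq> C \<Longrightarrow> x \<in> fc c \<Longrightarrow> 0 \<le> bprod c x"
  using in_face_iff[OF C, of c x] unfolding bprod_def by (intro prod_nonneg) auto

lemma bprod_polyP: "c \<subseteq> C \<Longrightarrow> bprod c \<in> polyP (card c)"
  using polyP_prod[of c "\<lambda>v x. bary C x v" "\<lambda>_. Suc 0"] fin bary_polyP[OF C]
  unfolding bprod_def by (auto simp: subset_iff)

lemma bprod_zero: "c \<subseteq> C \<Longrightarrow> d \<subseteq> C \<Longrightarrow> \<not> c \<subseteq> d \<Longrightarrow> x \<in> fc d \<Longrightarrow> bprod c x = 0"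
  using in_face_iff[OF C, of d x] fin(2)[of c] unfolding bprod_def by (auto intro!: prod_zero)

text \<open>Moving \<open>x\<close> slightly towards the barycenter \<open>m\<close> makes all
  coordinates of \<open>c\<close>, and with them the bubble, positive; continuity of
  \<open>q\<close> carries the vanishing back to \<open>x\<close>.\<close>

lemma bprod_dense:
  assumes c: "c \<subseteq> C" "c \<noteq> {}" and q: "continuous_on UNIV q"
    and z: "\<And>x. x \<in> fc c \<Longrightarrow> bprod c x \<noteq> 0 \<Longrightarrow> q x = (0::real)" and x: "x \<in> fc c"
  shows "q x = 0"
proof -
  have fc: "finite c" "card c > 0" using fin c by (auto simp: card_gt_0_iff)
  define m where "m = (\<Sum>v\<in>C. (if v \<in> c then 1 / real (card c) else 0) *\<^sub>R v)"
  have "sum (\<lambda>v. if v \<in> c then 1 / real (card c) else 0) C = 1"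
    using c fc fin by (simp add: sum.If_cases Int_absorb1)
  then have bm: "bary C m v = (if v \<in> c then 1 / real (card c) else 0)" if "v \<in> C" for v
    using bary_unique[OF C _ m_def[symmetric] that] by simp
  define y where "y t = (1 - t) *\<^sub>R x + t *\<^sub>R m" for t :: real
  have yb: "bary C (y t) v = (1 - t) * bary C x v + t * bary C m v" if "v \<in> C" for t v
    unfolding y_def
    by (rule bary_unique[OF C _ _ that])
      (use bary_spec[OF C] in \<open>simp_all add: sum.distrib scaleR_add_left
        flip: sum_distrib_left scaleR_scaleR scaleR_sum_right\<close>)
  have xb: "\<forall>v\<in>C. 0 \<le> bary C x v" "\<forall>v\<in>C - c. bary C x v = 0" using x in_face_iff[OF C c(1)] by auto
  have "q (y t) = 0" if t: "0 < t" "t \<le> 1" for t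
  proof (rule z)
    show "y t \<in> fc c" unfolding in_face_iff[OF C c(1)] using xb t by (auto simp: yb bm)
    have "bary C (y t) v > 0" if v: "v \<in> c" for v
    proof -
      have vC: "v \<in> C" using v c(1) by auto
      have "0 \<le> (1 - t) * bary C x v" using xb(1) vC t by simp
      moreover have "0 < t * bary C m v" using t fc(2) v bm[OF vC] by simp
      ultimately show ?thesis unfolding yb[OF vC] by linarith
    qed
    then show "bprod c (y t) \<noteq> 0" unfolding bprod_def using fc by (auto simp: less_le)
  qed
  then have "(\<lambda>j. q (y (inverse (real (Suc j))))) \<longlonglongrightarrow> 0"
    by (simp add: field_simps)
  moreover have "(\<lambda>j. y (inverse (real (Suc j)))) \<longlonglongrightarrow> (1 - 0) *\<^sub>R x + 0 *\<^sub>R m"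
    unfolding y_def by (intro tendsto_intros LIMSEQ_inverse_real_of_nat)
  then have "(\<lambda>j. q (y (inverse (real (Suc j))))) \<longlonglongrightarrow> q x"
    using continuous_on_tendsto_compose[OF q] by fastforce
  ultimately show ?thesis by (rule LIMSEQ_unique[symmetric])
qed

text \<open>As \<open>card c\<close> is the dimension plus one, this is the scalar test space of (b)
  and (c).\<close>

abbreviation pd where "pd c \<equiv> polys (int r - int (card c)) (fc c)"

text \<open>Riesz representation for the pairing weighted by \<open>bprod c\<close>, which is
  definite by \<open>bprod_dense\<close>. The weight becomes a factor of \<open>Q\<close>: it brings
  the degree up to \<open>r\<close> and makes \<open>Q\<close> vanish with the bubble. For
  \<open>card c > r\<close> both the test space and \<open>Q\<close> are 0.\<close>

lemma riesz_face:
  assumes c: "c \<subseteq> C" "c \<noteq> {}"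
    and add: "\<And>p q. p \<in> pd c \<Longrightarrow> q \<in> pd c \<Longrightarrow> L (p + q) = L p + L q"
    and scale: "\<And>a p. p \<in> pd c \<Longrightarrow> L (a *\<^sub>R p) = a * (L p :: real)"
  shows "\<exists>Q\<in>polyP r. (\<forall>x. bprod c x = 0 \<longrightarrow> Q x = 0) \<and> (\<forall>p\<in>pd c. I c (\<lambda>x. p x * Q x) = L p)"
proof -
  obtain S where S: "finite S" "pd c = span S" by (rule polys_span)
  let ?B = "\<lambda>p q. I c (\<lambda>x. bprod c x * (p x * q x))"
  have cont: "continuous_on (fc c) p" if "p \<in> pd c" for p using that by (rule polys_continuous)
  have bc: "continuous_on (fc c) (bprod c)" by (rule polyP_continuous[OF bprod_polyP[OF c(1)]])
  have prod_cont: "continuous_on (fc c) (\<lambda>u. bprod c u * (p u * q u))" if "p \<in> pd c" "q \<in> pd c" for p q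
    using that by (intro continuous_on_mult bc cont)
  have L0: "L 0 = 0" using scale[OF subspace_0[OF subspace_polys], of 0] by simp
  have "\<exists>q\<in>span S. \<forall>p\<in>span S. ?B q p = L p"
    unfolding S(2)[symmetric]
  proof (rule riesz_finite[OF S(1), folded S(2)])
    fix x y z assume "x \<in> pd c" "y \<in> pd c" "z \<in> pd c"
    then show "?B (x + y) z = ?B x z + ?B y z"
      by (subst I_add[OF c prod_cont prod_cont, symmetric]) (simp_all add: algebra_simps)
  next
    fix a x z
    have "?B (a *\<^sub>R x) z = I c (\<lambda>u. a * (bprod c u * (x u * z u)))" by (simp add: mult_ac)
    then show "?B (a *\<^sub>R x) z = a * ?B x z" by (simp add: I_cmult)
  next
    fix x y show "?B x y = ?B y x" by (simp add: mult_ac)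
  next
    fix x assume x: "x \<in> pd c" and z: "?B x x = 0"
    obtain q where q: "q \<in> polyP (nat (int r - int (card c)))" "x = restr (fc c) q" using x by (rule polysE)
    have 1: "bprod c u * (x u * x u) = 0" if "u \<in> fc c" for u
      by (rule I_definite[OF c prod_cont[OF x x] mult_nonneg_nonneg[OF bprod_nonneg[OF c(1)] zero_le_square] z that])
    have "q u = 0" if "u \<in> fc c" for u
      by (rule bprod_dense[OF c polyP_continuous[OF q(1)] _ that]) (use 1 q(2) in fastforce)
    then show "x = 0" by (auto simp: q(2) fun_eq_iff)
  qed (use L0 add scale in auto)
  then obtain q where q: "q \<in> pd c" "\<And>p. p \<in> pd c \<Longrightarrow> ?B q p = L p" by (auto simp: S(2))
  obtain q' where q': "q' \<in> polyP (nat (int r - int (card c)))" "q = restr (fc c) q'"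
    "int r - int (card c) < 0 \<longrightarrow> q' = (\<lambda>x. 0)" using q(1) by (rule polysE)
  show ?thesis
  proof (intro bexI[of _ "\<lambda>x. bprod c x * q' x"] conjI allI impI ballI)
    show "(\<lambda>x. bprod c x * q' x) \<in> polyP r"
    proof (cases "card c \<le> r")
      case True
      then have "card c + nat (int r - int (card c)) = r" by simp
      then show ?thesis using polyP_mult[OF bprod_polyP[OF c(1)] q'(1)] by metis
    qed (use q'(3) in simp)
    fix p assume p: "p \<in> pd c"
    have "I c (\<lambda>x. p x * (bprod c x * q' x)) = ?B q p"
      by (rule I_cong) (simp add: q'(2) mult_ac)
    then show "I c (\<lambda>x. p x * (bprod c x * q' x)) = L p" using q(2)[OF p] by simp
  qed simp
qed

section \<open>Facet normals\<close>

lemma nv_tangent: "v \<in> C \<Longrightarrow> u \<in> tangent_space (fc (C - {v})) \<Longrightarrow> nv v \<bullet> u = 0"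
  using normal by blast

lemma nv_diff: "v \<in> C \<Longrightarrow> w \<in> C - {v} \<Longrightarrow> w' \<in> C - {v} \<Longrightarrow> nv v \<bullet> (w - w') = 0"
  by (rule nv_tangent) (auto intro!: tangent_space_diff hull_inc)

lemma tangent_mono: "f \<subseteq> g \<Longrightarrow> tangent_space f \<subseteq> tangent_space g"
  unfolding tangent_space_def by (intro span_mono) auto

lemma nv_face: "v \<in> C \<Longrightarrow> c \<subseteq> C - {v} \<Longrightarrow> u \<in> tangent_space (fc c) \<Longrightarrow> nv v \<bullet> u = 0"
  using nv_tangent tangent_mono[OF fc_mono] by blast

lemma bary_diff:
  assumes w: "w \<in> C"
  shows "y - w = (\<Sum>v\<in>C. bary C y v *\<^sub>R (v - w))"
proof -
  have "(\<Sum>v\<in>C. bary C y v *\<^sub>R (v - w)) = (\<Sum>v\<in>C. bary C y v *\<^sub>R v) - sum (bary C y) C *\<^sub>R w"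
    by (simp add: scaleR_diff_right sum_subtractf scaleR_sum_left)
  then show ?thesis using bary_spec[OF C, of y] by simp
qed

text \<open>Every vertex other than \<open>v\<close> lies in the facet, so only the term of
  \<open>v\<close> survives in \<open>bary_diff\<close>. The normal is thus a multiple of the
  gradient of the coordinate of \<open>v\<close>.\<close>

lemma nv_bary:
  assumes v: "v \<in> C" and w: "w \<in> C - {v}"
  shows "nv v \<bullet> (y - w) = bary C y v * (nv v \<bullet> (v - w))"
proof -
  have "nv v \<bullet> (y - w) = (\<Sum>u\<in>C. bary C y u * (nv v \<bullet> (u - w)))"
    using bary_diff[of w y] w by (simp add: inner_sum_right)
  also have "\<dots> = (\<Sum>u\<in>{v}. bary C y u * (nv v \<bullet> (u - w)))"
    by (rule sum.mono_neutral_right) (use fin v w nv_diff[OF v _ w] in auto)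
  finally show ?thesis by simp
qed

text \<open>With a vanishing factor, \<open>nv_bary\<close> would make the normal orthogonal to
  every vector, but its product with itself is 1.\<close>

lemma nv_nonzero:
  assumes v: "v \<in> C" and w: "w \<in> C - {v}"
  shows "nv v \<bullet> (v - w) \<noteq> 0"
proof
  assume "nv v \<bullet> (v - w) = 0"
  then have "nv v \<bullet> ((w + nv v) - w) = 0" using nv_bary[OF v w, of "w + nv v"] by simp
  then show False using normal[OF v] by (simp add: norm_eq_1)
qed

lemma nonempty_diff: "v \<in> C \<Longrightarrow> C - {v} \<noteq> {}"
  using cardC n fin by (metis card_Diff_singleton card.empty diff_add_inverse2 not_numeral_le_zero)

text \<open>Moving by \<open>y\<close> from a vertex of \<open>c\<close> leaves the coordinates off
  \<open>c\<close> at 0, so \<open>y\<close> is a combination of edges of \<open>c\<close>.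
  Equivalently, the normals of the facets through \<open>c\<close> span its normal space.\<close>

lemma tangent_of_normals:
  assumes c: "c \<subseteq> C" "c \<noteq> {}" and y: "\<And>v. v \<in> C - c \<Longrightarrow> nv v \<bullet> y = 0"
  shows "y \<in> tangent_space (fc c)"
proof -
  obtain w where w: "w \<in> c" using c by auto
  have z: "bary C (w + y) v = 0" if v: "v \<in> C - c" for v
  proof -
    have vw: "v \<in> C" "w \<in> C - {v}" using v w c by auto
    show ?thesis using nv_bary[OF vw, of "w + y"] nv_nonzero[OF vw] y[OF v] by simp
  qed
  have "y = (\<Sum>v\<in>C. bary C (w + y) v *\<^sub>R (v - w))" using bary_diff[of w "w + y"] w c by auto
  also have "\<dots> = (\<Sum>v\<in>c. bary C (w + y) v *\<^sub>R (v - w))"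
    by (rule sum.mono_neutral_right) (use fin c z in auto)
  also have "\<dots> \<in> tangent_space (fc c)"
    using w by (intro subspace_sum subspace_scale subspace_tangent_space tangent_space_diff hull_inc)
  finally show ?thesis .
qed

section \<open>Vanishing traces\<close>

text \<open>The facet opposite \<open>v\<close> contains \<open>c\<close>, so its normal is
  orthogonal to the tangential dual vectors \<open>b' c i\<close>, \<open>i < card c\<close>; only
  normal indices contribute to a trace.\<close>

lemma row_sum:
  assumes c: "c \<subseteq> C" "c \<noteq> {}" "card c \<le> CARD('n)" and v: "v \<in> C" "c \<subseteq> C - {v}"
  shows "(\<Sum>i=1..CARD('n). (nv v \<bullet> b' c i) * a i) = (\<Sum>i\<in>{card c..CARD('n)}. (nv v \<bullet> b' c i) * (a i :: real))"
proof (rule sum.mono_neutral_right)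
  have "card c \<ge> 1" using fin c by (simp add: Suc_le_eq card_gt_0_iff)
  then show "{card c..CARD('n)} \<subseteq> {1..CARD('n)}" by auto
  have "\<forall>i\<in>{1..card c - 1}. nv v \<bullet> b' c i = 0"
    using frame_c[OF c] nv_face[OF v] by (auto simp: frame_def)
  then show "\<forall>i\<in>{1..CARD('n)} - {card c..CARD('n)}. nv v \<bullet> b' c i * a i = 0" by auto
qed auto

lemma kappa_exists:
  assumes "c \<subseteq> C" "c \<noteq> {}" "card c \<le> CARD('n)"
  shows "\<exists>\<kappa>. \<kappa> \<noteq> 0 \<and> (\<forall>\<nu> \<omega> \<sigma>. \<omega> \<in> Alt2 k (CARD('n) - 1) \<longrightarrow> \<sigma> \<in> inc_seqs k CARD('n) \<longrightarrow>
    \<kappa> * alt_inner k (trv k \<nu> \<omega>) (wform (b' c) \<sigma>) = (\<Sum>i=1..CARD('n). (\<nu> \<bullet> b' c i) * cf (b' c) \<omega> \<sigma> i))"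
proof (rule trv_dual_coeff[OF dual_c[OF assms]])
  fix \<kappa> :: real
  assume "\<kappa> \<noteq> 0" and "\<And>k \<nu> \<omega> \<sigma>. \<omega> \<in> Alt2 k (CARD('n) - 1) \<Longrightarrow> \<sigma> \<in> inc_seqs k CARD('n) \<Longrightarrow>
    \<kappa> * alt_inner k (trv k \<nu> \<omega>) (wform (b' c) \<sigma>) = (\<Sum>i=1..CARD('n). (\<nu> \<bullet> b' c i) * cf (b' c) \<omega> \<sigma> i)"
  then show ?thesis by (intro exI[of _ \<kappa>] conjI allI impI)
qed

lemma trv_zero:
  assumes c: "c \<subseteq> C" "c \<noteq> {}" "card c \<le> CARD('n)"
    and z: "\<And>\<sigma>. \<sigma> \<in> inc_seqs k CARD('n) \<Longrightarrow> alt_inner k (trv k \<nu> \<omega>) (wform (b' c) \<sigma>) = 0"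
  shows "trv k \<nu> \<omega> = 0"
proof (intro ext)
  fix ws
  show "trv k \<nu> \<omega> ws = 0 ws"
    using Alt_eq_0[OF trv_Alt dual_vecs_span[OF dual_c[OF c]]] z by (simp add: alt_inner_wedge[OF trv_Alt])
qed

lemma linear_alt_inner: "linear (\<lambda>\<alpha>. alt_inner j \<alpha> \<beta>)"
  by (rule linearI) (auto simp: alt_inner_def algebra_simps sum.distrib sum_distrib_left)

lemma linear_trace_coeff: "linear (\<lambda>\<omega>. alt_inner k (trv k \<nu> \<omega>) \<beta>)"
  using linear_compose[OF linear_trv linear_alt_inner] by (simp add: o_def)

text \<open>Each coefficient \<open>h\<close> of the trace vanishes on the boundary of
  \<open>c\<close> and is orthogonal to \<open>pd c\<close>: in a free row by (c), in any other row
  because all normal entries are, either by (b) or through their constraint. Hence \<open>h\<close>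
  is the bubble times some \<open>q\<close>, and testing with \<open>q\<close> itself gives the
  integral of the bubble times the square of \<open>q\<close>.\<close>

lemma trace_vanishes:
  assumes \<omega>: "\<omega> \<in> poly_tensor (int r) UNIV XXk" and v: "v \<in> C" and c: "c \<subseteq> C - {v}" "c \<noteq> {}"
    and bz: "\<And>\<sigma> i p. free_index CARD('n) k (\<sigma>, i) \<Longrightarrow> (\<sigma>, i) \<in> normal_block CARD('n) k (card c - 1) \<Longrightarrow> p \<in> pd c \<Longrightarrow>
      I c (\<lambda>x. p x * cf (b' c) (\<omega> x) \<sigma> i) = 0"
    and cz: "\<And>\<sigma> p. free_row CARD('n) k (card c - 1) \<sigma> \<Longrightarrow> p \<in> pd c \<Longrightarrow>
      I c (\<lambda>x. p x * alt_inner k (trv k (nv v) (\<omega> x)) (wform (b' c) \<sigma>)) = 0"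
    and z: "\<And>u x. u \<in> c \<Longrightarrow> x \<in> fc (c - {u}) \<Longrightarrow> trv k (nv v) (\<omega> x) = 0"
    and x: "x \<in> fc c"
  shows "trv k (nv v) (\<omega> x) = 0"
proof -
  have cC: "c \<subseteq> C" using c by auto
  have "card c \<le> card (C - {v})" using c fin by (intro card_mono) auto
  then have cN: "card c \<le> CARD('n)" using v fin cardC by simp
  have c1: "card c \<ge> 1" using fin(2)[OF cC] c by (simp add: Suc_le_eq card_gt_0_iff)
  have XX: "\<omega> y \<in> XXk" for y by (rule poly_tensor_in[OF \<omega> subspace_XX])
  note frame_c[OF cC c(2) cN] and d = dual_c[OF cC c(2) cN]
  obtain \<kappa> where \<kappa>: "\<kappa> \<noteq> 0" "\<And>\<nu> \<omega> \<sigma>. \<omega> \<in> Alt2 k (CARD('n) - 1) \<Longrightarrow> \<sigma> \<in> inc_seqs k CARD('n) \<Longrightarrow>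
      \<kappa> * alt_inner k (trv k \<nu> \<omega>) (wform (b' c) \<sigma>) = (\<Sum>i=1..CARD('n). (\<nu> \<bullet> b' c i) * cf (b' c) \<omega> \<sigma> i)"
    using kappa_exists[OF cC c(2) cN] by blast
  have cfpoly: "(\<lambda>y. cf (b' c) (\<omega> y) \<sigma> i) \<in> polyP r" for \<sigma> i
    using poly_tensor_polys[OF \<omega> linear_cf] by (simp add: polys_UNIV)
  have cfcont: "continuous_on (fc c) (\<lambda>y. cf (b' c) (\<omega> y) \<sigma> i)" for \<sigma> i
    by (rule polyP_continuous[OF cfpoly])
  have "alt_inner k (trv k (nv v) (\<omega> x)) (wform (b' c) \<sigma>) = 0" if \<sigma>: "\<sigma> \<in> inc_seqs k CARD('n)" for \<sigma>
  proof -
    define h where "h y = alt_inner k (trv k (nv v) (\<omega> y)) (wform (b' c) \<sigma>)" for y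
    have hp: "h \<in> polyP r"
      using poly_tensor_polys[OF \<omega> linear_trace_coeff] by (simp add: polys_UNIV h_def[abs_def])
    have hz: "I c (\<lambda>y. p y * h y) = 0" if p: "p \<in> pd c" for p
    proof (cases "free_row CARD('n) k (card c - 1) \<sigma>")
      case False
      note pc = polys_continuous[OF p]
      have cfz: "I c (\<lambda>y. p y * cf (b' c) (\<omega> y) \<sigma> i) = 0" if i: "i \<in> {card c..CARD('n)}" for i
      proof (cases "free_index CARD('n) k (\<sigma>, i)")
        case True
        then show ?thesis using bz p False i c1 \<sigma> by (auto simp: normal_block_def)
      next
        case nf: False
        have i': "i \<in> {card c - 1 + 1..CARD('n)}" using i c1 by auto
        note nb = XX_normal_block[OF XX k(1) kN \<sigma> False i' nf]
        have "I c (\<lambda>y. p y * cf (b' c) (\<omega> y) \<sigma> i) =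
            I c (\<lambda>y. \<Sum>j\<in>{1..CARD('n)} - \<sigma>. (- nsg i (\<sigma> - {i}) * nsg j (\<sigma> - {i})) *
              (p y * cf (b' c) (\<omega> y) (insert j (\<sigma> - {i})) j))"
          by (rule I_cong) (subst nb(2), simp add: sum_distrib_left sum_negf[symmetric] mult_ac)
        also have "\<dots> = (\<Sum>j\<in>{1..CARD('n)} - \<sigma>. (- nsg i (\<sigma> - {i}) * nsg j (\<sigma> - {i})) *
              I c (\<lambda>y. p y * cf (b' c) (\<omega> y) (insert j (\<sigma> - {i})) j))"
          unfolding I_cmult[symmetric]
          by (rule I_sum[OF cC c(2)]) (intro continuous_intros pc cfcont)
        also have "\<dots> = 0"
          using nb(3) bz p by (intro sum.neutral) auto
        finally show ?thesis .
      qed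
      have "\<kappa> * I c (\<lambda>y. p y * h y) = I c (\<lambda>y. p y * (\<kappa> * h y))"
        unfolding I_cmult[symmetric] by (rule I_cong) simp
      also have "\<dots> = I c (\<lambda>y. \<Sum>i\<in>{card c..CARD('n)}. (nv v \<bullet> b' c i) * (p y * cf (b' c) (\<omega> y) \<sigma> i))"
        unfolding h_def \<kappa>(2)[OF XX_Alt2[OF XX] \<sigma>] row_sum[OF cC c(2) cN v c(1)]
        by (rule I_cong) (simp add: sum_distrib_left mult_ac)
      also have "\<dots> = (\<Sum>i\<in>{card c..CARD('n)}. (nv v \<bullet> b' c i) * I c (\<lambda>y. p y * cf (b' c) (\<omega> y) \<sigma> i))"
        unfolding I_cmult[symmetric]
        by (rule I_sum[OF cC c(2)]) (intro continuous_intros pc cfcont)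
      also have "\<dots> = 0" using cfz by simp
      finally show ?thesis using \<kappa>(1) by simp
    qed (use cz p in \<open>simp add: h_def\<close>)
    have h0: "h y = 0" if "u \<in> c" "y \<in> fc (c - {u})" for u y
      using z[OF that] by (simp add: h_def alt_inner_def)
    show ?thesis
    proof (rule polyP_face_factor[OF C cC r hp h0])
      assume "\<And>x. x \<in> fc c \<Longrightarrow> h x = 0"
      then show ?thesis using x by (simp add: h_def)
    next
      fix q assume le: "card c \<le> r" and q: "q \<in> polyP (r - card c)"
        and hq: "\<And>x. x \<in> fc c \<Longrightarrow> h x = (\<Prod>v\<in>c. bary C x v) * q x"
      have e: "nat (int r - int (card c)) = r - card c" by simp
      have qp: "restr (fc c) q \<in> pd c" by (rule polysI) (use q le e in auto)
      have "I c (\<lambda>y. bprod c y * (q y * q y)) = I c (\<lambda>y. restr (fc c) q y * h y)"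
        by (rule I_cong) (simp add: hq bprod_def mult_ac)
      then have "I c (\<lambda>y. bprod c y * (q y * q y)) = 0" using hz[OF qp] by simp
      then have "bprod c x * (q x * q x) = 0"
        by (intro I_definite[OF cC c(2) _ mult_nonneg_nonneg[OF bprod_nonneg[OF cC] zero_le_square] _ x]
          continuous_on_mult polyP_continuous[OF q] polyP_continuous[OF bprod_polyP[OF cC]])
      then show ?thesis using hq[OF x] by (auto simp: h_def bprod_def)
    qed
  qed
  then show ?thesis by (rule trv_zero[OF cC c(2) cN])
qed

text \<open>Induction on the number of vertices, starting from (a). Only DoFs on subsimplices of one
  facet enter, which is why the lemma gives both uniqueness on a simplex and single-valuedness
  across a facet.\<close>

lemma trace_vanishes_facet:
  assumes \<omega>: "\<omega> \<in> poly_tensor (int r) UNIV XXk" and v: "v \<in> C"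
    and az: "\<And>u. u \<in> C - {v} \<Longrightarrow> \<omega> u = 0"
    and bz: "\<And>c \<sigma> i p. c \<subseteq> C - {v} \<Longrightarrow> 2 \<le> card c \<Longrightarrow>
      free_index CARD('n) k (\<sigma>, i) \<Longrightarrow> (\<sigma>, i) \<in> normal_block CARD('n) k (card c - 1) \<Longrightarrow> p \<in> pd c \<Longrightarrow>
      I c (\<lambda>x. p x * cf (b' c) (\<omega> x) \<sigma> i) = 0"
    and cz: "\<And>c \<sigma> p. c \<subseteq> C - {v} \<Longrightarrow> 2 \<le> card c \<Longrightarrow> free_row CARD('n) k (card c - 1) \<sigma> \<Longrightarrow> p \<in> pd c \<Longrightarrow>
      I c (\<lambda>x. p x * alt_inner k (trv k (nv v) (\<omega> x)) (wform (b' c) \<sigma>)) = 0"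
    and c: "c \<subseteq> C - {v}" and x: "x \<in> fc c"
  shows "trv k (nv v) (\<omega> x) = 0"
  using c x
proof (induction "card c" arbitrary: c x rule: less_induct)
  case less
  have fc: "finite c" using fin less.prems by auto
  have ne: "c \<noteq> {}" using less.prems by auto
  show ?case
  proof (cases "card c = 1")
    case True
    then obtain u where "c = {u}" by (auto simp: card_1_singleton_iff)
    then show ?thesis using less.prems az linear_0[OF linear_trv] by auto
  next
    case False
    then have c2: "2 \<le> card c" using ne fc by (metis One_nat_def Suc_1 card_eq_0_iff le_SucE le_zero_eq not_less_eq_eq)
    show ?thesis
    proof (rule trace_vanishes[OF \<omega> v less.prems(1) ne bz[OF less.prems(1) c2] cz[OF less.prems(1) c2] _ less.prems(2)])
      fix u y assume u: "u \<in> c" "y \<in> fc (c - {u})"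
      then have "card (c - {u}) < card c" using fc by (intro psubset_card_mono) auto
      then show "trv k (nv v) (\<omega> y) = 0" using less.hyps[of "c - {u}" y] u less.prems(1) by auto
    qed auto
  qed
qed

text \<open>The row of \<sigma>, read as the vector \<open>?y\<close> in the dual frame, has
  products with the facet normals equal to traces up to \<kappa>. If these vanish on all facets
  through \<open>c\<close>, the vector is tangential, and pairing it with the normal vector
  \<open>b c i\<close> reads off the coefficient.\<close>

lemma normal_coeffs_vanish:
  assumes \<omega>: "\<omega> \<in> XXk" and c: "c \<subseteq> C" "c \<noteq> {}" "card c \<le> CARD('n)"
    and z: "\<And>v. v \<in> C - c \<Longrightarrow> trv k (nv v) \<omega> = 0"
    and \<sigma>: "\<sigma> \<in> inc_seqs k CARD('n)" and i: "i \<in> {card c..CARD('n)}"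
  shows "cf (b' c) \<omega> \<sigma> i = 0"
proof -
  note d = dual_c[OF c]
  have i1: "i \<in> {1..CARD('n)}" "i \<in> {card c - 1 + 1..CARD('n)}" using i c fin by (auto simp: Suc_le_eq card_gt_0_iff)
  obtain \<kappa> where \<kappa>: "\<kappa> \<noteq> 0" "\<And>\<nu> \<omega> \<sigma>. \<omega> \<in> Alt2 k (CARD('n) - 1) \<Longrightarrow> \<sigma> \<in> inc_seqs k CARD('n) \<Longrightarrow>
      \<kappa> * alt_inner k (trv k \<nu> \<omega>) (wform (b' c) \<sigma>) = (\<Sum>i=1..CARD('n). (\<nu> \<bullet> b' c i) * cf (b' c) \<omega> \<sigma> i)"
    using kappa_exists[OF c] by blast
  let ?y = "\<Sum>j=1..CARD('n). cf (b' c) \<omega> \<sigma> j *\<^sub>R b' c j"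
  have "nv v \<bullet> ?y = 0" if v: "v \<in> C - c" for v
  proof -
    have "nv v \<bullet> ?y = (\<Sum>j=1..CARD('n). (nv v \<bullet> b' c j) * cf (b' c) \<omega> \<sigma> j)"
      by (simp add: inner_sum_right mult.commute)
    also have "\<dots> = \<kappa> * alt_inner k (trv k (nv v) \<omega>) (wform (b' c) \<sigma>)"
      using \<kappa>(2)[OF XX_Alt2[OF \<omega>] \<sigma>] by simp
    also have "\<dots> = 0" by (simp add: z[OF v] alt_inner_def)
    finally show ?thesis .
  qed
  then have "?y \<in> tangent_space (fc c)" by (rule tangent_of_normals[OF c(1,2)])
  then have "b c i \<bullet> ?y = 0" using frame_c[OF c] i1 by (auto simp: frame_def)
  moreover have "b c i \<bullet> ?y = (\<Sum>j=1..CARD('n). if j = i then cf (b' c) \<omega> \<sigma> j else 0)"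
    unfolding inner_sum_right by (rule sum.cong) (use d i1 in \<open>auto simp: dual_vecs_def\<close>)
  ultimately show ?thesis using i1 by simp
qed

text \<open>At a vertex the tangent space is trivial and every index is normal, so the traces on the
  facets through the vertex determine all coefficients.\<close>

lemma XX_zero_of_traces:
  assumes \<omega>: "\<omega> \<in> XXk" and v: "v \<in> C" and z: "\<And>u. u \<in> C - {v} \<Longrightarrow> trv k (nv u) \<omega> = 0"
  shows "\<omega> = 0"
proof -
  have c: "{v} \<subseteq> C" "{v} \<noteq> {}" "card {v} \<le> CARD('n)" using v n by auto
  show ?thesis
  proof (rule Alt2_eq_0[OF XX_Alt2[OF \<omega>] dual_vecs_span[OF dual_c[OF c]]])
    fix \<sigma> \<rho> assume s: "\<sigma> \<in> inc_seqs k CARD('n)" and "\<rho> \<in> inc_seqs (CARD('n) - 1) CARD('n)"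
    then obtain i where i: "i \<in> {1..CARD('n)}" "\<rho> = {1..CARD('n)} - {i}" using inc_seqs_codim1 n by (metis One_nat_def Suc_1 Suc_leD)
    then have "cf (b' {v}) \<omega> \<sigma> i = 0"
      using normal_coeffs_vanish[OF \<omega> c z s, of i] by auto
    then show "\<omega> (blist (b' {v}) \<sigma>) (blist (b' {v}) \<rho>) = 0" by (simp add: cf_def i(2))
  qed
qed

end

section \<open>Finite dimension\<close>

lemma Alt2_finite_span:
  obtains S :: "'n::{finite,linorder} form2 set" where "finite S" "Alt2 j m \<subseteq> span S"
proof -
  let ?e = "std_vec :: nat \<Rightarrow> 'n Rn" and ?I = "\<lambda>j. inc_seqs j CARD('n)"
  let ?S = "(\<lambda>(\<sigma>, \<rho>). tensor (wform ?e \<sigma>) (wform ?e \<rho>)) ` (?I j \<times> ?I m)"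
  have "tensor \<alpha> \<beta> \<in> span ?S" if a: "\<alpha> \<in> Alt j" and b: "\<beta> \<in> Alt m" for \<alpha> \<beta> :: "'n form"
  proof -
    have "tensor \<alpha> \<beta> = (\<Sum>\<sigma>\<in>?I j. \<Sum>\<rho>\<in>?I m. (\<alpha> (blist ?e \<sigma>) * \<beta> (blist ?e \<rho>)) *\<^sub>R tensor (wform ?e \<sigma>) (wform ?e \<rho>))"
    proof (intro ext)
      fix ws vs
      have "tensor \<alpha> \<beta> ws vs = (\<Sum>\<sigma>\<in>?I j. \<alpha> (blist ?e \<sigma>) * wform ?e \<sigma> ws) * (\<Sum>\<rho>\<in>?I m. \<beta> (blist ?e \<rho>) * wform ?e \<rho> vs)"
        unfolding Alt_expand[OF dual_vecs_std a, symmetric] Alt_expand[OF dual_vecs_std b, symmetric]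
        by (simp add: tensor_def)
      then show "tensor \<alpha> \<beta> ws vs = (\<Sum>\<sigma>\<in>?I j. \<Sum>\<rho>\<in>?I m. (\<alpha> (blist ?e \<sigma>) * \<beta> (blist ?e \<rho>)) *\<^sub>R tensor (wform ?e \<sigma>) (wform ?e \<rho>)) ws vs"
        by (simp add: fun_sum_apply tensor_def sum_product mult_ac)
    qed
    also have "\<dots> \<in> span ?S" by (intro span_sum span_scale span_base) auto
    finally show ?thesis .
  qed
  then have "Alt2 j m \<subseteq> span ?S" unfolding Alt2_def by (intro span_minimal) auto
  then show ?thesis using that[of ?S] by simp
qed

lemma poly_tensor_finite_span:
  assumes "W \<subseteq> span S2" "finite S2"
  obtains S where "finite S" "poly_tensor d f W \<subseteq> span S"
proof -
  obtain S1 where S1: "finite S1" "polys d f = span S1" by (rule polys_span)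
  let ?S = "(\<lambda>(q, w). \<lambda>x. q x *\<^sub>R w) ` (S1 \<times> S2)"
  have 1: "(\<lambda>x. q x *\<^sub>R w) \<in> span ?S" if q: "q \<in> S1" and w: "w \<in> span S2" for q w
    using w
  proof (induction rule: span_induct_alt)
    case base
    then show ?case using span_zero[of ?S] by (simp add: zero_fun_def)
  next
    case (step c x w)
    have "(\<lambda>u. q u *\<^sub>R (c *\<^sub>R x + w)) = c *\<^sub>R (\<lambda>u. q u *\<^sub>R x) + (\<lambda>u. q u *\<^sub>R w)"
      by (simp add: fun_eq_iff algebra_simps)
    moreover have "(\<lambda>u. q u *\<^sub>R x) \<in> span ?S" using q step(1) by (intro span_base) auto
    ultimately show ?case using step(2) by (simp only: span_add span_scale)
  qed
  have 2: "(\<lambda>x. q x *\<^sub>R w) \<in> span ?S" if q: "q \<in> span S1" and w: "w \<in> span S2" for q w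
    using q
  proof (induction rule: span_induct_alt)
    case base
    then show ?case using span_zero[of ?S] by (simp add: zero_fun_def)
  next
    case (step c x q)
    have "(\<lambda>u. (c *\<^sub>R x + q) u *\<^sub>R w) = c *\<^sub>R (\<lambda>u. x u *\<^sub>R w) + (\<lambda>u. q u *\<^sub>R w)"
      by (simp add: fun_eq_iff algebra_simps)
    then show ?case using step(2) 1[OF step(1) w] by (simp only: span_add span_scale)
  qed
  have "poly_tensor d f W \<subseteq> span ?S"
    unfolding poly_tensor_def using 2 assms(1) S1(2) by (intro span_minimal) auto
  then show ?thesis using that[of ?S] S1(1) assms(2) by simp
qed

context simplex_dofs
begin

section \<open>Pairings with generators of the test spaces\<close>

lemma linear_eval: "linear (\<lambda>\<omega> :: 'n form2. \<omega> ws vs)" "linear (\<lambda>\<omega> :: 'n form. \<omega> ws)"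
  by (auto intro!: linearI)

lemma poly_tensor_cont2: "\<omega> \<in> poly_tensor d f W \<Longrightarrow> g \<subseteq> f \<Longrightarrow> continuous_on g (\<lambda>x. \<omega> x ws vs)"
  for \<omega> :: "'n Rn \<Rightarrow> 'n form2"
  using polys_continuous[OF poly_tensor_polys[OF _ linear_eval(1)]] continuous_on_subset by blast

lemma poly_tensor_cont1: "\<omega> \<in> poly_tensor d f W \<Longrightarrow> g \<subseteq> f \<Longrightarrow> continuous_on g (\<lambda>x. \<omega> x ws)"
  for \<omega> :: "'n Rn \<Rightarrow> 'n form"
  using polys_continuous[OF poly_tensor_polys[OF _ linear_eval(2)]] continuous_on_subset by blast

lemma alt2_inner_cont:
  assumes "\<And>ws vs. continuous_on g (\<lambda>x. \<omega> x ws vs)" "\<And>ws vs. continuous_on g (\<lambda>x. \<eta> x ws vs)"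
  shows "continuous_on g (\<lambda>x. alt2_inner j m (\<omega> x) (\<eta> x :: 'n form2))"
  unfolding alt2_inner_def by (intro continuous_on_sum continuous_on_mult assms)

lemma alt_inner_cont:
  assumes "\<And>ws. continuous_on g (\<lambda>x. \<omega> x ws)" "\<And>ws. continuous_on g (\<lambda>x. \<eta> x ws)"
  shows "continuous_on g (\<lambda>x. alt_inner j (\<omega> x) (\<eta> x :: 'n form))"
  unfolding alt_inner_def by (intro continuous_on_sum continuous_on_mult assms)

lemma alt2_inner_add_right: "alt2_inner j m \<omega> (x + y) = alt2_inner j m \<omega> x + alt2_inner j m \<omega> (y :: 'n form2)"
  and alt2_inner_scale_right: "alt2_inner j m \<omega> (a *\<^sub>R x) = a * alt2_inner j m \<omega> x"
  and alt2_inner_add_left: "alt2_inner j m (x + y) \<omega> = alt2_inner j m x \<omega> + alt2_inner j m y \<omega>"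
  and alt2_inner_scale_left: "alt2_inner j m (a *\<^sub>R x) \<omega> = a * alt2_inner j m x \<omega>"
  and alt2_inner_commute: "alt2_inner j m x y = alt2_inner j m y x"
  by (simp_all add: alt2_inner_def sum.distrib algebra_simps sum_distrib_left)

lemma alt_inner_add_right: "alt_inner j \<omega> (x + y) = alt_inner j \<omega> x + alt_inner j \<omega> (y :: 'n form)"
  and alt_inner_scale_right: "alt_inner j \<omega> (a *\<^sub>R x) = a * alt_inner j \<omega> x"
  by (simp_all add: alt_inner_def sum.distrib algebra_simps sum_distrib_left)

lemma L2_pair2_I: "L2_pair2 k (fc c) \<omega> \<eta> = I c (\<lambda>x. alt2_inner k (CARD('n) - 1) (\<omega> x) (\<eta> x))"
  by (simp add: L2_pair2_def I_def)

lemma L2_pair_I: "L2_pair k (fc c) \<omega> \<eta> = I c (\<lambda>x. alt_inner k (\<omega> x) (\<eta> x))"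
  by (simp add: L2_pair_def I_def)

lemma pair_b_generator:
  assumes "\<And>x. x \<in> fc c \<Longrightarrow> \<omega> x \<in> XXk"
  shows "L2_pair2 k (fc c) \<omega> (\<lambda>x. p x *\<^sub>R tform (b' c) \<sigma> i) = I c (\<lambda>x. p x * cf (b' c) (\<omega> x) \<sigma> i)"
  unfolding L2_pair2_I
  by (rule I_cong) (simp only: alt2_inner_scale_right alt2_inner_tform[OF XX_Alt2[OF assms]])

lemma pair_c_generator:
  assumes "c \<subseteq> C - {v}"
  shows "L2_pair k (fc c) (trace_div k (nv v) (fc (C - {v})) \<omega>) (\<lambda>x. p x *\<^sub>R wform (b' c) \<sigma>) =
    I c (\<lambda>x. p x * alt_inner k (trv k (nv v) (\<omega> x)) (wform (b' c) \<sigma>))"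
  unfolding L2_pair_I
  by (rule I_cong) (use fc_mono[OF assms] in \<open>auto simp: alt_inner_scale_right trace_div_eq\<close>)

text \<open>The DoFs (b) on \<open>c\<close>, tested on the generators \<open>p\<close> times
  \<open>tform\<close>, with prescribed values \<open>L\<close>. In \<open>matchC\<close> the facets
  containing \<open>c\<close> are indexed by the vertices \<open>v\<close> outside \<open>c\<close>
  opposite to them.\<close>

definition matchB where
  "matchB c \<omega> L \<longleftrightarrow> (\<forall>\<sigma> i p. free_index CARD('n) k (\<sigma>, i) \<longrightarrow> (\<sigma>, i) \<in> normal_block CARD('n) k (card c - 1) \<longrightarrow>
    p \<in> pd c \<longrightarrow> I c (\<lambda>x. p x * cf (b' c) (\<omega> x) \<sigma> i) = L \<sigma> i p)"

definition matchC where
  "matchC c \<omega> L \<longleftrightarrow> (\<forall>v \<sigma> p. v \<in> C - c \<longrightarrow> free_row CARD('n) k (card c - 1) \<sigma> \<longrightarrow> p \<in> pd c \<longrightarrow>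
    I c (\<lambda>x. p x * alt_inner k (trv k (nv v) (\<omega> x)) (wform (b' c) \<sigma>)) = L v \<sigma> p)"

abbreviation tB where "tB c \<equiv> test_b k r (card c - 1) (fc c) (dyh (fc c))"
abbreviation tC where "tC c \<equiv> test_c k r (card c - 1) (fc c) (dyh (fc c))"

lemma test_b_eq:
  assumes c: "c \<subseteq> C" "c \<noteq> {}" "card c \<le> CARD('n)"
  shows "tB c = poly_tensor (int r - int (card c)) (fc c)
    (span {tform (b' c) \<sigma> i | \<sigma> i. free_index CARD('n) k (\<sigma>, i) \<and> (\<sigma>, i) \<in> normal_block CARD('n) k (card c - 1)})"
proof -
  have "card c \<ge> 1" using fin c by (simp add: Suc_le_eq card_gt_0_iff)
  then have d: "int (card c - 1) + 1 = int (card c)" by simp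
  have "tensor (form_at (dyh (fc c)) \<sigma>) (star_form (dyh (fc c)) i) = tform (b' c) \<sigma> i"
    if "\<sigma> \<in> inc_seqs k CARD('n)" for \<sigma> i
    using frame_c[OF c] by (intro tform_eq[OF _ that]) (auto simp: frame_def)
  then have "{tensor (form_at (dyh (fc c)) \<sigma>) (star_form (dyh (fc c)) i) | \<sigma> i.
       free_index CARD('n) k (\<sigma>, i) \<and> (\<sigma>, i) \<in> normal_block CARD('n) k (card c - 1)} =
     {tform (b' c) \<sigma> i | \<sigma> i. free_index CARD('n) k (\<sigma>, i) \<and> (\<sigma>, i) \<in> normal_block CARD('n) k (card c - 1)}"
    by (intro Collect_cong ex_cong1) (auto simp: normal_block_def)
  then show ?thesis unfolding test_b_def d by simp
qed

lemma test_c_eq: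
  assumes c: "c \<subseteq> C" "c \<noteq> {}" "card c \<le> CARD('n)"
  shows "tC c = poly_tensor (int r - int (card c)) (fc c)
    (span {wform (b' c) \<sigma> | \<sigma>. free_row CARD('n) k (card c - 1) \<sigma>})"
proof -
  have "card c \<ge> 1" using fin c by (simp add: Suc_le_eq card_gt_0_iff)
  then have d: "int (card c - 1) + 1 = int (card c)" by simp
  have "form_at (dyh (fc c)) \<sigma> = wform (b' c) \<sigma>" if "\<sigma> \<in> inc_seqs k CARD('n)" for \<sigma>
    using frame_c[OF c] inc_seqsD[OF that] by (intro form_at_eq) (auto simp: frame_def)
  then have "{form_at (dyh (fc c)) \<sigma> | \<sigma>. free_row CARD('n) k (card c - 1) \<sigma>} =
     {wform (b' c) \<sigma> | \<sigma>. free_row CARD('n) k (card c - 1) \<sigma>}"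
    by (intro Collect_cong ex_cong1) (auto simp: free_row_def)
  then show ?thesis unfolding test_c_def d by simp
qed

lemma matchB_iff:
  assumes c: "c \<subseteq> C" "c \<noteq> {}" "card c \<le> CARD('n)"
    and \<omega>: "\<omega> \<in> poly_XX k r (fc C)" and L: "linear L"
  shows "(\<forall>\<eta>\<in>tB c. L2_pair2 k (fc c) \<omega> \<eta> = L \<eta>) \<longleftrightarrow>
    matchB c \<omega> (\<lambda>\<sigma> i p. L (\<lambda>x. p x *\<^sub>R tform (b' c) \<sigma> i))"
proof -
  have XX: "\<omega> x \<in> XXk" for x using \<omega> unfolding poly_XX_def by (rule poly_tensor_in) (rule subspace_XX)
  note gen = pair_b_generator[where \<omega> = \<omega>, OF XX]
  have wc: "continuous_on (fc c) (\<lambda>x. \<omega> x ws vs)" for ws vs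
    using poly_tensor_cont2[OF \<omega>[unfolded poly_XX_def] fc_mono[OF c(1)]] .
  show ?thesis
  proof
    assume l: "\<forall>\<eta>\<in>tB c. L2_pair2 k (fc c) \<omega> \<eta> = L \<eta>"
    show "matchB c \<omega> (\<lambda>\<sigma> i p. L (\<lambda>x. p x *\<^sub>R tform (b' c) \<sigma> i))"
      unfolding matchB_def
    proof (intro allI impI)
      fix \<sigma> i p assume a: "free_index CARD('n) k (\<sigma>, i)" "(\<sigma>, i) \<in> normal_block CARD('n) k (card c - 1)" "p \<in> pd c"
      have "(\<lambda>x. p x *\<^sub>R tform (b' c) \<sigma> i) \<in> tB c"
        unfolding test_b_eq[OF c] using a by (intro poly_tensor_base span_base) auto
      then show "I c (\<lambda>x. p x * cf (b' c) (\<omega> x) \<sigma> i) = L (\<lambda>x. p x *\<^sub>R tform (b' c) \<sigma> i)"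
        using l unfolding gen[symmetric] by blast
    qed
  next
    assume m: "matchB c \<omega> (\<lambda>\<sigma> i p. L (\<lambda>x. p x *\<^sub>R tform (b' c) \<sigma> i))"
    show "\<forall>\<eta>\<in>tB c. L2_pair2 k (fc c) \<omega> \<eta> = L \<eta>"
      unfolding test_b_eq[OF c]
    proof (intro ballI, rule poly_tensor_span_cong[OF L])
      fix x y
      assume "x \<in> poly_tensor (int r - int (card c)) (fc c) (span {tform (b' c) \<sigma> i | \<sigma> i. free_index CARD('n) k (\<sigma>, i) \<and> (\<sigma>, i) \<in> normal_block CARD('n) k (card c - 1)})"
        "y \<in> poly_tensor (int r - int (card c)) (fc c) (span {tform (b' c) \<sigma> i | \<sigma> i. free_index CARD('n) k (\<sigma>, i) \<and> (\<sigma>, i) \<in> normal_block CARD('n) k (card c - 1)})"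
      from this[THEN poly_tensor_cont2, OF order_refl]
      show "L2_pair2 k (fc c) \<omega> (x + y) = L2_pair2 k (fc c) \<omega> x + L2_pair2 k (fc c) \<omega> y"
        unfolding L2_pair2_I plus_fun_apply alt2_inner_add_right
        by (intro I_add c alt2_inner_cont wc)
    next
      fix a x
      show "L2_pair2 k (fc c) \<omega> (a *\<^sub>R x) = a * L2_pair2 k (fc c) \<omega> x"
        unfolding L2_pair2_I fun_scaleR_apply alt2_inner_scale_right by (rule I_cmult)
    next
      fix p g assume p: "p \<in> pd c" and "g \<in> {tform (b' c) \<sigma> i | \<sigma> i. free_index CARD('n) k (\<sigma>, i) \<and> (\<sigma>, i) \<in> normal_block CARD('n) k (card c - 1)}"
      then obtain \<sigma> i where g: "g = tform (b' c) \<sigma> i" "free_index CARD('n) k (\<sigma>, i)" "(\<sigma>, i) \<in> normal_block CARD('n) k (card c - 1)"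
        by auto
      show "L2_pair2 k (fc c) \<omega> (\<lambda>x. p x *\<^sub>R g) = L (\<lambda>x. p x *\<^sub>R g)"
        unfolding g(1) gen using m p g(2,3) unfolding matchB_def by blast
    qed
  qed
qed

lemma trv_cont:
  assumes \<omega>: "\<omega> \<in> poly_tensor (int r) f XXk" and g: "g \<subseteq> f"
  shows "continuous_on g (\<lambda>x. trv k \<nu> (\<omega> x) ws)"
proof -
  have "linear (\<lambda>\<omega>. trv k \<nu> \<omega> ws)"
    using linear_compose[OF linear_trv linear_eval(2)] by (simp add: o_def)
  from polys_continuous[OF poly_tensor_polys[OF \<omega> this]] g show ?thesis by (rule continuous_on_subset)
qed

lemma matchC_iff:
  assumes c: "c \<subseteq> C" "c \<noteq> {}" "card c \<le> CARD('n)"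
    and \<omega>: "\<omega> \<in> poly_XX k r (fc C)" and L: "\<And>v. linear (L v)"
  shows "(\<forall>v\<in>C - c. \<forall>\<eta>\<in>tC c. L2_pair k (fc c) (trace_div k (nv v) (fc (C - {v})) \<omega>) \<eta> = L v \<eta>) \<longleftrightarrow>
    matchC c \<omega> (\<lambda>v \<sigma> p. L v (\<lambda>x. p x *\<^sub>R wform (b' c) \<sigma>))"
proof -
  have cv: "c \<subseteq> C - {v}" if "v \<in> C - c" for v using that c by auto
  note gen = pair_c_generator[OF cv]
  have wc: "continuous_on (fc c) (\<lambda>x. trace_div k (nv v) (fc (C - {v})) \<omega> x ws)" if v: "v \<in> C - c" for ws v
  proof (rule continuous_on_eq)
    show "continuous_on (fc c) (\<lambda>x. trv k (nv v) (\<omega> x) ws)"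
      by (rule trv_cont[OF \<omega>[unfolded poly_XX_def] fc_mono[OF c(1)]])
  qed (use fc_mono[OF cv[OF v]] in \<open>auto simp: trace_div_eq\<close>)
  show ?thesis
  proof
    assume l: "\<forall>v\<in>C - c. \<forall>\<eta>\<in>tC c. L2_pair k (fc c) (trace_div k (nv v) (fc (C - {v})) \<omega>) \<eta> = L v \<eta>"
    show "matchC c \<omega> (\<lambda>v \<sigma> p. L v (\<lambda>x. p x *\<^sub>R wform (b' c) \<sigma>))"
      unfolding matchC_def
    proof (intro allI impI)
      fix v \<sigma> p assume v: "v \<in> C - c" and a: "free_row CARD('n) k (card c - 1) \<sigma>" "p \<in> pd c"
      have "(\<lambda>x. p x *\<^sub>R wform (b' c) \<sigma>) \<in> tC c"
        unfolding test_c_eq[OF c] using a by (intro poly_tensor_base span_base) auto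
      then show "I c (\<lambda>x. p x * alt_inner k (trv k (nv v) (\<omega> x)) (wform (b' c) \<sigma>)) = L v (\<lambda>x. p x *\<^sub>R wform (b' c) \<sigma>)"
        using l v unfolding gen[OF v, symmetric] by blast
    qed
  next
    assume m: "matchC c \<omega> (\<lambda>v \<sigma> p. L v (\<lambda>x. p x *\<^sub>R wform (b' c) \<sigma>))"
    show "\<forall>v\<in>C - c. \<forall>\<eta>\<in>tC c. L2_pair k (fc c) (trace_div k (nv v) (fc (C - {v})) \<omega>) \<eta> = L v \<eta>"
      unfolding test_c_eq[OF c]
    proof (intro ballI, rule poly_tensor_span_cong[OF L])
      fix v x y assume v: "v \<in> C - c"
      assume "x \<in> poly_tensor (int r - int (card c)) (fc c) (span {wform (b' c) \<sigma> | \<sigma>. free_row CARD('n) k (card c - 1) \<sigma>})"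
        "y \<in> poly_tensor (int r - int (card c)) (fc c) (span {wform (b' c) \<sigma> | \<sigma>. free_row CARD('n) k (card c - 1) \<sigma>})"
      from this[THEN poly_tensor_cont1, OF order_refl]
      show "L2_pair k (fc c) (trace_div k (nv v) (fc (C - {v})) \<omega>) (x + y) =
          L2_pair k (fc c) (trace_div k (nv v) (fc (C - {v})) \<omega>) x + L2_pair k (fc c) (trace_div k (nv v) (fc (C - {v})) \<omega>) y"
        unfolding L2_pair_I plus_fun_apply alt_inner_add_right
        by (intro I_add c alt_inner_cont wc[OF v])
    next
      fix v a x
      show "L2_pair k (fc c) (trace_div k (nv v) (fc (C - {v})) \<omega>) (a *\<^sub>R x) =
          a * L2_pair k (fc c) (trace_div k (nv v) (fc (C - {v})) \<omega>) x"
        unfolding L2_pair_I fun_scaleR_apply alt_inner_scale_right by (rule I_cmult)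
    next
      fix v p g assume v: "v \<in> C - c" and p: "p \<in> pd c" and "g \<in> {wform (b' c) \<sigma> | \<sigma>. free_row CARD('n) k (card c - 1) \<sigma>}"
      then obtain \<sigma> where g: "g = wform (b' c) \<sigma>" "free_row CARD('n) k (card c - 1) \<sigma>" by auto
      show "L2_pair k (fc c) (trace_div k (nv v) (fc (C - {v})) \<omega>) (\<lambda>x. p x *\<^sub>R g) = L v (\<lambda>x. p x *\<^sub>R g)"
        unfolding g(1) gen[OF v] using m p g(2) v unfolding matchC_def by blast
    qed
  qed
qed

section \<open>Corrections supported around one face\<close>

text \<open>The free coefficients in the frame of \<open>c\<close> are prescribed one by one. In
  rows of the normal constraint block they are the Riesz representatives of the values for (b). In a
  free row they form the sum of the \<open>QB v \<sigma>\<close> times \<open>z v\<close>, where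
  \<open>z\<close> is biorthogonal to the facet normals, so that the trace on the facet opposite
  \<open>v\<close> sees only \<open>QB v \<sigma>\<close>. All of them contain the bubble of
  \<open>c\<close>, so \<open>W\<close> vanishes with it.\<close>

lemma correction:
  assumes c: "c \<subseteq> C" "c \<noteq> {}" "card c \<le> CARD('n)"
    and la_add: "\<And>\<sigma> i p q. p \<in> pd c \<Longrightarrow> q \<in> pd c \<Longrightarrow> la \<sigma> i (p + q) = la \<sigma> i p + la \<sigma> i q"
    and la_scale: "\<And>\<sigma> i a p. p \<in> pd c \<Longrightarrow> la \<sigma> i (a *\<^sub>R p) = a * la \<sigma> i p"
    and lb_add: "\<And>v \<sigma> p q. p \<in> pd c \<Longrightarrow> q \<in> pd c \<Longrightarrow> lb v \<sigma> (p + q) = lb v \<sigma> p + lb v \<sigma> q"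
    and lb_scale: "\<And>v \<sigma> a p. p \<in> pd c \<Longrightarrow> lb v \<sigma> (a *\<^sub>R p) = a * lb v \<sigma> p"
  shows "\<exists>W\<in>poly_XX k r (fc C). (\<forall>x. bprod c x = 0 \<longrightarrow> W x = 0) \<and> matchB c W la \<and> matchC c W lb"
proof -
  note d = dual_c[OF c]
  obtain \<kappa> where \<kappa>: "\<kappa> \<noteq> 0" "\<And>\<nu> \<omega> \<sigma>. \<omega> \<in> Alt2 k (CARD('n) - 1) \<Longrightarrow> \<sigma> \<in> inc_seqs k CARD('n) \<Longrightarrow>
      \<kappa> * alt_inner k (trv k \<nu> \<omega>) (wform (b' c) \<sigma>) = (\<Sum>i=1..CARD('n). (\<nu> \<bullet> b' c i) * cf (b' c) \<omega> \<sigma> i)"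
    using kappa_exists[OF c] by blast
  have "\<exists>Q\<in>polyP r. (\<forall>x. bprod c x = 0 \<longrightarrow> Q x = 0) \<and> (\<forall>p\<in>pd c. I c (\<lambda>x. p x * Q x) = la \<sigma> i p)" for \<sigma> i
    by (rule riesz_face[OF c(1,2) la_add la_scale])
  then obtain QA where QA: "\<And>\<sigma> i. QA \<sigma> i \<in> polyP r" "\<And>\<sigma> i x. bprod c x = 0 \<Longrightarrow> QA \<sigma> i x = 0"
    "\<And>\<sigma> i p. p \<in> pd c \<Longrightarrow> I c (\<lambda>x. p x * QA \<sigma> i x) = la \<sigma> i p" by metis
  \<comment> \<open>The factor \<kappa> compensates the one between a coefficient of the trace and
    the sum over the row.\<close>
  have "\<exists>Q\<in>polyP r. (\<forall>x. bprod c x = 0 \<longrightarrow> Q x = 0) \<and> (\<forall>p\<in>pd c. I c (\<lambda>x. p x * Q x) = \<kappa> * lb v \<sigma> p)" for v \<sigma>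
    by (rule riesz_face[OF c(1,2)]) (simp_all add: lb_add lb_scale algebra_simps)
  then obtain QB where QB: "\<And>v \<sigma>. QB v \<sigma> \<in> polyP r" "\<And>v \<sigma> x. bprod c x = 0 \<Longrightarrow> QB v \<sigma> x = 0"
    "\<And>v \<sigma> p. p \<in> pd c \<Longrightarrow> I c (\<lambda>x. p x * QB v \<sigma> x) = \<kappa> * lb v \<sigma> p" by metis
  obtain w0 where w0: "w0 \<in> c" using c by auto
  \<comment> \<open>Scaled edges from a vertex \<open>w0\<close> of \<open>c\<close> to the vertices
    off \<open>c\<close>: such an edge lies in every facet through \<open>c\<close> except the one
    opposite its endpoint.\<close>
  define z where "z v = (1 / (nv v \<bullet> (v - w0))) *\<^sub>R (v - w0)" for v
  have nz: "nv u \<bullet> z v = (if u = v then 1 else 0)" if "u \<in> C - c" "v \<in> C - c" for u v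
  proof -
    have u: "u \<in> C" "w0 \<in> C - {u}" and v: "v \<in> C" "w0 \<in> C - {v}" using that w0 c by auto
    show ?thesis using nv_nonzero[OF v] nv_diff[OF u(1) _ u(2), of v] v by (auto simp: z_def)
  qed
  \<comment> \<open>Elements of the kernel whose matrix of free coefficients has a single entry 1;
    combining them with polynomial weights stays in the kernel pointwise.\<close>
  have "\<exists>w. w \<in> XXk \<and> (\<forall>\<sigma>' i'. free_index CARD('n) k (\<sigma>', i') \<longrightarrow> cf (b' c) w \<sigma>' i' = (if \<sigma>' = \<sigma> \<and> i' = i then 1 else 0))" for \<sigma> i
    by (rule XX_free_coeffs[OF d k(1) kN, of "\<lambda>\<sigma>' i'. if \<sigma>' = \<sigma> \<and> i' = i then 1 else 0"]) blast
  then obtain w where w: "\<And>\<sigma> i. w \<sigma> i \<in> XXk"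
    "\<And>\<sigma> i \<sigma>' i'. free_index CARD('n) k (\<sigma>', i') \<Longrightarrow> cf (b' c) (w \<sigma> i) \<sigma>' i' = (if \<sigma>' = \<sigma> \<and> i' = i then 1 else 0)"
    by metis
  let ?l = "card c - 1"
  define Q where "Q \<sigma> i = (if free_row CARD('n) k ?l \<sigma>
    then (\<lambda>x. \<Sum>v\<in>C - c. (z v \<bullet> b c i) * QB v \<sigma> x) else QA \<sigma> i)" for \<sigma> i
  have QP: "Q \<sigma> i \<in> polyP r" for \<sigma> i
    unfolding Q_def using QA(1) QB(1) by (auto intro!: polyP_sum polyP_cmult)
  have Q0: "Q \<sigma> i x = 0" if "bprod c x = 0" for \<sigma> i x
    using QA(2) QB(2) that by (simp add: Q_def)
  define FI where "FI = {\<iota> \<in> inc_seqs k CARD('n) \<times> {1..CARD('n)}. free_index CARD('n) k \<iota>}"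
  have FI: "finite FI" by (simp add: FI_def)
  define W where "W = (\<Sum>(\<sigma>, i)\<in>FI. (\<lambda>x. restr (fc C) (Q \<sigma> i) x *\<^sub>R w \<sigma> i))"
  have Wx: "W x = (\<Sum>(\<sigma>, i)\<in>FI. restr (fc C) (Q \<sigma> i) x *\<^sub>R w \<sigma> i)" for x
    unfolding W_def fun_sum_apply by (simp add: case_prod_unfold)
  have WP: "W \<in> poly_XX k r (fc C)"
    unfolding W_def poly_XX_def
  proof (intro subspace_sum subspace_poly_tensor, clarify)
    fix \<sigma> i
    have "restr (fc C) (Q \<sigma> i) \<in> polys (int r) (fc C)" using polysI[of "Q \<sigma> i" "int r" "fc C"] QP[of \<sigma> i] by simp
    then show "(\<lambda>x. restr (fc C) (Q \<sigma> i) x *\<^sub>R w \<sigma> i) \<in> poly_tensor (int r) (fc C) XXk"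
      by (rule poly_tensor_base) (rule w(1))
  qed
  have WXX: "W x \<in> XXk" for x using WP unfolding poly_XX_def by (rule poly_tensor_in) (rule subspace_XX)
  have cfW: "cf (b' c) (W x) \<sigma> i = Q \<sigma> i x" if f: "free_index CARD('n) k (\<sigma>, i)" and x: "x \<in> fc C" for \<sigma> i x
  proof -
    have "(\<sigma>, i) \<in> FI" using f free_index_iff[OF k(1) kN] by (auto simp: FI_def)
    have "cf (b' c) (W x) \<sigma> i = (\<Sum>\<iota>\<in>FI. Q (fst \<iota>) (snd \<iota>) x * cf (b' c) (w (fst \<iota>) (snd \<iota>)) \<sigma> i)"
      unfolding Wx case_prod_unfold linear_sum[OF linear_cf] linear_cmul[OF linear_cf] using x by simp
    also have "\<dots> = (\<Sum>\<iota>\<in>FI. if \<iota> = (\<sigma>, i) then Q \<sigma> i x else 0)"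
      by (rule sum.cong) (auto simp: w(2)[OF f])
    also have "\<dots> = Q \<sigma> i x" using FI \<open>(\<sigma>, i) \<in> FI\<close> by simp
    finally show ?thesis .
  qed
  show ?thesis
  proof (intro bexI[OF _ WP] conjI allI impI)
    fix x assume "bprod c x = 0"
    then show "W x = 0" unfolding Wx by (intro sum.neutral) (auto simp: Q0)
  next
    show "matchB c W la"
      unfolding matchB_def
    proof (intro allI impI)
      fix \<sigma> i p assume a: "free_index CARD('n) k (\<sigma>, i)" "(\<sigma>, i) \<in> normal_block CARD('n) k ?l" "p \<in> pd c"
      then have "\<not> free_row CARD('n) k ?l \<sigma>" by (simp add: normal_block_def)
      then have "I c (\<lambda>x. p x * cf (b' c) (W x) \<sigma> i) = I c (\<lambda>x. p x * QA \<sigma> i x)"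
        using fc_mono[OF c(1)] by (intro I_cong) (auto simp: cfW[OF a(1)] Q_def)
      then show "I c (\<lambda>x. p x * cf (b' c) (W x) \<sigma> i) = la \<sigma> i p" using QA(3)[OF a(3)] by simp
    qed
  next
    show "matchC c W lb"
      unfolding matchC_def
    proof (intro allI impI)
      fix v \<sigma> p assume v: "v \<in> C - c" and fr: "free_row CARD('n) k ?l \<sigma>" and p: "p \<in> pd c"
      have vC: "v \<in> C" "c \<subseteq> C - {v}" using v c by auto
      have \<sigma>: "\<sigma> \<in> inc_seqs k CARD('n)" using fr by (simp add: free_row_def)
      have c1: "card c \<ge> 1" using fin c by (simp add: Suc_le_eq card_gt_0_iff)
      \<comment> \<open>Expanding \<open>nv v\<close> in the frame gives its product with
        \<open>z u\<close> as a sum over all indices; the tangential ones drop out by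
        \<open>row_sum\<close>.\<close>
      have par: "(\<Sum>i\<in>{card c..CARD('n)}. (nv v \<bullet> b' c i) * (z u \<bullet> b c i)) = nv v \<bullet> z u" for u
      proof -
        have "nv v \<bullet> z u = (\<Sum>i=1..CARD('n). (nv v \<bullet> b' c i) *\<^sub>R b c i) \<bullet> z u"
          using dual_vecs_expand[OF d, of "nv v"] by simp
        also have "\<dots> = (\<Sum>i=1..CARD('n). (nv v \<bullet> b' c i) * (z u \<bullet> b c i))"
          unfolding inner_sum_left inner_scaleR_left
          by (intro sum.cong refl arg_cong2[of _ _ _ _ "(*)"] inner_commute)
        finally show ?thesis unfolding row_sum[OF c vC, symmetric] by (rule sym)
      qed
      have "alt_inner k (trv k (nv v) (W x)) (wform (b' c) \<sigma>) = QB v \<sigma> x / \<kappa>" if x: "x \<in> fc c" for x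
      proof -
        have xC: "x \<in> fc C" using x fc_mono[OF c(1)] by auto
        have "\<kappa> * alt_inner k (trv k (nv v) (W x)) (wform (b' c) \<sigma>) =
            (\<Sum>i\<in>{card c..CARD('n)}. (nv v \<bullet> b' c i) * cf (b' c) (W x) \<sigma> i)"
          unfolding \<kappa>(2)[OF XX_Alt2[OF WXX] \<sigma>] by (rule row_sum[OF c vC])
        also have "\<dots> = (\<Sum>i\<in>{card c..CARD('n)}. \<Sum>u\<in>C - c. (nv v \<bullet> b' c i) * (z u \<bullet> b c i) * QB u \<sigma> x)"
        proof (rule sum.cong[OF refl])
          fix i assume "i \<in> {card c..CARD('n)}"
          then have "free_index CARD('n) k (\<sigma>, i)" using free_row_free_index[OF k(1) kN fr, of i] c1 by auto
          then show "(nv v \<bullet> b' c i) * cf (b' c) (W x) \<sigma> i = (\<Sum>u\<in>C - c. (nv v \<bullet> b' c i) * (z u \<bullet> b c i) * QB u \<sigma> x)"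
            using fr xC by (simp add: cfW Q_def sum_distrib_left mult_ac)
        qed
        also have "\<dots> = (\<Sum>u\<in>C - c. (nv v \<bullet> z u) * QB u \<sigma> x)"
          by (subst sum.swap) (simp add: sum_distrib_right[symmetric] par)
        also have "\<dots> = (\<Sum>u\<in>C - c. if u = v then QB u \<sigma> x else 0)"
          by (rule sum.cong) (auto simp: nz[OF v])
        also have "\<dots> = QB v \<sigma> x" using v fin by simp
        finally show ?thesis using \<kappa>(1) by (simp add: field_simps)
      qed
      then have "I c (\<lambda>x. p x * alt_inner k (trv k (nv v) (W x)) (wform (b' c) \<sigma>)) = I c (\<lambda>x. (1 / \<kappa>) * (p x * QB v \<sigma> x))"
        by (intro I_cong) simp
      also have "\<dots> = lb v \<sigma> p" unfolding I_cmult QB(3)[OF p] using \<kappa>(1) by simp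
      finally show "I c (\<lambda>x. p x * alt_inner k (trv k (nv v) (W x)) (wform (b' c) \<sigma>)) = lb v \<sigma> p" .
    qed
  qed
qed

end

context simplex_dofs
begin

section \<open>Unisolvence\<close>

lemma poly_XX_XX: "\<omega> \<in> poly_XX k r f \<Longrightarrow> \<omega> x \<in> XXk"
  unfolding poly_XX_def by (erule poly_tensor_in) (rule subspace_XX)

lemma subspace_poly_XX: "subspace (poly_XX k r f)"
  by (simp add: poly_XX_def subspace_poly_tensor)

lemma poly_XX_zero: "\<omega> \<in> poly_XX k r f \<Longrightarrow> x \<notin> f \<Longrightarrow> \<omega> x = 0"
  unfolding poly_XX_def by (rule poly_tensor_outside)

lemma cf_cont: "\<omega> \<in> poly_XX k r (fc C) \<Longrightarrow> c \<subseteq> C \<Longrightarrow> continuous_on (fc c) (\<lambda>x. cf (b' c) (\<omega> x) \<sigma> i)"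
  unfolding poly_XX_def
  by (rule continuous_on_subset[OF polys_continuous[OF poly_tensor_polys[OF _ linear_cf]] fc_mono])

lemma trace_coeff_cont: "\<omega> \<in> poly_XX k r (fc C) \<Longrightarrow> c \<subseteq> C \<Longrightarrow>
    continuous_on (fc c) (\<lambda>x. alt_inner k (trv k \<nu> (\<omega> x)) \<beta>)"
  unfolding poly_XX_def
  by (rule continuous_on_subset[OF polys_continuous[OF poly_tensor_polys[OF _ linear_trace_coeff]] fc_mono])

text \<open>Residual form: \<eta> supplies what \<omega> is lacking. Equality is asked only on the
  face, as \<zeta> will carry further corrections that vanish there.\<close>

lemma matchB_add:
  assumes c: "c \<subseteq> C" "c \<noteq> {}" and \<omega>: "\<omega> \<in> poly_XX k r (fc C)" "\<eta> \<in> poly_XX k r (fc C)"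
    and e: "\<And>x. x \<in> fc c \<Longrightarrow> \<zeta> x = \<omega> x + \<eta> x"
    and m: "matchB c \<eta> (\<lambda>\<sigma> i p. L \<sigma> i p - I c (\<lambda>x. p x * cf (b' c) (\<omega> x) \<sigma> i))"
  shows "matchB c \<zeta> L"
  unfolding matchB_def
proof (intro allI impI)
  fix \<sigma> i p assume a: "free_index CARD('n) k (\<sigma>, i)" "(\<sigma>, i) \<in> normal_block CARD('n) k (card c - 1)" "p \<in> pd c"
  have "I c (\<lambda>x. p x * cf (b' c) (\<zeta> x) \<sigma> i) =
      I c (\<lambda>x. p x * cf (b' c) (\<omega> x) \<sigma> i + p x * cf (b' c) (\<eta> x) \<sigma> i)"
    by (rule I_cong) (simp add: e linear_add[OF linear_cf] algebra_simps)
  also have "\<dots> = I c (\<lambda>x. p x * cf (b' c) (\<omega> x) \<sigma> i) + I c (\<lambda>x. p x * cf (b' c) (\<eta> x) \<sigma> i)"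
    by (intro I_add c continuous_on_mult polys_continuous[OF a(3)] cf_cont \<omega>)
  finally show "I c (\<lambda>x. p x * cf (b' c) (\<zeta> x) \<sigma> i) = L \<sigma> i p"
    using m a by (simp add: matchB_def)
qed

lemma matchC_add:
  assumes c: "c \<subseteq> C" "c \<noteq> {}" and \<omega>: "\<omega> \<in> poly_XX k r (fc C)" "\<eta> \<in> poly_XX k r (fc C)"
    and e: "\<And>x. x \<in> fc c \<Longrightarrow> \<zeta> x = \<omega> x + \<eta> x"
    and m: "matchC c \<eta> (\<lambda>v \<sigma> p. L v \<sigma> p - I c (\<lambda>x. p x * alt_inner k (trv k (nv v) (\<omega> x)) (wform (b' c) \<sigma>)))"
  shows "matchC c \<zeta> L"
  unfolding matchC_def
proof (intro allI impI)
  fix v \<sigma> p assume a: "v \<in> C - c" "free_row CARD('n) k (card c - 1) \<sigma>" "p \<in> pd c"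
  let ?t = "\<lambda>\<omega> x. alt_inner k (trv k (nv v) (\<omega> x)) (wform (b' c) \<sigma>)"
  have "I c (\<lambda>x. p x * ?t \<zeta> x) = I c (\<lambda>x. p x * ?t \<omega> x + p x * ?t \<eta> x)"
    by (rule I_cong) (simp add: e linear_add[OF linear_trace_coeff] algebra_simps)
  also have "\<dots> = I c (\<lambda>x. p x * ?t \<omega> x) + I c (\<lambda>x. p x * ?t \<eta> x)"
    by (intro I_add c continuous_on_mult polys_continuous[OF a(3)] trace_coeff_cont \<omega>)
  finally show "I c (\<lambda>x. p x * ?t \<zeta> x) = L v \<sigma> p"
    using m a by (simp add: matchC_def)
qed

lemma matchB_cong: "(\<And>x. x \<in> fc c \<Longrightarrow> \<omega> x = \<eta> x) \<Longrightarrow> matchB c \<omega> L \<longleftrightarrow> matchB c \<eta> L"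
  unfolding matchB_def using I_cong[of c "\<lambda>x. _ x * cf (b' c) (\<omega> x) _ _" "\<lambda>x. _ x * cf (b' c) (\<eta> x) _ _"] by simp

lemma matchC_cong: "(\<And>x. x \<in> fc c \<Longrightarrow> \<omega> x = \<eta> x) \<Longrightarrow> matchC c \<omega> L \<longleftrightarrow> matchC c \<eta> L"
  unfolding matchC_def
  using I_cong[of c "\<lambda>x. _ x * alt_inner k (trv k (nv _) (\<omega> x)) _" "\<lambda>x. _ x * alt_inner k (trv k (nv _) (\<eta> x)) _"] by simp

lemma in_vertex: "v \<in> fc {v}"
  by simp

lemma interpolate_vertices:
  assumes A: "\<And>v. v \<in> C \<Longrightarrow> A v \<in> XXk"
  shows "\<exists>\<omega>\<in>poly_XX k r (fc C). \<forall>v\<in>C. \<omega> v = A v"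
proof -
  \<comment> \<open>The power \<open>r\<close> of the coordinate of \<open>v\<close> is 1 at
    \<open>v\<close> and, since \<open>r\<close> is at least 1, 0 at the other vertices.\<close>
  define \<omega> where "\<omega> = (\<Sum>v\<in>C. (\<lambda>x. restr (fc C) (\<lambda>x. bary C x v ^ r) x *\<^sub>R A v))"
  have "\<omega> \<in> poly_XX k r (fc C)"
    unfolding \<omega>_def poly_XX_def
  proof (intro subspace_sum subspace_poly_tensor)
    fix v assume v: "v \<in> C"
    have "(\<lambda>x. bary C x v ^ r) \<in> polyP r" using polyP_power[OF bary_polyP[OF C v], of r] by simp
    then have "restr (fc C) (\<lambda>x. bary C x v ^ r) \<in> polys (int r) (fc C)"
      using polysI[of "\<lambda>x. bary C x v ^ r" "int r" "fc C"] by simp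
    then show "(\<lambda>x. restr (fc C) (\<lambda>x. bary C x v ^ r) x *\<^sub>R A v) \<in> poly_tensor (int r) (fc C) XXk"
      by (rule poly_tensor_base) (rule A[OF v])
  qed
  moreover have "\<omega> u = A u" if u: "u \<in> C" for u
  proof -
    have "u \<in> fc C" using u by (rule hull_inc)
    then have "\<omega> u = (\<Sum>v\<in>C. bary C u v ^ r *\<^sub>R A v)" by (simp add: \<omega>_def fun_sum_apply)
    also have "\<dots> = (\<Sum>v\<in>C. if v = u then A v else 0)"
      by (rule sum.cong) (use r in \<open>auto simp: bary_vertex[OF C _ u] zero_power\<close>)
    finally show ?thesis using u fin by simp
  qed
  ultimately show ?thesis by blast
qed

text \<open>Induction on the number \<open>m\<close> of vertices of the faces already matched. All
  corrections for faces with one vertex more are added at once: each vanishes with its bubble, hence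
  on smaller faces and on the other faces of the same size, and leaves the DoFs there alone.\<close>

lemma interpolate_faces:
  assumes A: "\<And>v. v \<in> C \<Longrightarrow> A v \<in> XXk"
    and la_add: "\<And>c \<sigma> i p q. la c \<sigma> i (p + q) = la c \<sigma> i p + la c \<sigma> i q"
    and la_scale: "\<And>c \<sigma> i a p. la c \<sigma> i (a *\<^sub>R p) = a * la c \<sigma> i p"
    and lb_add: "\<And>c v \<sigma> p q. lb c v \<sigma> (p + q) = lb c v \<sigma> p + lb c v \<sigma> q"
    and lb_scale: "\<And>c v \<sigma> a p. lb c v \<sigma> (a *\<^sub>R p) = a * lb c v \<sigma> p"
    and m: "1 \<le> m" "m \<le> CARD('n)"
  shows "\<exists>\<omega>\<in>poly_XX k r (fc C). (\<forall>v\<in>C. \<omega> v = A v) \<and>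
    (\<forall>c. c \<subseteq> C \<longrightarrow> 2 \<le> card c \<longrightarrow> card c \<le> m \<longrightarrow> matchB c \<omega> (la c) \<and> matchC c \<omega> (lb c))"
  using m
proof (induction m rule: dec_induct)
  case base
  then show ?case using interpolate_vertices[OF A] by force
next
  case (step m)
  then obtain \<omega> where \<omega>: "\<omega> \<in> poly_XX k r (fc C)" "\<And>v. v \<in> C \<Longrightarrow> \<omega> v = A v"
    "\<And>c. c \<subseteq> C \<Longrightarrow> 2 \<le> card c \<Longrightarrow> card c \<le> m \<Longrightarrow> matchB c \<omega> (la c) \<and> matchC c \<omega> (lb c)" by auto
  let ?D = "{c. c \<subseteq> C \<and> card c = Suc m}"
  have fD: "finite ?D" by (rule finite_subset[of _ "Pow C"]) (use fin in auto)
  have D: "c \<noteq> {}" "card c \<le> CARD('n)" "2 \<le> card c" if "c \<in> ?D" for c using that step by auto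
  have ex: "\<exists>W\<in>poly_XX k r (fc C). (\<forall>x. bprod c x = 0 \<longrightarrow> W x = 0) \<and>
      matchB c W (\<lambda>\<sigma> i p. la c \<sigma> i p - I c (\<lambda>x. p x * cf (b' c) (\<omega> x) \<sigma> i)) \<and>
      matchC c W (\<lambda>v \<sigma> p. lb c v \<sigma> p - I c (\<lambda>x. p x * alt_inner k (trv k (nv v) (\<omega> x)) (wform (b' c) \<sigma>)))"
    if c: "c \<in> ?D" for c
  proof (rule correction)
    have cC: "c \<subseteq> C" using c by simp
    show "c \<subseteq> C" "c \<noteq> {}" "card c \<le> CARD('n)" using cC D[OF c] by auto
    fix \<sigma> i p q v assume p: "p \<in> pd c" and q: "q \<in> pd c"
    have "I c (\<lambda>x. (p + q) x * cf (b' c) (\<omega> x) \<sigma> i) =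
        I c (\<lambda>x. p x * cf (b' c) (\<omega> x) \<sigma> i) + I c (\<lambda>x. q x * cf (b' c) (\<omega> x) \<sigma> i)"
      unfolding plus_fun_apply distrib_right
      by (intro I_add cC D[OF c] continuous_on_mult polys_continuous[OF p] polys_continuous[OF q] cf_cont \<omega>)
    then show "la c \<sigma> i (p + q) - I c (\<lambda>x. (p + q) x * cf (b' c) (\<omega> x) \<sigma> i) =
      la c \<sigma> i p - I c (\<lambda>x. p x * cf (b' c) (\<omega> x) \<sigma> i) + (la c \<sigma> i q - I c (\<lambda>x. q x * cf (b' c) (\<omega> x) \<sigma> i))"
      by (simp only: la_add)
    have "I c (\<lambda>x. (p + q) x * alt_inner k (trv k (nv v) (\<omega> x)) (wform (b' c) \<sigma>)) =
        I c (\<lambda>x. p x * alt_inner k (trv k (nv v) (\<omega> x)) (wform (b' c) \<sigma>)) +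
        I c (\<lambda>x. q x * alt_inner k (trv k (nv v) (\<omega> x)) (wform (b' c) \<sigma>))"
      unfolding plus_fun_apply distrib_right
      by (intro I_add cC D[OF c] continuous_on_mult polys_continuous[OF p] polys_continuous[OF q] trace_coeff_cont \<omega>)
    then show "lb c v \<sigma> (p + q) - I c (\<lambda>x. (p + q) x * alt_inner k (trv k (nv v) (\<omega> x)) (wform (b' c) \<sigma>)) =
      lb c v \<sigma> p - I c (\<lambda>x. p x * alt_inner k (trv k (nv v) (\<omega> x)) (wform (b' c) \<sigma>)) +
      (lb c v \<sigma> q - I c (\<lambda>x. q x * alt_inner k (trv k (nv v) (\<omega> x)) (wform (b' c) \<sigma>)))"
      by (simp only: lb_add)
  next
    fix \<sigma> i a p v
    show "la c \<sigma> i (a *\<^sub>R p) - I c (\<lambda>x. (a *\<^sub>R p) x * cf (b' c) (\<omega> x) \<sigma> i) =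
      a * (la c \<sigma> i p - I c (\<lambda>x. p x * cf (b' c) (\<omega> x) \<sigma> i))"
      unfolding fun_scaleR_apply real_scaleR_def mult.assoc I_cmult la_scale by (simp only: right_diff_distrib)
    show "lb c v \<sigma> (a *\<^sub>R p) - I c (\<lambda>x. (a *\<^sub>R p) x * alt_inner k (trv k (nv v) (\<omega> x)) (wform (b' c) \<sigma>)) =
      a * (lb c v \<sigma> p - I c (\<lambda>x. p x * alt_inner k (trv k (nv v) (\<omega> x)) (wform (b' c) \<sigma>)))"
      unfolding fun_scaleR_apply real_scaleR_def mult.assoc I_cmult lb_scale by (simp only: right_diff_distrib)
  qed
  define corr where "corr c W \<longleftrightarrow> W \<in> poly_XX k r (fc C) \<and> (\<forall>x. bprod c x = 0 \<longrightarrow> W x = 0) \<and>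
      matchB c W (\<lambda>\<sigma> i p. la c \<sigma> i p - I c (\<lambda>x. p x * cf (b' c) (\<omega> x) \<sigma> i)) \<and>
      matchC c W (\<lambda>v \<sigma> p. lb c v \<sigma> p - I c (\<lambda>x. p x * alt_inner k (trv k (nv v) (\<omega> x)) (wform (b' c) \<sigma>)))"
    for c W
  have "\<forall>c\<in>?D. \<exists>W. corr c W" using ex unfolding corr_def Bex_def by (rule ballI)
  from bchoice[OF this] obtain W where "\<forall>c\<in>?D. corr c (W c)" by (elim exE)
  note Wc = bspec[OF this, unfolded corr_def]
  note W = Wc[THEN conjunct1] Wc[THEN conjunct2, THEN conjunct1, rule_format]
    Wc[THEN conjunct2, THEN conjunct2, THEN conjunct1] Wc[THEN conjunct2, THEN conjunct2, THEN conjunct2]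
  define \<omega>' where "\<omega>' = \<omega> + (\<Sum>c\<in>?D. W c)"
  have \<omega>': "\<omega>' \<in> poly_XX k r (fc C)"
    unfolding \<omega>'_def by (intro subspace_add subspace_sum subspace_poly_XX \<omega> W(1))
  have Wd: "W c x = 0" if "c \<in> ?D" "d \<subseteq> C" "\<not> c \<subseteq> d" "x \<in> fc d" for c d x
    using W(2)[OF that(1)] bprod_zero[OF _ that(2,3,4)] that(1) by blast
  have low: "\<omega>' x = \<omega> x" if d: "d \<subseteq> C" "card d \<le> m" and x: "x \<in> fc d" for d x
  proof -
    have "W c x = 0" if c: "c \<in> ?D" for c
    proof (rule Wd[OF c d(1) _ x])
      show "\<not> c \<subseteq> d" using card_mono[OF fin(2)[OF d(1)], of c] c d(2) by auto
    qed
    then show ?thesis by (simp add: \<omega>'_def fun_sum_apply)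
  qed
  have top: "\<omega>' x = \<omega> x + W d x" if d: "d \<in> ?D" and x: "x \<in> fc d" for d x
  proof -
    have dC: "d \<subseteq> C" using d by simp
    have "W c x = 0" if c: "c \<in> ?D - {d}" for c
    proof (rule Wd[OF _ dC _ x])
      show "\<not> c \<subseteq> d" using card_subset_eq[OF fin(2)[OF dC], of c] c d by auto
    qed (use c in auto)
    then have "(\<Sum>c\<in>?D. W c x) = (\<Sum>c\<in>{d}. W c x)"
      by (intro sum.mono_neutral_right fD) (use d in auto)
    then show ?thesis by (simp add: \<omega>'_def fun_sum_apply)
  qed
  show ?case
  proof (intro bexI[OF _ \<omega>'] conjI ballI allI impI)
    fix v assume v: "v \<in> C"
    have "\<omega>' v = \<omega> v" by (rule low[of "{v}"]) (use v step in auto)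
    then show "\<omega>' v = A v" using \<omega>(2)[OF v] by simp
  next
    fix c assume c: "c \<subseteq> C" "2 \<le> card c" "card c \<le> Suc m"
    show "matchB c \<omega>' (la c)"
    proof (cases "card c = Suc m")
      case True
      then have cD: "c \<in> ?D" using c by simp
      show ?thesis by (rule matchB_add[OF c(1) D(1)[OF cD] \<omega>(1) W(1)[OF cD] top[OF cD] W(3)[OF cD]])
    next
      case False
      then have cm: "card c \<le> m" using c by simp
      have "matchB c \<omega>' (la c) \<longleftrightarrow> matchB c \<omega> (la c)" by (rule matchB_cong) (rule low[OF c(1) cm])
      then show ?thesis using \<omega>(3)[OF c(1,2) cm] by simp
    qed
    show "matchC c \<omega>' (lb c)"
    proof (cases "card c = Suc m")
      case True
      then have cD: "c \<in> ?D" using c by simp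
      show ?thesis by (rule matchC_add[OF c(1) D(1)[OF cD] \<omega>(1) W(1)[OF cD] top[OF cD] W(4)[OF cD]])
    next
      case False
      then have cm: "card c \<le> m" using c by simp
      have "matchC c \<omega>' (lb c) \<longleftrightarrow> matchC c \<omega> (lb c)" by (rule matchC_cong) (rule low[OF c(1) cm])
      then show ?thesis using \<omega>(3)[OF c(1,2) cm] by simp
    qed
  qed
qed

lemma in_bubble_iff:
  "\<eta> \<in> bubble k r nF (fc C) \<longleftrightarrow> \<eta> \<in> poly_XX k r (fc C) \<and>
    (\<forall>v\<in>C. \<forall>x\<in>fc (C - {v}). trv k (nv v) (\<eta> x) = 0)"
proof -
  have "trace_div k (nv v) (fc (C - {v})) \<eta> = 0 \<longleftrightarrow> (\<forall>x\<in>fc (C - {v}). trv k (nv v) (\<eta> x) = 0)" for v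
    by (auto simp: trace_div_eq fun_eq_iff[of "trace_div _ _ _ _"])
  then show ?thesis unfolding bubble_def facets by auto
qed

lemma subspace_bubble: "subspace (bubble k r nF (fc C))"
proof (rule subspaceI)
  show "0 \<in> bubble k r nF (fc C)"
    unfolding in_bubble_iff
    by (intro conjI ballI subspace_0[OF subspace_poly_XX]) (simp add: linear_0[OF linear_trv])
next
  fix x y assume "x \<in> bubble k r nF (fc C)" "y \<in> bubble k r nF (fc C)"
  then show "x + y \<in> bubble k r nF (fc C)"
    unfolding in_bubble_iff by (auto intro: subspace_add[OF subspace_poly_XX] simp: linear_add[OF linear_trv])
next
  fix c x assume "x \<in> bubble k r nF (fc C)"
  then show "c *\<^sub>R x \<in> bubble k r nF (fc C)"
    unfolding in_bubble_iff by (auto intro: subspace_scale[OF subspace_poly_XX] simp: linear_cmul[OF linear_trv])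
qed

lemma bubble_traces:
  assumes "\<eta> \<in> bubble k r nF (fc C)" "c \<subseteq> C" "x \<in> fc c" "v \<in> C - c"
  shows "trv k (nv v) (\<eta> x) = 0"
proof -
  have "x \<in> fc (C - {v})" using assms fc_mono[of c "C - {v}"] by auto
  then show ?thesis using assms by (auto simp: in_bubble_iff)
qed

lemma bubble_vertex:
  assumes \<eta>: "\<eta> \<in> bubble k r nF (fc C)" and v: "v \<in> C"
  shows "\<eta> v = 0"
proof (rule XX_zero_of_traces[OF _ v])
  show "\<eta> v \<in> XXk" using \<eta> by (auto simp: in_bubble_iff intro: poly_XX_XX)
  show "trv k (nv u) (\<eta> v) = 0" if "u \<in> C - {v}" for u
    by (rule bubble_traces[OF \<eta> _ in_vertex that]) (use v in auto)
qed

text \<open>Vanishing traces on all facets through \<open>c\<close> kill the normal coefficients on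
  \<open>c\<close>, and (b) involves only these. With \<open>bubble_vertex\<close> and
  \<open>bubble_matchC\<close> it follows that adding a bubble leaves (a) to (c) unchanged.\<close>

lemma bubble_matchB:
  assumes \<eta>: "\<eta> \<in> bubble k r nF (fc C)" and c: "c \<subseteq> C" "c \<noteq> {}" "card c \<le> CARD('n)"
  shows "matchB c \<eta> (\<lambda>\<sigma> i p. 0)"
  unfolding matchB_def
proof (intro allI impI)
  fix \<sigma> i p assume a: "(\<sigma>, i) \<in> normal_block CARD('n) k (card c - 1)"
  have c1: "card c \<ge> 1" using fin c by (simp add: Suc_le_eq card_gt_0_iff)
  have \<sigma>: "\<sigma> \<in> inc_seqs k CARD('n)" "i \<in> {card c..CARD('n)}" using a c1 by (auto simp: normal_block_def)
  have "cf (b' c) (\<eta> x) \<sigma> i = 0" if x: "x \<in> fc c" for x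
  proof (rule normal_coeffs_vanish[OF _ c _ \<sigma>])
    show "\<eta> x \<in> XXk" using \<eta> by (auto simp: in_bubble_iff intro: poly_XX_XX)
  qed (rule bubble_traces[OF \<eta> c(1) x])
  then have "I c (\<lambda>x. p x * cf (b' c) (\<eta> x) \<sigma> i) = I c (\<lambda>x. 0)" by (intro I_cong) simp
  then show "I c (\<lambda>x. p x * cf (b' c) (\<eta> x) \<sigma> i) = 0" by (simp add: I_0)
qed

lemma bubble_matchC:
  assumes \<eta>: "\<eta> \<in> bubble k r nF (fc C)" and c: "c \<subseteq> C" "c \<noteq> {}"
  shows "matchC c \<eta> (\<lambda>v \<sigma> p. 0)"
  unfolding matchC_def
proof (intro allI impI)
  fix v \<sigma> p assume v: "v \<in> C - c"
  have "I c (\<lambda>x. p x * alt_inner k (trv k (nv v) (\<eta> x)) (wform (b' c) \<sigma>)) = I c (\<lambda>x. 0)"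
    by (rule I_cong) (simp add: bubble_traces[OF \<eta> c(1) _ v] alt_inner_def)
  then show "I c (\<lambda>x. p x * alt_inner k (trv k (nv v) (\<eta> x)) (wform (b' c) \<sigma>)) = 0" by (simp add: I_0)
qed

lemma L2_pair2_lin:
  assumes "\<omega> \<in> poly_XX k r (fc C)" "\<eta> \<in> poly_XX k r (fc C)" "\<zeta> \<in> poly_XX k r (fc C)"
  shows "L2_pair2 k (fc C) (\<omega> + \<eta>) \<zeta> = L2_pair2 k (fc C) \<omega> \<zeta> + L2_pair2 k (fc C) \<eta> \<zeta>"
    and "L2_pair2 k (fc C) (a *\<^sub>R \<omega>) \<zeta> = a * L2_pair2 k (fc C) \<omega> \<zeta>"
    and "L2_pair2 k (fc C) \<omega> \<zeta> = L2_pair2 k (fc C) \<zeta> \<omega>"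
proof -
  have ne: "C \<noteq> {}" using cardC by auto
  note cont = poly_tensor_cont2[OF _ order_refl, folded poly_XX_def]
  show "L2_pair2 k (fc C) (\<omega> + \<eta>) \<zeta> = L2_pair2 k (fc C) \<omega> \<zeta> + L2_pair2 k (fc C) \<eta> \<zeta>"
    unfolding L2_pair2_I plus_fun_apply alt2_inner_add_left
    by (intro I_add order_refl ne alt2_inner_cont) (use assms cont in \<open>auto simp: poly_XX_def\<close>)
  show "L2_pair2 k (fc C) (a *\<^sub>R \<omega>) \<zeta> = a * L2_pair2 k (fc C) \<omega> \<zeta>"
    unfolding L2_pair2_I fun_scaleR_apply alt2_inner_scale_left by (rule I_cmult)
  show "L2_pair2 k (fc C) \<omega> \<zeta> = L2_pair2 k (fc C) \<zeta> \<omega>"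
    unfolding L2_pair2_I by (rule I_cong) (rule alt2_inner_commute)
qed

lemma L2_pair2_definite:
  assumes \<omega>: "\<omega> \<in> poly_XX k r (fc C)" and z: "L2_pair2 k (fc C) \<omega> \<omega> = 0"
  shows "\<omega> = 0"
proof
  fix x
  have ne: "C \<noteq> {}" using cardC by auto
  show "\<omega> x = 0 x"
  proof (cases "x \<in> fc C")
    case True
    have "alt2_inner k (CARD('n) - 1) (\<omega> x) (\<omega> x) = 0"
    proof (rule I_definite[OF order_refl ne _ _ _ True])
      show "continuous_on (fc C) (\<lambda>x. alt2_inner k (CARD('n) - 1) (\<omega> x) (\<omega> x))"
        using poly_tensor_cont2[OF \<omega>[unfolded poly_XX_def] order_refl] by (intro alt2_inner_cont)
      show "I C (\<lambda>x. alt2_inner k (CARD('n) - 1) (\<omega> x) (\<omega> x)) = 0" using z by (simp add: L2_pair2_I)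
    qed (auto simp: alt2_inner_def intro!: sum_nonneg)
    then show ?thesis using alt2_inner_definite[OF XX_Alt2[OF poly_XX_XX[OF \<omega>]]] by simp
  qed (simp add: poly_XX_zero[OF \<omega>])
qed

lemma bubble_riesz:
  assumes add: "\<And>x y. x \<in> bubble k r nF (fc C) \<Longrightarrow> y \<in> bubble k r nF (fc C) \<Longrightarrow> L (x + y) = L x + (L y :: real)"
    and scale: "\<And>c x. x \<in> bubble k r nF (fc C) \<Longrightarrow> L (c *\<^sub>R x) = c * L x"
  shows "\<exists>\<beta>\<in>bubble k r nF (fc C). \<forall>\<eta>\<in>bubble k r nF (fc C). L2_pair2 k (fc C) \<beta> \<eta> = L \<eta>"
proof -
  obtain S2 :: "'n form2 set" where S2: "finite S2" "Alt2 k (CARD('n) - 1) \<subseteq> span S2" by (rule Alt2_finite_span)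
  have "XXk \<subseteq> span S2" using XX_Alt2 S2(2) by blast
  then obtain S where S: "finite S" "poly_XX k r (fc C) \<subseteq> span S"
    using poly_tensor_finite_span[OF _ S2(1)] unfolding poly_XX_def by metis
  have sub: "\<eta> \<in> poly_XX k r (fc C)" if "\<eta> \<in> bubble k r nF (fc C)" for \<eta> using that by (simp add: in_bubble_iff)
  obtain B where B: "finite B" "bubble k r nF (fc C) = span B"
    using finite_spanning_subset[OF subspace_bubble _ S(1)] sub S(2) by blast
  have L0: "L 0 = 0" using scale[OF subspace_0[OF subspace_bubble], of 0] by simp
  show ?thesis
  proof (rule riesz_finite[OF B(1), folded B(2)])
    show "L2_pair2 k (fc C) x y = L2_pair2 k (fc C) y x"
      if "x \<in> bubble k r nF (fc C)" "y \<in> bubble k r nF (fc C)" for x y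
      by (rule L2_pair2_lin(3)[OF sub[OF that(1)] sub[OF that(1)] sub[OF that(2)]])
    show "L2_pair2 k (fc C) (x + y) z = L2_pair2 k (fc C) x z + L2_pair2 k (fc C) y z"
      if "x \<in> bubble k r nF (fc C)" "y \<in> bubble k r nF (fc C)" "z \<in> bubble k r nF (fc C)" for x y z
      by (rule L2_pair2_lin(1)[OF sub[OF that(1)] sub[OF that(2)] sub[OF that(3)]])
    show "L2_pair2 k (fc C) (c *\<^sub>R x) z = c * L2_pair2 k (fc C) x z"
      if "x \<in> bubble k r nF (fc C)" "z \<in> bubble k r nF (fc C)" for c x z
      by (rule L2_pair2_lin(2)[OF sub[OF that(1)] sub[OF that(1)] sub[OF that(2)]])
    show "x = 0" if "x \<in> bubble k r nF (fc C)" "L2_pair2 k (fc C) x x = 0" for x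
      by (rule L2_pair2_definite[OF sub[OF that(1)] that(2)])
  qed (fact L0 add scale)+
qed

text \<open>Vanishing of (a) to (c) makes all facet traces vanish, so \<delta> is itself a bubble
  and may be tested against itself in (d).\<close>

lemma vanishing_dofs:
  assumes \<delta>: "\<delta> \<in> poly_XX k r (fc C)" and A: "\<And>v. v \<in> C \<Longrightarrow> \<delta> v = 0"
    and B: "\<And>c. c \<subseteq> C \<Longrightarrow> 2 \<le> card c \<Longrightarrow> card c \<le> CARD('n) \<Longrightarrow> matchB c \<delta> (\<lambda>\<sigma> i p. 0) \<and> matchC c \<delta> (\<lambda>v \<sigma> p. 0)"
    and bub: "\<And>\<eta>. \<eta> \<in> bubble k r nF (fc C) \<Longrightarrow> L2_pair2 k (fc C) \<delta> \<eta> = 0"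
  shows "\<delta> = 0"
proof -
  obtain G where G: "G \<in> poly_tensor (int r) UNIV XXk" "\<delta> = restr (fc C) G"
    using poly_tensor_extend[OF \<delta>[unfolded poly_XX_def]] by blast
  have Gx: "G x = \<delta> x" if "x \<in> fc c" "c \<subseteq> C" for x c using G(2) that fc_mono[OF that(2)] by auto
  have "trv k (nv v) (\<delta> x) = 0" if v: "v \<in> C" and x: "x \<in> fc (C - {v})" for v x
  proof -
    have cC: "c \<subseteq> C" "card c \<le> CARD('n)" if "c \<subseteq> C - {v}" for c
      using that card_mono[of "C - {v}" c] fin cardC v by auto
    have "trv k (nv v) (G x) = 0"
    proof (rule trace_vanishes_facet[OF G(1) v _ _ _ order_refl x])
      show "G u = 0" if "u \<in> C - {v}" for u using Gx[OF hull_inc[of u C]] A that by auto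
    next
      fix c \<sigma> i p
      assume a: "c \<subseteq> C - {v}" "2 \<le> card c" "free_index CARD('n) k (\<sigma>, i)"
        "(\<sigma>, i) \<in> normal_block CARD('n) k (card c - 1)" "p \<in> pd c"
      have "I c (\<lambda>x. p x * cf (b' c) (G x) \<sigma> i) = I c (\<lambda>x. p x * cf (b' c) (\<delta> x) \<sigma> i)"
        by (rule I_cong) (simp add: Gx[OF _ cC(1)[OF a(1)]])
      then show "I c (\<lambda>x. p x * cf (b' c) (G x) \<sigma> i) = 0"
        using B[OF cC(1)[OF a(1)] a(2) cC(2)[OF a(1)]] a(3,4,5) by (simp add: matchB_def)
    next
      fix c \<sigma> p
      assume a: "c \<subseteq> C - {v}" "2 \<le> card c" "free_row CARD('n) k (card c - 1) \<sigma>" "p \<in> pd c"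
      have "I c (\<lambda>x. p x * alt_inner k (trv k (nv v) (G x)) (wform (b' c) \<sigma>)) =
          I c (\<lambda>x. p x * alt_inner k (trv k (nv v) (\<delta> x)) (wform (b' c) \<sigma>))"
        by (rule I_cong) (simp add: Gx[OF _ cC(1)[OF a(1)]])
      moreover have "v \<in> C - c" using a(1) v by auto
      ultimately show "I c (\<lambda>x. p x * alt_inner k (trv k (nv v) (G x)) (wform (b' c) \<sigma>)) = 0"
        using B[OF cC(1)[OF a(1)] a(2) cC(2)[OF a(1)]] a(3,4) by (simp add: matchC_def)
    qed
    then show ?thesis using Gx[OF x] by simp
  qed
  then have "\<delta> \<in> bubble k r nF (fc C)" using \<delta> by (simp add: in_bubble_iff)
  from bub[OF this] show ?thesis by (rule L2_pair2_definite[OF \<delta>])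
qed

end

context simplex_dofs
begin

lemma matchB_lin:
  assumes c: "c \<subseteq> C" "c \<noteq> {}" and \<omega>: "\<omega> \<in> poly_XX k r (fc C)" "\<eta> \<in> poly_XX k r (fc C)"
    and m: "matchB c \<omega> L" "matchB c \<eta> M"
  shows "matchB c (\<omega> + a *\<^sub>R \<eta>) (\<lambda>\<sigma> i p. L \<sigma> i p + a * M \<sigma> i p)"
proof -
  have a\<eta>: "a *\<^sub>R \<eta> \<in> poly_XX k r (fc C)" by (intro subspace_scale subspace_poly_XX \<omega>)
  have "matchB c (a *\<^sub>R \<eta>) (\<lambda>\<sigma> i p. (L \<sigma> i p + a * M \<sigma> i p) - I c (\<lambda>x. p x * cf (b' c) (\<omega> x) \<sigma> i))"
    unfolding matchB_def
  proof (intro allI impI)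
    fix \<sigma> i p assume f: "free_index CARD('n) k (\<sigma>, i)" "(\<sigma>, i) \<in> normal_block CARD('n) k (card c - 1)" "p \<in> pd c"
    have "I c (\<lambda>x. p x * cf (b' c) ((a *\<^sub>R \<eta>) x) \<sigma> i) = I c (\<lambda>x. a * (p x * cf (b' c) (\<eta> x) \<sigma> i))"
      by (rule I_cong) (simp add: linear_cmul[OF linear_cf])
    then show "I c (\<lambda>x. p x * cf (b' c) ((a *\<^sub>R \<eta>) x) \<sigma> i) = L \<sigma> i p + a * M \<sigma> i p - I c (\<lambda>x. p x * cf (b' c) (\<omega> x) \<sigma> i)"
      using m f by (simp add: matchB_def I_cmult)
  qed
  then show ?thesis by (rule matchB_add[OF c \<omega>(1) a\<eta>, rotated]) simp
qed

lemma matchC_lin: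
  assumes c: "c \<subseteq> C" "c \<noteq> {}" and \<omega>: "\<omega> \<in> poly_XX k r (fc C)" "\<eta> \<in> poly_XX k r (fc C)"
    and m: "matchC c \<omega> L" "matchC c \<eta> M"
  shows "matchC c (\<omega> + a *\<^sub>R \<eta>) (\<lambda>v \<sigma> p. L v \<sigma> p + a * M v \<sigma> p)"
proof -
  have a\<eta>: "a *\<^sub>R \<eta> \<in> poly_XX k r (fc C)" by (intro subspace_scale subspace_poly_XX \<omega>)
  let ?t = "\<lambda>v \<sigma> \<omega> x. alt_inner k (trv k (nv v) (\<omega> x)) (wform (b' c) \<sigma>)"
  have "matchC c (a *\<^sub>R \<eta>) (\<lambda>v \<sigma> p. (L v \<sigma> p + a * M v \<sigma> p) - I c (\<lambda>x. p x * ?t v \<sigma> \<omega> x))"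
    unfolding matchC_def
  proof (intro allI impI)
    fix v \<sigma> p assume f: "v \<in> C - c" "free_row CARD('n) k (card c - 1) \<sigma>" "p \<in> pd c"
    have "I c (\<lambda>x. p x * ?t v \<sigma> (a *\<^sub>R \<eta>) x) = I c (\<lambda>x. a * (p x * ?t v \<sigma> \<eta> x))"
      by (rule I_cong) (simp add: linear_cmul[OF linear_trace_coeff])
    then show "I c (\<lambda>x. p x * ?t v \<sigma> (a *\<^sub>R \<eta>) x) = L v \<sigma> p + a * M v \<sigma> p - I c (\<lambda>x. p x * ?t v \<sigma> \<omega> x)"
      using m f by (simp add: matchC_def I_cmult)
  qed
  then show ?thesis by (rule matchC_add[OF c \<omega>(1) a\<eta>, rotated]) simp
qed

lemma vertex_iff: "{v} \<in> subsimplices 0 (fc C) \<longleftrightarrow> v \<in> C"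
proof
  assume "{v} \<in> subsimplices 0 (fc C)"
  then obtain c where c: "{v} = fc c" "c \<subseteq> C" "card c = Suc 0" unfolding subsimplices_eq[OF indC] by auto
  from c(3) obtain u where "c = {u}" by (metis One_nat_def card_1_singletonE)
  then show "v \<in> C" using c by auto
next
  assume v: "v \<in> C"
  show "{v} \<in> subsimplices 0 (fc C)"
    unfolding subsimplices_eq[OF indC] by (intro CollectI exI[of _ "{v}"]) (use v in auto)
qed

text \<open>Translates the quantifiers of \<open>unisolvent\<close> into vertex sets, for which the
  matching lemmas are stated; dimensions 1 to n - 1 become cardinalities 2 to n.\<close>

lemma all_faces_iff:
  assumes d: "d \<subseteq> C"
  shows "(\<forall>l\<in>{1..CARD('n) - 1}. \<forall>f\<in>subsimplices l (fc d). P l f) \<longleftrightarrow>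
    (\<forall>c. c \<subseteq> d \<longrightarrow> 2 \<le> card c \<longrightarrow> card c \<le> CARD('n) \<longrightarrow> P (card c - 1) (fc c))"
proof
  assume l: "\<forall>l\<in>{1..CARD('n) - 1}. \<forall>f\<in>subsimplices l (fc d). P l f"
  show "\<forall>c. c \<subseteq> d \<longrightarrow> 2 \<le> card c \<longrightarrow> card c \<le> CARD('n) \<longrightarrow> P (card c - 1) (fc c)"
  proof (intro allI impI)
    fix c assume c: "c \<subseteq> d" "2 \<le> card c" "card c \<le> CARD('n)"
    have "fc c \<in> subsimplices (card c - 1) (fc d)"
      unfolding subsimplices_eq[OF ind[OF d]] by (intro CollectI exI[of _ c]) (use c in auto)
    moreover have "card c - 1 \<in> {1..CARD('n) - 1}" using c by auto
    ultimately show "P (card c - 1) (fc c)" using l by blast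
  qed
next
  assume r: "\<forall>c. c \<subseteq> d \<longrightarrow> 2 \<le> card c \<longrightarrow> card c \<le> CARD('n) \<longrightarrow> P (card c - 1) (fc c)"
  show "\<forall>l\<in>{1..CARD('n) - 1}. \<forall>f\<in>subsimplices l (fc d). P l f"
  proof (intro ballI)
    fix l f assume l: "l \<in> {1..CARD('n) - 1}" and "f \<in> subsimplices l (fc d)"
    then obtain c where c: "f = fc c" "c \<subseteq> d" "card c = Suc l" unfolding subsimplices_eq[OF ind[OF d]] by auto
    then show "P l f" using r[rule_format, OF c(2)] l by auto
  qed
qed

lemma all_facets_iff:
  "(\<forall>F\<in>subsimplices (CARD('n) - 1) (fc C). \<forall>l\<in>{1..CARD('n) - 1}. \<forall>f\<in>subsimplices l F. P F l f) \<longleftrightarrow>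
    (\<forall>c. c \<subseteq> C \<longrightarrow> 2 \<le> card c \<longrightarrow> card c \<le> CARD('n) \<longrightarrow> (\<forall>v\<in>C - c. P (fc (C - {v})) (card c - 1) (fc c)))"
proof -
  have "(\<forall>F\<in>subsimplices (CARD('n) - 1) (fc C). \<forall>l\<in>{1..CARD('n) - 1}. \<forall>f\<in>subsimplices l F. P F l f) \<longleftrightarrow>
      (\<forall>v\<in>C. \<forall>l\<in>{1..CARD('n) - 1}. \<forall>f\<in>subsimplices l (fc (C - {v})). P (fc (C - {v})) l f)"
    unfolding facets by blast
  also have "\<dots> \<longleftrightarrow> (\<forall>v\<in>C. \<forall>c. c \<subseteq> C - {v} \<longrightarrow> 2 \<le> card c \<longrightarrow> card c \<le> CARD('n) \<longrightarrow> P (fc (C - {v})) (card c - 1) (fc c))"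
    by (intro ball_cong refl all_faces_iff) auto
  also have "\<dots> \<longleftrightarrow> (\<forall>c. c \<subseteq> C \<longrightarrow> 2 \<le> card c \<longrightarrow> card c \<le> CARD('n) \<longrightarrow> (\<forall>v\<in>C - c. P (fc (C - {v})) (card c - 1) (fc c)))"
    by (auto simp: subset_Diff_insert)
  finally show ?thesis .
qed

lemma linear_tensor_map: "linear L \<Longrightarrow> linear (\<lambda>p. L (\<lambda>x. p x *\<^sub>R w))"
  for L :: "('n Rn \<Rightarrow> 'b::real_vector) \<Rightarrow> real"
proof (rule linearI)
  assume L: "linear L"
  fix p q :: "'n Rn \<Rightarrow> real" and a
  have "(\<lambda>x. (p + q) x *\<^sub>R w) = (\<lambda>x. p x *\<^sub>R w) + (\<lambda>x. q x *\<^sub>R w)" by (simp add: fun_eq_iff scaleR_add_left)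
  then show "L (\<lambda>x. (p + q) x *\<^sub>R w) = L (\<lambda>x. p x *\<^sub>R w) + L (\<lambda>x. q x *\<^sub>R w)" by (simp only: linear_add[OF L])
  have "(\<lambda>x. (a *\<^sub>R p) x *\<^sub>R w) = a *\<^sub>R (\<lambda>x. p x *\<^sub>R w)" by (simp add: fun_eq_iff)
  then show "L (\<lambda>x. (a *\<^sub>R p) x *\<^sub>R w) = a *\<^sub>R L (\<lambda>x. p x *\<^sub>R w)" by (simp only: linear_cmul[OF L])
qed

theorem unisolvent_simplex: "unisolvent k r dyh nF (fc C)"
  unfolding unisolvent_def vertex_iff all_facets_iff all_faces_iff[OF order_refl]
proof (intro allI impI)
  fix A :: "'n Rn \<Rightarrow> 'n form2" and La :: "'n Rn set \<Rightarrow> ('n Rn \<Rightarrow> 'n form2) \<Rightarrow> real"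
    and Lb :: "'n Rn set \<Rightarrow> 'n Rn set \<Rightarrow> ('n Rn \<Rightarrow> 'n form) \<Rightarrow> real" and Lc :: "('n Rn \<Rightarrow> 'n form2) \<Rightarrow> real"
  assume A: "\<forall>v. v \<in> C \<longrightarrow> A v \<in> XXk"
    and La: "\<forall>f. linear (La f)" and Lb: "\<forall>F f. linear (Lb F f)" and Lc: "linear Lc"
  have LaL: "linear (La f)" and LbL: "linear (Lb F f)" for F f using La Lb by auto
  define la where "la c \<sigma> i p = La (fc c) (\<lambda>x. p x *\<^sub>R tform (b' c) \<sigma> i)" for c \<sigma> i p
  define lb where "lb c v \<sigma> p = Lb (fc (C - {v})) (fc c) (\<lambda>x. p x *\<^sub>R wform (b' c) \<sigma>)" for c v \<sigma> p
  have lal: "linear (la c \<sigma> i)" for c \<sigma> i unfolding la_def[abs_def] by (rule linear_tensor_map[OF LaL])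
  have lbl: "linear (lb c v \<sigma>)" for c v \<sigma> unfolding lb_def[abs_def] by (rule linear_tensor_map[OF LbL])
  define sol where "sol \<omega> \<longleftrightarrow> \<omega> \<in> poly_XX k r (fc C) \<and> (\<forall>v. v \<in> C \<longrightarrow> \<omega> v = A v) \<and>
    (\<forall>c. c \<subseteq> C \<longrightarrow> 2 \<le> card c \<longrightarrow> card c \<le> CARD('n) \<longrightarrow> matchB c \<omega> (la c)) \<and>
    (\<forall>c. c \<subseteq> C \<longrightarrow> 2 \<le> card c \<longrightarrow> card c \<le> CARD('n) \<longrightarrow> matchC c \<omega> (lb c)) \<and>
    (\<forall>\<eta>\<in>bubble k r nF (fc C). L2_pair2 k (fc C) \<omega> \<eta> = Lc \<eta>)" for \<omega>
  have ne: "c \<noteq> {}" if "2 \<le> card c" for c :: "'n Rn set" using that by auto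
  have sol_eq: "(\<omega> \<in> poly_XX k r (fc C) \<and> (\<forall>v. v \<in> C \<longrightarrow> \<omega> v = A v) \<and>
      (\<forall>c. c \<subseteq> C \<longrightarrow> 2 \<le> card c \<longrightarrow> card c \<le> CARD('n) \<longrightarrow> (\<forall>\<eta>\<in>tB c. L2_pair2 k (fc c) \<omega> \<eta> = La (fc c) \<eta>)) \<and>
      (\<forall>c. c \<subseteq> C \<longrightarrow> 2 \<le> card c \<longrightarrow> card c \<le> CARD('n) \<longrightarrow> (\<forall>v\<in>C - c. \<forall>\<eta>\<in>tC c.
        L2_pair k (fc c) (trace_div k (nv v) (fc (C - {v})) \<omega>) \<eta> = Lb (fc (C - {v})) (fc c) \<eta>)) \<and>
      (\<forall>\<eta>\<in>bubble k r nF (fc C). L2_pair2 k (fc C) \<omega> \<eta> = Lc \<eta>)) \<longleftrightarrow> sol \<omega>" for \<omega>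
    unfolding sol_def la_def lb_def
    by (intro conj_cong refl all_cong imp_cong matchB_iff matchC_iff LaL LbL ne)
  have ex: "\<exists>\<omega>. sol \<omega>"
  proof -
    have n1: "1 \<le> CARD('n)" using n by simp
    obtain \<omega> where \<omega>: "\<omega> \<in> poly_XX k r (fc C)" "\<forall>v\<in>C. \<omega> v = A v"
      "\<forall>c. c \<subseteq> C \<longrightarrow> 2 \<le> card c \<longrightarrow> card c \<le> CARD('n) \<longrightarrow> matchB c \<omega> (la c) \<and> matchC c \<omega> (lb c)"
      using interpolate_faces[where A = A and la = la and lb = lb, OF _ linear_add[OF lal] _ linear_add[OF lbl] _ n1 order_refl]
        A linear_cmul[OF lal] linear_cmul[OF lbl] by auto
    have sub: "\<eta> \<in> poly_XX k r (fc C)" if "\<eta> \<in> bubble k r nF (fc C)" for \<eta> using that by (simp add: in_bubble_iff)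
    \<comment> \<open>(d) is matched last: the bubble \<beta> represents the residual of
      \<open>Lc\<close> left by \<omega>.\<close>
    have "\<exists>\<beta>\<in>bubble k r nF (fc C). \<forall>\<eta>\<in>bubble k r nF (fc C). L2_pair2 k (fc C) \<beta> \<eta> = Lc \<eta> - L2_pair2 k (fc C) \<eta> \<omega>"
    proof (rule bubble_riesz)
      fix x y assume x: "x \<in> bubble k r nF (fc C)" and y: "y \<in> bubble k r nF (fc C)"
      show "Lc (x + y) - L2_pair2 k (fc C) (x + y) \<omega> = Lc x - L2_pair2 k (fc C) x \<omega> + (Lc y - L2_pair2 k (fc C) y \<omega>)"
        unfolding linear_add[OF Lc] L2_pair2_lin(1)[OF sub[OF x] sub[OF y] \<omega>(1)] by simp
    next
      fix c x assume x: "x \<in> bubble k r nF (fc C)"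
      show "Lc (c *\<^sub>R x) - L2_pair2 k (fc C) (c *\<^sub>R x) \<omega> = c * (Lc x - L2_pair2 k (fc C) x \<omega>)"
        unfolding linear_cmul[OF Lc] L2_pair2_lin(2)[OF sub[OF x] sub[OF x] \<omega>(1)] by (simp add: algebra_simps)
    qed
    then obtain \<beta> where \<beta>: "\<beta> \<in> bubble k r nF (fc C)"
      "\<And>\<eta>. \<eta> \<in> bubble k r nF (fc C) \<Longrightarrow> L2_pair2 k (fc C) \<beta> \<eta> = Lc \<eta> - L2_pair2 k (fc C) \<eta> \<omega>" by auto
    have "sol (\<omega> + 1 *\<^sub>R \<beta>)"
      unfolding sol_def
    proof (intro conjI allI impI ballI)
      show "\<omega> + 1 *\<^sub>R \<beta> \<in> poly_XX k r (fc C)" by (intro subspace_add subspace_scale subspace_poly_XX \<omega> sub \<beta>)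
      show "(\<omega> + 1 *\<^sub>R \<beta>) v = A v" if "v \<in> C" for v using \<omega>(2) that bubble_vertex[OF \<beta>(1) that] by simp
      fix c assume c: "c \<subseteq> C" "2 \<le> card c" "card c \<le> CARD('n)"
      show "matchB c (\<omega> + 1 *\<^sub>R \<beta>) (la c)"
        using matchB_lin[OF c(1) ne[OF c(2)] \<omega>(1) sub[OF \<beta>(1)] _ bubble_matchB[OF \<beta>(1) c(1) ne[OF c(2)] c(3)], of "la c" 1] \<omega>(3) c
        by simp
      show "matchC c (\<omega> + 1 *\<^sub>R \<beta>) (lb c)"
        using matchC_lin[OF c(1) ne[OF c(2)] \<omega>(1) sub[OF \<beta>(1)] _ bubble_matchC[OF \<beta>(1) c(1) ne[OF c(2)]], of "lb c" 1] \<omega>(3) c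
        by simp
    next
      fix \<eta> assume \<eta>: "\<eta> \<in> bubble k r nF (fc C)"
      show "L2_pair2 k (fc C) (\<omega> + 1 *\<^sub>R \<beta>) \<eta> = Lc \<eta>"
        using L2_pair2_lin(1)[OF \<omega>(1) sub[OF \<beta>(1)] sub[OF \<eta>]] L2_pair2_lin(3)[OF \<omega>(1) \<omega>(1) sub[OF \<eta>]] \<beta>(2)[OF \<eta>] by simp
    qed
    then show ?thesis by blast
  qed
  have uniq: "\<omega> = \<omega>'" if s: "sol \<omega>" and s': "sol \<omega>'" for \<omega> \<omega>'
  proof -
    have P: "\<omega> \<in> poly_XX k r (fc C)" "\<omega>' \<in> poly_XX k r (fc C)" using s s' by (auto simp: sol_def)
    have "\<omega> + (- 1) *\<^sub>R \<omega>' = 0"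
    proof (rule vanishing_dofs)
      show "\<omega> + (- 1) *\<^sub>R \<omega>' \<in> poly_XX k r (fc C)" by (intro subspace_add subspace_scale subspace_poly_XX P)
      show "(\<omega> + (- 1) *\<^sub>R \<omega>') v = 0" if "v \<in> C" for v using s s' that by (simp add: sol_def)
      fix c assume c: "c \<subseteq> C" "2 \<le> card c" "card c \<le> CARD('n)"
      show "matchB c (\<omega> + (- 1) *\<^sub>R \<omega>') (\<lambda>\<sigma> i p. 0) \<and> matchC c (\<omega> + (- 1) *\<^sub>R \<omega>') (\<lambda>v \<sigma> p. 0)"
        using matchB_lin[OF c(1) ne[OF c(2)] P, of "la c" "la c" "-1"] matchC_lin[OF c(1) ne[OF c(2)] P, of "lb c" "lb c" "-1"] s s' c
        by (simp add: sol_def)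
    next
      fix \<eta> assume \<eta>: "\<eta> \<in> bubble k r nF (fc C)"
      then have \<eta>P: "\<eta> \<in> poly_XX k r (fc C)" by (simp add: in_bubble_iff)
      have mP: "(- 1) *\<^sub>R \<omega>' \<in> poly_XX k r (fc C)" by (intro subspace_scale subspace_poly_XX P)
      show "L2_pair2 k (fc C) (\<omega> + (- 1) *\<^sub>R \<omega>') \<eta> = 0"
        unfolding L2_pair2_lin(1)[OF P(1) mP \<eta>P] L2_pair2_lin(2)[OF P(2) P(2) \<eta>P]
        using s s' \<eta> by (simp add: sol_def)
    qed
    then show ?thesis by simp
  qed
  show "\<exists>!\<omega>. \<omega> \<in> poly_XX k r (fc C) \<and> (\<forall>v. v \<in> C \<longrightarrow> \<omega> v = A v) \<and>
      (\<forall>c. c \<subseteq> C \<longrightarrow> 2 \<le> card c \<longrightarrow> card c \<le> CARD('n) \<longrightarrow> (\<forall>\<eta>\<in>tB c. L2_pair2 k (fc c) \<omega> \<eta> = La (fc c) \<eta>)) \<and>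
      (\<forall>c. c \<subseteq> C \<longrightarrow> 2 \<le> card c \<longrightarrow> card c \<le> CARD('n) \<longrightarrow> (\<forall>v\<in>C - c. \<forall>\<eta>\<in>tC c.
        L2_pair k (fc c) (trace_div k (nv v) (fc (C - {v})) \<omega>) \<eta> = Lb (fc (C - {v})) (fc c) \<eta>)) \<and>
      (\<forall>\<eta>\<in>bubble k r nF (fc C). L2_pair2 k (fc C) \<omega> \<eta> = Lc \<eta>)"
    unfolding sol_eq using ex uniq by blast
qed

section \<open>Single-valued traces\<close>

text \<open>\<open>p\<close> and \<open>p'\<close> live on different simplices, so both are extended
  to polynomials on the whole space. Their difference has vanishing DoFs on the subsimplices of the
  shared facet, which is all that \<open>trace_vanishes_facet\<close> looks at.\<close>

lemma trace_single_valued: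
  assumes p: "p \<in> poly_XX k r (fc C)" and p': "p' \<in> poly_XX k r T'" and v: "v \<in> C" and T': "fc (C - {v}) \<subseteq> T'"
    and A: "\<And>u. u \<in> C - {v} \<Longrightarrow> p u = p' u"
    and B: "\<And>c \<eta>. c \<subseteq> C - {v} \<Longrightarrow> 2 \<le> card c \<Longrightarrow> \<eta> \<in> tB c \<Longrightarrow> L2_pair2 k (fc c) p \<eta> = L2_pair2 k (fc c) p' \<eta>"
    and Cc: "\<And>c \<eta>. c \<subseteq> C - {v} \<Longrightarrow> 2 \<le> card c \<Longrightarrow> \<eta> \<in> tC c \<Longrightarrow>
      L2_pair k (fc c) (trace_div k (nv v) (fc (C - {v})) p) \<eta> = L2_pair k (fc c) (trace_div k (nv v) (fc (C - {v})) p') \<eta>"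
    and x: "x \<in> fc (C - {v})"
  shows "trv k (nv v) (p x) = trv k (nv v) (p' x)"
proof -
  obtain G where G: "G \<in> poly_tensor (int r) UNIV XXk" "p = restr (fc C) G"
    using poly_tensor_extend[OF p[unfolded poly_XX_def]] by blast
  obtain G' where G': "G' \<in> poly_tensor (int r) UNIV XXk" "p' = restr T' G'"
    using poly_tensor_extend[OF p'[unfolded poly_XX_def]] by blast
  have eq: "p x = G x" "p' x = G' x" if "x \<in> fc c" "c \<subseteq> C - {v}" for x c
  proof -
    have "x \<in> fc (C - {v})" using that fc_mono by blast
    moreover have "fc (C - {v}) \<subseteq> fc C" by (rule fc_mono) auto
    ultimately have "x \<in> fc C" "x \<in> T'" using T' by auto
    then show "p x = G x" "p' x = G' x" by (auto simp: G(2) G'(2))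
  qed
  let ?H = "G + (- 1) *\<^sub>R G'"
  have H: "?H \<in> poly_tensor (int r) UNIV XXk"
    by (intro subspace_add subspace_scale subspace_poly_tensor G G')
  have cC: "c \<subseteq> C" "card c \<le> CARD('n)" if "c \<subseteq> C - {v}" for c
    using that card_mono[of "C - {v}" c] fin cardC v by auto
  have pc: "continuous_on (fc c) (\<lambda>x. q x * \<phi> (G x))" "continuous_on (fc c) (\<lambda>x. q x * \<phi> (G' x))"
    if "q \<in> pd c" "linear \<phi>" for q \<phi> c
  proof -
    have "(\<lambda>x. \<phi> (G x)) \<in> polyP r" "(\<lambda>x. \<phi> (G' x)) \<in> polyP r"
      using poly_tensor_polys[OF G(1) that(2)] poly_tensor_polys[OF G'(1) that(2)] by (simp_all add: polys_UNIV)
    then show "continuous_on (fc c) (\<lambda>x. q x * \<phi> (G x))" "continuous_on (fc c) (\<lambda>x. q x * \<phi> (G' x))"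
      by (auto intro: continuous_on_mult[OF polys_continuous[OF that(1)] polyP_continuous])
  qed
  have IH: "I c (\<lambda>x. q x * \<phi> (?H x)) = 0"
    if q: "q \<in> pd c" and lin: "linear \<phi>" and c: "c \<subseteq> C - {v}" "c \<noteq> {}"
      and e: "I c (\<lambda>x. q x * \<phi> (p x)) = I c (\<lambda>x. q x * \<phi> (p' x))" for q \<phi> c
  proof -
    have "I c (\<lambda>x. q x * \<phi> (G x)) = I c (\<lambda>x. q x * \<phi> (p x))" by (rule I_cong) (simp add: eq[OF _ c(1)])
    also have "\<dots> = I c (\<lambda>x. q x * \<phi> (G' x))" unfolding e by (rule I_cong) (simp add: eq[OF _ c(1)])
    finally have e': "I c (\<lambda>x. q x * \<phi> (G x)) = I c (\<lambda>x. q x * \<phi> (G' x))" .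
    have "I c (\<lambda>x. q x * \<phi> (?H x)) = I c (\<lambda>x. q x * \<phi> (G x) + (- 1) * (q x * \<phi> (G' x)))"
      by (rule I_cong) (simp add: linear_diff[OF lin] algebra_simps)
    also have "\<dots> = I c (\<lambda>x. q x * \<phi> (G x)) + I c (\<lambda>x. (- 1) * (q x * \<phi> (G' x)))"
      by (intro I_add cC(1)[OF c(1)] c(2) pc[OF q lin] continuous_on_mult continuous_on_const)
    also have "\<dots> = 0" unfolding I_cmult e' by simp
    finally show ?thesis .
  qed
  have "trv k (nv v) (?H x) = 0"
  proof (rule trace_vanishes_facet[OF H v _ _ _ order_refl x])
    fix u assume u: "u \<in> C - {v}"
    then show "?H u = 0" using A[OF u] eq[OF hull_inc[OF u] order_refl] by simp
  next
    fix c \<sigma> i q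
    assume a: "c \<subseteq> C - {v}" "2 \<le> card c" "free_index CARD('n) k (\<sigma>, i)"
      "(\<sigma>, i) \<in> normal_block CARD('n) k (card c - 1)" "q \<in> pd c"
    have ne: "c \<noteq> {}" using a(2) by auto
    note c = cC(1)[OF a(1)] ne cC(2)[OF a(1)]
    have "(\<lambda>x. q x *\<^sub>R tform (b' c) \<sigma> i) \<in> tB c"
      unfolding test_b_eq[OF c] using a by (intro poly_tensor_base span_base) auto
    from B[OF a(1,2) this] show "I c (\<lambda>x. q x * cf (b' c) (?H x) \<sigma> i) = 0"
      unfolding pair_b_generator[of c p, OF poly_XX_XX[OF p]] pair_b_generator[of c p', OF poly_XX_XX[OF p']]
      by (rule IH[OF a(5) linear_cf a(1) ne])
  next
    fix c \<sigma> q
    assume a: "c \<subseteq> C - {v}" "2 \<le> card c" "free_row CARD('n) k (card c - 1) \<sigma>" "q \<in> pd c"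
    have ne: "c \<noteq> {}" using a(2) by auto
    note c = cC(1)[OF a(1)] ne cC(2)[OF a(1)]
    have "(\<lambda>x. q x *\<^sub>R wform (b' c) \<sigma>) \<in> tC c"
      unfolding test_c_eq[OF c] using a by (intro poly_tensor_base span_base) auto
    from Cc[OF a(1,2) this] show "I c (\<lambda>x. q x * alt_inner k (trv k (nv v) (?H x)) (wform (b' c) \<sigma>)) = 0"
      unfolding pair_c_generator[OF a(1)]
      by (rule IH[OF a(4) linear_trace_coeff a(1) ne])
  qed
  then show ?thesis
    using eq[OF x order_refl] by (simp add: linear_diff[OF linear_trv])
qed

end

section \<open>Conformity: from single-valued traces to a square integrable weak divergence on the
  mesh\<close>

section \<open>Continuously differentiable functions\<close>

definition has_grad :: "('a::euclidean_space \<Rightarrow> real) \<Rightarrow> ('a \<Rightarrow> 'a) \<Rightarrow> bool"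
  where "has_grad p p' \<longleftrightarrow> continuous_on UNIV p' \<and> (\<forall>x. (p has_derivative (\<lambda>h. p' x \<bullet> h)) (at x))"

lemma has_grad_cont: "has_grad p p' \<Longrightarrow> continuous_on S p"
  unfolding has_grad_def by (meson has_derivative_continuous continuous_at_imp_continuous_on)

lemma has_grad_add: "has_grad p p' \<Longrightarrow> has_grad q q' \<Longrightarrow> has_grad (\<lambda>x. p x + q x) (\<lambda>x. p' x + q' x)"
  unfolding has_grad_def by (auto intro!: continuous_intros derivative_eq_intros simp: inner_add_left)

lemma has_grad_mult:
  assumes "has_grad p p'" "has_grad q q'"
  shows "has_grad (\<lambda>x. p x * q x) (\<lambda>x. p x *\<^sub>R q' x + q x *\<^sub>R p' x)"
  unfolding has_grad_def
proof (intro conjI allI)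
  show "continuous_on UNIV (\<lambda>x. p x *\<^sub>R q' x + q x *\<^sub>R p' x)"
    using assms has_grad_cont[OF assms(1)] has_grad_cont[OF assms(2)]
    by (auto simp: has_grad_def intro!: continuous_intros)
  fix x
  have "((\<lambda>x. p x * q x) has_derivative (\<lambda>h. p x * (q' x \<bullet> h) + (p' x \<bullet> h) * q x)) (at x)"
    using assms by (intro has_derivative_mult) (auto simp: has_grad_def)
  then show "((\<lambda>x. p x * q x) has_derivative (\<lambda>h. (p x *\<^sub>R q' x + q x *\<^sub>R p' x) \<bullet> h)) (at x)"
    by (simp add: inner_add_left algebra_simps)
qed

lemma has_grad_const: "has_grad (\<lambda>x. c) (\<lambda>x. 0)"
  by (simp add: has_grad_def)

lemma has_grad_inner: "has_grad (\<lambda>x. a \<bullet> x) (\<lambda>x. a)"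
  unfolding has_grad_def by (auto intro!: derivative_eq_intros)

lemma has_grad_power: "has_grad p p' \<Longrightarrow> \<exists>q'. has_grad (\<lambda>x. p x ^ m) q'"
proof (induction m)
  case (Suc m)
  then obtain q' where "has_grad (\<lambda>x. p x ^ m) q'" by blast
  from has_grad_mult[OF Suc.prems this] show ?case by auto
qed (auto intro: has_grad_const)

lemma has_grad_prod:
  assumes "finite I" "\<And>i. i \<in> I \<Longrightarrow> \<exists>q'. has_grad (p i) q'"
  shows "\<exists>q'. has_grad (\<lambda>x. \<Prod>i\<in>I. p i x) q'"
  using assms
proof (induction I rule: finite_induct)
  case (insert i I)
  then obtain q' r' where "has_grad (p i) q'" "has_grad (\<lambda>x. \<Prod>i\<in>I. p i x) r'" by blast
  from has_grad_mult[OF this] insert(1,2) show ?case by auto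
qed (auto intro: has_grad_const)

lemma polyP_has_grad: "p \<in> polyP r \<Longrightarrow> \<exists>p'. has_grad p p'"
  unfolding polyP_def
proof (induction rule: span_induct_alt)
  case base
  then show ?case using has_grad_const[of 0] by (auto simp: zero_fun_def)
next
  case (step c m p)
  then obtain \<alpha> p' where m: "m = mon \<alpha>" and p': "has_grad p p'" by auto
  have "(\<lambda>x :: 'a Rn. axis i 1 \<bullet> x) = (\<lambda>x. x $ i)" for i by (simp add: inner_axis')
  then have "\<exists>q'. has_grad (\<lambda>x :: 'a Rn. x $ i) q'" for i using has_grad_inner[of "axis i 1 :: 'a Rn"] by auto
  then have "\<exists>q'. has_grad (\<lambda>x :: 'a Rn. (x $ i) ^ \<alpha> i) q'" for i
    using has_grad_power[of "\<lambda>x :: 'a Rn. x $ i" _ "\<alpha> i"] by blast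
  then have "\<exists>q'. has_grad (\<lambda>x :: 'a Rn. \<Prod>i\<in>UNIV. (x $ i) ^ \<alpha> i) q'"
    by (intro has_grad_prod) auto
  then obtain q' where "has_grad m q'" unfolding m mon_def[abs_def] by blast
  from has_grad_add[OF has_grad_mult[OF has_grad_const[of c] this] p'] show ?case
    by (auto simp: plus_fun_def scaleR_fun_def)
qed

lemma std_vec_expand: "(\<Sum>i=1..CARD('n). (h \<bullet> std_vec i) *\<^sub>R std_vec i) = (h :: 'n::{finite,linorder} Rn)"
  using dual_vecs_expand[OF dual_vecs_std, of h] by simp

lemma norm_std_vec: "i \<in> {1..CARD('n)} \<Longrightarrow> norm (std_vec i :: 'n::{finite,linorder} Rn) = 1"
  using dual_vecs_std[where 'n = 'n] by (auto simp: dual_vecs_def norm_eq_1)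

lemma C_k_has_grad:
  assumes "C_k 1 \<phi>"
  shows "has_grad \<phi> (\<lambda>x. \<Sum>i=1..CARD('n). partial_deriv i \<phi> x *\<^sub>R (std_vec i :: 'n::{finite,linorder} Rn))"
  unfolding has_grad_def
proof (intro conjI allI)
  have diff: "\<phi> differentiable (at x)" for x using assms by simp
  show "continuous_on UNIV (\<lambda>x. \<Sum>i=1..CARD('n). partial_deriv i \<phi> x *\<^sub>R (std_vec i :: 'n Rn))"
    using assms by (intro continuous_intros) auto
  fix x
  have D: "(\<phi> has_derivative frechet_derivative \<phi> (at x)) (at x)"
    using diff frechet_derivative_works by blast
  have "frechet_derivative \<phi> (at x) h = (\<Sum>i=1..CARD('n). partial_deriv i \<phi> x *\<^sub>R std_vec i) \<bullet> h" for h
  proof -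
    have lin: "linear (frechet_derivative \<phi> (at x))" using D by (rule has_derivative_linear)
    have "frechet_derivative \<phi> (at x) h = frechet_derivative \<phi> (at x) (\<Sum>i=1..CARD('n). (h \<bullet> std_vec i) *\<^sub>R std_vec i)"
      by (simp only: std_vec_expand)
    also have "\<dots> = (\<Sum>i=1..CARD('n). (h \<bullet> std_vec i) * frechet_derivative \<phi> (at x) (std_vec i))"
      by (simp add: linear_sum[OF lin] linear_cmul[OF lin])
    also have "\<dots> = (\<Sum>i=1..CARD('n). partial_deriv i \<phi> x *\<^sub>R std_vec i) \<bullet> h"
      unfolding inner_sum_left inner_scaleR_left partial_deriv_def
      by (intro sum.cong refl) (simp add: inner_commute)
    finally show ?thesis .
  qed
  then have "frechet_derivative \<phi> (at x) = (\<lambda>h. (\<Sum>i=1..CARD('n). partial_deriv i \<phi> x *\<^sub>R std_vec i) \<bullet> h)" by (rule ext)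
  with D show "(\<phi> has_derivative (\<lambda>h. (\<Sum>i=1..CARD('n). partial_deriv i \<phi> x *\<^sub>R std_vec i) \<bullet> h)) (at x)" by simp
qed

lemma grad_std_vec:
  assumes "i \<in> {1..CARD('n)}"
  shows "(\<Sum>j=1..CARD('n). a j *\<^sub>R std_vec j) \<bullet> (std_vec i :: 'n::{finite,linorder} Rn) = a i"
proof -
  have "(\<Sum>j=1..CARD('n). a j * (std_vec j \<bullet> (std_vec i :: 'n Rn))) = (\<Sum>j=1..CARD('n). if j = i then a j else 0)"
    by (rule sum.cong) (use assms dual_vecs_std[where 'n = 'n] in \<open>auto simp: dual_vecs_def\<close>)
  then show ?thesis using assms by (simp add: inner_sum_left)
qed

section \<open>Flux through a face\<close>

context polyhedron_flux
begin

lemma face_fun_integrable: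
  assumes j: "j \<in> J" and \<sigma>: "\<sigma> = 1 \<or> \<sigma> = -1" and \<mu>: "\<nu> j = \<sigma> *\<^sub>R \<mu>"
  shows "integrable lborel (\<lambda>x. unit_ind (\<mu> \<bullet> x) * face_fun j x)"
proof -
  obtain K where K: "K \<ge> 0" "\<And>x. norm (g x) \<le> K" using bounded_by_support[OF g_cont supp] by metis
  have [measurable]: "Measurable.pred borel (\<lambda>x. \<forall>i\<in>J - {j}. 0 < d i (proj j x))"
    using J by (intro pred_intros_finite) auto
  show ?thesis
  proof (rule integrable_bounded_support[where K = K and R = "\<bar>R\<bar> + \<bar>c j\<bar> + 3"])
    show "(\<lambda>x. unit_ind (\<mu> \<bullet> x) * face_fun j x) \<in> borel_measurable borel"
      unfolding face_fun_def by measurable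
    fix x
    have "\<bar>face_fun j x\<bar> \<le> K" using K by (simp add: face_fun_def)
    then have "unit_ind (\<mu> \<bullet> x) * \<bar>face_fun j x\<bar> \<le> 1 * K"
      using unit_ind_bound by (intro mult_mono) auto
    then show "\<bar>unit_ind (\<mu> \<bullet> x) * face_fun j x\<bar> \<le> K" using unit_ind_bound by (simp add: abs_mult)
    assume x: "norm x > \<bar>R\<bar> + \<bar>c j\<bar> + 3"
    show "unit_ind (\<mu> \<bullet> x) * face_fun j x = 0"
    proof (cases "unit_ind (\<mu> \<bullet> x) = 0")
      case False
      then have "\<bar>\<mu> \<bullet> x\<bar> \<le> 1" by (auto simp: unit_ind_def split: if_splits)
      then have "\<bar>\<nu> j \<bullet> x\<bar> \<le> 1" using \<sigma> by (auto simp: \<mu>)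
      then have dj: "\<bar>d j x\<bar> \<le> 1 + \<bar>c j\<bar>" by (simp add: d_def)
      have "norm x \<le> norm (proj j x) + norm (x - proj j x)" by (rule norm_triangle_sub)
      also have "norm (x - proj j x) = \<bar>d j x\<bar>" using unit[OF j] by (simp add: proj_def)
      finally have "norm (proj j x) > R" using x dj by linarith
      then show ?thesis by (simp add: face_fun_def supp)
    qed simp
  qed
qed

end

text \<open>Orthogonal projection to the hyperplane of the facet. The base point is chosen from
  \<open>F\<close> alone, so the result is the same for both simplices sharing \<open>F\<close>; by
  \<open>foot_eq\<close> a vertex of the facet may replace it.\<close>

definition foot :: "('n::finite Rn set \<Rightarrow> 'n Rn) \<Rightarrow> 'n Rn set \<Rightarrow> 'n Rn \<Rightarrow> 'n Rn"
  where "foot nF F x = x - (nF F \<bullet> (x - (SOME w. w \<in> F))) *\<^sub>R nF F"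

text \<open>The integral of \<open>h\<close> over \<open>F\<close> for the surface measure, as a volume integral over a slab of
  thickness 1; meaningful for \<open>h\<close> on the facet \<open>F\<close> with unit normal \<open>nF F\<close>.\<close>

definition flux :: "('n::finite Rn set \<Rightarrow> 'n Rn) \<Rightarrow> 'n Rn set \<Rightarrow> ('n Rn \<Rightarrow> real) \<Rightarrow> real"
  where "flux nF F h = (\<integral>x. unit_ind (nF F \<bullet> x) *
    (h (foot nF F x) * (if foot nF F x \<in> rel_interior F then 1 else 0)) \<partial>lborel)"

lemma flux_cong: "(\<And>y. y \<in> rel_interior F \<Longrightarrow> h y = h' y) \<Longrightarrow> flux nF F h = flux nF F h'"
  unfolding flux_def by (rule Bochner_Integration.integral_cong) auto

lemma flux_0: "(\<And>y. y \<in> rel_interior F \<Longrightarrow> h y = 0) \<Longrightarrow> flux nF F h = 0"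
  using flux_cong[of F h "\<lambda>_. 0" nF] by (simp add: flux_def)

context simplex_dofs
begin

lemma exists_other: "v \<in> C \<Longrightarrow> \<exists>w. w \<in> C - {v}"
  using nonempty_diff by blast

definition wv where "wv v = (SOME w. w \<in> C - {v})"
text \<open>The sign that turns the fixed facet normal into the inward normal of this
  simplex.\<close>

definition side where "side v = sgn (nv v \<bullet> (v - wv v))"
abbreviation inner_set where "inner_set \<equiv> {x. \<forall>v\<in>C. 0 < bary C x v}"

lemma wv: "v \<in> C \<Longrightarrow> wv v \<in> C - {v}"
  unfolding wv_def by (rule someI_ex) (rule exists_other)

lemma side_cases: "v \<in> C \<Longrightarrow> side v = 1 \<or> side v = -1"
  using nv_nonzero[OF _ wv, of v] by (auto simp: side_def sgn_real_def)

lemma side_dist: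
  assumes v: "v \<in> C"
  shows "side v * (nv v \<bullet> (x - wv v)) = \<bar>nv v \<bullet> (v - wv v)\<bar> * bary C x v"
  unfolding nv_bary[OF v wv[OF v], of x] side_def abs_sgn by (simp add: mult_ac)

lemma side_pos: "v \<in> C \<Longrightarrow> 0 < side v * (nv v \<bullet> (x - wv v)) \<longleftrightarrow> 0 < bary C x v"
  using side_dist[of v x] nv_nonzero[OF _ wv, of v] by (simp add: zero_less_mult_iff)

text \<open>Positive coordinates describe the open facet as the polyhedron sees it, while the
  relative interior is intrinsic to the facet. The translation makes the flux independent of the
  simplex.\<close>

lemma rel_interior_facet:
  assumes v: "v \<in> C" and y: "nv v \<bullet> (y - wv v) = 0"
  shows "y \<in> rel_interior (fc (C - {v})) \<longleftrightarrow> (\<forall>u\<in>C - {v}. 0 < bary C y u)"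
proof -
  have bv: "bary C y v = 0" using nv_bary[OF v wv[OF v], of y] nv_nonzero[OF v wv[OF v]] y by simp
  note explicit = rel_interior_convex_hull_explicit[OF ind[of "C - {v}"]]
  show ?thesis
  proof
    assume "y \<in> rel_interior (fc (C - {v}))"
    then obtain u where u: "\<forall>x\<in>C - {v}. 0 < u x" "sum u (C - {v}) = 1" "(\<Sum>x\<in>C - {v}. u x *\<^sub>R x) = y"
      using explicit by auto
    let ?u = "\<lambda>x. if x = v then 0 else u x"
    have "sum ?u C = 1" "(\<Sum>x\<in>C. ?u x *\<^sub>R x) = y"
      using u v fin sum.remove[of C v ?u] sum.remove[of C v "\<lambda>x. ?u x *\<^sub>R x"] by (auto intro: trans[OF sum.cong])
    then have "bary C y x = ?u x" if "x \<in> C" for x using bary_unique[OF C] that by blast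
    then show "\<forall>u\<in>C - {v}. 0 < bary C y u" using u(1) by auto
  next
    assume p: "\<forall>u\<in>C - {v}. 0 < bary C y u"
    have "sum (bary C y) (C - {v}) = 1" "(\<Sum>x\<in>C - {v}. bary C y x *\<^sub>R x) = y"
      using bary_spec[OF C, of y] sum.remove[of C v "bary C y"] sum.remove[of C v "\<lambda>x. bary C y x *\<^sub>R x"] fin v bv
      by auto
    then show "y \<in> rel_interior (fc (C - {v}))" using p explicit by auto
  qed
qed

lemma foot_eq:
  assumes v: "v \<in> C"
  shows "foot nF (fc (C - {v})) x = x - (nv v \<bullet> (x - wv v)) *\<^sub>R nv v"
    and "nv v \<bullet> (foot nF (fc (C - {v})) x - wv v) = 0"
proof -
  define s where "s = (SOME w. w \<in> fc (C - {v}))"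
  have "s \<in> fc (C - {v})" unfolding s_def by (rule someI[of _ "wv v"]) (rule hull_inc[OF wv[OF v]])
  then have "s - wv v \<in> tangent_space (fc (C - {v}))"
    by (rule tangent_space_diff[OF _ hull_inc[OF wv[OF v]]])
  then have "nv v \<bullet> (s - wv v) = 0" by (rule nv_tangent[OF v])
  then have "nv v \<bullet> (x - s) = nv v \<bullet> (x - wv v)" by (simp add: inner_diff_right)
  then show e: "foot nF (fc (C - {v})) x = x - (nv v \<bullet> (x - wv v)) *\<^sub>R nv v"
    unfolding foot_def s_def[symmetric] by (simp only:)
  have "nv v \<bullet> nv v = 1" using normal[OF v] by (simp add: norm_eq_1)
  then show "nv v \<bullet> (foot nF (fc (C - {v})) x - wv v) = 0"
    unfolding e by (simp add: inner_diff_right)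
qed

lemma polyhedron:
  assumes g: "has_grad g g'" and supp: "\<And>x. norm x > R \<Longrightarrow> g x = 0"
  shows "polyhedron_flux C (\<lambda>v. side v *\<^sub>R nv v) g g' R"
proof
  show "finite C" by (rule fin)
  show "norm (side v *\<^sub>R nv v) = 1" if "v \<in> C" for v using normal[OF that] side_cases[OF that] by auto
  show "side u *\<^sub>R nv u \<noteq> (side u *\<^sub>R nv u \<bullet> side v *\<^sub>R nv v) *\<^sub>R side v *\<^sub>R nv v"
    if uv: "u \<in> C" "v \<in> C" "u \<noteq> v" for u v
  proof
    assume e: "side u *\<^sub>R nv u = (side u *\<^sub>R nv u \<bullet> side v *\<^sub>R nv v) *\<^sub>R side v *\<^sub>R nv v"
    \<comment> \<open>For n at least 2 there is a third vertex \<open>w\<close>. The edge from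
      \<open>u\<close> to \<open>w\<close> lies in the facet opposite \<open>v\<close> but not in
      the one opposite \<open>u\<close>, so the two normals are not parallel.\<close>
    have "card (C - {u, v}) > 0" using uv cardC n fin(1) by (simp add: card_Diff_subset)
    then obtain w where w: "w \<in> C" "w \<noteq> u" "w \<noteq> v" by (auto simp: card_gt_0_iff)
    have "nv v \<bullet> (u - w) = 0" by (rule nv_diff) (use uv w in auto)
    then have "(side u *\<^sub>R nv u) \<bullet> (u - w) = 0" by (subst e) simp
    moreover have "nv u \<bullet> (u - w) \<noteq> 0" by (rule nv_nonzero) (use uv w in auto)
    ultimately show False using side_cases[OF uv(1)] by auto
  qed
  show "(g has_derivative (\<lambda>h. g' x \<bullet> h)) (at x)" "continuous_on UNIV g'" for x
    using g by (auto simp: has_grad_def)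
qed (rule supp)

text \<open>\<open>divergence_polyhedron\<close> in each coordinate direction, with the slabs placed
  along the fixed normals \<open>nv v\<close>. The flux functional then depends on the facet alone,
  and the position of the simplex enters only through \<open>side v\<close>.\<close>

lemma divergence_simplex:
  assumes g: "\<And>i. i \<in> {1..CARD('n)} \<Longrightarrow> has_grad (g i) (g' i)"
    and supp: "\<And>i x. i \<in> {1..CARD('n)} \<Longrightarrow> norm x > R \<Longrightarrow> g i x = 0"
  shows "(\<Sum>i=1..CARD('n). \<integral>x. (g' i x \<bullet> std_vec i) * (if x \<in> inner_set then 1 else 0) \<partial>lborel) =
    - (\<Sum>v\<in>C. side v * flux nF (fc (C - {v})) (\<lambda>y. \<Sum>i=1..CARD('n). g i y * (nv v \<bullet> std_vec i)))"
proof -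
  let ?\<nu> = "\<lambda>v. side v *\<^sub>R nv v" and ?c = "\<lambda>v. side v * (nv v \<bullet> wv v)"
  have d: "polyhedron_flux.d ?\<nu> ?c v x = side v * (nv v \<bullet> (x - wv v))" if "polyhedron_flux C ?\<nu> h h' R" for v x h h'
    by (simp add: polyhedron_flux.d_def[OF that] inner_diff_right right_diff_distrib)
  have pr: "polyhedron_flux.proj ?\<nu> ?c v x = foot nF (fc (C - {v})) x"
    if p: "polyhedron_flux C ?\<nu> h h' R" and v: "v \<in> C" for v x h h'
    using side_cases[OF v] by (auto simp: polyhedron_flux.proj_def[OF p] d[OF p] foot_eq(1)[OF v])
  have ff: "polyhedron_flux.face_fun C ?\<nu> ?c h v x =
      h (foot nF (fc (C - {v})) x) * (if foot nF (fc (C - {v})) x \<in> rel_interior (fc (C - {v})) then 1 else 0)"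
    if p: "polyhedron_flux C ?\<nu> h h' R" and v: "v \<in> C" for v x h h'
    unfolding polyhedron_flux.face_fun_def[OF p] pr[OF p v] d[OF p] rel_interior_facet[OF v foot_eq(2)[OF v]]
    by (simp add: side_pos)
  let ?L = "\<lambda>i v. \<integral>x. unit_ind (nv v \<bullet> x) * (g i (foot nF (fc (C - {v})) x) *
      (if foot nF (fc (C - {v})) x \<in> rel_interior (fc (C - {v})) then 1 else 0)) \<partial>lborel"
  have one: "(\<integral>x. (g' i x \<bullet> std_vec i) * (if x \<in> inner_set then 1 else 0) \<partial>lborel) =
      - (\<Sum>v\<in>C. side v * (nv v \<bullet> std_vec i) * ?L i v)" if i: "i \<in> {1..CARD('n)}" for i
  proof -
    have p: "polyhedron_flux C ?\<nu> (g i) (g' i) R" by (rule polyhedron[OF g[OF i] supp[OF i]])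
    have "(\<integral>x. (g' i x \<bullet> std_vec i) * (if \<forall>v\<in>C. 0 < polyhedron_flux.d ?\<nu> ?c v x then 1 else 0) \<partial>lborel) =
        - (\<Sum>v\<in>C. (side v *\<^sub>R nv v \<bullet> std_vec i) * (\<integral>x. unit_ind (nv v \<bullet> x) * polyhedron_flux.face_fun C ?\<nu> ?c (g i) v x \<partial>lborel))"
      by (rule polyhedron_flux.divergence_polyhedron[OF p norm_std_vec[OF i] side_cases refl])
    moreover have "(\<forall>v\<in>C. 0 < polyhedron_flux.d ?\<nu> ?c v x) \<longleftrightarrow> x \<in> inner_set" for x
      by (simp add: d[OF p] side_pos)
    ultimately show ?thesis by (simp add: ff[OF p])
  qed
  have fl: "flux nF (fc (C - {v})) (\<lambda>y. \<Sum>i=1..CARD('n). g i y * (nv v \<bullet> std_vec i)) = (\<Sum>i=1..CARD('n). (nv v \<bullet> std_vec i) * ?L i v)"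
    if v: "v \<in> C" for v
  proof -
    let ?y = "foot nF (fc (C - {v}))"
    let ?r = "\<lambda>x. if ?y x \<in> rel_interior (fc (C - {v})) then 1 else 0 :: real"
    have int: "integrable lborel (\<lambda>x. unit_ind (nv v \<bullet> x) * (g i (?y x) * ?r x))" if i: "i \<in> {1..CARD('n)}" for i
    proof -
      have p: "polyhedron_flux C ?\<nu> (g i) (g' i) R" by (rule polyhedron[OF g[OF i] supp[OF i]])
      have "integrable lborel (\<lambda>x. unit_ind (nv v \<bullet> x) * polyhedron_flux.face_fun C ?\<nu> ?c (g i) v x)"
        by (rule polyhedron_flux.face_fun_integrable[OF p v side_cases[OF v] refl])
      then show ?thesis by (simp only: ff[OF p v])
    qed
    have "flux nF (fc (C - {v})) (\<lambda>y. \<Sum>i=1..CARD('n). g i y * (nv v \<bullet> std_vec i)) =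
        (\<integral>x. (\<Sum>i=1..CARD('n). (nv v \<bullet> std_vec i) * (unit_ind (nv v \<bullet> x) * (g i (?y x) * ?r x))) \<partial>lborel)"
      unfolding flux_def by (rule Bochner_Integration.integral_cong) (simp_all add: sum_distrib_left sum_distrib_right mult_ac)
    also have "\<dots> = (\<Sum>i=1..CARD('n). (nv v \<bullet> std_vec i) * ?L i v)"
      using int by (subst Bochner_Integration.integral_sum) auto
    finally show ?thesis .
  qed
  have "(\<Sum>i=1..CARD('n). \<integral>x. (g' i x \<bullet> std_vec i) * (if x \<in> inner_set then 1 else 0) \<partial>lborel) =
      (\<Sum>i=1..CARD('n). - (\<Sum>v\<in>C. side v * (nv v \<bullet> std_vec i) * ?L i v))"
    by (rule sum.cong[OF refl one])
  also have "\<dots> = - (\<Sum>i=1..CARD('n). \<Sum>v\<in>C. side v * (nv v \<bullet> std_vec i) * ?L i v)"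
    by (rule sum_negf)
  also have "\<dots> = - (\<Sum>v\<in>C. side v * (\<Sum>i=1..CARD('n). (nv v \<bullet> std_vec i) * ?L i v))"
    by (subst sum.swap) (simp add: sum_distrib_left mult.assoc)
  also have "\<dots> = - (\<Sum>v\<in>C. side v * flux nF (fc (C - {v})) (\<lambda>y. \<Sum>i=1..CARD('n). g i y * (nv v \<bullet> std_vec i)))"
    by (intro arg_cong[where f = uminus] sum.cong refl) (simp only: fl)
  finally show ?thesis .
qed

end

section \<open>Mesh geometry\<close>

context simplex_dofs
begin

text \<open>The coordinate of \<open>v\<close> grows in the inward direction from 0, and the other
  coordinates are positive at \<open>x\<close> and stay so by continuity.\<close>

lemma eventually_inner:
  assumes v: "v \<in> C" and x: "x \<in> rel_interior (fc (C - {v}))"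
  shows "\<forall>\<^sub>F \<epsilon> in at_right 0. x + (\<epsilon> * side v) *\<^sub>R nv v \<in> inner_set"
proof -
  have xF: "x \<in> fc (C - {v})" using x rel_interior_subset by blast
  have x0: "nv v \<bullet> (x - wv v) = 0" by (rule nv_tangent[OF v tangent_space_diff[OF xF hull_inc[OF wv[OF v]]]])
  have pos: "\<forall>u\<in>C - {v}. 0 < bary C x u" using rel_interior_facet[OF v x0] x by simp
  have nn: "nv v \<bullet> nv v = 1" using normal[OF v] by (simp add: norm_eq_1)
  have "\<forall>\<^sub>F \<epsilon> in at_right 0. 0 < bary C (x + (\<epsilon> * side v) *\<^sub>R nv v) u" if u: "u \<in> C" for u
  proof (cases "u = v")
    case True
    have "0 < bary C (x + (\<epsilon> * side v) *\<^sub>R nv v) v" if "\<epsilon> > 0" for \<epsilon>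
    proof -
      have "side v * (nv v \<bullet> (x + (\<epsilon> * side v) *\<^sub>R nv v - wv v)) = \<epsilon> * (side v * side v)"
        using x0 nn by (simp add: inner_add_right inner_diff_right algebra_simps)
      also have "\<dots> > 0" using side_cases[OF v] that by auto
      finally show ?thesis using side_pos[OF v] by blast
    qed
    then show ?thesis unfolding True eventually_at_right_field using zero_less_one by blast
  next
    case False
    have "((\<lambda>\<epsilon>. bary C (x + (\<epsilon> * side v) *\<^sub>R nv v) u) \<longlongrightarrow> bary C (x + (0 * side v) *\<^sub>R nv v) u) (at_right 0)"
    proof (rule continuous_on_tendsto_compose[OF bary_continuous[OF C u, of UNIV]])
      show "((\<lambda>\<epsilon>. x + (\<epsilon> * side v) *\<^sub>R nv v) \<longlongrightarrow> x + (0 * side v) *\<^sub>R nv v) (at_right 0)"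
        by (intro tendsto_intros)
    qed auto
    then show ?thesis using pos u False by (intro order_tendstoD(1)) auto
  qed
  then have "\<forall>\<^sub>F \<epsilon> in at_right 0. \<forall>u\<in>C. 0 < bary C (x + (\<epsilon> * side v) *\<^sub>R nv v) u"
    using fin(1) by (intro eventually_ball_finite) auto
  then show ?thesis by simp
qed

lemma outside_simplex:
  assumes v: "v \<in> C" and x: "x \<in> fc (C - {v})" and e: "\<epsilon> > 0"
  shows "x - (\<epsilon> * side v) *\<^sub>R nv v \<notin> fc C"
proof -
  let ?y = "x - (\<epsilon> * side v) *\<^sub>R nv v"
  have x0: "nv v \<bullet> (x - wv v) = 0" by (rule nv_tangent[OF v tangent_space_diff[OF x hull_inc[OF wv[OF v]]]])
  have nn: "nv v \<bullet> nv v = 1" using normal[OF v] by (simp add: norm_eq_1)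
  have "side v * (nv v \<bullet> (?y - wv v)) = - (\<epsilon> * (side v * side v))"
    using x0 nn by (simp add: inner_diff_right algebra_simps)
  also have "\<dots> < 0" using side_cases[OF v] e by auto
  finally have "bary C ?y v < 0" using side_dist[OF v, of ?y] by (simp add: mult_less_0_iff)
  then show ?thesis using in_face_iff[OF C order_refl, of ?y] v by auto
qed

lemma inner_subset: "inner_set \<subseteq> fc C"
  using in_face_iff[OF C order_refl] by (auto intro: less_imp_le)

lemma open_inner: "open inner_set"
proof -
  have "inner_set = (\<Inter>v\<in>C. {x. 0 < bary C x v})" by auto
  moreover have "open (\<Inter>v\<in>C. {x. 0 < bary C x v})"
    using fin(1) bary_continuous[OF C] by (intro open_INT ballI open_Collect_less continuous_on_const) auto
  ultimately show ?thesis by simp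
qed

lemma AE_inner: "AE x in lborel. x \<in> fc C \<longrightarrow> x \<in> inner_set"
proof -
  have "AE x in lborel. bary C x v \<noteq> 0" if v: "v \<in> C" for v
  proof -
    have "nv v \<noteq> 0" using normal[OF v] by auto
    from AE_hyperplane[OF this, of "nv v \<bullet> wv v"] show ?thesis
    proof eventually_elim
      case (elim x)
      then show ?case using nv_bary[OF v wv[OF v], of x] by (auto simp: inner_diff_right)
    qed
  qed
  then have "AE x in lborel. \<forall>v\<in>C. bary C x v \<noteq> 0" using fin(1) by (intro AE_finite_allI)
  then show ?thesis
    by eventually_elim (use in_face_iff[OF C order_refl] in \<open>force simp: less_le\<close>)
qed

lemma facet_inj: "v \<in> C \<Longrightarrow> v' \<in> C \<Longrightarrow> fc (C - {v}) = fc (C - {v'}) \<Longrightarrow> v = v'"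
proof -
  assume v: "v \<in> C" "v' \<in> C" and e: "fc (C - {v}) = fc (C - {v'})"
  have "C - {v} \<subseteq> C - {v'}" by (rule convex_hull_inj[OF C]) (use e in auto)
  then show "v = v'" using v by auto
qed

end

locale mesh_dofs =
  fixes \<Omega> :: "'n::{finite,linorder} Rn set" and \<T> :: "'n Rn set set" and k r :: nat
    and dyh :: "'n Rn set \<Rightarrow> nat \<Rightarrow> 'n form" and nF :: "'n Rn set \<Rightarrow> 'n Rn"
  assumes n: "CARD('n) \<ge> 2" and k: "1 \<le> k" "k \<le> CARD('n) - 1" and r: "1 \<le> r"
    and dom: "bounded_domain \<Omega>" and mesh: "conforming_mesh \<T> \<Omega>"
    and frames: "\<And>l f. l \<le> CARD('n) - 1 \<Longrightarrow> f \<in> mesh_simplices l \<T> \<Longrightarrow> \<exists>b b'. frame l f (dyh f) b b'"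
    and nF: "\<And>F. F \<in> mesh_simplices (CARD('n) - 1) \<T> \<Longrightarrow>
               norm (nF F) = 1 \<and> (\<forall>u\<in>tangent_space F. nF F \<bullet> u = 0)"
begin

definition V where "V T = (SOME C. simplex_verts C \<and> T = convex hull C)"

lemma V: "T \<in> \<T> \<Longrightarrow> simplex_verts (V T) \<and> T = convex hull (V T)"
proof -
  assume "T \<in> \<T>"
  then have "int CARD('n) simplex T" using mesh by (simp add: conforming_mesh_def)
  then have "\<exists>C. simplex_verts C \<and> T = convex hull C" by (metis simplex_verts_obtain)
  then show ?thesis unfolding V_def by (rule someI_ex)
qed

lemma V_hull: "T \<in> \<T> \<Longrightarrow> convex hull (V T) = T"
  using V by simp

lemma finT: "finite \<T>"
  using mesh by (simp add: conforming_mesh_def triangulation_def)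

lemma inter_face: "T \<in> \<T> \<Longrightarrow> T' \<in> \<T> \<Longrightarrow> (T \<inter> T') face_of T"
  using mesh by (simp add: conforming_mesh_def triangulation_def)

lemma dofs:
  assumes T: "T \<in> \<T>"
  shows "simplex_dofs (V T) k r dyh nF"
proof
  have C: "simplex_verts (V T)" and TC: "T = convex hull (V T)" using V[OF T] by auto
  have ind: "\<not> affine_dependent (V T)" and card: "card (V T) = CARD('n) + 1" using C by (auto simp: simplex_verts_def)
  note sub = subsimplices_eq[OF ind, folded TC]
  show "simplex_verts (V T)" by (rule C)
  show "2 \<le> CARD('n)" "1 \<le> k" "k \<le> CARD('n) - 1" "1 \<le> r" by (fact n k r)+
  show "\<exists>b b'. frame (card c - 1) (convex hull c) (dyh (convex hull c)) b b'"
    if c: "c \<subseteq> V T" "c \<noteq> {}" "card c \<le> CARD('n)" for c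
  proof (rule frames)
    have "card c > 0" using c simplex_verts_finite[OF C] finite_subset by (auto simp: card_gt_0_iff)
    then have "convex hull c \<in> subsimplices (card c - 1) T" unfolding sub using c by auto
    then show "convex hull c \<in> mesh_simplices (card c - 1) \<T>" using T by (auto simp: mesh_simplices_def)
  qed (use c in auto)
  fix v assume v: "v \<in> V T"
  have "convex hull (V T - {v}) \<in> subsimplices (CARD('n) - 1) T"
    unfolding sub using v card simplex_verts_finite[OF C] by (intro CollectI exI[of _ "V T - {v}"]) auto
  then have "convex hull (V T - {v}) \<in> mesh_simplices (CARD('n) - 1) \<T>" using T by (auto simp: mesh_simplices_def)
  then show "norm (nF (convex hull (V T - {v}))) = 1 \<and>
      (\<forall>u\<in>tangent_space (convex hull (V T - {v})). nF (convex hull (V T - {v})) \<bullet> u = 0)" by (rule nF)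
qed

abbreviation In :: "'n Rn set \<Rightarrow> 'n Rn set" where "In T \<equiv> {x. \<forall>v\<in>V T. 0 < bary (V T) x v}"
abbreviation facet :: "'n Rn set \<Rightarrow> 'n Rn \<Rightarrow> 'n Rn set" where "facet T v \<equiv> convex hull (V T - {v})"
abbreviation sd where "sd T v \<equiv> simplex_dofs.side (V T) nF v"

lemma In_subset: "T \<in> \<T> \<Longrightarrow> In T \<subseteq> T"
  using simplex_dofs.inner_subset[OF dofs] V_hull by simp

text \<open>The intersection with \<open>T'\<close> is a face of \<open>T\<close>; containing a
  point with all coordinates positive, it must have all vertices of \<open>T\<close>.\<close>

lemma In_mem_subset:
  assumes T: "T \<in> \<T>" "T' \<in> \<T>" and x: "x \<in> In T" "x \<in> T'"
  shows "T \<subseteq> T'"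
proof -
  have C: "simplex_verts (V T)" and TC: "T = convex hull (V T)" using V[OF T(1)] by auto
  have "x \<in> T" using In_subset[OF T(1)] x by blast
  have "(T \<inter> T') face_of convex hull (V T)" using inter_face[OF T] TC by simp
  then obtain c where c: "c \<subseteq> V T" "T \<inter> T' = convex hull c"
    using face_of_convex_hull_affine_independent[of "V T"] C by (auto simp: simplex_verts_def)
  have "x \<in> convex hull c" using \<open>x \<in> T\<close> x(2) c(2) by auto
  then have "\<forall>v\<in>V T - c. bary (V T) x v = 0" using in_face_iff[OF C c(1)] by simp
  then have "c = V T" using x(1) c(1) by force
  then show ?thesis using c(2) TC by auto
qed

lemma In_unique: "T \<in> \<T> \<Longrightarrow> T' \<in> \<T> \<Longrightarrow> x \<in> In T \<Longrightarrow> x \<in> In T' \<Longrightarrow> T = T'"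
  using In_mem_subset[of T T' x] In_mem_subset[of T' T x] In_subset[of T] In_subset[of T'] by blast

lemma rel_interior_facet_nonempty:
  assumes "T \<in> \<T>" "v \<in> V T"
  shows "rel_interior (facet T v) \<noteq> {}"
  using simplex_dofs.nonempty_diff[OF dofs[OF assms(1)] assms(2)]
  by (simp add: rel_interior_eq_empty)

text \<open>Points slightly inward from a relatively interior point of the facet lie in both open
  simplices, and these are disjoint for different members of the mesh.\<close>

lemma same_side_unique:
  assumes T: "T \<in> \<T>" "T' \<in> \<T>" and v: "v \<in> V T" "v' \<in> V T'" and F: "facet T v = facet T' v'"
    and s: "sd T v = sd T' v'"
  shows "T = T'"
proof -
  obtain x where x: "x \<in> rel_interior (facet T v)" using rel_interior_facet_nonempty[OF T(1) v(1)] by blast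
  have 1: "\<forall>\<^sub>F \<epsilon> in at_right 0. x + (\<epsilon> * sd T v) *\<^sub>R nF (facet T v) \<in> In T"
    by (rule simplex_dofs.eventually_inner[OF dofs[OF T(1)] v(1) x])
  have 2: "\<forall>\<^sub>F \<epsilon> in at_right 0. x + (\<epsilon> * sd T v) *\<^sub>R nF (facet T v) \<in> In T'"
    using simplex_dofs.eventually_inner[OF dofs[OF T(2)] v(2) x[unfolded F]] unfolding F s .
  obtain \<epsilon> where "x + (\<epsilon> * sd T v) *\<^sub>R nF (facet T v) \<in> In T"
    "x + (\<epsilon> * sd T v) *\<^sub>R nF (facet T v) \<in> In T'"
    using eventually_happens[OF eventually_conj[OF 1 2]] by auto
  then show ?thesis by (rule In_unique[OF T])
qed

lemma aff_dim_mesh: "T \<in> \<T> \<Longrightarrow> aff_dim T = int CARD('n)"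
  using mesh aff_dim_simplex by (auto simp: conforming_mesh_def)

text \<open>As \<Omega> is open, points just beyond the facet at \<open>x\<close> lie in \<Omega>
  but not in \<open>T\<close>, hence in the other simplices. These are finitely many closed sets, so
  one of them contains \<open>x\<close>; conformity then makes its intersection with
  \<open>T\<close> a face containing the facet.\<close>

lemma opposite_exists:
  assumes T: "T \<in> \<T>" and v: "v \<in> V T" and x: "x \<in> rel_interior (facet T v)" "x \<in> \<Omega>"
  shows "\<exists>T'\<in>\<T>. \<exists>v'\<in>V T'. facet T' v' = facet T v \<and> sd T' v' = - sd T v"
proof -
  note dT = dofs[OF T]
  have C: "simplex_verts (V T)" and TC: "T = convex hull (V T)" using V[OF T] by auto
  let ?F = "facet T v"
  have xF: "x \<in> ?F" using x rel_interior_subset by blast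
  have FT: "?F \<subseteq> T" using hull_mono[of "V T - {v}" "V T" convex] V_hull[OF T] by auto
  define y where "y m = x - (inverse (real (Suc m)) * sd T v) *\<^sub>R nF ?F" for m
  have "y \<longlonglongrightarrow> x - (0 * sd T v) *\<^sub>R nF ?F"
    unfolding y_def
    by (rule tendsto_diff[OF tendsto_const tendsto_scaleR[OF tendsto_mult[OF LIMSEQ_inverse_real_of_nat tendsto_const] tendsto_const]])
  then have yx: "y \<longlonglongrightarrow> x" by simp
  have "open \<Omega>" using dom by (simp add: bounded_domain_def)
  then have ev: "\<forall>\<^sub>F m in sequentially. y m \<in> \<Omega>" using topological_tendstoD[OF yx _ x(2)] by blast
  have "y m \<notin> T" for m
    using simplex_dofs.outside_simplex[OF dT v xF, of "inverse (real (Suc m))"] by (simp add: y_def V_hull[OF T])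
  moreover have "\<Omega> \<subseteq> \<Union>\<T>" using mesh closure_subset by (auto simp: conforming_mesh_def)
  ultimately have yU: "\<forall>\<^sub>F m in sequentially. y m \<in> \<Union>(\<T> - {T})" using ev by (auto elim!: eventually_mono)
  have cl: "closed (\<Union>(\<T> - {T}))"
  proof (rule closed_Union)
    show "\<forall>S\<in>\<T> - {T}. closed S"
    proof
      fix S assume S: "S \<in> \<T> - {T}"
      then have "closed (convex hull (V S))"
        using simplex_verts_finite V by (metis DiffD1 compact_imp_closed finite_imp_compact_convex_hull)
      then show "closed S" using V_hull S by auto
    qed
  qed (use finT in auto)
  have "x \<in> \<Union>(\<T> - {T})" by (rule Lim_in_closed_set[OF cl yU sequentially_bot yx])
  then obtain T' where T': "T' \<in> \<T>" "T' \<noteq> T" "x \<in> T'" by auto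
  have f: "(T \<inter> T') face_of T" by (rule inter_face[OF T T'(1)])
  have "?F \<subseteq> T \<inter> T'"
    by (rule subset_of_face_of[OF f FT]) (use xF FT T'(3) x(1) in auto)
  have "(T \<inter> T') face_of convex hull (V T)" using f TC by simp
  then obtain c where c: "c \<subseteq> V T" "T \<inter> T' = convex hull c"
    using face_of_convex_hull_affine_independent[of "V T"] C by (auto simp: simplex_verts_def)
  have "V T - {v} \<subseteq> c"
    by (rule convex_hull_inj[OF C _ c(1)]) (use \<open>?F \<subseteq> T \<inter> T'\<close> c(2) in auto)
  \<comment> \<open>Otherwise \<open>T\<close> would be a proper face of \<open>T'\<close> and have
    smaller dimension, whereas both have dimension n.\<close>
  moreover have "c \<noteq> V T"
  proof
    assume "c = V T"
    then have "T \<inter> T' = T" using c(2) TC by simp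
    moreover have "(T' \<inter> T) face_of T'" by (rule inter_face[OF T'(1) T])
    ultimately have "T face_of T'" by (simp add: Int_commute)
    moreover have "convex T'" using V_hull[OF T'(1)] convex_convex_hull by metis
    ultimately have "aff_dim T < aff_dim T'" using T'(2) by (intro face_of_aff_dim_lt) auto
    then show False using aff_dim_mesh T T'(1) by simp
  qed
  ultimately have "c = V T - {v}" using c(1) by blast
  then have TT: "T \<inter> T' = ?F" using c(2) by simp
  have "?F \<in> subsimplices (CARD('n) - 1) (convex hull (V T))"
    unfolding simplex_dofs.facets[OF dT] using v by blast
  then have "int (CARD('n) - 1) simplex ?F" by (simp add: subsimplices_def)
  moreover have "?F face_of T'" using inter_face[OF T'(1) T] TT by (simp add: Int_commute)
  ultimately have "?F \<in> subsimplices (CARD('n) - 1) (convex hull (V T'))"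
    by (simp add: subsimplices_def V_hull[OF T'(1)])
  then obtain v' where v': "v' \<in> V T'" "?F = facet T' v'"
    unfolding simplex_dofs.facets[OF dofs[OF T'(1)]] by blast
  have "sd T v \<noteq> sd T' v'" using same_side_unique[OF T T'(1) v v'(1,2)] T'(2) by blast
  then have "sd T' v' = - sd T v"
    using simplex_dofs.side_cases[OF dT v] simplex_dofs.side_cases[OF dofs[OF T'(1)] v'(1)] by auto
  then show ?thesis using T'(1) v' by metis
qed

text \<open>A sign-reversing involution on the pairs of a simplex and a facet whose relative
  interior meets \<Omega>: the partner exists by \<open>opposite_exists\<close>, and
  \<open>same_side_unique\<close> makes the choice involutive. The remaining facets contribute
  nothing because \<open>h\<close> vanishes off \<Omega>.\<close>

lemma flux_cancel:
  fixes h :: "'n Rn set \<Rightarrow> 'n Rn \<Rightarrow> 'n Rn \<Rightarrow> real"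
  assumes shared: "\<And>T T' v v' y. T \<in> \<T> \<Longrightarrow> T' \<in> \<T> \<Longrightarrow> v \<in> V T \<Longrightarrow> v' \<in> V T' \<Longrightarrow> facet T v = facet T' v' \<Longrightarrow>
      y \<in> facet T v \<Longrightarrow> h T v y = h T' v' y"
    and out: "\<And>T v y. T \<in> \<T> \<Longrightarrow> v \<in> V T \<Longrightarrow> y \<notin> \<Omega> \<Longrightarrow> h T v y = 0"
  shows "(\<Sum>T\<in>\<T>. \<Sum>v\<in>V T. sd T v * flux nF (facet T v) (h T v)) = 0"
proof -
  define X where "X = (\<lambda>(T, v). sd T v * flux nF (facet T v) (h T v))"
  define Q where "Q = {(T, v). T \<in> \<T> \<and> v \<in> V T \<and> rel_interior (facet T v) \<inter> \<Omega> \<noteq> {}}"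
  have finV: "finite (V T)" if "T \<in> \<T>" for T using V[OF that] simplex_verts_finite by blast
  have finS: "finite (Sigma \<T> V)" using finT finV by auto
  have "(\<Sum>T\<in>\<T>. \<Sum>v\<in>V T. sd T v * flux nF (facet T v) (h T v)) = sum X (Sigma \<T> V)"
    unfolding X_def by (rule sum.Sigma) (use finT finV in auto)
  also have "\<dots> = sum X Q"
  proof (rule sum.mono_neutral_right[OF finS])
    show "Q \<subseteq> Sigma \<T> V" by (auto simp: Q_def)
    show "\<forall>q\<in>Sigma \<T> V - Q. X q = 0"
    proof
      fix q assume q: "q \<in> Sigma \<T> V - Q"
      obtain T v where Tv: "q = (T, v)" by fastforce
      have "flux nF (facet T v) (h T v) = 0"
        by (rule flux_0, rule out) (use q in \<open>auto simp: Tv Q_def\<close>)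
      then show "X q = 0" by (simp add: X_def Tv)
    qed
  qed
  also have "sum X Q = 0"
  proof -
    define opp where "opp q q' \<longleftrightarrow> q' \<in> Q \<and> facet (fst q') (snd q') = facet (fst q) (snd q) \<and>
      sd (fst q') (snd q') = - sd (fst q) (snd q)" for q q'
    have ex: "\<exists>q'. opp q q'" if q: "q \<in> Q" for q
    proof -
      obtain T v where Tv: "q = (T, v)" by fastforce
      obtain x where x: "T \<in> \<T>" "v \<in> V T" "x \<in> rel_interior (facet T v)" "x \<in> \<Omega>"
        using q by (auto simp: Tv Q_def)
      obtain T' v' where o: "T' \<in> \<T>" "v' \<in> V T'" "facet T' v' = facet T v" "sd T' v' = - sd T v"
        using opposite_exists[OF x] by blast
      then have "opp q (T', v')" using x by (auto simp: opp_def Tv Q_def)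
      then show ?thesis by blast
    qed
    define \<iota> where "\<iota> q = (SOME q'. opp q q')" for q
    have \<iota>: "opp q (\<iota> q)" if "q \<in> Q" for q unfolding \<iota>_def by (rule someI_ex[OF ex[OF that]])
    have inQ: "\<iota> q \<in> Q" if "q \<in> Q" for q using \<iota>[OF that] by (simp add: opp_def)
    have inv: "\<iota> (\<iota> q) = q" if q: "q \<in> Q" for q
    proof -
      have o: "opp q (\<iota> q)" "opp (\<iota> q) (\<iota> (\<iota> q))" using \<iota>[OF q] \<iota>[OF inQ[OF q]] by auto
      obtain T v where Tv: "q = (T, v)" by fastforce
      obtain T' v' where Tv': "\<iota> (\<iota> q) = (T', v')" by fastforce
      have m: "T \<in> \<T>" "v \<in> V T" "T' \<in> \<T>" "v' \<in> V T'" using q inQ[OF inQ[OF q]] unfolding Tv' unfolding Tv Q_def by auto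
      have f: "facet T' v' = facet T v" "sd T' v' = sd T v" using o unfolding opp_def Tv' unfolding Tv by auto
      have "T' = T" by (rule same_side_unique[OF m(3,1,4,2) f])
      then have "v' = v" using simplex_dofs.facet_inj[OF dofs[OF m(1)], of v' v] m f by auto
      then show ?thesis using \<open>T' = T\<close> Tv Tv' by simp
    qed
    have neg: "X (\<iota> q) = - X q" if q: "q \<in> Q" for q
    proof -
      obtain T v where Tv: "q = (T, v)" by fastforce
      obtain T' v' where Tv': "\<iota> q = (T', v')" by fastforce
      have m: "T \<in> \<T>" "v \<in> V T" "T' \<in> \<T>" "v' \<in> V T'" using q inQ[OF q] unfolding Tv' unfolding Tv Q_def by auto
      have f: "facet T' v' = facet T v" "sd T' v' = - sd T v" using \<iota>[OF q] unfolding opp_def Tv' unfolding Tv by auto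
      have "flux nF (facet T v) (h T' v') = flux nF (facet T v) (h T v)"
        by (rule flux_cong, rule shared[OF m(3,1,4,2) f(1)]) (use rel_interior_subset f(1) in blast)
      then show ?thesis using f unfolding Tv' unfolding Tv X_def by simp
    qed
    have "sum X Q = (\<Sum>q\<in>Q. X (\<iota> q))"
      by (rule sum.reindex_bij_witness[of _ \<iota> \<iota>]) (use inv inQ in auto)
    also have "\<dots> = - sum X Q" by (simp add: neg sum_negf cong: sum.cong)
    finally show ?thesis by simp
  qed
  finally show ?thesis .
qed

end

section \<open>The weak divergence\<close>

lemma subsimplices_trans: "f \<in> subsimplices l F \<Longrightarrow> F \<in> subsimplices m T \<Longrightarrow> f \<in> subsimplices l T"
  by (auto simp: subsimplices_def intro: face_of_trans)

lemma integral_lebesgue_on_support: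
  fixes f :: "'a::euclidean_space \<Rightarrow> real"
  assumes f: "f \<in> borel_measurable borel" and S: "S \<in> sets borel" and z: "\<And>x. x \<notin> S \<Longrightarrow> f x = 0"
  shows "integral\<^sup>L (lebesgue_on S) f = integral\<^sup>L lborel f"
proof -
  have "integral\<^sup>L (lebesgue_on S) f = (\<integral>x. indicator S x *\<^sub>R f x \<partial>lebesgue)"
    by (rule integral_restrict_space) (use S in auto)
  also have "(\<lambda>x. indicator S x *\<^sub>R f x) = f" using z by (auto simp: fun_eq_iff indicator_def)
  also have "integral\<^sup>L lebesgue f = integral\<^sup>L lborel f"
    by (rule integral_completion) (use f in auto)
  finally show ?thesis .
qed

lemma partial_deriv_outside:
  assumes "closed K" "\<And>x. x \<notin> K \<Longrightarrow> \<phi> x = 0" "x \<notin> K"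
  shows "partial_deriv i \<phi> x = 0"
proof -
  have "(\<phi> has_derivative (\<lambda>h. 0)) (at x)"
    by (rule has_derivative_transform_within_open[OF has_derivative_const open_Compl[OF assms(1)]])
       (use assms in auto)
  from frechet_derivative_at[OF this] show ?thesis by (metis partial_deriv_def)
qed

context mesh_dofs
begin

lemma trace_shared:
  assumes p: "\<And>T. T \<in> \<T> \<Longrightarrow> p T \<in> poly_XX k r T"
    and A: "\<forall>T\<in>\<T>. \<forall>T'\<in>\<T>. \<forall>v. {v} \<in> subsimplices 0 T \<inter> subsimplices 0 T' \<longrightarrow> p T v = p T' v"
    and B: "\<forall>T\<in>\<T>. \<forall>T'\<in>\<T>. \<forall>l\<in>{1..CARD('n) - 1}. \<forall>f\<in>subsimplices l T \<inter> subsimplices l T'.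
        \<forall>\<eta>\<in>test_b k r l f (dyh f). L2_pair2 k f (p T) \<eta> = L2_pair2 k f (p T') \<eta>"
    and D: "\<forall>T\<in>\<T>. \<forall>T'\<in>\<T>.
        \<forall>F\<in>subsimplices (CARD('n) - 1) T \<inter> subsimplices (CARD('n) - 1) T'.
        \<forall>l\<in>{1..CARD('n) - 1}. \<forall>f\<in>subsimplices l F. \<forall>\<eta>\<in>test_c k r l f (dyh f).
          L2_pair k f (trace_div k (nF F) F (p T)) \<eta> = L2_pair k f (trace_div k (nF F) F (p T')) \<eta>"
    and T: "T \<in> \<T>" "T' \<in> \<T>" and v: "v \<in> V T" "v' \<in> V T'" and F: "facet T v = facet T' v'"
    and y: "y \<in> facet T v"
  shows "trv k (nF (facet T v)) (p T y) = trv k (nF (facet T v)) (p T' y)"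
proof -
  have C: "simplex_verts (V T)" using V[OF T(1)] by simp
  have ind: "\<not> affine_dependent (V T)" and card: "card (V T) = CARD('n) + 1" using C by (auto simp: simplex_verts_def)
  have fin: "finite (V T)" using C by (rule simplex_verts_finite)
  have ind': "\<not> affine_dependent (V T - {v})" using ind affine_dependent_subset by blast
  have FT: "facet T v \<in> subsimplices (CARD('n) - 1) T"
    using simplex_dofs.facets[OF dofs[OF T(1)]] v(1) V_hull[OF T(1)] by auto
  have FT': "facet T v \<in> subsimplices (CARD('n) - 1) T'"
    using simplex_dofs.facets[OF dofs[OF T(2)]] v(2) V_hull[OF T(2)] F by auto
  have sub: "convex hull c \<in> subsimplices (card c - 1) (facet T v)" if c: "c \<subseteq> V T - {v}" "c \<noteq> {}" for c
  proof -
    have "card c > 0" using c fin finite_subset by (auto simp: card_gt_0_iff)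
    then show ?thesis unfolding subsimplices_eq[OF ind'] using c by auto
  qed
  have le: "card c - 1 \<in> {1..CARD('n) - 1}" if "c \<subseteq> V T - {v}" "2 \<le> card c" for c
    using card_mono[OF _ that(1)] that fin card v(1) by auto
  have p1: "p T \<in> poly_XX k r (convex hull (V T))" using p[OF T(1)] V_hull[OF T(1)] by simp
  have FsT': "facet T v \<subseteq> T'" using FT' face_of_imp_subset by (auto simp: subsimplices_def)
  show ?thesis
  proof (rule simplex_dofs.trace_single_valued[OF dofs[OF T(1)] p1 p[OF T(2)] v(1) FsT' _ _ _ y])
    fix u assume "u \<in> V T - {v}"
    then have "{u} \<in> subsimplices 0 (facet T v)" using sub[of "{u}"] by simp
    then show "p T u = p T' u" using A T subsimplices_trans[OF _ FT] subsimplices_trans[OF _ FT'] by blast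
  next
    fix c \<eta> assume c: "c \<subseteq> V T - {v}" "2 \<le> card c"
      and \<eta>: "\<eta> \<in> test_b k r (card c - 1) (convex hull c) (dyh (convex hull c))"
    have "convex hull c \<in> subsimplices (card c - 1) (facet T v)" using c by (intro sub) auto
    then have "convex hull c \<in> subsimplices (card c - 1) T \<inter> subsimplices (card c - 1) T'"
      using subsimplices_trans[OF _ FT] subsimplices_trans[OF _ FT'] by blast
    then show "L2_pair2 k (convex hull c) (p T) \<eta> = L2_pair2 k (convex hull c) (p T') \<eta>"
      using B T le[OF c] \<eta> by blast
  next
    fix c \<eta> assume c: "c \<subseteq> V T - {v}" "2 \<le> card c"
      and \<eta>: "\<eta> \<in> test_c k r (card c - 1) (convex hull c) (dyh (convex hull c))"
    have "convex hull c \<in> subsimplices (card c - 1) (facet T v)" using c by (intro sub) auto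
    then show "L2_pair k (convex hull c) (trace_div k (nF (facet T v)) (facet T v) (p T)) \<eta> =
        L2_pair k (convex hull c) (trace_div k (nF (facet T v)) (facet T v) (p T')) \<eta>"
      using D T FT FT' le[OF c] \<eta> by blast
  qed
qed

text \<open>Open simplices are used so that distinct indicators never overlap; what is lost is a
  null set by \<open>AE_ind\<close>.\<close>

definition ind :: "'n Rn set \<Rightarrow> 'n Rn \<Rightarrow> real" where "ind T x = (if x \<in> In T then 1 else 0)"

lemma ind_measurable: "T \<in> \<T> \<Longrightarrow> ind T \<in> borel_measurable borel"
proof -
  assume "T \<in> \<T>"
  then have "In T \<in> sets borel" by (intro borel_open simplex_dofs.open_inner[OF dofs])
  then have "indicator (In T) \<in> borel_measurable borel" by (rule borel_measurable_indicator)
  moreover have "ind T = indicator (In T)" by (simp add: ind_def fun_eq_iff indicator_def)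
  ultimately show ?thesis by (rule ssubst[rotated])
qed

lemma compactT: "T \<in> \<T> \<Longrightarrow> compact T"
  using finite_imp_compact_convex_hull[OF simplex_verts_finite, of "V T"] V_hull[of T] V[of T] by simp

lemma integrable_ind:
  assumes T: "T \<in> \<T>" and u: "continuous_on UNIV u"
  shows "integrable lborel (\<lambda>x. u x * ind T x)"
proof -
  have "bounded (u ` T)"
    using compact_imp_bounded[OF compact_continuous_image[OF continuous_on_subset[OF u subset_UNIV] compactT[OF T]]] .
  then obtain M where M: "\<And>x. x \<in> T \<Longrightarrow> \<bar>u x\<bar> \<le> M" by (auto simp: bounded_iff)
  obtain R where R: "\<And>x. x \<in> T \<Longrightarrow> norm x \<le> R" using compact_imp_bounded[OF compactT[OF T]] by (auto simp: bounded_iff)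
  note [measurable] = ind_measurable[OF T] borel_measurable_continuous_onI[OF u]
  have 0: "ind T x = 0 \<or> (ind T x = 1 \<and> x \<in> T)" for x using In_subset[OF T] by (auto simp: ind_def)
  show ?thesis
  proof (rule integrable_bounded_support[where K = "\<bar>M\<bar>" and R = R])
    show "\<bar>u x * ind T x\<bar> \<le> \<bar>M\<bar>" for x using 0[of x] M[of x] by auto
    show "u x * ind T x = 0" if "norm x > R" for x using 0[of x] R[of x] that by auto
  qed measurable
qed

lemma AE_ind: "AE x in lebesgue. \<forall>T\<in>\<T>. x \<in> T \<longrightarrow> ind T x = 1"
proof -
  have "AE x in lborel. x \<in> T \<longrightarrow> ind T x = 1" if T: "T \<in> \<T>" for T
    using simplex_dofs.AE_inner[OF dofs[OF T]] unfolding V_hull[OF T]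
    by eventually_elim (simp add: ind_def)
  then show ?thesis using finT by (intro AE_completion AE_finite_allI)
qed

lemma sum_ind:
  assumes "T \<in> \<T>" "ind T x = 1"
  shows "(\<Sum>T'\<in>\<T>. w T' * ind T' x) = w T"
proof -
  have xT: "x \<in> In T" using assms(2) by (simp add: ind_def split: if_splits)
  have "(\<Sum>T'\<in>\<T>. w T' * ind T' x) = (\<Sum>T'\<in>\<T>. if T' = T then w T' else 0)"
  proof (rule sum.cong)
    fix T' assume T': "T' \<in> \<T>"
    show "w T' * ind T' x = (if T' = T then w T' else 0)"
    proof (cases "T' = T")
      case False
      then have "x \<notin> In T'" using In_unique[OF assms(1) T' xT] by blast
      then have "ind T' x = 0" unfolding ind_def by (rule if_not_P)
      then show ?thesis using False by simp
    qed (use assms(2) in simp)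
  qed simp
  then show ?thesis using assms(1) finT by simp
qed

text \<open>The weak divergence is the elementwise one. \<open>P T i\<close> extends the component
  on \<open>T\<close> to the whole space, so the divergence theorem applies on each simplex to
  \<open>P T i\<close> times the test function; the facet terms of the whole mesh cancel by
  \<open>flux_cancel\<close>.\<close>

lemma weak_divergence:
  assumes P: "\<And>T i. T \<in> \<T> \<Longrightarrow> i \<in> {1..CARD('n)} \<Longrightarrow> \<exists>p'. has_grad (P T i) p'"
    and shared: "\<And>T T' v v' y. T \<in> \<T> \<Longrightarrow> T' \<in> \<T> \<Longrightarrow> v \<in> V T \<Longrightarrow> v' \<in> V T' \<Longrightarrow> facet T v = facet T' v' \<Longrightarrow>
      y \<in> facet T v \<Longrightarrow> (\<Sum>i=1..CARD('n). P T i y * (nF (facet T v) \<bullet> std_vec i)) =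
        (\<Sum>i=1..CARD('n). P T' i y * (nF (facet T v) \<bullet> std_vec i))"
    and a: "\<And>i. a i \<in> borel_measurable (lebesgue_on \<Omega>)"
    and aP: "\<And>T. T \<in> \<T> \<Longrightarrow> AE x in lebesgue. x \<in> T \<inter> \<Omega> \<longrightarrow> (\<forall>i. a i x = P T i x)"
  shows "\<exists>g\<in>L2_fun \<Omega>. \<forall>\<phi>\<in>test_functions \<Omega>. (\<integral>x. g x * \<phi> x \<partial>lebesgue_on \<Omega>) =
       - (\<integral>x. (\<Sum>i=1..CARD('n). a i x * partial_deriv i \<phi> x) \<partial>lebesgue_on \<Omega>)"
proof -
  let ?n = "CARD('n)"
  define P' where "P' T i = (SOME p'. has_grad (P T i) p')" for T i
  have P': "has_grad (P T i) (P' T i)" if "T \<in> \<T>" "i \<in> {1..?n}" for T i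
    unfolding P'_def by (rule someI_ex[OF P[OF that]])
  define dv where "dv T x = (\<Sum>i=1..?n. P' T i x \<bullet> std_vec i)" for T x
  define g where "g x = (\<Sum>T\<in>\<T>. dv T x * ind T x)" for x
  have cP: "continuous_on UNIV (P T i)" "continuous_on UNIV (\<lambda>x. P' T i x \<bullet> std_vec i)"
    if "T \<in> \<T>" "i \<in> {1..?n}" for T i
    using has_grad_cont[OF P'[OF that]] P'[OF that] by (auto simp: has_grad_def intro!: continuous_intros)
  have cdv: "continuous_on UNIV (dv T)" if "T \<in> \<T>" for T
    unfolding dv_def by (intro continuous_on_sum cP that)
  have gm [measurable]: "g \<in> borel_measurable borel"
    unfolding g_def using ind_measurable cdv
    by (intro borel_measurable_sum borel_measurable_times) (auto intro: borel_measurable_continuous_onI)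
  have \<Omega>: "open \<Omega>" "bounded \<Omega>" using dom by (auto simp: bounded_domain_def)
  then have \<Omega>b: "\<Omega> \<in> sets borel" by simp
  then have \<Omega>l: "\<Omega> \<inter> space lebesgue \<in> sets lebesgue" by simp
  have cover: "\<Omega> \<subseteq> \<Union>\<T>" using mesh closure_subset by (auto simp: conforming_mesh_def)
  obtain R where R: "\<And>x. x \<in> \<Omega> \<Longrightarrow> norm x \<le> R" using \<Omega>(2) by (auto simp: bounded_iff)
  have L2: "g \<in> L2_fun \<Omega>"
  proof -
    have "g \<in> borel_measurable (lebesgue_on \<Omega>)"
      by (intro measurable_restrict_space1 measurable_completion) simp
    moreover have "integrable lborel (\<lambda>x. (g x)\<^sup>2)"
    proof -
      have ii: "indicator (In T) x = ind T x" for T x by (simp add: ind_def indicator_def)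
      have "(\<lambda>x. (g x)\<^sup>2) = (\<lambda>x. \<Sum>T\<in>\<T>. \<Sum>T'\<in>\<T>. indicator (In T') x *\<^sub>R (dv T x * dv T' x * ind T x))"
        by (simp only: g_def power2_eq_square sum_product real_scaleR_def ii mult_ac)
      moreover have "integrable lborel (\<lambda>x. indicator (In T') x *\<^sub>R (dv T x * dv T' x * ind T x))"
        if "T \<in> \<T>" "T' \<in> \<T>" for T T'
        using simplex_dofs.open_inner[OF dofs[OF that(2)]]
        by (intro integrable_mult_indicator integrable_ind continuous_on_mult cdv that) auto
      ultimately show ?thesis by simp
    qed
    then have "integrable lebesgue (\<lambda>x. indicator \<Omega> x *\<^sub>R (g x)\<^sup>2)"
      using \<Omega>b by (intro integrable_mult_indicator) (auto simp: integrable_completion)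
    then have "integrable (lebesgue_on \<Omega>) (\<lambda>x. (g x)\<^sup>2)"
      using integrable_restrict_space[OF \<Omega>l, of "\<lambda>x. (g x)\<^sup>2"] by simp
    ultimately show ?thesis by (simp add: L2_fun_def)
  qed
  moreover have "(\<integral>x. g x * \<phi> x \<partial>lebesgue_on \<Omega>) =
       - (\<integral>x. (\<Sum>i=1..?n. a i x * partial_deriv i \<phi> x) \<partial>lebesgue_on \<Omega>)" if \<phi>: "\<phi> \<in> test_functions \<Omega>" for \<phi>
  proof -
    have ck: "C_k m \<phi>" for m using \<phi> by (simp add: test_functions_def)
    obtain K where K: "compact K" "K \<subseteq> \<Omega>" "\<And>x. x \<notin> K \<Longrightarrow> \<phi> x = 0" using \<phi> by (auto simp: test_functions_def)
    define \<phi>' where "\<phi>' x = (\<Sum>i=1..?n. partial_deriv i \<phi> x *\<^sub>R (std_vec i :: 'n Rn))" for x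
    have g\<phi>: "has_grad \<phi> \<phi>'" using C_k_has_grad[OF ck] by (simp add: \<phi>'_def[abs_def])
    have \<phi>z: "\<phi> x = 0" if "x \<notin> \<Omega>" for x using K that by blast
    have \<phi>'z: "partial_deriv i \<phi> x = 0" if "x \<notin> \<Omega>" for x i
      by (rule partial_deriv_outside[OF compact_imp_closed[OF K(1)] K(3)]) (use K that in auto)
    have cd: "continuous_on UNIV (partial_deriv i \<phi>)" if "i \<in> {1..?n}" for i
      using ck[of 1] that by simp
    have c\<phi>: "continuous_on UNIV \<phi>" by (rule has_grad_cont[OF g\<phi>])
    define h where "h T v y = (\<Sum>i=1..?n. (P T i y * \<phi> y) * (nF (facet T v) \<bullet> std_vec i))" for T v y
    define b where "b x = (\<Sum>T\<in>\<T>. (\<Sum>i=1..?n. P T i x * partial_deriv i \<phi> x) * ind T x)" for x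
    have bm [measurable]: "b \<in> borel_measurable borel"
      unfolding b_def using ind_measurable cP cd
      by (intro borel_measurable_sum borel_measurable_times) (auto intro: borel_measurable_continuous_onI)
    have ci1: "continuous_on UNIV (\<lambda>x. \<Sum>i=1..?n. P T i x * partial_deriv i \<phi> x)" if "T \<in> \<T>" for T
      by (intro continuous_on_sum continuous_on_mult cP cd that)
    have ci2: "continuous_on UNIV (\<lambda>x. dv T x * \<phi> x)" if "T \<in> \<T>" for T
      by (intro continuous_on_mult cdv c\<phi> that)
    have gi: "has_grad (\<lambda>x. P T i x * \<phi> x) (\<lambda>x. P T i x *\<^sub>R \<phi>' x + \<phi> x *\<^sub>R P' T i x)"
      if "T \<in> \<T>" "i \<in> {1..?n}" for T i
      by (rule has_grad_mult[OF P'[OF that] g\<phi>])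
    have dot: "(P T i x *\<^sub>R \<phi>' x + \<phi> x *\<^sub>R P' T i x) \<bullet> std_vec i =
        P T i x * partial_deriv i \<phi> x + (P' T i x \<bullet> std_vec i) * \<phi> x" if "i \<in> {1..?n}" for T i x
      using grad_std_vec[OF that, of "\<lambda>j. partial_deriv j \<phi> x"] by (simp add: inner_add_left \<phi>'_def)
    have elem: "(\<integral>x. ((\<Sum>i=1..?n. P T i x * partial_deriv i \<phi> x) + dv T x * \<phi> x) * ind T x \<partial>lborel) =
        - (\<Sum>v\<in>V T. sd T v * flux nF (facet T v) (h T v))" if T: "T \<in> \<T>" for T
    proof -
      have "(\<Sum>i=1..?n. \<integral>x. ((P T i x *\<^sub>R \<phi>' x + \<phi> x *\<^sub>R P' T i x) \<bullet> std_vec i) * (if x \<in> In T then 1 else 0) \<partial>lborel) =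
        - (\<Sum>v\<in>V T. sd T v * flux nF (facet T v) (\<lambda>y. \<Sum>i=1..?n. (P T i y * \<phi> y) * (nF (facet T v) \<bullet> std_vec i)))"
        by (rule simplex_dofs.divergence_simplex[OF dofs[OF T] gi[OF T], where R = R]) (use R \<phi>z in force)+
      moreover have "(\<Sum>i=1..?n. \<integral>x. ((P T i x *\<^sub>R \<phi>' x + \<phi> x *\<^sub>R P' T i x) \<bullet> std_vec i) * (if x \<in> In T then 1 else 0) \<partial>lborel) =
        (\<Sum>i=1..?n. \<integral>x. (P T i x * partial_deriv i \<phi> x + (P' T i x \<bullet> std_vec i) * \<phi> x) * ind T x \<partial>lborel)"
        unfolding ind_def by (intro sum.cong refl Bochner_Integration.integral_cong) (simp only: dot)
      moreover have "(\<Sum>i=1..?n. \<integral>x. (P T i x * partial_deriv i \<phi> x + (P' T i x \<bullet> std_vec i) * \<phi> x) * ind T x \<partial>lborel) =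
        (\<integral>x. (\<Sum>i=1..?n. (P T i x * partial_deriv i \<phi> x + (P' T i x \<bullet> std_vec i) * \<phi> x) * ind T x) \<partial>lborel)"
        by (rule Bochner_Integration.integral_sum[symmetric], rule integrable_ind[OF T])
           (intro continuous_on_add continuous_on_mult cP cd c\<phi> T)
      moreover have "(\<Sum>i=1..?n. (P T i x * partial_deriv i \<phi> x + (P' T i x \<bullet> std_vec i) * \<phi> x) * ind T x) =
         ((\<Sum>i=1..?n. P T i x * partial_deriv i \<phi> x) + dv T x * \<phi> x) * ind T x" for x
        by (simp only: dv_def sum_distrib_right[symmetric] sum.distrib)
      ultimately show ?thesis unfolding h_def by simp
    qed
    have "(\<integral>x. g x * \<phi> x \<partial>lborel) + (\<integral>x. b x \<partial>lborel) =
        (\<Sum>T\<in>\<T>. \<integral>x. ((\<Sum>i=1..?n. P T i x * partial_deriv i \<phi> x) + dv T x * \<phi> x) * ind T x \<partial>lborel)"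
    proof -
      have "(\<integral>x. g x * \<phi> x \<partial>lborel) = (\<integral>x. (\<Sum>T\<in>\<T>. dv T x * \<phi> x * ind T x) \<partial>lborel)"
        by (simp add: g_def sum_distrib_left mult_ac)
      also have "\<dots> = (\<Sum>T\<in>\<T>. \<integral>x. dv T x * \<phi> x * ind T x \<partial>lborel)"
        by (rule Bochner_Integration.integral_sum) (rule integrable_ind[OF _ ci2])
      moreover have "(\<integral>x. b x \<partial>lborel) = (\<Sum>T\<in>\<T>. \<integral>x. (\<Sum>i=1..?n. P T i x * partial_deriv i \<phi> x) * ind T x \<partial>lborel)"
        unfolding b_def by (rule Bochner_Integration.integral_sum) (rule integrable_ind[OF _ ci1])
      moreover have "(\<integral>x. ((\<Sum>i=1..?n. P T i x * partial_deriv i \<phi> x) + dv T x * \<phi> x) * ind T x \<partial>lborel) =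
          (\<integral>x. (\<Sum>i=1..?n. P T i x * partial_deriv i \<phi> x) * ind T x \<partial>lborel) + (\<integral>x. dv T x * \<phi> x * ind T x \<partial>lborel)"
        if T: "T \<in> \<T>" for T
        unfolding distrib_right by (rule Bochner_Integration.integral_add[OF integrable_ind[OF T ci1[OF T]] integrable_ind[OF T ci2[OF T]]])
      ultimately show ?thesis by (simp add: sum.distrib)
    qed
    also have "\<dots> = - (\<Sum>T\<in>\<T>. \<Sum>v\<in>V T. sd T v * flux nF (facet T v) (h T v))"
      by (simp only: elem sum_negf cong: sum.cong)
    also have "(\<Sum>T\<in>\<T>. \<Sum>v\<in>V T. sd T v * flux nF (facet T v) (h T v)) = 0"
    proof (rule flux_cancel)
      fix T T' v v' y
      assume s: "T \<in> \<T>" "T' \<in> \<T>" "v \<in> V T" "v' \<in> V T'" "facet T v = facet T' v'" "y \<in> facet T v"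
      have hh: "h T v y = \<phi> y * (\<Sum>i=1..?n. P T i y * (nF (facet T v) \<bullet> std_vec i))" for T v
        by (simp add: h_def sum_distrib_left mult_ac)
      show "h T v y = h T' v' y" unfolding hh shared[OF s] unfolding s(5) ..
    qed (simp add: h_def \<phi>z)
    finally have sum0: "(\<integral>x. g x * \<phi> x \<partial>lborel) = - (\<integral>x. b x \<partial>lborel)" by simp
    have \<phi>m [measurable]: "\<phi> \<in> borel_measurable borel" by (rule borel_measurable_continuous_onI[OF c\<phi>])
    have "(\<integral>x. g x * \<phi> x \<partial>lebesgue_on \<Omega>) = (\<integral>x. g x * \<phi> x \<partial>lborel)"
      by (rule integral_lebesgue_on_support[OF _ \<Omega>b]) (auto simp: \<phi>z)
    moreover have "(\<integral>x. b x \<partial>lebesgue_on \<Omega>) = (\<integral>x. b x \<partial>lborel)"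
      by (rule integral_lebesgue_on_support[OF bm \<Omega>b]) (simp add: b_def \<phi>'z)
    moreover have "(\<integral>x. (\<Sum>i=1..?n. a i x * partial_deriv i \<phi> x) \<partial>lebesgue_on \<Omega>) = (\<integral>x. b x \<partial>lebesgue_on \<Omega>)"
    proof (rule integral_cong_AE)
      have "partial_deriv i \<phi> \<in> borel_measurable (lebesgue_on \<Omega>)" if "i \<in> {1..?n}" for i
        by (intro measurable_restrict_space1 measurable_completion) (simp add: borel_measurable_continuous_onI[OF cd[OF that]])
      then show "(\<lambda>x. \<Sum>i=1..?n. a i x * partial_deriv i \<phi> x) \<in> borel_measurable (lebesgue_on \<Omega>)"
        using a by (intro borel_measurable_sum borel_measurable_times)
      show "b \<in> borel_measurable (lebesgue_on \<Omega>)"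
        by (intro measurable_restrict_space1 measurable_completion) simp
      have "AE x in lebesgue. \<forall>T\<in>\<T>. x \<in> T \<inter> \<Omega> \<longrightarrow> (\<forall>i. a i x = P T i x)"
        using finT aP by (intro AE_finite_allI)
      with AE_ind have "AE x in lebesgue. x \<in> \<Omega> \<longrightarrow> (\<Sum>i=1..?n. a i x * partial_deriv i \<phi> x) = b x"
      proof eventually_elim
        case (elim x)
        show ?case
        proof
          assume x: "x \<in> \<Omega>"
          then obtain T where T: "T \<in> \<T>" "x \<in> T" using cover by blast
          have "b x = (\<Sum>i=1..?n. P T i x * partial_deriv i \<phi> x)"
            unfolding b_def by (rule sum_ind) (use elim T in auto)
          then show "(\<Sum>i=1..?n. a i x * partial_deriv i \<phi> x) = b x" using elim(2) T x by simp
        qed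
      qed
      then show "AE x in lebesgue_on \<Omega>. (\<Sum>i=1..?n. a i x * partial_deriv i \<phi> x) = b x"
        unfolding AE_restrict_space_iff[OF \<Omega>l] .
    qed
    ultimately show ?thesis using sum0 by simp
  qed
  ultimately show ?thesis by blast
qed

text \<open>The rows \<sigma> decouple: the value of the trace at \<open>std_args \<sigma>\<close>
  is the normal component of that row, so single-valued traces are the matching condition of
  \<open>weak_divergence\<close> row by row. The extensions \<open>G T\<close> replace
  \<open>p T\<close>, which is cut off outside \<open>T\<close>.\<close>

lemma V_h_subset_H_div: "V_h k r dyh nF \<T> \<Omega> \<subseteq> H_div k \<Omega>"
proof
  fix \<omega> assume "\<omega> \<in> V_h k r dyh nF \<T> \<Omega>"
  then obtain p where L2: "\<omega> \<in> L2_XX k \<Omega>"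
    and p: "\<forall>T\<in>\<T>. p T \<in> poly_XX k r T \<and> (AE x in lebesgue. x \<in> T \<inter> \<Omega> \<longrightarrow> \<omega> x = p T x)"
    and A: "\<forall>T\<in>\<T>. \<forall>T'\<in>\<T>. \<forall>v. {v} \<in> subsimplices 0 T \<inter> subsimplices 0 T' \<longrightarrow> p T v = p T' v"
    and B: "\<forall>T\<in>\<T>. \<forall>T'\<in>\<T>. \<forall>l\<in>{1..CARD('n) - 1}. \<forall>f\<in>subsimplices l T \<inter> subsimplices l T'.
        \<forall>\<eta>\<in>test_b k r l f (dyh f). L2_pair2 k f (p T) \<eta> = L2_pair2 k f (p T') \<eta>"
    and D: "\<forall>T\<in>\<T>. \<forall>T'\<in>\<T>.
        \<forall>F\<in>subsimplices (CARD('n) - 1) T \<inter> subsimplices (CARD('n) - 1) T'.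
        \<forall>l\<in>{1..CARD('n) - 1}. \<forall>f\<in>subsimplices l F. \<forall>\<eta>\<in>test_c k r l f (dyh f).
          L2_pair k f (trace_div k (nF F) F (p T)) \<eta> = L2_pair k f (trace_div k (nF F) F (p T')) \<eta>"
    unfolding V_h_def by blast
  have pX: "\<And>T. T \<in> \<T> \<Longrightarrow> p T \<in> poly_XX k r T" using p by blast
  have "\<exists>G. G \<in> poly_tensor (int r) UNIV (XX k) \<and> p T = restr T G" if "T \<in> \<T>" for T
    using poly_tensor_extend[OF pX[OF that, unfolded poly_XX_def]] by blast
  then obtain G where G: "\<And>T. T \<in> \<T> \<Longrightarrow> G T \<in> poly_tensor (int r) UNIV (XX k)"
    and pG: "\<And>T. T \<in> \<T> \<Longrightarrow> p T = restr T (G T)" by metis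
  have GX: "G T x \<in> XX k" if "T \<in> \<T>" for T x by (rule poly_tensor_in[OF G[OF that] subspace_XX])
  have "\<exists>g\<in>L2_fun \<Omega>. \<forall>\<phi>\<in>test_functions \<Omega>. (\<integral>x. g x * \<phi> x \<partial>lebesgue_on \<Omega>) =
       - (\<integral>x. (\<Sum>i=1..CARD('n). mat_coeff k (\<omega> x) \<sigma> i * partial_deriv i \<phi> x) \<partial>lebesgue_on \<Omega>)"
    if \<sigma>: "\<sigma> \<in> inc_seqs k CARD('n)" for \<sigma>
  proof (rule weak_divergence[where P = "\<lambda>T i x. mat_coeff k (G T x) \<sigma> i"])
    show "\<exists>p'. has_grad (\<lambda>x. mat_coeff k (G T x) \<sigma> i) p'" if "T \<in> \<T>" for T i
      using polyP_has_grad poly_tensor_polys[OF G[OF that] linear_mat_coeff] unfolding polys_UNIV by blast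
  next
    fix T T' v v' y
    assume s: "T \<in> \<T>" "T' \<in> \<T>" "v \<in> V T" "v' \<in> V T'" "facet T v = facet T' v'" "y \<in> facet T v"
    have m: "(\<Sum>i=1..CARD('n). mat_coeff k (G T y) \<sigma> i * (nF (facet S v) \<bullet> std_vec i)) =
      trv k (nF (facet S v)) (G T y) (std_args \<sigma>)" if "T \<in> \<T>" for T S v
      by (rule trv_std[OF XX_Alt2[OF GX[OF that]] \<sigma>, symmetric])
    have "facet T v \<subseteq> T" "facet T' v' \<subseteq> T'"
      using hull_mono[of "V T - {v}" "V T" convex] hull_mono[of "V T' - {v'}" "V T'" convex] V_hull[OF s(1)] V_hull[OF s(2)] by auto
    then have yy: "y \<in> T" "y \<in> T'" using s(5,6) by auto
    have "trv k (nF (facet T v)) (G T y) = trv k (nF (facet T v)) (G T' y)"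
      using trace_shared[OF pX A B D s] yy by (simp add: pG s(1,2))
    then show "(\<Sum>i=1..CARD('n). mat_coeff k (G T y) \<sigma> i * (nF (facet T v) \<bullet> std_vec i)) =
        (\<Sum>i=1..CARD('n). mat_coeff k (G T' y) \<sigma> i * (nF (facet T v) \<bullet> std_vec i))"
      unfolding m[OF s(1)] m[OF s(2)] by simp
  next
    have "(\<lambda>x. \<omega> x ws vs) \<in> borel_measurable (lebesgue_on \<Omega>)" for ws vs
      using L2 by (simp add: L2_XX_def L2_fun_def)
    then show "(\<lambda>x. mat_coeff k (\<omega> x) \<sigma> i) \<in> borel_measurable (lebesgue_on \<Omega>)" for i
      unfolding mat_coeff_def alt2_inner_def
      by (intro borel_measurable_sum borel_measurable_times borel_measurable_const)
  next
    fix T assume T: "T \<in> \<T>"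
    then have "AE x in lebesgue. x \<in> T \<inter> \<Omega> \<longrightarrow> \<omega> x = p T x" using p by blast
    then show "AE x in lebesgue. x \<in> T \<inter> \<Omega> \<longrightarrow> (\<forall>i. mat_coeff k (\<omega> x) \<sigma> i = mat_coeff k (G T x) \<sigma> i)"
      by eventually_elim (simp add: pG[OF T])
  qed
  then have "\<exists>g. \<forall>\<sigma>\<in>inc_seqs k CARD('n). g \<sigma> \<in> L2_fun \<Omega> \<and> (\<forall>\<phi>\<in>test_functions \<Omega>. (\<integral>x. g \<sigma> x * \<phi> x \<partial>lebesgue_on \<Omega>) =
       - (\<integral>x. (\<Sum>i=1..CARD('n). mat_coeff k (\<omega> x) \<sigma> i * partial_deriv i \<phi> x) \<partial>lebesgue_on \<Omega>))"
    by (intro bchoice) blast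
  then show "\<omega> \<in> H_div k \<Omega>" using L2 unfolding H_div_def has_weak_div_def by blast
qed

end

theorem theorem6p6:
  fixes \<Omega> :: "'n::{finite,linorder} Rn set"
    and \<T> :: "'n Rn set set"
    and t \<nu> :: "'n Rn set \<Rightarrow> nat \<Rightarrow> 'n Rn"
    and dy dyh :: "'n Rn set \<Rightarrow> nat \<Rightarrow> 'n form"
    and nF :: "'n Rn set \<Rightarrow> 'n Rn"
    and k r :: nat
  assumes n: "CARD('n) \<ge> 2"
    and k: "1 \<le> k" "k \<le> CARD('n) - 1"
    and r: "r \<ge> 1"
    and \<Omega>: "bounded_domain \<Omega>"
    and mesh: "conforming_mesh \<T> \<Omega>"
    and tn: "\<And>l f. l \<le> CARD('n) - 1 \<Longrightarrow> f \<in> mesh_simplices l \<T> \<Longrightarrow> tn_basis l f (t f) (\<nu> f)"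
    and dy: "\<And>l f. l \<le> CARD('n) - 1 \<Longrightarrow> f \<in> mesh_simplices l \<T> \<Longrightarrow> dy f = tn_forms l (t f) (\<nu> f)"
    and dyh: "\<And>l f. l \<le> CARD('n) - 1 \<Longrightarrow> f \<in> mesh_simplices l \<T> \<Longrightarrow> dual_basis (dy f) (dyh f)"
    and nF: "\<And>F. F \<in> mesh_simplices (CARD('n) - 1) \<T> \<Longrightarrow>
               norm (nF F) = 1 \<and> (\<forall>u\<in>tangent_space F. nF F \<bullet> u = 0)"
  shows "(\<forall>T\<in>\<T>. unisolvent k r dyh nF T) \<and> V_h k r dyh nF \<T> \<Omega> \<subseteq> H_div k \<Omega>"
proof -
  interpret mesh_dofs \<Omega> \<T> k r dyh nF
  proof
    show "\<exists>b b'. frame l f (dyh f) b b'" if l: "l \<le> CARD('n) - 1" and f: "f \<in> mesh_simplices l \<T>" for l f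
      by (rule frame_exists[OF tn[OF l f]]) (use dyh[OF l f] dy[OF l f] l in auto)
  qed (use assms in auto)
  have "unisolvent k r dyh nF T" if "T \<in> \<T>" for T
    using simplex_dofs.unisolvent_simplex[OF dofs[OF that]] V_hull[OF that] by simp
  then show ?thesis using V_h_subset_H_div by blast
qed

end
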